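(* There is a nonlinear partial differential operator $P\neq 0$, which can be computed explicitly and involves derivatives of order at most $6$, such that the following holds. Let $U\subseteq\mathbb{R}^3$ be a domain, let $f:U\to\mathbb{R}$ be a nonconstant function of class $C^{6,\alpha}$, and suppose that the vector field $u$ satisfies $$\operatorname{curl} u = f u,\qquad \operatorname{div} u = 0$$ in $U$. Then $u\equiv 0$ in $U$ unless $P[f]$ is identically zero in $U$. In particular, for each $k\geq 7$ there is an open and dense subset of $C^k(U)$ such that, for every $f$ in this subset, the only vector field $u$ in $U$ satisfying $\operatorname{curl} u=fu$ and $\operatorname{div} u=0$ is $u\equiv 0$.
   Context: A domain is a connected open set. $C^{k,\alpha}$ denotes the usual Hölder class, $0<\alpha<1$, and $C^k(U)$ is considered with the $C^k$ topology. The operators $\operatorname{curl}$ and $\operatorname{div}$ are the Euclidean ones in $\mathbb{R}^3$. No a priori regularity assumption is made on $u$: if $f$ is of class $C^{k,\alpha}$, any solution $u$ is automatically of class $C^{k+1,\alpha}$. A nonlinear partial differential operator involving derivatives of order at most $6$ is an assignment $f\mapsto P[f]$ that is local, in the sense that the value $P[f](x)$ is given by a fixed expression in the values at $x$ of $f$ and its partial derivatives of order at most $6$. The condition $P\neq 0$ means that $P[f]$ is not identically zero for some function $f$. *)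

theory Defs
  imports "HOL-Analysis.Analysis"
begin

section \<open>Partial derivatives and spaces of differentiable functions\<close>

text \<open>Functions on an open set \<open>U\<close> are represented by total functions; only their values on \<open>U\<close>
  matter for anything evaluated at points of \<open>U\<close>.\<close>

definition partial :: "3 \<Rightarrow> (real^3 \<Rightarrow> real) \<Rightarrow> real^3 \<Rightarrow> real" where
  "partial i f x = frechet_derivative f (at x) (axis i 1)"

definition partials :: "3 list \<Rightarrow> (real^3 \<Rightarrow> real) \<Rightarrow> real^3 \<Rightarrow> real" where
  "partials is f = foldr partial is f"

definition Ck_on :: "nat \<Rightarrow> (real^3) set \<Rightarrow> (real^3 \<Rightarrow> real) \<Rightarrow> bool" where
  "Ck_on k U f \<longleftrightarrow>
     (\<forall>is. length is < k \<longrightarrow> partials is f differentiable_on U) \<and>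
     (\<forall>is. length is \<le> k \<longrightarrow> continuous_on U (partials is f))"

text \<open>The Hoelder condition is the interior one: the constant may depend on the compact subset. This
  is the class for which interior elliptic regularity holds, and it contains \<open>C\<^sup>k\<^sup>+\<^sup>1(U)\<close>.\<close>

definition Ck_holder_on :: "nat \<Rightarrow> real \<Rightarrow> (real^3) set \<Rightarrow> (real^3 \<Rightarrow> real) \<Rightarrow> bool" where
  "Ck_holder_on k \<alpha> U f \<longleftrightarrow> Ck_on k U f \<and>
     (\<forall>is K. length is = k \<and> compact K \<and> K \<subseteq> U \<longrightarrow>
        (\<exists>C. \<forall>x\<in>K. \<forall>y\<in>K. \<bar>partials is f x - partials is f y\<bar> \<le> C * dist x y powr \<alpha>))"

text \<open>The space \<open>C\<^sup>k(U)\<close>: extensionality makes functions with the same values on \<open>U\<close> equal.\<close>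

definition Ck_space :: "nat \<Rightarrow> (real^3) set \<Rightarrow> (real^3 \<Rightarrow> real) set" where
  "Ck_space k U = {f \<in> extensional U. Ck_on k U f}"

text \<open>The \<open>C\<^sup>k\<close> topology is that of uniform convergence on compact subsets of \<open>U\<close> of all partial
  derivatives of order at most \<open>k\<close>. The sets \<open>Ck_ball k U K e f\<close> are the open balls of the
  corresponding seminorms.\<close>

definition Ck_ball ::
  "nat \<Rightarrow> (real^3) set \<Rightarrow> (real^3) set \<Rightarrow> real \<Rightarrow> (real^3 \<Rightarrow> real) \<Rightarrow> (real^3 \<Rightarrow> real) set" where
  "Ck_ball k U K e f =
     {g \<in> Ck_space k U. \<forall>is. length is \<le> k \<longrightarrow> (\<forall>x\<in>K. \<bar>partials is g x - partials is f x\<bar> < e)}"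

definition Ck_topology :: "nat \<Rightarrow> (real^3) set \<Rightarrow> (real^3 \<Rightarrow> real) topology" where
  "Ck_topology k U =
     topology_generated_by
       {Ck_ball k U K e f | K e f. compact K \<and> K \<subseteq> U \<and> e > 0 \<and> f \<in> Ck_space k U}"

lemma topspace_Ck_topology [simp]: "topspace (Ck_topology k U) = Ck_space k U"
proof (rule subset_antisym)
  show "topspace (Ck_topology k U) \<subseteq> Ck_space k U"
    unfolding Ck_topology_def topology_generated_by_topspace by (auto simp: Ck_ball_def)
  show "Ck_space k U \<subseteq> topspace (Ck_topology k U)"
  proof
    fix f assume f: "f \<in> Ck_space k U"
    then have "f \<in> Ck_ball k U {} 1 f"
      by (simp add: Ck_ball_def)
    moreover have "Ck_ball k U {} 1 f
        \<in> {Ck_ball k U K e f | K e f. compact K \<and> K \<subseteq> U \<and> e > 0 \<and> f \<in> Ck_space k U}"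
      unfolding mem_Collect_eq
      by (rule exI[of _ "{}"], rule exI[of _ 1], rule exI[of _ f]) (simp add: f)
    ultimately show "f \<in> topspace (Ck_topology k U)"
      unfolding Ck_topology_def topology_generated_by_topspace by (rule UnionI[rotated])
  qed
qed


section \<open>Nonlinear differential operators\<close>

text \<open>An operator is an explicit polynomial expression with rational coefficients in the partial
  derivatives of the argument: unlike expressions with quotients or roots, it is defined at every
  point for every sufficiently differentiable function. \<open>Deriv is\<close> stands for the partial
  derivative in the directions \<open>is\<close>; \<open>Deriv []\<close> is the function itself.\<close>

datatype diff_op =
    Const rat
  | Deriv "3 list"
  | Add diff_op diff_op
  | Mult diff_op diff_op

primrec apply_op :: "diff_op \<Rightarrow> (real^3 \<Rightarrow> real) \<Rightarrow> real^3 \<Rightarrow> real" where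
  "apply_op (Const c) f x = of_rat c"
| "apply_op (Deriv is) f x = partials is f x"
| "apply_op (Add P Q) f x = apply_op P f x + apply_op Q f x"
| "apply_op (Mult P Q) f x = apply_op P f x * apply_op Q f x"

primrec op_order :: "diff_op \<Rightarrow> nat" where
  "op_order (Const c) = 0"
| "op_order (Deriv is) = length is"
| "op_order (Add P Q) = max (op_order P) (op_order Q)"
| "op_order (Mult P Q) = max (op_order P) (op_order Q)"

text \<open>Not syntactic: \<open>P \<noteq> 0\<close> means that \<open>P[f]\<close> is not identically zero for some \<open>f\<close> that is
  differentiable often enough for \<open>P[f]\<close> to make sense.\<close>

definition nonzero_op :: "diff_op \<Rightarrow> bool" where
  "nonzero_op P \<longleftrightarrow> (\<exists>f x. Ck_on (op_order P) UNIV f \<and> apply_op P f x \<noteq> 0)"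


section \<open>The equations \<open>curl u = f u\<close>, \<open>div u = 0\<close>\<close>

definition grad :: "(real^3 \<Rightarrow> real) \<Rightarrow> real^3 \<Rightarrow> real^3" where
  "grad g x = (\<chi> i. partial i g x)"

definition divergence :: "(real^3 \<Rightarrow> real^3) \<Rightarrow> real^3 \<Rightarrow> real" where
  "divergence u x = (\<Sum>i\<in>UNIV. partial i (\<lambda>y. u y $ i) x)"

definition curl :: "(real^3 \<Rightarrow> real^3) \<Rightarrow> real^3 \<Rightarrow> real^3" where
  "curl u x = vector
     [partial 2 (\<lambda>y. u y $ 3) x - partial 3 (\<lambda>y. u y $ 2) x,
      partial 3 (\<lambda>y. u y $ 1) x - partial 1 (\<lambda>y. u y $ 3) x,
      partial 1 (\<lambda>y. u y $ 2) x - partial 2 (\<lambda>y. u y $ 1) x]"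

text \<open>Solutions in the classical sense. The derivatives of \<open>u\<close> are only required to exist.\<close>

definition classical_solution ::
  "(real^3) set \<Rightarrow> (real^3 \<Rightarrow> real) \<Rightarrow> (real^3 \<Rightarrow> real^3) \<Rightarrow> bool" where
  "classical_solution U f u \<longleftrightarrow>
     u differentiable_on U \<and> (\<forall>x\<in>U. curl u x = f x *\<^sub>R u x \<and> divergence u x = 0)"

definition test_function :: "(real^3) set \<Rightarrow> (real^3 \<Rightarrow> real) \<Rightarrow> bool" where
  "test_function U \<phi> \<longleftrightarrow>
     (\<forall>k. Ck_on k UNIV \<phi>) \<and> (\<exists>K. compact K \<and> K \<subseteq> U \<and> (\<forall>x. x \<notin> K \<longrightarrow> \<phi> x = 0))"

text \<open>Solutions in the sense of distributions, for locally integrable \<open>u\<close>. The formal adjoints of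
  \<open>curl\<close> and \<open>div\<close> are \<open>curl\<close> and \<open>- grad\<close>.\<close>

definition weak_solution ::
  "(real^3) set \<Rightarrow> (real^3 \<Rightarrow> real) \<Rightarrow> (real^3 \<Rightarrow> real^3) \<Rightarrow> bool" where
  "weak_solution U f u \<longleftrightarrow>
     (\<forall>K. compact K \<and> K \<subseteq> U \<longrightarrow> u absolutely_integrable_on K) \<and>
     (\<forall>w. (\<forall>i. test_function U (\<lambda>x. w x $ i)) \<longrightarrow>
        integral U (\<lambda>x. u x \<bullet> curl w x) = integral U (\<lambda>x. f x * (u x \<bullet> w x))) \<and>
     (\<forall>\<phi>. test_function U \<phi> \<longrightarrow> integral U (\<lambda>x. u x \<bullet> grad \<phi> x) = 0)"

text \<open>A classical solution vanishes identically when it vanishes at every point; a weak solution,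
  which is determined only up to null sets, when it vanishes almost everywhere.\<close>

definition only_trivial_solution :: "(real^3) set \<Rightarrow> (real^3 \<Rightarrow> real) \<Rightarrow> bool" where
  "only_trivial_solution U f \<longleftrightarrow>
     (\<forall>u. classical_solution U f u \<longrightarrow> (\<forall>x\<in>U. u x = 0)) \<and>
     (\<forall>u. weak_solution U f u \<longrightarrow> negligible {x \<in> U. u x \<noteq> 0})"

end

(* Write w for the gradient of f. Taking the divergence of curl u = f u gives w . u = 0, and a
   solution is transported along w by a first order system: w . grad u = A u. Differentiating the
   constraint and the equations along w yields further linear equations for u whose coefficients are
   polynomials in the derivatives of f. Eliminating the first derivatives of u leaves two homogeneous
   linear equations for the values of u besides w . u = 0, and P[f] is the determinant of the three,
   so that u vanishes wherever P[f] does not. Since curl and div together form an elliptic system with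
   bounded zero order term, a Carleman estimate with weight exp (t / |x|) extends the zero to the
   whole connected domain. Weak solutions are reduced to continuous ones by the Newton potential: on
   small balls the potential of the right-hand side is absorbed into the left. On the line joining f
   to a translate g of an explicit function with P[g] nonzero, P is a nonzero polynomial in the line
   parameter; hence the factors admitting only the zero solution are dense. *)
theory Submission
  imports Defs
begin

subsection \<open>Calculus of partial derivatives\<close>

text \<open>The derivatives of u need not be continuous, or even exist, so every equation is kept in
  the weak form \<open>weqs\<close>, tested against functions that are merely C^1: then a
  coefficient of class C^1 may be moved onto the test function. A first order equation is a row of
  twelve coefficients, and differentiation along w is transposed onto the test function. The nine
  first derivatives of u call for nine pivots, and two rows must remain: three rows from the curl,
  three from the transport along w, one from the divergence and four from its successive derivatives
  along w make eleven. The fourth of these brings in derivatives of f up to order 6. Elimination is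
  free of division, so the result is polynomial in the derivatives of f and valid whether or not a
  pivot vanishes; only for one explicit function must the pivots be known. For weak solutions a
  regularized representation formula bounds u by a Riesz potential of itself, and iterating that
  potential on a ball of radius R gains a factor proportional to R.\<close>

lemma partial_eqI: "(f has_derivative D) (at x) \<Longrightarrow> partial i f x = D (axis i 1)"
  unfolding partial_def by (simp add: frechet_derivative_at[symmetric])

lemma has_derivative_cong_open:
  assumes "open U" "x \<in> U" "\<And>y. y \<in> U \<Longrightarrow> f y = g y"
  shows "(f has_derivative D) (at x) \<longleftrightarrow> (g has_derivative D) (at x)"
  using has_derivative_transform_within_open[of f D x UNIV U g]
    has_derivative_transform_within_open[of g D x UNIV U f] assms by auto

text \<open>This holds also where no derivative exists: \<open>frechet_derivative\<close> is a
  choice from the set of derivatives, and functions that agree near x have the same set.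
  \<open>partial_shift\<close> rests on the same observation.\<close>

lemma partial_cong_open:
  assumes "open U" "x \<in> U" "\<And>y. y \<in> U \<Longrightarrow> f y = g y"
  shows "partial i f x = partial i g x"
  unfolding partial_def frechet_derivative_def
  using has_derivative_cong_open[OF assms] by simp

lemma axis_decomp: "(h::real^3) = (\<Sum>i\<in>UNIV. h $ i *\<^sub>R axis i 1)"
  by (simp add: vec_eq_iff axis_def if_distrib cong: if_cong)

lemma has_derivative_partial:
  assumes "f differentiable (at x)"
  shows "(f has_derivative (\<lambda>h. \<Sum>i\<in>UNIV. h $ i * partial i f x)) (at x)"
proof -
  let ?D = "frechet_derivative f (at x)"
  have d: "(f has_derivative ?D) (at x)"
    using assms frechet_derivative_works by blast
  then have lin: "linear ?D" by (rule has_derivative_linear)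
  have "?D h = (\<Sum>i\<in>UNIV. h $ i * partial i f x)" for h
  proof -
    have "?D h = ?D (\<Sum>i\<in>UNIV. h $ i *\<^sub>R axis i 1)" using axis_decomp[of h] by simp
    also have "\<dots> = (\<Sum>i\<in>UNIV. h $ i * partial i f x)"
      by (simp add: linear_sum[OF lin] linear_cmul[OF lin] partial_def)
    finally show ?thesis .
  qed
  then have "?D = (\<lambda>h. \<Sum>i\<in>UNIV. h $ i * partial i f x)" by auto
  with d show ?thesis by simp
qed

lemma partial_const [simp]: "partial i (\<lambda>x. c) x = 0"
  by (rule partial_eqI[where D="\<lambda>h. 0", simplified]) simp

lemma partial_add:
  assumes "f differentiable (at x)" "g differentiable (at x)"
  shows "partial i (\<lambda>x. f x + g x) x = partial i f x + partial i g x"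
  using partial_eqI[OF has_derivative_add[OF assms[unfolded frechet_derivative_works]]]
  by (simp add: partial_def)

lemma partial_diff:
  assumes "f differentiable (at x)" "g differentiable (at x)"
  shows "partial i (\<lambda>x. f x - g x) x = partial i f x - partial i g x"
  using partial_eqI[OF has_derivative_diff[OF assms[unfolded frechet_derivative_works]]]
  by (simp add: partial_def)

lemma partial_uminus:
  assumes "f differentiable (at x)"
  shows "partial i (\<lambda>x. - f x) x = - partial i f x"
  using partial_eqI[OF has_derivative_minus[OF assms[unfolded frechet_derivative_works]]]
  by (simp add: partial_def)

lemma partial_mult:
  assumes "f differentiable (at x)" "g differentiable (at x)"
  shows "partial i (\<lambda>x. f x * g x) x = partial i f x * g x + f x * partial i g x"
  using partial_eqI[OF has_derivative_mult[OF assms[unfolded frechet_derivative_works]]]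
  by (simp add: partial_def)

lemma partial_cmult:
  assumes "f differentiable (at x)"
  shows "partial i (\<lambda>x. c * f x) x = c * partial i f x"
  using partial_mult[where f="\<lambda>x. c", OF differentiable_const assms] by simp

lemma partial_sum:
  assumes "\<And>a. a \<in> A \<Longrightarrow> f a differentiable (at x)"
  shows "partial i (\<lambda>x. \<Sum>a\<in>A. f a x) x = (\<Sum>a\<in>A. partial i (f a) x)"
proof -
  have "((\<lambda>x. \<Sum>a\<in>A. f a x) has_derivative (\<lambda>h. \<Sum>a\<in>A. frechet_derivative (f a) (at x) h)) (at x)"
    using assms frechet_derivative_works by (intro has_derivative_sum) blast
  from partial_eqI[OF this] show ?thesis by (simp add: partial_def)
qed

lemma has_derivative_nth: "((\<lambda>x::real^3. x $ j) has_derivative (\<lambda>h. h $ j)) F"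
  by (rule bounded_linear_imp_has_derivative) (rule bounded_linear_vec_nth)

lemma partial_nth: "partial i (\<lambda>x. x $ j) x = (if i = j then 1 else 0)"
  using partial_eqI[OF has_derivative_nth] by (simp add: axis_def)

lemma differentiable_nth [simp]: "(\<lambda>x::real^3. x $ j) differentiable F"
  using has_derivative_nth unfolding differentiable_def by blast

lemma partial_compose:
  assumes "g differentiable (at x)" "(h has_real_derivative h') (at (g x))"
  shows "partial i (\<lambda>x. h (g x)) x = h' * partial i g x"
proof -
  have "((\<lambda>x. h (g x)) has_derivative (\<lambda>y. h' * frechet_derivative g (at x) y)) (at x)"
    using has_derivative_compose[OF assms(1)[unfolded frechet_derivative_works], of h "\<lambda>y. h' * y"]
      assms(2) by (simp add: has_field_derivative_def)
  from partial_eqI[OF this] show ?thesis by (simp add: partial_def)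
qed

lemma differentiable_compose_real:
  assumes "g differentiable (at x)" "(h has_real_derivative h') (at (g x))"
  shows "(\<lambda>x. h (g x)) differentiable (at x)"
  using differentiable_compose[of h g x UNIV] assms
  by (meson differentiable_at_withinI differentiable_def has_field_derivative_imp_has_derivative)

lemma has_derivative_shift:
  fixes f :: "real^3 \<Rightarrow> real"
  assumes "(f has_derivative D) (at (x + c))"
  shows "((\<lambda>x. f (x + c)) has_derivative D) (at x)"
proof -
  have "((\<lambda>x. x + c) has_derivative (\<lambda>h. h)) (at x)"
    by (auto intro!: derivative_eq_intros)
  from has_derivative_compose[OF this assms] show ?thesis .
qed

lemma partial_shift: "partial i (\<lambda>x. f (x + c)) x = partial i f (x + c)"
proof -
  have "((\<lambda>x. f (x + c)) has_derivative D) (at x) \<longleftrightarrow> (f has_derivative D) (at (x + c))" for D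
    using has_derivative_shift[of f D x c] has_derivative_shift[of "\<lambda>x. f (x + c)" D "x + c" "- c"]
    by auto
  then show ?thesis unfolding partial_def frechet_derivative_def by simp
qed

lemma partial_reflect:
  assumes "f differentiable (at (c - x))"
  shows "partial i (\<lambda>x. f (c - x)) x = - partial i f (c - x)"
proof -
  have "((\<lambda>x. c - x) has_derivative (\<lambda>h. - h)) (at x)"
    by (auto intro!: derivative_eq_intros)
  from has_derivative_compose[OF this assms[unfolded frechet_derivative_works]]
  have "((\<lambda>x. f (c - x)) has_derivative (\<lambda>h. frechet_derivative f (at (c - x)) (- h))) (at x)" .
  from partial_eqI[OF this] show ?thesis
    using linear_neg[OF linear_frechet_derivative[OF assms]] by (simp add: partial_def)
qed

lemma differentiable_reflect:
  assumes "f differentiable (at (c - x :: real^3))"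
  shows "(\<lambda>x. f (c - x)) differentiable (at x)"
  by (rule differentiable_compose[where f=f]) (use assms in auto)

section \<open>Iterated partial derivatives and the classes \<open>Ck_on\<close>\<close>

lemma partials_Nil [simp]: "partials [] f = f" by (simp add: partials_def)
lemma partials_Cons: "partials (i # is) f = partial i (partials is f)" by (simp add: partials_def)
lemma partials_snoc: "partials (is @ [i]) f = partials is (partial i f)" by (simp add: partials_def)
lemma partials_append: "partials (is @ js) f = partials is (partials js f)" by (simp add: partials_def)

lemma partials_cong_open:
  assumes "open U" "x \<in> U" "\<And>y. y \<in> U \<Longrightarrow> f y = g y"
  shows "partials is f x = partials is g x"
  using assms(2)
proof (induction "is" arbitrary: x)
  case (Cons i "is")
  then show ?case unfolding partials_Cons
    by (intro partial_cong_open[OF assms(1)]) auto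
qed (use assms in auto)

lemma Ck_on_0: "Ck_on 0 U f \<longleftrightarrow> continuous_on U f"
  by (simp add: Ck_on_def)

text \<open>Splits off the innermost derivative, which is the last entry of the list. This turns the
  definition by lists into a recursion on k, on which the closure properties below are
  proved.\<close>

lemma Ck_on_Suc:
  assumes "open U"
  shows "Ck_on (Suc k) U f \<longleftrightarrow> f differentiable_on U \<and> (\<forall>i. Ck_on k U (partial i f))"
proof
  assume C: "Ck_on (Suc k) U f"
  have "f differentiable_on U"
    using C unfolding Ck_on_def by (metis length_0_conv partials_Nil zero_less_Suc list.size(3))
  moreover have "Ck_on k U (partial i f)" for i
    unfolding Ck_on_def
  proof (intro conjI allI impI)
    fix "is" :: "3 list" assume "length is < k"
    then show "partials is (partial i f) differentiable_on U"
      using C unfolding Ck_on_def partials_snoc[symmetric] by simp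
  next
    fix "is" :: "3 list" assume "length is \<le> k"
    then show "continuous_on U (partials is (partial i f))"
      using C unfolding Ck_on_def partials_snoc[symmetric] by simp
  qed
  ultimately show "f differentiable_on U \<and> (\<forall>i. Ck_on k U (partial i f))" by blast
next
  assume C: "f differentiable_on U \<and> (\<forall>i. Ck_on k U (partial i f))"
  show "Ck_on (Suc k) U f" unfolding Ck_on_def
  proof (intro conjI allI impI)
    fix "is" :: "3 list" assume "length is < Suc k"
    then show "partials is f differentiable_on U"
      using C by (cases "is" rule: rev_cases) (auto simp: partials_snoc Ck_on_def)
  next
    fix "is" :: "3 list" assume "length is \<le> Suc k"
    then show "continuous_on U (partials is f)"
      using C by (cases "is" rule: rev_cases)
        (auto simp: partials_snoc Ck_on_def intro: differentiable_imp_continuous_on)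
  qed
qed

lemma Ck_on_mono: "Ck_on k U f \<Longrightarrow> l \<le> k \<Longrightarrow> Ck_on l U f"
  unfolding Ck_on_def by auto

lemma Ck_on_subset: "Ck_on k U f \<Longrightarrow> V \<subseteq> U \<Longrightarrow> Ck_on k V f"
  unfolding Ck_on_def by (meson continuous_on_subset differentiable_on_subset)

lemma Ck_on_cong:
  assumes "open U" "\<And>y. y \<in> U \<Longrightarrow> f y = g y"
  shows "Ck_on k U f \<longleftrightarrow> Ck_on k U g"
proof -
  have eq: "partials is f x = partials is g x" if "x \<in> U" for x "is"
    using partials_cong_open[OF assms(1) that assms(2)] .
  have "partials is f differentiable_on U \<longleftrightarrow> partials is g differentiable_on U" for "is"
    using has_derivative_cong_open[OF assms(1), of _ "partials is f" "partials is g"] eq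
    unfolding differentiable_on_eq_differentiable_at[OF assms(1)] differentiable_def by simp
  moreover have "continuous_on U (partials is f) \<longleftrightarrow> continuous_on U (partials is g)" for "is"
    using eq by (intro continuous_on_cong) auto
  ultimately show ?thesis unfolding Ck_on_def by simp
qed

lemma Ck_on_Un:
  assumes "open U" "open V" "Ck_on k U f" "Ck_on k V f"
  shows "Ck_on k (U \<union> V) f"
proof -
  have "partials is f differentiable_on (U \<union> V)" if "length is < k" for "is"
    using that assms unfolding Ck_on_def
    by (auto simp: differentiable_on_eq_differentiable_at open_Un)
  moreover have "continuous_on (U \<union> V) (partials is f)" if "length is \<le> k" for "is"
    using that assms unfolding Ck_on_def by (intro continuous_on_open_Un) auto
  ultimately show ?thesis unfolding Ck_on_def by blast
qed

lemma Ck_on_differentiable_at: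
  assumes "open U" "Ck_on k U f" "0 < k" "x \<in> U"
  shows "f differentiable (at x)"
  using assms unfolding Ck_on_def
  by (metis differentiable_on_eq_differentiable_at list.size(3) partials_Nil)

lemma Ck_on_continuous: "Ck_on k U f \<Longrightarrow> continuous_on U f"
  unfolding Ck_on_def by (metis le0 list.size(3) partials_Nil)

lemma Ck_on_partial:
  assumes "open U" "Ck_on (Suc k) U f" shows "Ck_on k U (partial i f)"
  using assms Ck_on_Suc by blast

lemma Ck_on_partials:
  assumes "Ck_on (k + length is) U f" shows "Ck_on k U (partials is f)"
  unfolding Ck_on_def
proof (intro conjI allI impI)
  fix js :: "3 list" assume "length js < k"
  then show "partials js (partials is f) differentiable_on U"
    using assms unfolding Ck_on_def partials_append[symmetric] by simp
next
  fix js :: "3 list" assume "length js \<le> k"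
  then show "continuous_on U (partials js (partials is f))"
    using assms unfolding Ck_on_def partials_append[symmetric] by simp
qed

lemma Ck_on_const: "open U \<Longrightarrow> Ck_on k U (\<lambda>x. c)"
proof (induction k arbitrary: c)
  case (Suc k)
  then have "Ck_on k U (partial i (\<lambda>x. c))" for i
    by (subst Ck_on_cong[where g="\<lambda>x. 0"]) auto
  with Suc show ?case by (simp add: Ck_on_Suc)
qed (simp add: Ck_on_0)

lemma Ck_on_nth: assumes "open U" shows "Ck_on k U (\<lambda>x. x $ j)"
proof (cases k)
  case (Suc l)
  have "partial i (\<lambda>x. x $ j) = (\<lambda>x. if i = j then 1 else 0)" for i
    by (simp add: partial_nth fun_eq_iff)
  then show ?thesis unfolding Suc Ck_on_Suc[OF assms]
    by (auto simp: Ck_on_const[OF assms] differentiable_on_def)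
qed (simp add: Ck_on_0 continuous_on_component continuous_on_id)

lemma Ck_on_add:
  assumes "open U" "Ck_on k U f" "Ck_on k U g" shows "Ck_on k U (\<lambda>x. f x + g x)"
  using assms(2,3)
proof (induction k arbitrary: f g)
  case 0 then show ?case by (auto simp: Ck_on_0 intro: continuous_on_add)
next
  case (Suc k)
  have d: "f differentiable (at x)" "g differentiable (at x)" if "x \<in> U" for x
    using Suc.prems that assms(1) by (auto intro: Ck_on_differentiable_at)
  have "Ck_on k U (partial i (\<lambda>x. f x + g x))" for i
    by (subst Ck_on_cong[OF assms(1), where g="\<lambda>x. partial i f x + partial i g x"])
      (use Suc d assms(1) in \<open>auto simp: partial_add Ck_on_Suc\<close>)
  with Suc.prems show ?case by (auto simp: Ck_on_Suc[OF assms(1)] intro: differentiable_on_add)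
qed

lemma Ck_on_mult:
  assumes "open U" "Ck_on k U f" "Ck_on k U g" shows "Ck_on k U (\<lambda>x. f x * g x)"
  using assms(2,3)
proof (induction k arbitrary: f g)
  case 0 then show ?case by (auto simp: Ck_on_0 intro: continuous_on_mult)
next
  case (Suc k)
  have d: "f differentiable (at x)" "g differentiable (at x)" if "x \<in> U" for x
    using Suc.prems that assms(1) by (auto intro: Ck_on_differentiable_at)
  have fg: "Ck_on k U f" "Ck_on k U g" using Suc.prems Ck_on_mono by auto
  have "Ck_on k U (partial i (\<lambda>x. f x * g x))" for i
    by (subst Ck_on_cong[OF assms(1), where g="\<lambda>x. partial i f x * g x + f x * partial i g x"])
      (use Suc d fg assms(1) in \<open>auto simp: partial_mult Ck_on_Suc intro!: Ck_on_add\<close>)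
  with Suc.prems show ?case by (auto simp: Ck_on_Suc[OF assms(1)] intro: differentiable_on_mult)
qed

lemma Ck_on_cmult: "open U \<Longrightarrow> Ck_on k U f \<Longrightarrow> Ck_on k U (\<lambda>x. c * f x)"
  by (intro Ck_on_mult Ck_on_const)

lemma Ck_on_uminus: "open U \<Longrightarrow> Ck_on k U f \<Longrightarrow> Ck_on k U (\<lambda>x. - f x)"
  using Ck_on_cmult[of U k f "-1"] by simp

lemma Ck_on_diff:
  assumes "open U" "Ck_on k U f" "Ck_on k U g" shows "Ck_on k U (\<lambda>x. f x - g x)"
  using Ck_on_add[OF assms(1,2) Ck_on_uminus[OF assms(1,3)]] by simp

lemma Ck_on_sum:
  assumes "open U" "\<And>a. a \<in> A \<Longrightarrow> Ck_on k U (f a)"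
  shows "Ck_on k U (\<lambda>x. \<Sum>a\<in>A. f a x)"
  using assms(2)
  by (induction A rule: infinite_finite_induct) (auto simp: Ck_on_const Ck_on_add assms(1))

text \<open>The outer function comes as a sequence in which every member is the derivative of the
  one before: the chain rule replaces \<open>h n\<close> by \<open>h (Suc n)\<close>, so the
  induction on k must cover all members at once.\<close>

lemma Ck_on_compose:
  assumes "open U" "\<And>n t. t \<in> T \<Longrightarrow> (h n has_real_derivative h (Suc n) t) (at t)"
    and "\<And>x. x \<in> U \<Longrightarrow> g x \<in> T" "Ck_on k U g"
  shows "Ck_on k U (\<lambda>x. h n (g x))"
  using assms(4)
proof (induction k arbitrary: n)
  case 0
  have "isCont (h n) (g x)" if "x \<in> U" for x
    using assms(2,3) that DERIV_isCont by blast
  moreover have "isCont g x" if "x \<in> U" for x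
    using 0 that by (simp add: Ck_on_0 continuous_on_eq_continuous_at[OF assms(1)])
  ultimately show ?case
    by (simp add: Ck_on_0 continuous_on_eq_continuous_at[OF assms(1)] isCont_o2)
next
  case (Suc k)
  have d: "g differentiable (at x)" if "x \<in> U" for x
    using Suc.prems that assms(1) by (auto intro: Ck_on_differentiable_at)
  have g: "Ck_on k U g" using Suc.prems Ck_on_mono by auto
  have "Ck_on k U (partial i (\<lambda>x. h n (g x)))" for i
  proof (subst Ck_on_cong[OF assms(1), where g="\<lambda>x. h (Suc n) (g x) * partial i g x"])
    show "partial i (\<lambda>x. h n (g x)) y = h (Suc n) (g y) * partial i g y" if "y \<in> U" for y
      using partial_compose[OF d[OF that] assms(2)[OF assms(3)[OF that]]] .
    show "Ck_on k U (\<lambda>x. h (Suc n) (g x) * partial i g x)"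
      by (intro Ck_on_mult[OF assms(1) Suc.IH[OF g] Ck_on_partial[OF assms(1) Suc.prems]])
  qed
  moreover have "(\<lambda>x. h n (g x)) differentiable_on U"
    unfolding differentiable_on_eq_differentiable_at[OF assms(1)]
    using differentiable_compose_real[OF d assms(2)[OF assms(3)]] by blast
  ultimately show ?case by (simp add: Ck_on_Suc[OF assms(1)])
qed

lemma Ck_on_shift:
  assumes "Ck_on k UNIV f" shows "Ck_on k UNIV (\<lambda>x. f (x + c))"
  using assms
proof (induction k arbitrary: f)
  case 0
  then show ?case by (auto simp: Ck_on_0 intro!: continuous_on_compose2[of UNIV f] continuous_intros)
next
  case (Suc k)
  have d: "f differentiable (at x)" for x
    using Suc.prems by (auto intro: Ck_on_differentiable_at)
  have "Ck_on k UNIV (partial i (\<lambda>x. f (x + c)))" for i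
  proof -
    have "partial i (\<lambda>x. f (x + c)) = (\<lambda>x. partial i f (x + c))"
      by (auto intro!: partial_shift)
    then show ?thesis using Suc by (auto simp: Ck_on_Suc)
  qed
  moreover have "(\<lambda>x. f (x + c)) differentiable (at x)" for x
    by (rule differentiable_compose[where f=f]) (use d in auto)
  ultimately show ?case by (auto simp: Ck_on_Suc differentiable_on_def)
qed

lemma Ck_on_reflect:
  assumes "Ck_on k UNIV f" shows "Ck_on k UNIV (\<lambda>x. f (c - x))"
  using assms
proof (induction k arbitrary: f)
  case 0
  then show ?case by (auto simp: Ck_on_0 intro!: continuous_on_compose2[of UNIV f] continuous_intros)
next
  case (Suc k)
  have d: "f differentiable (at x)" for x
    using Suc.prems by (auto intro: Ck_on_differentiable_at)
  have "Ck_on k UNIV (partial i (\<lambda>x. f (c - x)))" for i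
  proof -
    have "partial i (\<lambda>x. f (c - x)) = (\<lambda>x. - partial i f (c - x))"
      using d by (auto intro!: partial_reflect)
    then show ?thesis using Suc by (auto simp: Ck_on_Suc intro!: Ck_on_uminus)
  qed
  then show ?case using d by (auto simp: Ck_on_Suc differentiable_on_def intro!: differentiable_reflect)
qed

section \<open>Symmetry of mixed second derivatives\<close>

lemma partial_along_line:
  assumes "f differentiable (at (x + t *\<^sub>R axis i 1))"
  shows "((\<lambda>s. f (x + s *\<^sub>R axis i 1)) has_real_derivative partial i f (x + t *\<^sub>R axis i 1)) (at t)"
proof -
  let ?y = "x + t *\<^sub>R axis i 1"
  have "((\<lambda>s. f (x + s *\<^sub>R axis i 1)) has_derivative (\<lambda>h. frechet_derivative f (at ?y) (h *\<^sub>R axis i 1))) (at t)"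
    by (rule has_derivative_compose[of "\<lambda>s. x + s *\<^sub>R axis i 1" "\<lambda>h. h *\<^sub>R axis i 1" t UNIV f])
      (use assms frechet_derivative_works in \<open>auto intro!: derivative_eq_intros\<close>)
  moreover have "(\<lambda>h. frechet_derivative f (at ?y) (h *\<^sub>R axis i 1)) = (\<lambda>h. partial i f ?y * h)"
    using linear_cmul[OF linear_frechet_derivative[OF assms]] by (auto simp: partial_def)
  ultimately show ?thesis by (simp add: has_field_derivative_def)
qed

text \<open>Two mean value theorems: the first in direction i for the difference of f between two
  parallel segments, the second in direction j for the derivative \<open>partial i f\<close> that
  results.\<close>

lemma second_difference:
  assumes "open U" "Ck_on 2 U f" and h: "0 < h"
    and sub: "\<And>s t. 0 \<le> s \<Longrightarrow> s \<le> h \<Longrightarrow> 0 \<le> t \<Longrightarrow> t \<le> h \<Longrightarrow> x + s *\<^sub>R axis i 1 + t *\<^sub>R axis j 1 \<in> U"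
  obtains s t where "0 \<le> s" "s \<le> h" "0 \<le> t" "t \<le> h"
    "f (x + h *\<^sub>R axis i 1 + h *\<^sub>R axis j 1) - f (x + h *\<^sub>R axis i 1) - f (x + h *\<^sub>R axis j 1) + f x
      = h * h * partial j (partial i f) (x + s *\<^sub>R axis i 1 + t *\<^sub>R axis j 1)"
proof -
  have C1: "Ck_on 1 U (partial i f)"
    using assms(1,2) Ck_on_partial[of U 1 f] by (simp add: numeral_2_eq_2)
  have d: "f differentiable (at y)" "partial i f differentiable (at y)" if "y \<in> U" for y
    using Ck_on_differentiable_at[OF assms(1,2) _ that] Ck_on_differentiable_at[OF assms(1) C1 _ that] by auto
  let ?p = "\<lambda>s. f ((x + h *\<^sub>R axis j 1) + s *\<^sub>R axis i 1) - f (x + s *\<^sub>R axis i 1)"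
  let ?p' = "\<lambda>s. partial i f ((x + h *\<^sub>R axis j 1) + s *\<^sub>R axis i 1) - partial i f (x + s *\<^sub>R axis i 1)"
  have pd: "DERIV ?p s :> ?p' s" if "0 \<le> s" "s \<le> h" for s
    using sub[OF that, of h] sub[OF that, of 0] h
    by (intro DERIV_diff partial_along_line d) (auto simp: algebra_simps)
  obtain s where s: "0 < s" "s < h" "?p h - ?p 0 = (h - 0) * ?p' s"
    using MVT2[of 0 h ?p ?p'] pd h by auto
  let ?q = "\<lambda>t. partial i f ((x + s *\<^sub>R axis i 1) + t *\<^sub>R axis j 1)"
  let ?q' = "\<lambda>t. partial j (partial i f) ((x + s *\<^sub>R axis i 1) + t *\<^sub>R axis j 1)"
  have qd: "DERIV ?q t :> ?q' t" if "0 \<le> t" "t \<le> h" for t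
    using sub[of s t] that s by (intro partial_along_line d) auto
  obtain t where t: "0 < t" "t < h" "?q h - ?q 0 = (h - 0) * ?q' t"
    using MVT2[of 0 h ?q ?q'] qd h by auto
  have "?p h - ?p 0 = h * (?q h - ?q 0)" using s(3) by (simp add: algebra_simps)
  then have "?p h - ?p 0 = h * h * ?q' t" using t(3) by simp
  then show ?thesis using that[of s t] s t by (simp add: algebra_simps)
qed

text \<open>The second difference is symmetric in i and j, so the two mixed derivatives agree at
  suitable points arbitrarily close to x, and continuity carries this to x.\<close>

lemma partial_commute:
  assumes "open U" "Ck_on 2 U f" "x \<in> U"
  shows "partial i (partial j f) x = partial j (partial i f) x"
proof (rule ccontr)
  assume ne: "partial i (partial j f) x \<noteq> partial j (partial i f) x"
  define e where "e = \<bar>partial i (partial j f) x - partial j (partial i f) x\<bar> / 2"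
  have e: "e > 0" using ne by (simp add: e_def)
  have C: "continuous_on U (partial a (partial b f))" for a b
    using Ck_on_continuous[OF Ck_on_partial[OF assms(1) Ck_on_partial[OF assms(1)]], of 0 f] assms(2)
    by (simp add: numeral_2_eq_2)
  have "\<exists>d>0. \<forall>y. dist y x < d \<longrightarrow> y \<in> U \<and> dist (partial a (partial b f) y) (partial a (partial b f) x) < e" for a b
  proof -
    obtain d1 where "d1 > 0" "\<forall>y\<in>U. dist y x < d1 \<longrightarrow> dist (partial a (partial b f) y) (partial a (partial b f) x) < e"
      using C[of a b] e assms(3) unfolding continuous_on_iff by blast
    moreover obtain d2 where "d2 > 0" "ball x d2 \<subseteq> U" using assms(1,3) open_contains_ball by blast
    ultimately show ?thesis
      by (intro exI[of _ "min d1 d2"]) (auto simp: mem_ball dist_commute subset_eq)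
  qed
  then obtain d1 d2 where d1: "d1 > 0" "\<forall>y. dist y x < d1 \<longrightarrow> y \<in> U \<and> dist (partial i (partial j f) y) (partial i (partial j f) x) < e"
    and d2: "d2 > 0" "\<forall>y. dist y x < d2 \<longrightarrow> y \<in> U \<and> dist (partial j (partial i f) y) (partial j (partial i f) x) < e"
    by metis
  \<comment> \<open>A third, because the points in question are displaced from x by at most h in
    each of two directions.\<close>
  define h where "h = min d1 d2 / 3"
  have h: "h > 0" using d1 d2 by (simp add: h_def)
  have near: "dist (x + s *\<^sub>R axis a 1 + t *\<^sub>R axis b 1) x < min d1 d2"
    if "0 \<le> s" "s \<le> h" "0 \<le> t" "t \<le> h" for s t and a b :: 3
  proof -
    have "norm (s *\<^sub>R axis a 1 + t *\<^sub>R axis b (1::real)) \<le> s + t"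
      by (rule norm_triangle_le) (use that in \<open>auto simp: norm_axis_1\<close>)
    then show ?thesis using that h by (simp add: dist_norm h_def add.assoc)
  qed
  have inU: "x + s *\<^sub>R axis a 1 + t *\<^sub>R axis b 1 \<in> U"
    if "0 \<le> s" "s \<le> h" "0 \<le> t" "t \<le> h" for s t and a b :: 3
    using near[OF that] d1 by auto
  obtain s t where st: "0 \<le> s" "s \<le> h" "0 \<le> t" "t \<le> h"
    "f (x + h *\<^sub>R axis i 1 + h *\<^sub>R axis j 1) - f (x + h *\<^sub>R axis i 1) - f (x + h *\<^sub>R axis j 1) + f x
      = h * h * partial j (partial i f) (x + s *\<^sub>R axis i 1 + t *\<^sub>R axis j 1)"
    using second_difference[OF assms(1,2) h inU] by blast
  obtain s' t' where st': "0 \<le> s'" "s' \<le> h" "0 \<le> t'" "t' \<le> h"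
    "f (x + h *\<^sub>R axis j 1 + h *\<^sub>R axis i 1) - f (x + h *\<^sub>R axis j 1) - f (x + h *\<^sub>R axis i 1) + f x
      = h * h * partial i (partial j f) (x + s' *\<^sub>R axis j 1 + t' *\<^sub>R axis i 1)"
    using second_difference[OF assms(1,2) h inU] by blast
  have "partial j (partial i f) (x + s *\<^sub>R axis i 1 + t *\<^sub>R axis j 1) = partial i (partial j f) (x + s' *\<^sub>R axis j 1 + t' *\<^sub>R axis i 1)"
    using st(5) st'(5) h by (simp add: algebra_simps)
  moreover have "dist (partial j (partial i f) (x + s *\<^sub>R axis i 1 + t *\<^sub>R axis j 1)) (partial j (partial i f) x) < e"
    using d2 near[OF st(1-4)] by auto
  moreover have "dist (partial i (partial j f) (x + s' *\<^sub>R axis j 1 + t' *\<^sub>R axis i 1)) (partial i (partial j f) x) < e"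
    using d1 near[OF st'(1-4)] by auto
  ultimately show False unfolding e_def dist_real_def by (simp add: abs_if split: if_splits)
qed

text \<open>The added 1 admits m = 0. This is how a given error is divided by an integral in the
  limit arguments below.\<close>

lemma scaled_le: "0 \<le> m \<Longrightarrow> 0 < e \<Longrightarrow> e / (m + 1) * m \<le> (e::real)"
  by (simp add: pos_divide_le_eq algebra_simps)

section \<open>Invariance of Lebesgue measure, and functions of compact support\<close>

lemma distr_lborel_reflect: "distr lborel borel (\<lambda>x::'a::euclidean_space. c - x) = lborel"
proof -
  have "lborel = density (distr lborel borel (\<lambda>x::'a. c + (-1) *\<^sub>R x)) (\<lambda>_. 1)"
    using lborel_affine[of "-1" c] by simp
  then show ?thesis by (simp add: density_1)
qed

lemma distr_lborel_shift: "distr lborel borel (\<lambda>x::'a::euclidean_space. x + c) = lborel"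
proof -
  have "(\<lambda>x. x + c) = (+) c" by (simp add: fun_eq_iff add.commute)
  then show ?thesis using lborel_distr_plus[of c] by simp
qed

lemma integral_lborel_shift:
  fixes g :: "'a::euclidean_space \<Rightarrow> real"
  assumes [measurable]: "g \<in> borel_measurable borel"
  shows "(LBINT x. g (x + c)) = (LBINT x. g x)"
  by (subst (2) distr_lborel_shift[symmetric, of c]) (simp add: integral_distr)

lemma integrable_lborel_shift:
  fixes g :: "'a::euclidean_space \<Rightarrow> real"
  assumes "integrable lborel g"
  shows "integrable lborel (\<lambda>x. g (x + c))"
  using assms integrable_distr[of "\<lambda>x. x + c" lborel borel g]
  by (simp add: distr_lborel_shift)

lemma integral_lborel_reflect:
  fixes g :: "'a::euclidean_space \<Rightarrow> real"
  assumes [measurable]: "g \<in> borel_measurable borel"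
  shows "(LBINT x. g (c - x)) = (LBINT x. g x)"
  by (subst (2) distr_lborel_reflect[symmetric, of c]) (simp add: integral_distr)

lemma integrable_lborel_reflect:
  fixes g :: "'a::euclidean_space \<Rightarrow> real"
  assumes "integrable lborel g"
  shows "integrable lborel (\<lambda>x. g (c - x))"
  using assms integrable_distr[of "\<lambda>x. c - x" lborel borel g]
  by (simp add: distr_lborel_reflect)

lemma nn_integral_lborel_reflect:
  fixes g :: "'a::euclidean_space \<Rightarrow> ennreal"
  assumes [measurable]: "g \<in> borel_measurable borel"
  shows "(\<integral>\<^sup>+x. g (c - x) \<partial>lborel) = (\<integral>\<^sup>+x. g x \<partial>lborel)"
  by (subst (2) distr_lborel_reflect[symmetric, of c]) (simp add: nn_integral_distr)

definition csupp :: "'a::euclidean_space set \<Rightarrow> ('a \<Rightarrow> real) \<Rightarrow> bool" where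
  "csupp W g \<longleftrightarrow> (\<exists>K. compact K \<and> K \<subseteq> W \<and> (\<forall>x. x \<notin> K \<longrightarrow> g x = 0))"

lemma integrable_csupp:
  fixes g :: "'a::euclidean_space \<Rightarrow> real"
  assumes "continuous_on W g" "csupp W g"
  shows "integrable lborel g"
proof -
  obtain K where K: "compact K" "K \<subseteq> W" "\<And>x. x \<notin> K \<Longrightarrow> g x = 0" using assms(2) unfolding csupp_def by blast
  have "integrable lborel (\<lambda>x. indicator K x *\<^sub>R g x)"
    using K assms(1) by (intro borel_integrable_compact) (auto intro: continuous_on_subset)
  moreover have "(\<lambda>x. indicator K x *\<^sub>R g x) = g"
    using K(3) by (auto simp: fun_eq_iff indicator_def)
  ultimately show ?thesis by simp
qed

lemma csupp_mult: "csupp W g \<Longrightarrow> csupp W (\<lambda>x. h x * g x)" "csupp W g \<Longrightarrow> csupp W (\<lambda>x. g x * h x)"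
  unfolding csupp_def by (metis mult_zero_right, metis mult_zero_left)

lemma csupp_add: assumes "csupp W g" "csupp W h" shows "csupp W (\<lambda>x. g x + h x)"
proof -
  obtain K L where "compact K" "K \<subseteq> W" "\<And>x. x \<notin> K \<Longrightarrow> g x = 0" "compact L" "L \<subseteq> W" "\<And>x. x \<notin> L \<Longrightarrow> h x = 0"
    using assms unfolding csupp_def by metis
  then show ?thesis unfolding csupp_def by (intro exI[of _ "K \<union> L"]) (auto intro: compact_Un)
qed

lemma csupp_zero [simp]: "csupp W (\<lambda>x. 0)"
  unfolding csupp_def by (rule exI[of _ "{}"]) simp

lemma csupp_sum: "(\<And>a. a \<in> A \<Longrightarrow> csupp W (g a)) \<Longrightarrow> csupp W (\<lambda>x. \<Sum>a\<in>A. g a x)"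
  by (induction A rule: infinite_finite_induct) (auto intro: csupp_add)

lemma csupp_uminus: "csupp W g \<Longrightarrow> csupp W (\<lambda>x. - g x)"
  using csupp_mult(1)[of W g "\<lambda>_. -1"] by simp

lemma csupp_diff: "csupp W g \<Longrightarrow> csupp W h \<Longrightarrow> csupp W (\<lambda>x. g x - h x)"
  using csupp_add[OF _ csupp_uminus] by fastforce

lemma csupp_subset: "csupp W g \<Longrightarrow> W \<subseteq> V \<Longrightarrow> csupp V g"
  unfolding csupp_def by (meson subset_trans)

lemma csupp_partial: assumes "csupp W g" shows "csupp W (partial i g)"
proof -
  obtain K where K: "compact K" "K \<subseteq> W" "\<And>x. x \<notin> K \<Longrightarrow> g x = 0" using assms unfolding csupp_def by blast
  have "partial i g x = 0" if "x \<notin> K" for x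
    using partial_cong_open[of "- K" x g "\<lambda>_. 0" i] K that by (simp add: compact_imp_closed open_Compl)
  then show ?thesis unfolding csupp_def using K by blast
qed

section \<open>Averages and difference quotients in coordinate directions\<close>

definition lavg :: "3 \<Rightarrow> real \<Rightarrow> (real^3 \<Rightarrow> real) \<Rightarrow> real^3 \<Rightarrow> real" where
  "lavg i r g x = integral {0..r} (\<lambda>s. g (x + s *\<^sub>R axis i 1)) / r"

definition dquot :: "3 \<Rightarrow> real \<Rightarrow> (real^3 \<Rightarrow> real) \<Rightarrow> real^3 \<Rightarrow> real" where
  "dquot i r g x = (g (x + r *\<^sub>R axis i 1) - g x) / r"

definition halve :: "3 \<Rightarrow> real \<Rightarrow> (real^3 \<Rightarrow> real) \<Rightarrow> real^3 \<Rightarrow> real" where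
  "halve i r g x = (g x + g (x + r *\<^sub>R axis i 1)) / 2"

lemma continuous_line:
  assumes "continuous_on UNIV (g :: real^3 \<Rightarrow> real)"
  shows "continuous_on S (\<lambda>s. g (x + s *\<^sub>R v))"
  by (rule continuous_on_compose2[OF assms]) (auto intro!: continuous_intros)

lemma continuous_lavg:
  assumes "continuous_on UNIV g" shows "continuous_on UNIV (lavg i r g)"
proof -
  have "continuous_on (UNIV \<times> cbox 0 r) (\<lambda>(x, s). g (x + s *\<^sub>R axis i 1))"
    unfolding split_beta by (rule continuous_on_compose2[OF assms]) (auto intro!: continuous_intros)
  from integral_continuous_on_param[OF this]
  have "continuous_on UNIV (\<lambda>x. integral {0..r} (\<lambda>s. g (x + s *\<^sub>R axis i 1)))"
    by (simp add: cbox_interval)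
  then show ?thesis unfolding lavg_def[abs_def]
    by (cases "r = 0") (auto intro!: continuous_intros)
qed

lemma continuous_shift:
  assumes "continuous_on UNIV (g :: real^3 \<Rightarrow> real)" shows "continuous_on UNIV (\<lambda>x. g (x + v))"
  by (rule continuous_on_compose2[OF assms]) (auto intro!: continuous_intros)

lemma continuous_dquot:
  assumes "continuous_on UNIV g" shows "continuous_on UNIV (dquot i r g)"
  unfolding dquot_def[abs_def]
  by (cases "r = 0") (auto intro!: continuous_intros continuous_shift assms)

lemma continuous_halve:
  assumes "continuous_on UNIV g" shows "continuous_on UNIV (halve i r g)"
  unfolding halve_def[abs_def] by (intro continuous_intros continuous_shift assms) auto

text \<open>A segment of length 2 r consists of two of length r. With the analogue for
  \<open>dquot\<close> this makes the subdivision of a cube an exact mean over its eight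
  parts.\<close>

lemma lavg_double:
  assumes "continuous_on UNIV g" "0 < r"
  shows "lavg i (2 * r) g = halve i r (lavg i r g)"
proof
  fix x
  let ?h = "\<lambda>s. g (x + s *\<^sub>R axis i 1)"
  have "integral {0..2*r} ?h = integral {0..r} ?h + integral {r..2*r} ?h"
    using assms by (subst Henstock_Kurzweil_Integration.integral_combine)
      (auto intro!: integrable_continuous_real continuous_line)
  moreover have "integral {r..2*r} ?h = integral {0..r} (\<lambda>s. g (x + r *\<^sub>R axis i 1 + s *\<^sub>R axis i 1))"
  proof -
    have "integral {r - r..2*r - r} (\<lambda>s. ?h (s + r)) = integral {r..2*r} ?h"
      by (rule integral_shift_real_ivl)
    then show ?thesis by (simp add: algebra_simps)
  qed
  ultimately show "lavg i (2 * r) g x = halve i r (lavg i r g) x"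
    using assms(2) by (simp add: lavg_def halve_def field_simps)
qed

lemma dquot_double:
  assumes "0 < r" shows "dquot i (2 * r) g = halve i r (dquot i r g)"
proof -
  have "x + (2 * r) *\<^sub>R axis i 1 = x + r *\<^sub>R axis i 1 + r *\<^sub>R axis i 1" for x :: "real^3"
    by (simp add: algebra_simps flip: scaleR_add_left)
  then show ?thesis using assms by (auto simp: fun_eq_iff dquot_def halve_def field_simps)
qed

lemma lavg_halve:
  assumes "continuous_on UNIV g"
  shows "lavg j s (halve i r g) = halve i r (lavg j s g)"
proof
  fix x
  have eq: "x + t *\<^sub>R axis j 1 + r *\<^sub>R axis i 1 = (x + r *\<^sub>R axis i 1) + t *\<^sub>R axis j (1::real)" for t
    by (simp add: algebra_simps)
  have E: "integral {0..s} (\<lambda>t. (g (x + t *\<^sub>R axis j 1) + g (x + t *\<^sub>R axis j 1 + r *\<^sub>R axis i 1)) / 2)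
      = (integral {0..s} (\<lambda>t. g (x + t *\<^sub>R axis j 1)) + integral {0..s} (\<lambda>t. g ((x + r *\<^sub>R axis i 1) + t *\<^sub>R axis j 1))) / 2"
    unfolding integral_divide eq
    by (subst Henstock_Kurzweil_Integration.integral_add[symmetric])
      (auto intro!: integrable_continuous_real continuous_line assms)
  then show "lavg j s (halve i r g) x = halve i r (lavg j s g) x"
    unfolding lavg_def halve_def E by (simp add: add_divide_distrib)
qed

lemma lavg_dquot:
  assumes "continuous_on UNIV g"
  shows "lavg j s (dquot i r g) = dquot i r (lavg j s g)"
proof
  fix x
  have eq: "x + t *\<^sub>R axis j 1 + r *\<^sub>R axis i 1 = (x + r *\<^sub>R axis i 1) + t *\<^sub>R axis j (1::real)" for t
    by (simp add: algebra_simps)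
  have E: "integral {0..s} (\<lambda>t. (g (x + t *\<^sub>R axis j 1 + r *\<^sub>R axis i 1) - g (x + t *\<^sub>R axis j 1)) / r)
      = (integral {0..s} (\<lambda>t. g ((x + r *\<^sub>R axis i 1) + t *\<^sub>R axis j 1)) - integral {0..s} (\<lambda>t. g (x + t *\<^sub>R axis j 1))) / r"
    unfolding integral_divide eq
    by (subst Henstock_Kurzweil_Integration.integral_diff[symmetric])
      (auto intro!: integrable_continuous_real continuous_line assms)
  then show "lavg j s (dquot i r g) x = dquot i r (lavg j s g) x"
    unfolding lavg_def dquot_def E by (simp add: diff_divide_distrib mult.commute)
qed

lemma lavg_bound:
  assumes "continuous_on UNIV g" "0 < r" "\<And>s. 0 \<le> s \<Longrightarrow> s \<le> r \<Longrightarrow> \<bar>g (x + s *\<^sub>R axis i 1) - c\<bar> \<le> B"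
  shows "\<bar>lavg i r g x - c\<bar> \<le> B"
proof -
  let ?h = "\<lambda>s. g (x + s *\<^sub>R axis i 1)"
  have int: "?h integrable_on {0..r}"
    by (intro integrable_continuous_real continuous_line assms(1))
  have "integral {0..r} ?h \<le> integral {0..r} (\<lambda>s. c + B)" "integral {0..r} (\<lambda>s. c - B) \<le> integral {0..r} ?h"
    by (rule integral_le; use int assms(3) in \<open>force simp: abs_le_iff\<close>)+
  then have "integral {0..r} ?h \<le> (c + B) * r" "(c - B) * r \<le> integral {0..r} ?h"
    using assms(2) by (auto simp: mult.commute)
  then show ?thesis using assms(2) by (simp add: lavg_def abs_le_iff field_simps)
qed

lemma halve_bound:
  assumes "e \<le> \<bar>halve i r g x\<bar>"
  shows "\<exists>s\<in>{0, r}. e \<le> \<bar>g (x + s *\<^sub>R axis i 1)\<bar>"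
  using assms by (auto simp: halve_def)

lemma lavg_zero:
  assumes "\<And>x. norm x > R \<Longrightarrow> g x = 0" "0 < r" "norm x > R + r"
  shows "lavg i r g x = 0"
proof -
  have "g (x + s *\<^sub>R axis i 1) = 0" if "s \<in> {0..r}" for s
  proof (rule assms(1))
    have "norm x \<le> norm (x + s *\<^sub>R axis i 1) + norm (s *\<^sub>R axis i (1::real))"
      using norm_triangle_ineq4[of "x + s *\<^sub>R axis i 1" "s *\<^sub>R axis i 1"] by simp
    then show "norm (x + s *\<^sub>R axis i 1) > R" using that assms by (simp add: norm_axis_1)
  qed
  then have "integral {0..r} (\<lambda>s. g (x + s *\<^sub>R axis i 1)) = integral {0..r} (\<lambda>s. 0)"
    by (intro Henstock_Kurzweil_Integration.integral_cong) auto
  then show ?thesis by (simp add: lavg_def)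
qed

lemma integral_dquot:
  assumes "continuous_on UNIV g" "csupp UNIV g"
  shows "(LBINT x. dquot i r g x) = 0"
proof -
  have int: "integrable lborel g" by (rule integrable_csupp[OF assms])
  have "(LBINT x. g (x + r *\<^sub>R axis i 1) - g x) = 0"
    using integrable_lborel_shift[OF int, of "r *\<^sub>R axis i 1"] int
      integral_lborel_shift[OF borel_measurable_integrable[OF int, simplified]]
    by (subst Bochner_Integration.integral_diff) auto
  then show ?thesis by (simp add: dquot_def)
qed

text \<open>Goursat's argument: a compactly supported field that is merely differentiable still has
  vanishing total divergence, provided that the divergence is continuous. The flux through faces is
  replaced by difference quotients averaged over the other two directions, and the subdivision of a
  cube becomes the halving identity.\<close>

context
  fixes b :: "3 \<Rightarrow> real^3 \<Rightarrow> real" and a :: "real^3 \<Rightarrow> real"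
  assumes b: "\<And>i x. b i differentiable (at x)"
    and a: "continuous_on UNIV a"
    and div: "\<And>x. (\<Sum>i\<in>UNIV. partial i (b i) x) = a x"
begin

text \<open>For the cube with lower corner x and edge r this is the outward flux of b through the
  six faces minus the integral of a, all divided by the volume r^3.\<close>

private definition defect :: "real \<Rightarrow> real^3 \<Rightarrow> real" where
  "defect r x = lavg 2 r (lavg 3 r (dquot 1 r (b 1))) x + lavg 1 r (lavg 3 r (dquot 2 r (b 2))) x
     + lavg 1 r (lavg 2 r (dquot 3 r (b 3))) x - lavg 1 r (lavg 2 r (lavg 3 r a)) x"

private lemma cb: "continuous_on UNIV (b i)"
  using b by (simp add: continuous_at_imp_continuous_on differentiable_imp_continuous_within)

private lemmas cont = continuous_lavg continuous_dquot continuous_halve cb a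

private lemma halve_commute: "halve i r (halve j s g) = halve j s (halve i r g)"
  by (rule ext) (simp add: halve_def field_simps)

text \<open>Fluxes through the inner faces cancel. Thanks to the division by the volume, the defect
  of a cube is the plain mean of the defects of its eight subcubes.\<close>

private lemma defect_double:
  assumes "0 < r" shows "defect (2 * r) x = halve 1 r (halve 2 r (halve 3 r (defect r))) x"
proof -
  have "lavg 2 (2*r) (lavg 3 (2*r) (dquot 1 (2*r) (b 1)))
      = halve 1 r (halve 2 r (halve 3 r (lavg 2 r (lavg 3 r (dquot 1 r (b 1))))))"
    by (simp add: lavg_double dquot_double lavg_halve cont assms halve_commute[of 3 _ 2] halve_commute[of 3 _ 1] halve_commute[of 2 _ 1])
  moreover have "lavg 1 (2*r) (lavg 3 (2*r) (dquot 2 (2*r) (b 2)))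
      = halve 1 r (halve 2 r (halve 3 r (lavg 1 r (lavg 3 r (dquot 2 r (b 2))))))"
    by (simp add: lavg_double dquot_double lavg_halve cont assms halve_commute[of 3 _ 2] halve_commute[of 3 _ 1] halve_commute[of 2 _ 1])
  moreover have "lavg 1 (2*r) (lavg 2 (2*r) (dquot 3 (2*r) (b 3)))
      = halve 1 r (halve 2 r (halve 3 r (lavg 1 r (lavg 2 r (dquot 3 r (b 3))))))"
    by (simp add: lavg_double dquot_double lavg_halve cont assms halve_commute[of 3 _ 2] halve_commute[of 3 _ 1] halve_commute[of 2 _ 1])
  moreover have "lavg 1 (2*r) (lavg 2 (2*r) (lavg 3 (2*r) a))
      = halve 1 r (halve 2 r (halve 3 r (lavg 1 r (lavg 2 r (lavg 3 r a)))))"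
    by (simp add: lavg_double lavg_halve cont assms halve_commute[of 3 _ 2] halve_commute[of 3 _ 1] halve_commute[of 2 _ 1])
  ultimately show ?thesis
    by (simp only: defect_def halve_def) argo
qed

text \<open>Of eight numbers, one is at least as large in absolute value as their mean.\<close>

private lemma defect_step:
  assumes "0 < r" "e \<le> \<bar>defect (2 * r) x\<bar>"
  shows "\<exists>y. e \<le> \<bar>defect r y\<bar> \<and> (\<forall>i. x $ i \<le> y $ i \<and> y $ i + r \<le> x $ i + 2 * r)"
proof -
  obtain s1 where s1: "s1 \<in> {0, r}" "e \<le> \<bar>halve 2 r (halve 3 r (defect r)) (x + s1 *\<^sub>R axis 1 1)\<bar>"
    using assms halve_bound unfolding defect_double[OF assms(1)] by metis
  obtain s2 where s2: "s2 \<in> {0, r}" "e \<le> \<bar>halve 3 r (defect r) (x + s1 *\<^sub>R axis 1 1 + s2 *\<^sub>R axis 2 1)\<bar>"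
    using s1(2) halve_bound by metis
  obtain s3 where s3: "s3 \<in> {0, r}" "e \<le> \<bar>defect r (x + s1 *\<^sub>R axis 1 1 + s2 *\<^sub>R axis 2 1 + s3 *\<^sub>R axis 3 1)\<bar>"
    using s2(2) halve_bound by metis
  show ?thesis
    by (rule exI, rule conjI, rule s3(2)) (use s1(1) s2(1) s3(1) assms(1) in \<open>auto simp: forall_3 axis_def\<close>)
qed

text \<open>On a cube of edge r that contains p, b differs from its linearization at p by o(r), and
  the linearization has constant divergence \<open>a p\<close>. Differentiability at the single
  point p and continuity of a there suffice, with no control of the derivatives nearby.\<close>

private lemma defect_small:
  assumes "e > 0"
  shows "\<exists>d>0. \<forall>r x. 0 < r \<and> r < d \<and> (\<forall>i. x $ i \<le> p $ i \<and> p $ i \<le> x $ i + r) \<longrightarrow> \<bar>defect r x\<bar> < e"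
proof -
  \<comment> \<open>Each of the three flux terms errs by at most 12 e' and the mean of a by at most
    e', together 37 e'.\<close>
  define e' where "e' = e / 40"
  have e': "e' > 0" using assms by (simp add: e'_def)
  define Q where "Q i d \<longleftrightarrow> d > 0 \<and> (\<forall>y. norm (y - p) < d \<longrightarrow>
      \<bar>b i y - b i p - (\<Sum>k\<in>UNIV. (y - p) $ k * partial k (b i) p)\<bar> \<le> e' * norm (y - p))" for i d
  have "\<exists>d. Q i d" for i
    using has_derivative_partial[OF b, of i p] e'
    unfolding has_derivative_at_alt Q_def by auto
  then obtain D where "\<And>i. Q i (D i)" by metis
  then have D: "\<And>i. D i > 0" "\<And>i y. norm (y - p) < D i \<Longrightarrow>
      \<bar>b i y - b i p - (\<Sum>k\<in>UNIV. (y - p) $ k * partial k (b i) p)\<bar> \<le> e' * norm (y - p)"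
    unfolding Q_def by auto
  obtain d0 where d0: "d0 > 0" "\<And>y. dist y p < d0 \<Longrightarrow> dist (a y) (a p) < e'"
    using a[unfolded continuous_on_iff] e' by (metis UNIV_I)
  define d where "d = min d0 (min (D 1) (min (D 2) (D 3))) / 6"
  have "\<forall>i. 6 * d \<le> D i" unfolding forall_3 d_def by auto
  then have d: "d > 0" "6 * d \<le> d0" "\<And>i. 6 * d \<le> D i"
    using d0(1) D(1) by (auto simp: d_def)
  show ?thesis
  proof (intro exI[of _ d] conjI allI impI d(1))
    fix r x assume r: "0 < r \<and> r < d \<and> (\<forall>i. x $ i \<le> p $ i \<and> p $ i \<le> x $ i + r)"
    \<comment> \<open>Each coordinate of y - p is at most 2 r, and the Euclidean norm is at most the
      sum of the three. The edge 2 r makes room for the shifted point in the difference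
      quotient.\<close>
    have near: "norm (y - p) \<le> 6 * r" if "\<And>i. x $ i \<le> y $ i \<and> y $ i \<le> x $ i + 2 * r" for y
    proof -
      have "norm (y - p) \<le> (\<Sum>i\<in>UNIV. \<bar>(y - p) $ i\<bar>)" by (rule norm_le_l1_cart)
      also have "\<dots> \<le> (\<Sum>i\<in>(UNIV::3 set). 2 * r)"
      proof (rule sum_mono)
        fix i :: 3
        have "x $ i \<le> p $ i" "p $ i \<le> x $ i + r" "0 < r" using r by auto
        then show "\<bar>(y - p) $ i\<bar> \<le> 2 * r" using that[of i] by (simp add: abs_le_iff)
      qed
      finally show ?thesis by simp
    qed
    have dq: "\<bar>dquot i r (b i) y - partial i (b i) p\<bar> \<le> 12 * e'"
      if y: "\<And>i. x $ i \<le> y $ i \<and> y $ i \<le> x $ i + r" for i y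
    proof -
      let ?y = "y + r *\<^sub>R axis i 1"
      let ?R = "\<lambda>y. b i y - b i p - (\<Sum>k\<in>UNIV. (y - p) $ k * partial k (b i) p)"
      have n1: "norm (y - p) \<le> 6 * r" by (rule near) (use y r in \<open>smt (verit)\<close>)
      have n2: "norm (?y - p) \<le> 6 * r"
        by (rule near) (use y r in \<open>auto simp: axis_def intro: order_trans[of _ "y $ _"]; smt (verit)\<close>)
      have "\<bar>?R y\<bar> \<le> e' * norm (y - p)" "\<bar>?R ?y\<bar> \<le> e' * norm (?y - p)"
        using D(2)[of y i] D(2)[of ?y i] n1 n2 r d(3)[of i] by auto
      then have "\<bar>?R y\<bar> \<le> e' * (6 * r)" "\<bar>?R ?y\<bar> \<le> e' * (6 * r)"
        using n1 n2 e' by (meson mult_left_mono less_imp_le order_trans)+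
      moreover have "?R ?y - ?R y = b i ?y - b i y - r * partial i (b i) p"
        by (simp add: sum_subtractf[symmetric] left_diff_distrib[symmetric] axis_def if_distrib
            if_distribR cong: if_cong)
      ultimately have "\<bar>b i ?y - b i y - r * partial i (b i) p\<bar> \<le> 12 * e' * r" by linarith
      moreover have "dquot i r (b i) y - partial i (b i) p = (b i ?y - b i y - r * partial i (b i) p) / r"
        using r by (simp add: dquot_def field_simps)
      ultimately show ?thesis using r by (simp add: abs_divide pos_divide_le_eq)
    qed
    have A: "\<bar>lavg 2 r (lavg 3 r (dquot 1 r (b 1))) x - partial 1 (b 1) p\<bar> \<le> 12 * e'"
      by (intro lavg_bound cont dq conjunct1[OF r]) (use r in \<open>auto simp: axis_def\<close>)
    have B: "\<bar>lavg 1 r (lavg 3 r (dquot 2 r (b 2))) x - partial 2 (b 2) p\<bar> \<le> 12 * e'"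
      by (intro lavg_bound cont dq conjunct1[OF r]) (use r in \<open>auto simp: axis_def\<close>)
    have C: "\<bar>lavg 1 r (lavg 2 r (dquot 3 r (b 3))) x - partial 3 (b 3) p\<bar> \<le> 12 * e'"
      by (intro lavg_bound cont dq conjunct1[OF r]) (use r in \<open>auto simp: axis_def\<close>)
    have aq: "\<bar>a y - a p\<bar> \<le> e'" if y: "\<And>i. x $ i \<le> y $ i \<and> y $ i \<le> x $ i + r" for y
    proof -
      have "norm (y - p) \<le> 6 * r" by (rule near) (use y r in \<open>smt (verit)\<close>)
      then show ?thesis using d0(2)[of y] r d(2) by (simp add: dist_norm)
    qed
    have E: "\<bar>lavg 1 r (lavg 2 r (lavg 3 r a)) x - a p\<bar> \<le> e'"
      by (intro lavg_bound cont aq conjunct1[OF r]) (use r in \<open>auto simp: axis_def\<close>)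
    have "partial 1 (b 1) p + partial 2 (b 2) p + partial 3 (b 3) p = a p"
      using div[of p] by (simp add: sum_3)
    then show "\<bar>defect r x\<bar> < e"
      using A B C E e' unfolding defect_def e'_def by linarith
  qed
qed

text \<open>Otherwise repeated halving gives nested cubes, all with defect at least e in absolute
  value, which shrink to a point p and contradict \<open>defect_small\<close> there.\<close>

private lemma defect_zero:
  assumes "0 < r" shows "defect r x = 0"
proof (rule ccontr)
  assume ne: "defect r x \<noteq> 0"
  define e where "e = \<bar>defect r x\<bar>"
  have e: "e > 0" using ne by (simp add: e_def)
  define R where "R n = r / 2 ^ n" for n
  have R: "R n > 0" "R n = 2 * R (Suc n)" for n using assms by (auto simp: R_def)
  have "\<exists>X. \<forall>n. (e \<le> \<bar>defect (R n) (X n)\<bar>) \<and> (\<forall>i. X n $ i \<le> X (Suc n) $ i \<and> X (Suc n) $ i + R (Suc n) \<le> X n $ i + R n)"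
  proof (rule dependent_nat_choice)
    show "\<exists>x. e \<le> \<bar>defect (R 0) x\<bar>" by (rule exI[of _ x]) (simp add: e_def R_def)
    show "\<exists>y. e \<le> \<bar>defect (R (Suc n)) y\<bar> \<and> (\<forall>i. x $ i \<le> y $ i \<and> y $ i + R (Suc n) \<le> x $ i + R n)"
      if "e \<le> \<bar>defect (R n) x\<bar>" for x n
      using defect_step[OF R(1)[of "Suc n"], of e x] that R(2)[of n] by simp
  qed
  then obtain X where X: "\<And>n. e \<le> \<bar>defect (R n) (X n)\<bar>"
      "\<And>n i. X n $ i \<le> X (Suc n) $ i" "\<And>n i. X (Suc n) $ i + R (Suc n) \<le> X n $ i + R n" by blast
  define Q where "Q n = cbox (X n) (X n + (\<chi> i. R n))" for n
  have "\<Inter>(range Q) \<noteq> {}"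
  proof (rule compact_nest)
    show "compact (Q n)" for n by (simp add: Q_def)
    have "X n \<in> Q n" for n using R(1)[of n] by (simp add: Q_def mem_box_cart less_imp_le)
    then show "Q n \<noteq> {}" for n by blast
    have "Q (Suc n) \<subseteq> Q n" for n
      using X(2,3) unfolding Q_def by (auto simp: mem_box_cart intro: order_trans; meson order_trans)
    then show "m \<le> n \<Longrightarrow> Q n \<subseteq> Q m" for m n by (rule lift_Suc_antimono_le)
  qed
  then obtain p where p: "\<And>n. p \<in> Q n" by blast
  obtain d where d: "d > 0" "\<And>r x. 0 < r \<and> r < d \<and> (\<forall>i. x $ i \<le> p $ i \<and> p $ i \<le> x $ i + r) \<Longrightarrow> \<bar>defect r x\<bar> < e"
    using defect_small[OF e] by blast
  have "R \<longlonglongrightarrow> 0" unfolding R_def[abs_def] by (rule LIMSEQ_divide_realpow_zero) simp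
  from order_tendstoD(2)[OF this d(1)] obtain n where "R n < d" by (auto simp: eventually_sequentially)
  then have "\<bar>defect (R n) (X n)\<bar> < e"
    using d(2)[of "R n" "X n"] R(1)[of n] p[of n] by (auto simp: Q_def mem_box_cart)
  with X(1)[of n] show False by simp
qed

text \<open>By \<open>defect_zero\<close> the average of a over small cubes is a sum of averaged
  difference quotients, and these integrate to 0 by translation invariance. As the cubes shrink, the
  averages converge uniformly to a, with supports in a fixed ball.\<close>

lemma integral_divergence_zero:
  assumes "\<And>i. csupp UNIV (b i)"
  shows "(LBINT x. a x) = 0"
proof -
  have sup_a: "csupp UNIV a"
    using csupp_sum[of UNIV UNIV "\<lambda>i. partial i (b i)"] csupp_partial[OF assms] div by simp
  have bd: "\<exists>R. \<forall>x. norm x > R \<longrightarrow> g x = 0" if g: "csupp UNIV g" for g :: "real^3 \<Rightarrow> real"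
  proof -
    obtain K where "compact K" "\<forall>x. x \<notin> K \<longrightarrow> g x = 0" using g unfolding csupp_def by blast
    moreover then obtain R where "\<forall>x\<in>K. norm x \<le> R" using compact_imp_bounded bounded_iff by metis
    ultimately show ?thesis by (meson not_le)
  qed
  have sup_lavg: "csupp UNIV (lavg i r g)" if g: "csupp UNIV g" and r: "0 < r" for g i r
  proof -
    obtain R where R: "\<And>x. norm x > R \<Longrightarrow> g x = 0" using bd[OF g] by blast
    show ?thesis unfolding csupp_def
      by (rule exI[of _ "cball 0 (R + r)"]) (use lavg_zero[OF R r] in auto)
  qed
  have D: "(LBINT x. lavg j r (lavg k r (dquot i r (b i))) x) = 0"
    and Di: "integrable lborel (lavg j r (lavg k r (dquot i r (b i))))" if "0 < r" for i j k r
  proof -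
    show "(LBINT x. lavg j r (lavg k r (dquot i r (b i))) x) = 0"
      using that by (simp add: lavg_dquot cont integral_dquot sup_lavg assms)
    have "csupp UNIV (dquot i r (b i))"
    proof -
      obtain R where R: "\<And>x. norm x > R \<Longrightarrow> b i x = 0" using bd[OF assms] by blast
      have "dquot i r (b i) x = 0" if x: "norm x > R + r" for x
      proof -
        have "norm x \<le> norm (x + r *\<^sub>R axis i 1) + norm (r *\<^sub>R axis i (1::real))"
          using norm_triangle_ineq4[of "x + r *\<^sub>R axis i 1" "r *\<^sub>R axis i 1"] by simp
        then have "norm (x + r *\<^sub>R axis i 1) > R" using x \<open>0 < r\<close> by (simp add: norm_axis_1)
        then show ?thesis using R x \<open>0 < r\<close> by (simp add: dquot_def)
      qed
      then show ?thesis unfolding csupp_def by (intro exI[of _ "cball 0 (R + r)"]) auto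
    qed
    then show "integrable lborel (lavg j r (lavg k r (dquot i r (b i))))"
      by (intro integrable_csupp[of UNIV] cont sup_lavg that)
  qed
  have E: "(LBINT x. lavg 1 r (lavg 2 r (lavg 3 r a)) x) = 0" if "0 < r" for r
  proof -
    have "lavg 1 r (lavg 2 r (lavg 3 r a)) x = lavg 2 r (lavg 3 r (dquot 1 r (b 1))) x
       + lavg 1 r (lavg 3 r (dquot 2 r (b 2))) x + lavg 1 r (lavg 2 r (dquot 3 r (b 3))) x" for x
      using defect_zero[OF that, of x] by (simp add: defect_def)
    then show ?thesis using D[OF that] Di[OF that] by simp
  qed
  obtain R where R: "\<And>x. norm x > R \<Longrightarrow> a x = 0" using bd[OF sup_a] by blast
  have bnd: "\<bar>LBINT x. a x\<bar> \<le> e * measure lborel (cball (0::real^3) (R + 3))" if e: "e > 0" for e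
  proof -
    have "uniformly_continuous_on (cball 0 (R + 10)) a"
      by (intro compact_uniformly_continuous) (auto intro: continuous_on_subset[OF a])
    then obtain d where d: "d > 0" "\<And>x y. x \<in> cball 0 (R+10) \<Longrightarrow> y \<in> cball 0 (R+10) \<Longrightarrow> dist y x < d \<Longrightarrow> dist (a y) (a x) < e"
      using e unfolding uniformly_continuous_on_def by meson
    \<comment> \<open>Three displacements of length at most r add up to less than d, and r at most 1
      keeps the averages supported in the ball of radius R + 3.\<close>
    define r where "r = min 1 (d / 4)"
    have r: "0 < r" "r \<le> 1" "4 * r \<le> d" using d(1) by (auto simp: r_def)
    let ?m = "lavg 1 r (lavg 2 r (lavg 3 r a))"
    have near: "\<bar>a (x + s1 *\<^sub>R axis 1 1 + s2 *\<^sub>R axis 2 1 + s3 *\<^sub>R axis 3 1) - a x\<bar> \<le> e"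
      if x: "norm x \<le> R + 3" and s: "0 \<le> s1" "s1 \<le> r" "0 \<le> s2" "s2 \<le> r" "0 \<le> s3" "s3 \<le> r" for x s1 s2 s3
    proof -
      let ?v = "s1 *\<^sub>R axis 1 1 + s2 *\<^sub>R axis 2 1 + s3 *\<^sub>R axis 3 1 :: real^3"
      have n: "norm ?v \<le> s1 + s2 + s3"
        by (intro norm_triangle_le add_mono) (use s in \<open>auto simp: norm_axis_1\<close>)
      have "dist (x + ?v) x < d" using n s r by (simp add: dist_norm)
      moreover have "norm (x + ?v) \<le> R + 10"
        using norm_triangle_ineq[of x ?v] n x s r by linarith
      ultimately have "dist (a (x + ?v)) (a x) < e" using d(2)[of x "x + ?v"] x by simp
      then show ?thesis by (simp add: dist_real_def add.assoc)
    qed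
    have b1: "\<bar>?m x - a x\<bar> \<le> e * indicator (cball 0 (R + 3)) x" for x
    proof (cases "norm x \<le> R + 3")
      case True
      have "\<bar>?m x - a x\<bar> \<le> e"
        by (intro lavg_bound cont r(1)) (use near[OF True] in auto)
      then show ?thesis using True by simp
    next
      case False
      have "?m x = 0"
        by (rule lavg_zero[of "R + r + r"], rule lavg_zero[of "R + r"], rule lavg_zero[of R])
          (use R r False in auto)
      then show ?thesis using False R[of x] by simp
    qed
    have ia: "integrable lborel a" by (rule integrable_csupp[OF a sup_a])
    have im: "integrable lborel ?m" by (intro integrable_csupp[of UNIV] cont sup_lavg sup_a r(1))
    have "\<bar>LBINT x. a x\<bar> = \<bar>LBINT x. ?m x - a x\<bar>"
      using E[OF r(1)] ia im by simp
    also have "\<dots> \<le> (LBINT x. \<bar>?m x - a x\<bar>)"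
      by (rule integral_abs_bound)
    also have "\<dots> \<le> (LBINT x. e * indicator (cball (0::real^3) (R + 3)) x)"
      by (rule Bochner_Integration.integral_mono)
        (use ia im b1 in \<open>auto intro!: integrable_real_indicator simp: emeasure_lborel_cball_finite[unfolded infinity_ennreal_def]\<close>)
    also have "\<dots> = e * measure lborel (cball (0::real^3) (R + 3))" by simp
    finally show ?thesis .
  qed
  have "\<bar>LBINT x. a x\<bar> \<le> 0 + e" if "e > 0" for e
  proof -
    let ?m = "measure lborel (cball (0::real^3) (R + 3))"
    have "\<bar>LBINT x. a x\<bar> \<le> e / (?m + 1) * ?m"
      by (rule bnd) (use that in \<open>auto intro!: divide_pos_pos add_nonneg_pos\<close>)
    also have "\<dots> \<le> e" using that by (intro scaled_le) auto
    finally show ?thesis by simp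
  qed
  then have "\<bar>LBINT x. a x\<bar> \<le> 0" by (rule field_le_epsilon)
  then show ?thesis by simp
qed

end

subsection \<open>Smooth bump functions and mollification\<close>

definition smooth :: "(real^3 \<Rightarrow> real) \<Rightarrow> bool" where
  "smooth \<phi> \<longleftrightarrow> (\<forall>k. Ck_on k UNIV \<phi>)"

text \<open>The functions exp(-1/t) t^(-n), extended by 0. The derivative of each is a combination
  of later ones, so smoothness across t = 0 is an induction over the family.\<close>

definition flat_exp :: "nat \<Rightarrow> real \<Rightarrow> real" where
  "flat_exp n t = (if 0 < t then exp (- inverse t) * inverse t ^ n else 0)"

lemma flat_exp_tendsto: "(flat_exp n \<longlongrightarrow> 0) (at 0)"
proof -
  have "((\<lambda>t. inverse t ^ n / exp (inverse t)) \<longlongrightarrow> (0::real)) (at_right 0)"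
    by (rule filterlim_compose[OF tendsto_power_div_exp_0 filterlim_inverse_at_top_right])
  then have "(flat_exp n \<longlongrightarrow> 0) (at_right 0)"
    by (rule Lim_transform_eventually)
      (auto simp: flat_exp_def eventually_at_filter exp_minus divide_inverse mult.commute)
  moreover have "(flat_exp n \<longlongrightarrow> 0) (at_left 0)"
    by (rule tendsto_eventually) (auto simp: flat_exp_def eventually_at_filter)
  ultimately show ?thesis by (rule filterlim_split_at_real[rotated])
qed

text \<open>At t = 0 the difference quotient of \<open>flat_exp n\<close> is
  \<open>flat_exp (n + 1)\<close>, which tends to 0; elsewhere this is the product rule.\<close>

lemma flat_exp_deriv:
  "(flat_exp n has_real_derivative flat_exp (n + 2) t - real n * flat_exp (n + 1) t) (at t)"
proof -
  consider "t < 0" | "t = 0" | "t > 0" by linarith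
  then show ?thesis
  proof cases
    case 1
    have "((\<lambda>_. 0) has_real_derivative 0) (at t)" by simp
    then have "(flat_exp n has_real_derivative 0) (at t)"
      by (rule has_field_derivative_transform_within_open[where S="{..<0}"])
        (use 1 in \<open>auto simp: flat_exp_def\<close>)
    then show ?thesis using 1 by (simp add: flat_exp_def)
  next
    case 2
    have "((\<lambda>h. flat_exp n h / h) \<longlongrightarrow> 0) (at 0)"
      using flat_exp_tendsto[of "n + 1"]
      by (rule Lim_transform_eventually) (auto simp: flat_exp_def eventually_at_filter divide_inverse)
    then have "(flat_exp n has_real_derivative 0) (at 0)"
      by (simp add: DERIV_def flat_exp_def[of n 0])
    then show ?thesis using 2 by (simp add: flat_exp_def)
  next
    case 3
    have "((\<lambda>t. exp (- inverse t) * inverse t ^ n) has_real_derivative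
        flat_exp (n + 2) t - real n * flat_exp (n + 1) t) (at t)"
    proof (cases n)
      case 0
      then show ?thesis using 3
        by (auto intro!: derivative_eq_intros simp: flat_exp_def power2_eq_square field_simps)
    next
      case (Suc m)
      have i: "(inverse has_real_derivative - (inverse t * inverse t)) (at t)"
        using DERIV_inverse[of t] 3 by (simp add: power2_eq_square)
      have e: "((\<lambda>t. exp (- inverse t)) has_real_derivative exp (- inverse t) * (inverse t * inverse t)) (at t)"
        using DERIV_chain2[OF DERIV_exp DERIV_minus[OF i]] by simp
      show ?thesis unfolding Suc
        by (rule DERIV_cong[OF DERIV_mult[OF e DERIV_power_Suc[OF i]]])
          (use 3 in \<open>simp add: flat_exp_def algebra_simps\<close>)
    qed
    then show ?thesis
      by (rule has_field_derivative_transform_within_open[where S="{0<..}"])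
        (use 3 in \<open>auto simp: flat_exp_def\<close>)
  qed
qed

lemma inner_self_sum: "(x::real^3) \<bullet> x = (\<Sum>i\<in>UNIV. x $ i * x $ i)"
  by (simp add: inner_vec_def)

lemma Ck_on_inner_self: "open U \<Longrightarrow> Ck_on k U (\<lambda>x. x \<bullet> x)"
  unfolding inner_self_sum by (intro Ck_on_sum Ck_on_mult Ck_on_nth)

lemma partial_inner_self: "partial i (\<lambda>x. x \<bullet> x) x = 2 * x $ i"
proof -
  have "((\<lambda>x. x \<bullet> x) has_derivative (\<lambda>h. x \<bullet> h + h \<bullet> x)) (at x)"
    by (rule has_derivative_inner) (auto intro: has_derivative_ident)
  from partial_eqI[OF this] show ?thesis
    by (simp add: inner_commute[of x] inner_axis inner_axis')
qed

lemma differentiable_inner_self: "(\<lambda>x::real^3. x \<bullet> x) differentiable (at x)"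
  using Ck_on_differentiable_at[OF open_UNIV Ck_on_inner_self[OF open_UNIV, of 1]] by simp

lemma smooth_flat_exp: "smooth (\<lambda>x. flat_exp n (c - x \<bullet> x))"
proof -
  have "Ck_on k UNIV (\<lambda>x. flat_exp n (c - x \<bullet> x))" for k
  proof (induction k arbitrary: n)
    case 0
    have "continuous_on UNIV (flat_exp n)"
      using DERIV_isCont[OF flat_exp_deriv] by (simp add: continuous_at_imp_continuous_on)
    then show ?case unfolding Ck_on_0
      by (rule continuous_on_compose2) (auto intro!: continuous_intros)
  next
    case (Suc k)
    let ?g = "\<lambda>x::real^3. c - x \<bullet> x"
    have dg: "?g differentiable (at x)" for x
      by (intro differentiable_diff differentiable_inner_self) auto
    have pg: "partial i ?g x = - 2 * x $ i" for i x
      by (subst partial_diff) (auto simp: partial_inner_self differentiable_inner_self)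
    have "partial i (\<lambda>x. flat_exp n (?g x))
        = (\<lambda>x. (flat_exp (n + 2) (?g x) - real n * flat_exp (n + 1) (?g x)) * (- 2 * x $ i))" for i
      by (rule ext, subst partial_compose[OF dg flat_exp_deriv]) (simp add: pg)
    then have "Ck_on k UNIV (partial i (\<lambda>x. flat_exp n (?g x)))" for i
      using Suc by (auto intro!: Ck_on_uminus Ck_on_mult Ck_on_diff Ck_on_cmult Ck_on_nth Ck_on_const)
    then show ?case
      using differentiable_compose_real[OF dg flat_exp_deriv]
      by (auto simp: Ck_on_Suc differentiable_on_def)
  qed
  then show ?thesis by (simp add: smooth_def)
qed

lemma integral_pos_continuous:
  fixes g :: "real^3 \<Rightarrow> real"
  assumes c: "continuous_on UNIV g" and s: "csupp UNIV g" and nn: "\<And>x. 0 \<le> g x" and p: "0 < g p"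
  shows "0 < (LBINT x. g x)"
proof -
  have int: "integrable lborel g" by (rule integrable_csupp[OF c s])
  have "(LBINT x. g x) \<noteq> 0"
  proof
    assume "(LBINT x. g x) = 0"
    then have "AE x in lborel. g x = 0"
      using integral_nonneg_eq_0_iff_AE[OF int] nn by auto
    moreover have "open {x. 0 < g x}"
      using c open_Collect_less[of "\<lambda>_. 0" g] by auto
    then obtain e where e: "e > 0" "ball p e \<subseteq> {x. 0 < g x}"
      using p open_contains_ball by (metis mem_Collect_eq)
    ultimately have "AE x in lborel. x \<notin> ball p e" by (auto elim!: eventually_mono)
    then have "ball p e \<in> null_sets lborel"
      by (subst AE_iff_null_sets) auto
    then have "measure lborel (ball p e) = 0"
      by (auto simp: measure_def null_setsD1)
    then show False using content_ball_pos[OF e(1), of p] by simp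
  qed
  moreover have "0 \<le> (LBINT x. g x)" using nn by (intro Bochner_Integration.integral_nonneg) auto
  ultimately show ?thesis by simp
qed

text \<open>Normalized separately for every radius e instead of being rescaled from one function, so
  that no change of variables occurs.\<close>

definition moll :: "real \<Rightarrow> real^3 \<Rightarrow> real" where
  "moll e x = flat_exp 0 (e\<^sup>2 - x \<bullet> x) / (LBINT y. flat_exp 0 (e\<^sup>2 - y \<bullet> (y::real^3)))"

lemma flat_exp_support: "0 < e \<Longrightarrow> e < norm (x::real^3) \<Longrightarrow> flat_exp n (e\<^sup>2 - x \<bullet> x) = 0"
  by (auto simp: flat_exp_def dot_square_norm not_less intro!: power_mono)

lemma flat_exp_nonneg: "0 \<le> flat_exp n t" by (simp add: flat_exp_def)

lemma csupp_flat_exp: assumes "0 < e" shows "csupp UNIV (\<lambda>x::real^3. flat_exp n (e\<^sup>2 - x \<bullet> x))"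
  unfolding csupp_def by (rule exI[of _ "cball 0 e"]) (use flat_exp_support[OF assms] in auto)

lemma smooth_continuous: "smooth g \<Longrightarrow> continuous_on UNIV g"
  using Ck_on_continuous smooth_def by blast

lemma moll_total_pos: "0 < e \<Longrightarrow> 0 < (LBINT y. flat_exp 0 (e\<^sup>2 - y \<bullet> (y::real^3)))"
  by (rule integral_pos_continuous[where p=0])
    (auto intro: smooth_continuous smooth_flat_exp csupp_flat_exp flat_exp_nonneg simp: flat_exp_def[of _ "e\<^sup>2"])

lemma moll_nonneg: "0 < e \<Longrightarrow> 0 \<le> moll e x"
  using moll_total_pos[of e] by (auto simp: moll_def flat_exp_nonneg)

lemma moll_support: "0 < e \<Longrightarrow> e < norm x \<Longrightarrow> moll e x = 0"
  by (simp add: moll_def flat_exp_support)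

lemma csupp_moll: assumes "0 < e" shows "csupp UNIV (moll e)"
  unfolding csupp_def by (rule exI[of _ "cball 0 e"]) (use moll_support[OF assms] in auto)

lemma smooth_moll: "smooth (moll e)"
  using smooth_flat_exp[of 0 "e\<^sup>2"] Ck_on_cmult[OF open_UNIV]
  unfolding smooth_def moll_def[abs_def] divide_inverse mult.commute[of _ "inverse _"] by blast

lemma integrable_moll: "0 < e \<Longrightarrow> integrable lborel (moll e)"
  by (intro integrable_csupp[of UNIV] csupp_moll smooth_continuous smooth_moll)

lemma integral_moll: "0 < e \<Longrightarrow> (LBINT x. moll e x) = 1"
  using moll_total_pos[of e] by (simp add: moll_def)

section \<open>Convolution and approximation\<close>

definition conv :: "(real^3 \<Rightarrow> real) \<Rightarrow> (real^3 \<Rightarrow> real) \<Rightarrow> real^3 \<Rightarrow> real" where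
  "conv k g x = (LBINT y. k (x - y) * g y)"

lemma integrable_mult_compact:
  fixes c g :: "'a::euclidean_space \<Rightarrow> real"
  assumes "continuous_on K c" "compact K" "integrable lborel g" "\<And>x. x \<notin> K \<Longrightarrow> g x = 0"
  shows "integrable lborel (\<lambda>x. c x * g x)"
proof -
  obtain B where B: "\<And>x. x \<in> K \<Longrightarrow> \<bar>c x\<bar> \<le> B"
    using compact_imp_bounded[OF compact_continuous_image[OF assms(1,2)]] by (auto simp: bounded_iff)
  have [measurable]: "g \<in> borel_measurable borel" using assms(3) by auto
  have "(\<lambda>x. indicator K x *\<^sub>R c x) \<in> borel_measurable borel"
    by (rule borel_measurable_continuous_on_indicator) (use assms in \<open>auto intro: borel_compact\<close>)
  then have "(\<lambda>x. (indicator K x *\<^sub>R c x) * g x) \<in> borel_measurable borel" by measurable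
  also have "(\<lambda>x. (indicator K x *\<^sub>R c x) * g x) = (\<lambda>x. c x * g x)"
    using assms(4) by (auto simp: fun_eq_iff indicator_def)
  finally have m: "(\<lambda>x. c x * g x) \<in> borel_measurable borel" .
  show ?thesis
  proof (rule Bochner_Integration.integrable_bound)
    show "integrable lborel (\<lambda>x. B * \<bar>g x\<bar>)" using assms(3) by auto
    show "(\<lambda>x. c x * g x) \<in> borel_measurable lborel" using m by simp
    have "\<bar>c x * g x\<bar> \<le> \<bar>B * \<bar>g x\<bar>\<bar>" for x
    proof (cases "x \<in> K")
      case True
      have "\<bar>c x\<bar> * \<bar>g x\<bar> \<le> B * \<bar>g x\<bar>" using True by (intro mult_right_mono B) auto
      also have "\<dots> \<le> \<bar>B * \<bar>g x\<bar>\<bar>" by (rule abs_ge_self)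
      finally show ?thesis by (simp add: abs_mult)
    qed (simp add: assms(4))
    then show "AE x in lborel. norm (c x * g x) \<le> norm (B * \<bar>g x\<bar>)" by simp
  qed
qed

lemma continuous_reflect:
  assumes "continuous_on UNIV (k :: real^3 \<Rightarrow> real)" shows "continuous_on S (\<lambda>y. k (x - y))"
  by (rule continuous_on_compose2[OF assms]) (auto intro!: continuous_intros)

lemma integrable_conv:
  fixes k g :: "real^3 \<Rightarrow> real"
  assumes "continuous_on UNIV k" "integrable lborel g" "csupp UNIV g"
  shows "integrable lborel (\<lambda>y. k (x - y) * g y)"
proof -
  obtain K where "compact K" "\<And>x. x \<notin> K \<Longrightarrow> g x = 0" using assms(3) unfolding csupp_def by blast
  then show ?thesis
    using integrable_mult_compact[OF continuous_reflect[OF assms(1)] _ assms(2), of K] by blast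
qed

lemma conv_commute:
  assumes [measurable]: "k \<in> borel_measurable borel" "g \<in> borel_measurable borel"
  shows "conv k g x = conv g k x"
  using integral_lborel_reflect[of "\<lambda>y. k (x - y) * g y" x] by (simp add: conv_def mult.commute)

lemma uniformly_continuous_csupp:
  fixes g :: "real^3 \<Rightarrow> real"
  assumes "continuous_on UNIV g" "csupp UNIV g"
  shows "uniformly_continuous_on UNIV g"
proof -
  obtain K where K: "compact K" "\<And>x. x \<notin> K \<Longrightarrow> g x = 0" using assms(2) unfolding csupp_def by blast
  obtain R where R: "\<And>x. x \<in> K \<Longrightarrow> norm x \<le> R" using compact_imp_bounded[OF K(1)] bounded_iff by metis
  have u: "uniformly_continuous_on (cball 0 (R + 1)) g"
    by (intro compact_uniformly_continuous continuous_on_subset[OF assms(1)]) auto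
  show ?thesis unfolding uniformly_continuous_on_def
  proof (intro allI impI)
    fix e :: real assume "e > 0"
    then obtain d where d: "d > 0" "\<And>x y. norm x \<le> R + 1 \<Longrightarrow> norm y \<le> R + 1 \<Longrightarrow> dist y x < d \<Longrightarrow> dist (g y) (g x) < e"
      using u unfolding uniformly_continuous_on_def by (metis mem_cball_0)
    show "\<exists>d>0. \<forall>x\<in>UNIV. \<forall>x'\<in>UNIV. dist x' x < d \<longrightarrow> dist (g x') (g x) < e"
    proof (intro exI[of _ "min d 1"] conjI ballI impI)
      fix x y :: "real^3" assume xy: "dist y x < min d 1"
      have tri: "norm x \<le> norm y + dist y x" "norm y \<le> norm x + dist y x"
        by (simp_all add: dist_norm norm_triangle_sub norm_minus_commute) (metis norm_minus_commute norm_triangle_sub)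
      show "dist (g y) (g x) < e"
      proof (cases "norm x \<le> R + 1 \<and> norm y \<le> R + 1")
        case True then show ?thesis using d(2) xy by simp
      next
        case False
        then have "norm x > R" "norm y > R" using tri xy by linarith+
        then have "g x = 0" "g y = 0" using K(2) R by (meson not_le)+
        then show ?thesis using \<open>e > 0\<close> by simp
      qed
    qed (use d in auto)
  qed
qed

lemma uniformly_continuous_compact_shift:
  fixes k :: "real^3 \<Rightarrow> real"
  assumes k: "continuous_on UNIV k" and K: "compact K" and e: "e > 0"
  shows "\<exists>d>0. \<forall>(h::real^3) y. norm h < d \<and> y \<in> K \<longrightarrow> \<bar>k (x + h - y) - k (x - y)\<bar> < e"
proof -
  obtain R where R: "\<And>y. y \<in> K \<Longrightarrow> norm y \<le> R" using compact_imp_bounded[OF K] bounded_iff by metis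
  have "uniformly_continuous_on (cball 0 (norm x + R + 1)) k"
    by (intro compact_uniformly_continuous continuous_on_subset[OF k]) auto
  then obtain d where d: "d > 0" "\<And>z w. norm z \<le> norm x + R + 1 \<Longrightarrow> norm w \<le> norm x + R + 1 \<Longrightarrow> dist w z < d \<Longrightarrow> dist (k w) (k z) < e"
    using e unfolding uniformly_continuous_on_def by (metis mem_cball_0)
  show ?thesis
  proof (intro exI[of _ "min d 1"] conjI allI impI)
    fix h y :: "real^3" assume hy: "norm h < min d 1 \<and> y \<in> K"
    have "norm (x - y) \<le> norm x + R" using norm_triangle_ineq4[of x y] R[of y] hy by simp
    moreover have "norm (x + h - y) \<le> norm (x - y) + norm h"
      using norm_triangle_ineq[of "x - y" h] by (simp add: algebra_simps)
    ultimately show "\<bar>k (x + h - y) - k (x - y)\<bar> < e"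
      using d(2)[of "x - y" "x + h - y"] hy by (simp add: dist_norm)
  qed (use d in auto)
qed

lemma continuous_conv:
  assumes k: "continuous_on UNIV k" and g: "integrable lborel g" "csupp UNIV g"
  shows "continuous_on UNIV (conv k g)"
  unfolding continuous_on_iff
proof (intro ballI allI impI)
  fix x :: "real^3" and e :: real assume e: "e > 0"
  obtain K where K: "compact K" "\<And>x. x \<notin> K \<Longrightarrow> g x = 0" using g(2) unfolding csupp_def by blast
  define G where "G = (LBINT y. \<bar>g y\<bar>)"
  have G: "G \<ge> 0" by (simp add: G_def)
  have "e / (G + 1) > 0" using e G by simp
  then obtain d where d: "d > 0" "\<And>h y. norm h < d \<Longrightarrow> y \<in> K \<Longrightarrow> \<bar>k (x + h - y) - k (x - y)\<bar> < e / (G + 1)"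
    using uniformly_continuous_compact_shift[OF k K(1)] by metis
  show "\<exists>d>0. \<forall>x'\<in>UNIV. dist x' x < d \<longrightarrow> dist (conv k g x') (conv k g x) < e"
  proof (intro exI[of _ d] conjI ballI impI d(1))
    fix x' assume x': "dist x' x < d"
    note i1 = integrable_conv[OF k g]
    have "\<bar>conv k g x' - conv k g x\<bar> = \<bar>LBINT y. k (x' - y) * g y - k (x - y) * g y\<bar>"
      using i1 by (simp add: conv_def)
    also have "\<dots> \<le> (LBINT y. \<bar>k (x' - y) * g y - k (x - y) * g y\<bar>)" by (rule integral_abs_bound)
    also have "\<dots> \<le> (LBINT y. e / (G + 1) * \<bar>g y\<bar>)"
    proof (rule Bochner_Integration.integral_mono)
      fix y
      show "\<bar>k (x' - y) * g y - k (x - y) * g y\<bar> \<le> e / (G + 1) * \<bar>g y\<bar>"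
      proof (cases "y \<in> K")
        case True
        have "\<bar>k (x' - y) - k (x - y)\<bar> \<le> e / (G + 1)"
          using d(2)[of "x' - x" y] True x' by (simp add: dist_norm)
        then show ?thesis
          unfolding left_diff_distrib[symmetric] abs_mult by (rule mult_right_mono) simp
      qed (simp add: K(2))
    qed (use i1 g in auto)
    also have "\<dots> = e / (G + 1) * G" by (simp add: G_def)
    also have "\<dots> < e" using e G by (simp add: field_simps)
    finally show "dist (conv k g x') (conv k g x) < e" by (simp add: dist_real_def)
  qed
qed

lemma increment_partials:
  assumes "\<And>y. f differentiable (at y)"
  shows "\<exists>t\<in>{0<..<1}. f (z + h) - f z = (\<Sum>i\<in>UNIV. h $ i * partial i f (z + t *\<^sub>R h))"
proof -
  have "((\<lambda>t. f (z + t *\<^sub>R h)) has_real_derivative (\<Sum>i\<in>UNIV. h $ i * partial i f (z + t *\<^sub>R h))) (at t)" for t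
  proof -
    have "((\<lambda>t. z + t *\<^sub>R h) has_derivative (\<lambda>s. s *\<^sub>R h)) (at t)"
      by (auto intro!: derivative_eq_intros)
    from has_derivative_compose[OF this has_derivative_partial[OF assms]]
    have "((\<lambda>t. f (z + t *\<^sub>R h)) has_derivative (\<lambda>s. \<Sum>i\<in>UNIV. (s *\<^sub>R h) $ i * partial i f (z + t *\<^sub>R h))) (at t)" .
    also have "(\<lambda>s. \<Sum>i\<in>UNIV. (s *\<^sub>R h) $ i * partial i f (z + t *\<^sub>R h))
        = (*) (\<Sum>i\<in>UNIV. h $ i * partial i f (z + t *\<^sub>R h))"
      by (simp add: fun_eq_iff sum_distrib_left mult_ac)
    finally show ?thesis by (simp add: has_field_derivative_def)
  qed
  from MVT2[of 0 1 "\<lambda>t. f (z + t *\<^sub>R h)", OF _ this] show ?thesis by auto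
qed

text \<open>All differentiation falls on the kernel, as g is merely integrable. The linearization
  error of k is uniform over the compact support of g, by the mean value theorem and uniform
  continuity of the partial derivatives of k.\<close>

lemma conv_has_derivative:
  assumes k: "Ck_on 1 UNIV k" and g: "integrable lborel g" "csupp UNIV g"
  shows "(conv k g has_derivative (\<lambda>h. \<Sum>i\<in>UNIV. h $ i * conv (partial i k) g x)) (at x)"
  unfolding has_derivative_at_alt
proof (intro conjI allI impI)
  show "bounded_linear (\<lambda>h. \<Sum>i\<in>UNIV. h $ i * conv (partial i k) g x)"
    by (intro bounded_linear_sum bounded_linear_mult_left[THEN bounded_linear_compose] bounded_linear_vec_nth)
next
  fix e :: real assume e: "e > 0"
  have kd: "k differentiable (at y)" for y using Ck_on_differentiable_at[OF open_UNIV k] by simp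
  have pk: "continuous_on UNIV (partial i k)" for i
    using Ck_on_continuous[OF Ck_on_partial[OF open_UNIV, of 0]] k by simp
  have kc: "continuous_on UNIV k" by (rule Ck_on_continuous[OF k])
  obtain K where K: "compact K" "\<And>x. x \<notin> K \<Longrightarrow> g x = 0" using g(2) unfolding csupp_def by blast
  define G where "G = (LBINT y. \<bar>g y\<bar>)"
  have G: "G \<ge> 0" by (simp add: G_def)
  \<comment> \<open>The 3 counts the coordinates; \<open>G\<close> is the L^1 norm of g.\<close>
  define e' where "e' = e / (3 * (G + 1))"
  have e': "e' > 0" using e G by (simp add: e'_def)
  have "\<forall>i. \<exists>d>0. \<forall>h y. norm h < d \<and> y \<in> K \<longrightarrow> \<bar>partial i k (x + h - y) - partial i k (x - y)\<bar> < e'"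
    using uniformly_continuous_compact_shift[OF pk K(1) e'] by blast
  then obtain D where D: "\<forall>i. D i > 0 \<and> (\<forall>h y. norm h < D i \<and> y \<in> K \<longrightarrow> \<bar>partial i k (x + h - y) - partial i k (x - y)\<bar> < e')"
    using choice[of "\<lambda>i d. d>0 \<and> (\<forall>h y. norm h < d \<and> y \<in> K \<longrightarrow> \<bar>partial i k (x + h - y) - partial i k (x - y)\<bar> < e')"] by blast
  define d where "d = Min (range D)"
  have d: "d > 0" "\<And>i. d \<le> D i" using D by (auto simp: d_def)
  show "\<exists>d>0. \<forall>x'. norm (x' - x) < d \<longrightarrow>
      norm (conv k g x' - conv k g x - (\<Sum>i\<in>UNIV. (x' - x) $ i * conv (partial i k) g x)) \<le> e * norm (x' - x)"
  proof (intro exI[of _ d] conjI allI impI d(1))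
    fix x' assume x': "norm (x' - x) < d"
    define h where "h = x' - x"
    let ?E = "\<lambda>y. k (x' - y) - k (x - y) - (\<Sum>i\<in>UNIV. h $ i * partial i k (x - y))"
    have E: "\<bar>?E y\<bar> \<le> 3 * e' * norm h" if y: "y \<in> K" for y
    proof -
      obtain t where t: "0 < t" "t < 1" "k (x - y + h) - k (x - y) = (\<Sum>i\<in>UNIV. h $ i * partial i k (x - y + t *\<^sub>R h))"
        using increment_partials[OF kd, of "x - y" h] by auto
      have "x' - y = x - y + h" by (simp add: h_def)
      then have "?E y = (\<Sum>i\<in>UNIV. h $ i * (partial i k (x + t *\<^sub>R h - y) - partial i k (x - y)))"
        using t(3) by (simp add: sum_subtractf right_diff_distrib algebra_simps)
      also have "\<bar>\<dots>\<bar> \<le> (\<Sum>i\<in>(UNIV::3 set). norm h * e')"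
      proof (rule order_trans[OF sum_abs sum_mono])
        fix i :: 3
        have "norm (t *\<^sub>R h) \<le> norm h" using t by (simp add: mult_left_le_one_le)
        then have "norm (t *\<^sub>R h) < D i" using x' d(2)[of i] unfolding h_def by linarith
        then have "\<bar>partial i k (x + t *\<^sub>R h - y) - partial i k (x - y)\<bar> \<le> e'"
          using D y less_imp_le by blast
        then show "\<bar>h $ i * (partial i k (x + t *\<^sub>R h - y) - partial i k (x - y))\<bar> \<le> norm h * e'"
          unfolding abs_mult by (intro mult_mono component_le_norm_cart) auto
      qed
      finally show ?thesis by (simp add: mult_ac)
    qed
    have int: "integrable lborel (\<lambda>y. ?E y * g y)"
      using integrable_conv[OF kc g] integrable_conv[OF pk g]
      by (auto simp: left_diff_distrib sum_distrib_right mult.assoc)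
    have "conv k g x' - conv k g x - (\<Sum>i\<in>UNIV. h $ i * conv (partial i k) g x) = (LBINT y. ?E y * g y)"
      using integrable_conv[OF kc g] integrable_conv[OF pk g]
      by (simp add: conv_def left_diff_distrib sum_distrib_right mult.assoc)
    also have "\<bar>\<dots>\<bar> \<le> (LBINT y. \<bar>?E y * g y\<bar>)" by (rule integral_abs_bound)
    also have "\<dots> \<le> (LBINT y. 3 * e' * norm h * \<bar>g y\<bar>)"
    proof (rule Bochner_Integration.integral_mono)
      fix y
      show "\<bar>?E y * g y\<bar> \<le> 3 * e' * norm h * \<bar>g y\<bar>"
        using E[of y] K(2)[of y] by (cases "y \<in> K") (auto simp: abs_mult intro: mult_right_mono)
    qed (use int g in auto)
    also have "\<dots> = 3 * e' * norm h * G" by (simp add: G_def)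
    also have "\<dots> = e * norm h * (G / (G + 1))" using G by (simp add: e'_def field_simps)
    also have "\<dots> \<le> e * norm h * 1" using e G by (intro mult_left_mono) auto
    finally show "norm (conv k g x' - conv k g x - (\<Sum>i\<in>UNIV. (x' - x) $ i * conv (partial i k) g x)) \<le> e * norm (x' - x)"
      by (simp add: h_def)
  qed
qed

lemma partial_conv:
  assumes "Ck_on 1 UNIV k" "integrable lborel g" "csupp UNIV g"
  shows "partial i (conv k g) = conv (partial i k) g"
proof
  fix x
  have "(\<Sum>j\<in>UNIV. axis i (1::real) $ j * conv (partial j k) g x) = conv (partial i k) g x"
    by (simp add: axis_def if_distrib if_distribR cong: if_cong)
  then show "partial i (conv k g) x = conv (partial i k) g x"
    using partial_eqI[OF conv_has_derivative[OF assms], of i x] by simp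
qed

lemma Ck_on_conv:
  assumes "Ck_on m UNIV k" "integrable lborel g" "csupp UNIV g"
  shows "Ck_on m UNIV (conv k g)"
  using assms(1)
proof (induction m arbitrary: k)
  case 0 then show ?case using continuous_conv assms by (simp add: Ck_on_0)
next
  case (Suc m)
  have k1: "Ck_on 1 UNIV k" using Suc.prems Ck_on_mono by fastforce
  have "conv k g differentiable (at x)" for x
    using conv_has_derivative[OF k1 assms(2,3)] differentiable_def by blast
  then show ?case using Suc
    by (auto simp: Ck_on_Suc differentiable_on_def partial_conv[OF k1 assms(2,3)])
qed

text \<open>Stated for every nonnegative kernel that is supported in a small ball, with its total
  mass left open, so that it serves both the mollifier \<open>moll\<close> and the density
  \<open>dens\<close> of the regularized Newton kernel.\<close>

lemma conv_concentrated:
  assumes g: "continuous_on UNIV g" "csupp UNIV g" and e: "0 < e"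
  shows "\<exists>d>0. \<forall>k r x. integrable lborel k \<and> (\<forall>y. 0 \<le> k y) \<and> (\<forall>y. r < norm y \<longrightarrow> k y = 0) \<and> r < d
    \<longrightarrow> \<bar>conv k g x - (LBINT y. k y) * g x\<bar> \<le> e * (LBINT y. k y)"
proof -
  obtain d where d: "d > 0" "\<And>x y. dist y x < d \<Longrightarrow> dist (g y) (g x) < e"
    using uniformly_continuous_csupp[OF g] e unfolding uniformly_continuous_on_def by (metis UNIV_I)
  show ?thesis
  proof (intro exI[of _ d] conjI allI impI d(1))
    fix k :: "real^3 \<Rightarrow> real" and r x assume k: "integrable lborel k \<and> (\<forall>y. 0 \<le> k y) \<and> (\<forall>y. r < norm y \<longrightarrow> k y = 0) \<and> r < d"
    then have mi: "integrable lborel k" and k0: "\<And>y. 0 \<le> k y" and kz: "\<And>y. r < norm y \<Longrightarrow> k y = 0" and r: "r < d"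
      by auto
    have gi: "integrable lborel g" by (rule integrable_csupp[OF g])
    have "csupp UNIV k" unfolding csupp_def by (rule exI[of _ "cball 0 r"]) (auto intro: kz)
    then have i1: "integrable lborel (\<lambda>y. g (x - y) * k y)" using integrable_conv[OF g(1) mi] by blast
    have "conv k g x = conv g k x" by (rule conv_commute) (use gi mi in auto)
    then have "conv k g x - (LBINT y. k y) * g x = (LBINT y. g (x - y) * k y) - (LBINT y. g x * k y)"
      by (simp add: conv_def mult.commute)
    also have "\<dots> = (LBINT y. (g (x - y) - g x) * k y)"
      using i1 mi by (simp add: left_diff_distrib)
    also have "\<bar>\<dots>\<bar> \<le> (LBINT y. \<bar>(g (x - y) - g x) * k y\<bar>)" by (rule integral_abs_bound)
    also have "\<dots> \<le> (LBINT y. e * k y)"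
    proof (rule Bochner_Integration.integral_mono)
      fix y
      show "\<bar>(g (x - y) - g x) * k y\<bar> \<le> e * k y"
      proof (cases "norm y \<le> r")
        case True
        then have "\<bar>g (x - y) - g x\<bar> \<le> e" using d(2)[of "x - y" x] r by (simp add: dist_norm)
        then show ?thesis using k0[of y] by (simp add: abs_mult mult_right_mono)
      qed (use kz[of y] in auto)
    qed (use i1 mi in \<open>auto simp: left_diff_distrib\<close>)
    also have "\<dots> = e * (LBINT y. k y)" by simp
    finally show "\<bar>conv k g x - (LBINT y. k y) * g x\<bar> \<le> e * (LBINT y. k y)" .
  qed
qed

lemma conv_moll_uniform:
  assumes g: "continuous_on UNIV g" "csupp UNIV g" and e: "0 < e"
  shows "\<exists>d>0. \<forall>r x. 0 < r \<and> r < d \<longrightarrow> \<bar>conv (moll r) g x - g x\<bar> \<le> e"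
proof -
  from conv_concentrated[OF g e] obtain d where d: "d > 0" "\<And>k r x. integrable lborel k \<and> (\<forall>y. 0 \<le> k y) \<and> (\<forall>y. r < norm y \<longrightarrow> k y = 0) \<and> r < d
    \<Longrightarrow> \<bar>conv k g x - (LBINT y. k y) * g x\<bar> \<le> e * (LBINT y. k y)" by blast
  have "\<bar>conv (moll r) g x - g x\<bar> \<le> e" if "0 < r" "r < d" for r x
    using d(2)[of "moll r" r x] that by (simp add: integrable_moll moll_nonneg moll_support integral_moll)
  then show ?thesis using d(1) by blast
qed

lemma conv_moll_zero:
  assumes "0 < r" "\<And>y. dist x y \<le> r \<Longrightarrow> g y = 0"
  shows "conv (moll r) g x = 0"
proof -
  have "(\<lambda>y. moll r (x - y) * g y) = (\<lambda>y. 0)"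
  proof
    fix y show "moll r (x - y) * g y = 0"
      using assms(2)[of y] moll_support[OF assms(1), of "x - y"] by (cases "dist x y \<le> r") (auto simp: dist_norm)
  qed
  then show ?thesis by (simp add: conv_def)
qed

text \<open>A closed neighbourhood of the support, still inside W, contains the supports of all
  mollifications of small radius; limits can then be taken on one compact set.\<close>

lemma csupp_thicken:
  assumes "open W" "csupp W g"
  shows "\<exists>K d. compact K \<and> K \<subseteq> W \<and> 0 < d \<and> (\<forall>r x. 0 < r \<and> r < d \<and> x \<notin> K \<longrightarrow> conv (moll r) g x = 0)
     \<and> (\<forall>x. x \<notin> K \<longrightarrow> g x = 0)"
proof -
  obtain K where K: "compact K" "K \<subseteq> W" "\<And>x. x \<notin> K \<Longrightarrow> g x = 0" using assms(2) unfolding csupp_def by blast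
  obtain d where d: "d > 0" "(\<Union>x\<in>K. cball x d) \<subseteq> W"
    using compact_subset_open_imp_cball_epsilon_subset[OF K(1) assms(1) K(2)] by blast
  let ?K = "{x + y |x y. x \<in> K \<and> y \<in> cball 0 d}"
  have mem: "x \<in> ?K" if "y \<in> K" "dist x y \<le> d" for x y
    unfolding mem_Collect_eq
    by (rule exI[of _ y], rule exI[of _ "x - y"]) (use that in \<open>auto simp: dist_norm norm_minus_commute\<close>)
  have "?K \<subseteq> (\<Union>x\<in>K. cball x d)" by (auto simp: dist_norm)
  then have sub: "?K \<subseteq> W" using d(2) by blast
  have "compact ?K" by (rule compact_sums[OF K(1) compact_cball])
  moreover have "conv (moll r) g x = 0" if "0 < r" "r < d" "x \<notin> ?K" for r x
    by (rule conv_moll_zero[OF that(1)]) (use mem[of _ x] that K(3) in fastforce)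
  moreover have "g x = 0" if "x \<notin> ?K" for x
    using K(3)[of x] mem[of x x] d(1) that by auto
  ultimately show ?thesis using sub d(1) by blast
qed

lemma integrable_locally_mult:
  fixes a :: "real^3 \<Rightarrow> real"
  assumes "compact K" "integrable lborel (\<lambda>x. indicator K x * a x)" "continuous_on UNIV p" "\<And>x. x \<notin> K \<Longrightarrow> p x = 0"
  shows "integrable lborel (\<lambda>x. a x * p x)"
proof -
  have "integrable lborel (\<lambda>x. p x * (indicator K x * a x))"
    by (rule integrable_mult_compact[of K]) (use assms continuous_on_subset[OF assms(3), of K] in auto)
  also have "(\<lambda>x. p x * (indicator K x * a x)) = (\<lambda>x. a x * p x)"
    using assms(4) by (auto simp: fun_eq_iff indicator_def)
  finally show ?thesis .
qed

text \<open>Mollifying \<open>\<phi>\<close> gives smooth test functions that converge uniformly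
  together with their first derivatives, all supported in one compact subset of W on which a and b
  are integrable.\<close>

lemma test_C1_from_smooth:
  fixes a :: "real^3 \<Rightarrow> real" and b :: "3 \<Rightarrow> real^3 \<Rightarrow> real"
  assumes W: "open W"
    and a: "\<And>K. compact K \<Longrightarrow> K \<subseteq> W \<Longrightarrow> integrable lborel (\<lambda>x. indicator K x * a x)"
    and b: "\<And>K i. compact K \<Longrightarrow> K \<subseteq> W \<Longrightarrow> integrable lborel (\<lambda>x. indicator K x * b i x)"
    and zero: "\<And>\<phi>. smooth \<phi> \<Longrightarrow> csupp W \<phi> \<Longrightarrow> (LBINT x. a x * \<phi> x + (\<Sum>i\<in>UNIV. b i x * partial i \<phi> x)) = 0"
    and p: "Ck_on 1 UNIV \<phi>" "csupp W \<phi>"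
  shows "(LBINT x. a x * \<phi> x + (\<Sum>i\<in>UNIV. b i x * partial i \<phi> x)) = 0"
proof -
  obtain K d0 where K: "compact K" "K \<subseteq> W" "0 < d0"
      "\<And>r x. 0 < r \<Longrightarrow> r < d0 \<Longrightarrow> x \<notin> K \<Longrightarrow> conv (moll r) \<phi> x = 0" "\<And>x. x \<notin> K \<Longrightarrow> \<phi> x = 0"
    using csupp_thicken[OF W p(2)] by blast
  have pU: "csupp UNIV \<phi>" using p(2) csupp_subset by blast
  have pc: "continuous_on UNIV \<phi>" by (rule Ck_on_continuous[OF p(1)])
  have pp: "continuous_on UNIV (partial i \<phi>)" for i
    using Ck_on_continuous[OF Ck_on_partial[OF open_UNIV, of 0]] p(1) by simp
  have psup: "csupp UNIV (partial i \<phi>)" for i by (rule csupp_partial[OF pU])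
  have z: "partial i q x = 0" if "\<And>x. x \<notin> K \<Longrightarrow> q x = 0" "x \<notin> K" for i x and q :: "real^3 \<Rightarrow> real"
    using partial_cong_open[of "- K" x q "\<lambda>_. 0" i] that K(1) by (simp add: compact_imp_closed open_Compl)
  let ?I = "LBINT x. a x * \<phi> x + (\<Sum>i\<in>UNIV. b i x * partial i \<phi> x)"
  let ?L = "\<lambda>x. indicator K x * \<bar>a x\<bar> + (\<Sum>i\<in>UNIV. indicator K x * \<bar>b i x\<bar>)"
  have iL0: "integrable lborel (\<lambda>x. indicator K x * \<bar>a x\<bar>)" "integrable lborel (\<lambda>x. indicator K x * \<bar>b i x\<bar>)" for i
    using integrable_abs[OF a[OF K(1,2)]] integrable_abs[OF b[OF K(1,2)]] by (auto simp: abs_mult)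
  have iL: "integrable lborel ?L" by (intro Bochner_Integration.integrable_add Bochner_Integration.integrable_sum iL0)
  have main: "\<bar>?I\<bar> \<le> e * (LBINT x. ?L x)" if e: "e > 0" for e
  proof -
    obtain d1 where d1: "d1 > 0" "\<And>r x. 0 < r \<Longrightarrow> r < d1 \<Longrightarrow> \<bar>conv (moll r) \<phi> x - \<phi> x\<bar> \<le> e"
      using conv_moll_uniform[OF pc pU e] by blast
    have "\<forall>i. \<exists>d>0. \<forall>r x. 0 < r \<and> r < d \<longrightarrow> \<bar>conv (moll r) (partial i \<phi>) x - partial i \<phi> x\<bar> \<le> e"
      using conv_moll_uniform[OF pp psup e] by blast
    then obtain D where D: "\<forall>i. D i > 0 \<and> (\<forall>r x. 0 < r \<and> r < D i \<longrightarrow> \<bar>conv (moll r) (partial i \<phi>) x - partial i \<phi> x\<bar> \<le> e)"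
      using choice[of "\<lambda>i d. d>0 \<and> (\<forall>r x. 0 < r \<and> r < d \<longrightarrow> \<bar>conv (moll r) (partial i \<phi>) x - partial i \<phi> x\<bar> \<le> e)"] by blast
    define r where "r = min d0 (min d1 (Min (range D))) / 2"
    have mp: "Min (range D) > 0" using D by simp
    have "2 * r = min d0 (min d1 (Min (range D)))" by (simp add: r_def)
    then have "2 * r \<le> Min (range D)" by linarith
    moreover have "Min (range D) \<le> D i" for i by simp
    ultimately have rD: "r < D i" for i using mp by (smt (verit) K(3) d1(1) r_def)
    have r: "0 < r" "r < d0" "r < d1" using K(3) d1(1) mp by (auto simp: r_def)
    define q where "q = conv (moll r) \<phi>"
    have pint: "integrable lborel \<phi>" by (rule integrable_csupp[OF pc pU])
    have q_smooth: "smooth q" unfolding q_def smooth_def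
      using Ck_on_conv[OF _ pint pU] smooth_moll smooth_def by blast
    have q_supp: "csupp W q" unfolding csupp_def q_def using K r by blast
    have qz: "q x = 0" if "x \<notin> K" for x using K(4) r that by (simp add: q_def)
    have q_part: "partial i q = conv (moll r) (partial i \<phi>)" for i
    proof -
      have mi: "integrable lborel (moll r)" using integrable_moll r by blast
      \<comment> \<open>In this order the convolution has \<open>\<phi>\<close> as its kernel, so
        \<open>partial_conv\<close> places the derivative on \<open>\<phi>\<close> and the result is
        a mollification of \<open>partial i \<phi>\<close>.\<close>
      have "q = conv \<phi> (moll r)" unfolding q_def
        by (rule ext, rule conv_commute) (use pint mi in auto)
      then have "partial i q = conv (partial i \<phi>) (moll r)"
        using partial_conv[OF p(1) mi csupp_moll[OF r(1)]] by simp
      also have "\<dots> = conv (moll r) (partial i \<phi>)"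
        using borel_measurable_continuous_onI[OF pp] by (intro ext conv_commute) (use mi in auto)
      finally show ?thesis .
    qed
    have qc: "continuous_on UNIV q" by (rule smooth_continuous[OF q_smooth])
    have qpc: "continuous_on UNIV (partial i q)" for i
      using Ck_on_continuous[OF Ck_on_partial[OF open_UNIV, of 0 q]] q_smooth by (simp add: smooth_def)
    have ints: "integrable lborel (\<lambda>x. a x * \<phi> x)" "integrable lborel (\<lambda>x. a x * q x)"
      "\<And>i. integrable lborel (\<lambda>x. b i x * partial i \<phi> x)" "\<And>i. integrable lborel (\<lambda>x. b i x * partial i q x)"
      using integrable_locally_mult[OF K(1) a[OF K(1,2)]] integrable_locally_mult[OF K(1) b[OF K(1,2)]]
        pc qc pp qpc K(5) qz z[OF qz] z[OF K(5)] by simp_all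
    have "(LBINT x. a x * q x + (\<Sum>i\<in>UNIV. b i x * partial i q x)) = 0"
      by (rule zero[OF q_smooth q_supp])
    then have "\<bar>?I\<bar> = \<bar>LBINT x. (a x * q x + (\<Sum>i\<in>UNIV. b i x * partial i q x)) - (a x * \<phi> x + (\<Sum>i\<in>UNIV. b i x * partial i \<phi> x))\<bar>"
      using ints by (subst Bochner_Integration.integral_diff) auto
    also have "\<dots> \<le> (LBINT x. \<bar>(a x * q x + (\<Sum>i\<in>UNIV. b i x * partial i q x)) - (a x * \<phi> x + (\<Sum>i\<in>UNIV. b i x * partial i \<phi> x))\<bar>)"
      by (rule integral_abs_bound)
    also have "\<dots> \<le> (LBINT x. e * ?L x)"
    proof (rule Bochner_Integration.integral_mono)
      fix x
      show "\<bar>(a x * q x + (\<Sum>i\<in>UNIV. b i x * partial i q x)) - (a x * \<phi> x + (\<Sum>i\<in>UNIV. b i x * partial i \<phi> x))\<bar> \<le> e * ?L x"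
      proof (cases "x \<in> K")
        case True
        have "(a x * q x + (\<Sum>i\<in>UNIV. b i x * partial i q x)) - (a x * \<phi> x + (\<Sum>i\<in>UNIV. b i x * partial i \<phi> x))
            = a x * (q x - \<phi> x) + (\<Sum>i\<in>UNIV. b i x * (partial i q x - partial i \<phi> x))"
          by (simp add: right_diff_distrib sum_subtractf)
        also have "\<bar>\<dots>\<bar> \<le> \<bar>a x\<bar> * e + (\<Sum>i\<in>UNIV. \<bar>b i x\<bar> * e)"
        proof (intro order_trans[OF abs_triangle_ineq] add_mono order_trans[OF sum_abs sum_mono])
          show "\<bar>a x * (q x - \<phi> x)\<bar> \<le> \<bar>a x\<bar> * e"
            unfolding abs_mult q_def using d1(2) r by (intro mult_left_mono) auto
          show "\<bar>b i x * (partial i q x - partial i \<phi> x)\<bar> \<le> \<bar>b i x\<bar> * e" for i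
            unfolding abs_mult q_part using D rD r by (intro mult_left_mono) auto
        qed
        also have "\<dots> = e * ?L x" using True by (simp add: distrib_left sum_distrib_left mult.commute)
        finally show ?thesis .
      next
        case False
        then show ?thesis using qz K(5) z[OF qz] z[OF K(5)] by simp
      qed
    qed (use ints iL in \<open>auto intro!: Bochner_Integration.integrable_diff Bochner_Integration.integrable_add\<close>)
    also have "\<dots> = e * (LBINT x. ?L x)" by simp
    finally show ?thesis .
  qed
  define L where "L = (LBINT x. ?L x)"
  have L0: "L \<ge> 0" unfolding L_def by (intro Bochner_Integration.integral_nonneg) (auto intro!: sum_nonneg add_nonneg_nonneg)
  have "\<bar>?I\<bar> \<le> 0 + e" if "e > 0" for e
  proof -
    have "0 < e / (L + 1)" using that L0 by simp
    from main[OF this] have "\<bar>?I\<bar> \<le> e / (L + 1) * L" unfolding L_def[symmetric] .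
    also have "\<dots> \<le> e" using that L0 by (intro scaled_le)
    finally show ?thesis by simp
  qed
  then have "\<bar>?I\<bar> \<le> 0" by (rule field_le_epsilon)
  then show ?thesis by simp
qed

text \<open>Where g p is nonzero, g keeps its sign on a small ball, and a bump function supported
  there has a nonzero pairing with g.\<close>

lemma continuous_zero_if_tests_zero:
  fixes g :: "real^3 \<Rightarrow> real"
  assumes W: "open W" and g: "continuous_on W g"
    and zero: "\<And>\<phi>. smooth \<phi> \<Longrightarrow> csupp W \<phi> \<Longrightarrow> (LBINT x. g x * \<phi> x) = 0"
    and p: "p \<in> W"
  shows "g p = 0"
proof (rule ccontr)
  assume ne: "g p \<noteq> 0"
  obtain d where d: "d > 0" "ball p d \<subseteq> W" "\<And>x. x \<in> ball p d \<Longrightarrow> \<bar>g x - g p\<bar> < \<bar>g p\<bar>"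
  proof -
    obtain d1 where d1: "d1 > 0" "ball p d1 \<subseteq> W" using W p open_contains_ball by blast
    have "0 < \<bar>g p\<bar>" using ne by simp
    then obtain d2 where d2: "d2 > 0" "\<And>x. x \<in> W \<Longrightarrow> dist x p < d2 \<Longrightarrow> dist (g x) (g p) < \<bar>g p\<bar>"
      using g p unfolding continuous_on_iff by blast
    show ?thesis by (rule that[of "min d1 d2"]) (use d1 d2 in \<open>auto simp: dist_real_def dist_commute subset_eq\<close>)
  qed
  define \<phi> where "\<phi> x = moll (d / 2) (x + (- p))" for x
  have sm: "smooth \<phi>" using smooth_moll Ck_on_shift unfolding smooth_def \<phi>_def by blast
  have out: "\<phi> x = 0" if "x \<notin> cball p (d / 2)" for x
    using moll_support[of "d/2" "x - p"] that d(1) by (simp add: \<phi>_def dist_norm norm_minus_commute)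
  have "cball p (d/2) \<subseteq> ball p d" using d(1) by auto
  then have cs: "csupp W \<phi>" unfolding csupp_def using out d(2) by (intro exI[of _ "cball p (d/2)"]) auto
  \<comment> \<open>The factor \<open>g p\<close> makes the integrand nonnegative whatever the sign
    of \<open>g p\<close>.\<close>
  let ?h = "\<lambda>x. g x * g p * \<phi> x"
  have pos: "g x * g p > 0" if "x \<in> ball p d" for x
    using d(3)[OF that] by (auto simp: abs_if zero_less_mult_iff split: if_splits)
  have nn: "0 \<le> \<phi> x" for x using moll_nonneg[of "d/2"] d(1) by (simp add: \<phi>_def)
  have hn: "0 \<le> ?h x" for x
    using pos[of x] nn[of x] out[of x] \<open>cball p (d/2) \<subseteq> ball p d\<close>
    by (cases "x \<in> cball p (d/2)") (auto simp: subset_eq less_imp_le simp del: mem_cball mem_ball)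
  have "0 < \<phi> p" using d(1) moll_total_pos[of "d/2"] by (simp add: \<phi>_def moll_def flat_exp_def)
  then have hp: "0 < ?h p" using pos[of p] d(1) by simp
  have "continuous_on UNIV ?h"
  proof -
    have U: "W \<union> - cball p (d/2) = UNIV" using d(2) \<open>cball p (d/2) \<subseteq> ball p d\<close> by blast
    have "continuous_on W ?h"
      by (intro continuous_on_mult g continuous_on_const continuous_on_subset[OF smooth_continuous[OF sm]]) auto
    moreover have "continuous_on (- cball p (d/2)) ?h"
      by (rule continuous_on_eq[of _ "\<lambda>_. 0"]) (use out in auto)
    ultimately have "continuous_on (W \<union> - cball p (d/2)) ?h"
      by (intro continuous_on_open_Un W open_Compl closed_cball)
    then show ?thesis unfolding U .
  qed
  moreover have "csupp UNIV ?h" by (rule csupp_mult(1)[OF csupp_subset[OF cs]]) simp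
  ultimately have "0 < (LBINT x. ?h x)" using hn hp by (intro integral_pos_continuous)
  moreover have "(LBINT x. ?h x) = g p * (LBINT x. g x * \<phi> x)"
    by (simp add: mult.commute mult.left_commute flip: integral_mult_right_zero)
  ultimately show False using zero[OF sm cs] by simp
qed

subsection \<open>Weak formulations with continuously differentiable test functions\<close>

definition levi :: "3 \<Rightarrow> 3 \<Rightarrow> 3 \<Rightarrow> real" where
  "levi i j k = (if (i, j, k) \<in> {(1, 2, 3), (2, 3, 1), (3, 1, 2)} then 1
     else if (i, j, k) \<in> {(1, 3, 2), (3, 2, 1), (2, 1, 3)} then - 1 else 0)"

lemma levi_eval [simp]:
  "levi 1 2 3 = 1" "levi 2 3 1 = 1" "levi 3 1 2 = 1"
  "levi 1 3 2 = -1" "levi 3 2 1 = -1" "levi 2 1 3 = -1"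
  "levi i i k = 0" "levi i j i = 0" "levi i j j = 0"
  by (auto simp: levi_def)

definition test1 :: "(real^3) set \<Rightarrow> (real^3 \<Rightarrow> real) \<Rightarrow> bool" where
  "test1 W \<phi> \<longleftrightarrow> Ck_on 1 UNIV \<phi> \<and> csupp W \<phi>"

text \<open>The curl equation is written by antisymmetric index pairs: the derivative of u_j in
  direction i minus that of u_i in direction j equals f times the component of u selected by
  \<open>levi i j\<close>. The test functions are only C^1, so that the product of one with a C^1
  coefficient is again admissible.\<close>

definition weqs :: "(real^3) set \<Rightarrow> (real^3 \<Rightarrow> real) \<Rightarrow> (real^3 \<Rightarrow> real^3) \<Rightarrow> bool" where
  "weqs W f u \<longleftrightarrow> (\<forall>\<phi>. test1 W \<phi> \<longrightarrow>
     (LBINT x. (\<Sum>i\<in>UNIV. u x $ i * partial i \<phi> x)) = 0 \<and>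
     (\<forall>i j. (LBINT x. u x $ j * partial i \<phi> x - u x $ i * partial j \<phi> x
         + f x * (\<Sum>k\<in>UNIV. levi i j k * u x $ k) * \<phi> x) = 0))"

lemma continuous_on_UNIV_csupp:
  assumes "open W" "continuous_on W g" "csupp W g"
  shows "continuous_on UNIV (g :: real^3 \<Rightarrow> real)"
proof -
  obtain K where K: "compact K" "K \<subseteq> W" "\<And>x. x \<notin> K \<Longrightarrow> g x = 0" using assms(3) unfolding csupp_def by blast
  have U: "W \<union> - K = UNIV" using K(2) by blast
  have "continuous_on (- K) g"
    by (rule continuous_on_eq[of _ "\<lambda>_. 0"]) (use K in auto)
  then have "continuous_on (W \<union> - K) g"
    by (intro continuous_on_open_Un assms open_Compl compact_imp_closed K)
  then show ?thesis unfolding U .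
qed

lemma Ck_on_UNIV_csupp:
  assumes "open W" "Ck_on k W g" "csupp W g"
  shows "Ck_on k UNIV g"
proof -
  obtain K where K: "compact K" "K \<subseteq> W" "\<And>x. x \<notin> K \<Longrightarrow> g x = 0" using assms(3) unfolding csupp_def by blast
  have U: "W \<union> - K = UNIV" using K(2) by blast
  have o: "open (- K)" using K(1) by (simp add: compact_imp_closed open_Compl)
  have "Ck_on k (- K) g"
    using Ck_on_const[OF o, of k 0] Ck_on_cong[OF o, of g "\<lambda>_. 0" k] K(3) by simp
  from Ck_on_Un[OF assms(1) o assms(2) this] show ?thesis unfolding U .
qed

lemma differentiable_UNIV_csupp:
  assumes "open W" "\<And>x. x \<in> W \<Longrightarrow> g differentiable (at x)" "csupp W g"
  shows "(g :: real^3 \<Rightarrow> real) differentiable (at x)"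
proof -
  obtain K where K: "compact K" "K \<subseteq> W" "\<And>x. x \<notin> K \<Longrightarrow> g x = 0" using assms(3) unfolding csupp_def by blast
  have o: "open (- K)" using K(1) by (simp add: compact_imp_closed open_Compl)
  show ?thesis
  proof (cases "x \<in> W")
    case False
    then have x: "x \<in> - K" using K by blast
    have "(g has_derivative (\<lambda>_. 0)) (at x)"
      by (subst has_derivative_cong_open[OF o x, of g "\<lambda>_. 0"]) (use K(3) in auto)
    then show ?thesis unfolding differentiable_def by blast
  qed (use assms in blast)
qed

lemma test1_continuous:
  assumes "test1 W \<phi>"
  shows "continuous_on S \<phi>" "continuous_on S (partial i \<phi>)" "csupp W \<phi>" "csupp W (partial i \<phi>)"
    "\<phi> differentiable (at x)"
  using assms Ck_on_continuous[of 1 UNIV \<phi>] Ck_on_continuous[OF Ck_on_partial[OF open_UNIV, of 0 \<phi>]]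
    csupp_partial[of W \<phi>] Ck_on_differentiable_at[of UNIV 1 \<phi>]
  unfolding test1_def by (auto intro: continuous_on_subset)

lemma test1_mult:
  assumes "open W" "Ck_on 1 W c" "test1 W \<phi>" shows "test1 W (\<lambda>x. c x * \<phi> x)"
proof -
  have "csupp W (\<lambda>x. c x * \<phi> x)" using assms(3) csupp_mult(1) test1_def by blast
  moreover have "Ck_on 1 W (\<lambda>x. c x * \<phi> x)"
    using assms Ck_on_subset unfolding test1_def by (intro Ck_on_mult) blast+
  ultimately show ?thesis using Ck_on_UNIV_csupp[OF assms(1)] unfolding test1_def by blast
qed

lemma test1_subset: "test1 W \<phi> \<Longrightarrow> W \<subseteq> V \<Longrightarrow> test1 V \<phi>"
  unfolding test1_def using csupp_subset by blast

lemma weqs_subset: "weqs V f u \<Longrightarrow> W \<subseteq> V \<Longrightarrow> weqs W f u"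
  unfolding weqs_def using test1_subset by blast

lemma integral_partial_zero:
  assumes "Ck_on 1 UNIV g" "csupp UNIV g"
  shows "(LBINT x. partial i g x) = 0"
proof -
  let ?b = "\<lambda>j x. if j = i then g x else 0"
  have g: "g differentiable (at x)" for x using Ck_on_differentiable_at[OF open_UNIV assms(1)] by simp
  show ?thesis
  proof (rule integral_divergence_zero[of ?b])
    show "?b j differentiable (at x)" for j x using g by (cases "j = i") auto
    show "continuous_on UNIV (partial i g)"
      using Ck_on_continuous[OF Ck_on_partial[OF open_UNIV, of 0 g]] assms(1) by simp
    have "partial j (?b j) x = (if j = i then partial i g x else 0)" for j x by (cases "j = i") auto
    then show "(\<Sum>j\<in>UNIV. partial j (?b j) x) = partial i g x" for x by simp
    show "csupp UNIV (?b j)" for j using assms(2) by (cases "j = i") auto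
  qed
qed

lemma curl_nth:
  "curl u x $ 1 = partial 2 (\<lambda>y. u y $ 3) x - partial 3 (\<lambda>y. u y $ 2) x"
  "curl u x $ 2 = partial 3 (\<lambda>y. u y $ 1) x - partial 1 (\<lambda>y. u y $ 3) x"
  "curl u x $ 3 = partial 1 (\<lambda>y. u y $ 2) x - partial 2 (\<lambda>y. u y $ 1) x"
  by (simp_all add: curl_def)

lemma curl_levi:
  "partial i (\<lambda>y. u y $ j) x - partial j (\<lambda>y. u y $ i) x = (\<Sum>k\<in>UNIV. levi i j k * curl u x $ k)"
proof -
  have "\<forall>i j. partial i (\<lambda>y. u y $ j) x - partial j (\<lambda>y. u y $ i) x = (\<Sum>k\<in>UNIV. levi i j k * curl u x $ k)"
    unfolding forall_3 sum_3 curl_nth by simp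
  then show ?thesis by blast
qed

text \<open>The derivatives of u need not be integrable, so there is no integration by parts term by
  term. But u times a test function is differentiable, and by the equations the relevant divergences
  contain no derivative of u and are continuous; this is the situation of
  \<open>integral_divergence_zero\<close>.\<close>

lemma classical_solution_weqs:
  assumes U: "open U" and f: "continuous_on U f" and s: "classical_solution U f u"
  shows "continuous_on U u" "weqs U f u"
proof -
  have ud: "u differentiable (at x)" if "x \<in> U" for x
    using s that unfolding classical_solution_def differentiable_on_eq_differentiable_at[OF U] by blast
  then show uc: "continuous_on U u"
    by (meson continuous_at_imp_continuous_on differentiable_imp_continuous_within)
  have ui: "(\<lambda>x. u x $ i) differentiable (at x)" if "x \<in> U" for x i
    using differentiable_compose[OF bounded_linear_imp_differentiable[OF bounded_linear_vec_nth] ud[OF that]] .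
  have uic: "continuous_on U (\<lambda>x. u x $ i)" for i by (intro continuous_on_component uc)
  have curl: "partial i (\<lambda>y. u y $ j) x - partial j (\<lambda>y. u y $ i) x = f x * (\<Sum>k\<in>UNIV. levi i j k * u x $ k)"
    and div: "(\<Sum>i\<in>UNIV. partial i (\<lambda>y. u y $ i) x) = 0" if "x \<in> U" for x i j
    using s that unfolding curl_levi classical_solution_def divergence_def
    by (simp_all add: sum_distrib_left mult_ac)
  show "weqs U f u" unfolding weqs_def
  proof (intro allI impI conjI)
    fix \<phi> assume t: "test1 U \<phi>"
    note tc = test1_continuous[OF t]
    have pu: "csupp U (\<lambda>x. u x $ i * \<phi> x)" for i by (intro csupp_mult tc)
    have pud: "(\<lambda>x. u x $ i * \<phi> x) differentiable (at x)" for i x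
      by (rule differentiable_UNIV_csupp[OF U _ pu]) (intro differentiable_mult ui tc)
    obtain K where K: "compact K" "K \<subseteq> U" "\<And>x. x \<notin> K \<Longrightarrow> \<phi> x = 0" using tc(3) unfolding csupp_def by blast
    have pup: "partial j (\<lambda>x. u x $ i * \<phi> x) x = (if x \<in> U then partial j (\<lambda>x. u x $ i) x * \<phi> x else 0) + u x $ i * partial j \<phi> x" for i j x
    proof (cases "x \<in> U")
      case False
      have o: "open (- K)" "x \<in> - K" using K(1,2) False by (auto simp: compact_imp_closed open_Compl)
      have "partial j (\<lambda>x. u x $ i * \<phi> x) x = 0" "partial j \<phi> x = 0"
        using partial_cong_open[OF o, of "\<lambda>x. u x $ i * \<phi> x" "\<lambda>_. 0"] partial_cong_open[OF o, of \<phi> "\<lambda>_. 0"] K(3) by auto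
      then show ?thesis using False by simp
    qed (simp add: partial_mult ui tc(5))
    show "(LBINT x. (\<Sum>i\<in>UNIV. u x $ i * partial i \<phi> x)) = 0"
    proof (rule integral_divergence_zero[of "\<lambda>i x. u x $ i * \<phi> x"])
      show "continuous_on UNIV (\<lambda>x. \<Sum>i\<in>UNIV. u x $ i * partial i \<phi> x)"
        by (rule continuous_on_UNIV_csupp[OF U])
          (intro continuous_intros uic tc csupp_sum csupp_mult)+
      show "(\<Sum>i\<in>UNIV. partial i (\<lambda>x. u x $ i * \<phi> x) x) = (\<Sum>i\<in>UNIV. u x $ i * partial i \<phi> x)" for x
        using div[of x] by (cases "x \<in> U") (auto simp: pup sum.distrib simp flip: sum_distrib_right)
      show "csupp UNIV (\<lambda>x. u x $ i * \<phi> x)" for i using pu csupp_subset by blast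
    qed (rule pud)
    fix i j
    \<comment> \<open>The field with \<open>u x $ j * \<phi> x\<close> in position i and the
      negative of \<open>u x $ i * \<phi> x\<close> in position j: its divergence is the (i, j)
      component of the curl of u times \<open>\<phi>\<close>, plus terms with derivatives of
      \<open>\<phi>\<close>. For i = j it is zero.\<close>
    let ?b = "\<lambda>l x. (if l = i then u x $ j * \<phi> x else 0) - (if l = j then u x $ i * \<phi> x else 0)"
    show "(LBINT x. u x $ j * partial i \<phi> x - u x $ i * partial j \<phi> x
         + f x * (\<Sum>k\<in>UNIV. levi i j k * u x $ k) * \<phi> x) = 0"
    proof (rule integral_divergence_zero[of ?b])
      have d1: "(\<lambda>x. if l = i then u x $ j * \<phi> x else 0) differentiable (at x)" for i j l x
        using pud by (cases "l = i") auto
      have p1: "partial l (\<lambda>x. if l = i then u x $ j * \<phi> x else 0) x = (if l = i then partial i (\<lambda>x. u x $ j * \<phi> x) x else 0)" for i j l x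
        by (cases "l = i") auto
      show "?b l differentiable (at x)" for l x by (intro differentiable_diff d1)
      show "continuous_on UNIV (\<lambda>x. u x $ j * partial i \<phi> x - u x $ i * partial j \<phi> x
         + f x * (\<Sum>k\<in>UNIV. levi i j k * u x $ k) * \<phi> x)"
        by (rule continuous_on_UNIV_csupp[OF U])
          (intro continuous_intros uic tc f csupp_sum csupp_mult csupp_diff csupp_add)+
      have S: "(\<Sum>l\<in>UNIV. partial l (?b l) x) = partial i (\<lambda>x. u x $ j * \<phi> x) x - partial j (\<lambda>x. u x $ i * \<phi> x) x" for x
        by (simp add: partial_diff d1 p1 sum_subtractf)
      show "(\<Sum>l\<in>UNIV. partial l (?b l) x) = u x $ j * partial i \<phi> x - u x $ i * partial j \<phi> x
         + f x * (\<Sum>k\<in>UNIV. levi i j k * u x $ k) * \<phi> x" for x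
      proof (cases "x \<in> U")
        case True
        have "partial i (\<lambda>y. u y $ j) x * \<phi> x
            = (partial j (\<lambda>y. u y $ i) x + f x * (\<Sum>k\<in>UNIV. levi i j k * u x $ k)) * \<phi> x"
          using curl[OF True, of i j] by simp
        then show ?thesis unfolding S pup using True by (simp add: distrib_right)
      next
        case False
        then have "\<phi> x = 0" using K by blast
        then show ?thesis unfolding S pup using False by simp
      qed
      have c1: "csupp UNIV (\<lambda>x. if l = i then u x $ j * \<phi> x else 0)" for i j l
        using csupp_subset[OF pu[of j], of UNIV] by (cases "l = i") auto
      show "csupp UNIV (?b l)" for l by (intro csupp_diff c1)
    qed
  qed
qed

lemma test_function_iff: "test_function U \<phi> \<longleftrightarrow> smooth \<phi> \<and> csupp U \<phi>"
  by (simp add: test_function_def smooth_def csupp_def)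

lemma integral_set_csupp:
  fixes h g :: "real^3 \<Rightarrow> real"
  assumes K: "K \<subseteq> U" and h: "\<And>x. x \<notin> K \<Longrightarrow> h x = 0" and g: "integrable lborel g"
    and N: "negligible N" and eq: "\<And>x. x \<notin> N \<Longrightarrow> h x = g x"
  shows "integral U h = (LBINT x. g x)"
proof -
  have "integral U h = integral UNIV h"
    by (subst integral_restrict_UNIV[symmetric], rule Henstock_Kurzweil_Integration.integral_cong)
      (use h K in auto)
  also have "\<dots> = integral UNIV g"
    by (rule integral_spike[OF N]) (use eq in auto)
  also have "\<dots> = (LBINT x. g x)" by (rule integral_lborel[OF g])
  finally show ?thesis .
qed

text \<open>On a ball, u is replaced by a Borel function v that equals u almost everywhere and
  vanishes outside, so that the integrals become integrals with respect to \<open>lborel\<close>.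
  The definition gives the equations for smooth tests; \<open>test_C1_from_smooth\<close> extends
  them.\<close>

lemma weak_solution_weqs:
  assumes U: "open U" and f: "continuous_on U f" and s: "weak_solution U f u"
    and B: "cball p r \<subseteq> U"
  shows "\<exists>v. (\<forall>i. integrable lborel (\<lambda>x. v x $ i)) \<and> (\<forall>x. x \<notin> cball p r \<longrightarrow> v x = 0)
     \<and> negligible {x \<in> cball p r. u x \<noteq> v x} \<and> weqs (ball p r) f v"
proof -
  let ?B = "cball p r"
  have ai: "u absolutely_integrable_on ?B" using s B unfolding weak_solution_def by auto
  define Q where "Q i g \<longleftrightarrow> integrable lborel g \<and> (\<forall>x. x \<notin> ?B \<longrightarrow> g x = 0) \<and> negligible {x \<in> ?B. u x $ i \<noteq> g x}" for i g
  have "\<exists>g. Q i g" for i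
  proof -
    have "(\<lambda>x. u x $ i) absolutely_integrable_on ?B"
      using absolutely_integrable_component[OF ai, of "axis i 1"] by (simp add: inner_axis)
    then have i: "integrable lebesgue (\<lambda>x. indicator ?B x * u x $ i)"
      by (simp add: set_integrable_def)
    then have "(\<lambda>x. indicator ?B x * u x $ i) \<in> borel_measurable (completion lborel)" by auto
    from completion_ex_borel_measurable_real[OF this] obtain g0
      where g0: "g0 \<in> borel_measurable lborel" "AE x in lborel. indicator ?B x * u x $ i = g0 x" by auto
    define g where "g x = indicator ?B x * g0 x" for x
    have gm: "g \<in> borel_measurable lborel" unfolding g_def using g0(1) by (intro borel_measurable_times borel_measurable_indicator) auto
    have ae: "AE x in lborel. indicator ?B x * u x $ i = g x"
      using g0(2) by eventually_elim (auto simp: g_def indicator_def split: if_splits)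
    have "integrable (completion lborel) g"
      by (rule Bochner_Integration.integrable_cong_AE_imp[OF i])
        (use gm ae AE_completion in \<open>auto simp: measurable_completion eq_commute\<close>)
    then have "integrable lborel g" using integrable_completion[of g lborel] gm by blast
    moreover have "negligible {x \<in> ?B. u x $ i \<noteq> g x}"
    proof -
      have "AE x in lebesgue. \<not> (x \<in> ?B \<and> u x $ i \<noteq> g x)"
        using AE_completion[OF ae] by eventually_elim (auto simp: indicator_def)
      then obtain N where N: "N \<in> null_sets lebesgue"
          "{x \<in> space lebesgue. \<not> \<not> (x \<in> ?B \<and> u x $ i \<noteq> g x)} \<subseteq> N"
        unfolding eventually_ae_filter by blast
      show ?thesis
        by (rule negligible_subset[of N]) (use N in \<open>auto simp: negligible_iff_null_sets\<close>)
    qed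
    ultimately show ?thesis unfolding Q_def by (intro exI[of _ g]) (auto simp: g_def)
  qed
  then obtain G where "\<And>i. Q i (G i)" by metis
  then have G: "\<And>i. integrable lborel (G i)" "\<And>i x. x \<notin> ?B \<Longrightarrow> G i x = 0"
      "\<And>i. negligible {x \<in> ?B. u x $ i \<noteq> G i x}" unfolding Q_def by auto
  define v where "v x = (\<chi> i. G i x)" for x
  have vi: "integrable lborel (\<lambda>x. v x $ i)" for i using G(1) by (simp add: v_def)
  define N where "N = {x \<in> ?B. u x \<noteq> v x}"
  have "N \<subseteq> (\<Union>i. {x \<in> ?B. u x $ i \<noteq> G i x})" by (auto simp: N_def v_def vec_eq_iff)
  then have N: "negligible N"
    by (rule negligible_subset[rotated]) (use G(3) in \<open>auto intro!: negligible_Union\<close>)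
  have fB: "continuous_on ?B f" using f B continuous_on_subset by blast
  have fv: "integrable lborel (\<lambda>x. f x * (\<Sum>k\<in>UNIV. levi i j k * v x $ k))" for i j
  proof -
    have "(\<Sum>k\<in>UNIV. levi i j k * v x $ k) = 0" if "x \<notin> ?B" for x using G(2)[OF that] by (simp add: v_def)
    then show ?thesis
      using vi by (intro integrable_mult_compact[OF fB compact_cball] Bochner_Integration.integrable_sum) auto
  qed
  have ind: "integrable lborel (\<lambda>x. indicator K x * h x)" if "integrable lborel h" "compact K" for h :: "real^3 \<Rightarrow> real" and K
    using integrable_real_mult_indicator[of K lborel h] that by (auto simp: mult.commute borel_compact)
  have test: "(LBINT x. (\<Sum>i\<in>UNIV. v x $ i * partial i \<phi> x)) = 0 \<and>
      (LBINT x. v x $ j * partial i \<phi> x - v x $ i * partial j \<phi> x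
         + f x * (\<Sum>k\<in>UNIV. levi i j k * v x $ k) * \<phi> x) = 0"
    if sm: "smooth \<phi>" and cs: "csupp (ball p r) \<phi>" for \<phi> i j
  proof -
    obtain K where K: "compact K" "K \<subseteq> ball p r" "\<And>x. x \<notin> K \<Longrightarrow> \<phi> x = 0" using cs unfolding csupp_def by blast
    have o: "open (- K)" using K(1) by (simp add: compact_imp_closed open_Compl)
    have pz: "partial i \<phi> x = 0" if "x \<notin> K" for i x
      using partial_cong_open[OF o, of x \<phi> "\<lambda>_. 0" i] K(3) that by simp
    have KB: "K \<subseteq> ?B" "K \<subseteq> U" using K(2) B ball_subset_cball[of p r] by blast+
    have csU: "csupp U \<phi>" using K KB unfolding csupp_def by blast
    have pc: "continuous_on UNIV \<phi>" by (rule smooth_continuous[OF sm])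
    have ppc: "continuous_on UNIV (partial i \<phi>)" for i
      using Ck_on_continuous[OF Ck_on_partial[OF open_UNIV, of 0 \<phi>]] sm by (simp add: smooth_def)
    have i1: "integrable lborel (\<lambda>x. v x $ i * partial j \<phi> x)" for i j
      by (rule integrable_locally_mult[OF K(1) ind[OF vi K(1)] ppc pz])
    have i2: "integrable lborel (\<lambda>x. f x * (\<Sum>k\<in>UNIV. levi i j k * v x $ k) * \<phi> x)" for i j
      by (rule integrable_locally_mult[OF K(1) ind[OF fv K(1)] pc K(3)])
    have i3: "integrable lborel (\<lambda>x. f x * (v x $ k * \<phi> x))" for k
    proof -
      have "integrable lborel (\<lambda>x. v x $ k * \<phi> x)"
        by (rule integrable_locally_mult[OF K(1) ind[OF vi K(1)] pc K(3)])
      moreover have "v x $ k * \<phi> x = 0" if "x \<notin> ?B" for x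
        using K(3)[of x] KB(1) that by fastforce
      ultimately show ?thesis by (rule integrable_mult_compact[OF fB compact_cball])
    qed
    \<comment> \<open>Test fields with a single nonzero component isolate the components of the curl
      equation.\<close>
    have cw: "curl (\<lambda>x. \<phi> x *\<^sub>R axis k 1) x $ i = (\<Sum>j\<in>UNIV. levi i j k * partial j \<phi> x)" for i k x
    proof -
      have wi: "(\<lambda>y. (\<phi> y *\<^sub>R axis k 1 :: real^3) $ i) = (if i = k then \<phi> else (\<lambda>_. 0))" for i
        by (auto simp: axis_def)
      have "\<forall>i. curl (\<lambda>x. \<phi> x *\<^sub>R axis k 1) x $ i = (\<Sum>j\<in>UNIV. levi i j k * partial j \<phi> x)"
        unfolding forall_3 curl_nth wi sum_3 using exhaust_3[of k] by auto
      then show ?thesis by blast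
    qed
    have "integral U (\<lambda>x. u x \<bullet> grad \<phi> x) = (LBINT x. (\<Sum>i\<in>UNIV. v x $ i * partial i \<phi> x))"
    proof (rule integral_set_csupp[OF KB(2) _ _ N])
      show "u x \<bullet> grad \<phi> x = 0" if "x \<notin> K" for x using pz[OF that] by (simp add: grad_def inner_vec_def)
      show "integrable lborel (\<lambda>x. \<Sum>i\<in>UNIV. v x $ i * partial i \<phi> x)" using i1 by auto
      show "u x \<bullet> grad \<phi> x = (\<Sum>i\<in>UNIV. v x $ i * partial i \<phi> x)" if "x \<notin> N" for x
        using that pz[of x] KB(1) unfolding N_def by (cases "x \<in> K") (auto simp: grad_def inner_vec_def)
    qed
    moreover have "integral U (\<lambda>x. u x \<bullet> grad \<phi> x) = 0"
      using s sm csU unfolding weak_solution_def test_function_iff by blast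
    moreover have cu: "(LBINT x. v x \<bullet> curl (\<lambda>x. \<phi> x *\<^sub>R axis k 1) x) = (LBINT x. f x * (v x $ k * \<phi> x)) \<and>
        integrable lborel (\<lambda>x. v x \<bullet> curl (\<lambda>x. \<phi> x *\<^sub>R axis k 1) x)" for k
    proof -
      let ?w = "\<lambda>x. \<phi> x *\<^sub>R axis k 1 :: real^3"
      have wi: "(\<lambda>y. ?w y $ i) = (if i = k then \<phi> else (\<lambda>_. 0))" for i
        by (auto simp: axis_def)
      have "test_function U (\<lambda>x. ?w x $ i)" for i
        unfolding wi test_function_iff using sm csU by (auto simp: smooth_def Ck_on_const)
      then have "integral U (\<lambda>x. u x \<bullet> curl ?w x) = integral U (\<lambda>x. f x * (u x \<bullet> ?w x))"
        using s[unfolded weak_solution_def, THEN conjunct2, THEN conjunct1, THEN spec[of _ ?w]] by simp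
      moreover note cw
      have ic: "integrable lborel (\<lambda>x. v x \<bullet> curl ?w x)"
        unfolding inner_vec_def inner_real_def cw sum_distrib_left
      proof (intro Bochner_Integration.integrable_sum)
        fix i n :: 3
        have "integrable lborel (\<lambda>x. levi i n k * (v x $ i * partial n \<phi> x))" using i1 by simp
        then show "integrable lborel (\<lambda>x. v x $ i * (levi i n k * partial n \<phi> x))"
          by (simp only: mult.left_commute)
      qed
      have "integral U (\<lambda>x. u x \<bullet> curl ?w x) = (LBINT x. v x \<bullet> curl ?w x)"
      proof (rule integral_set_csupp[OF KB(2) _ ic N])
        have cz: "curl ?w x = 0" if "x \<notin> K" for x using pz[OF that] by (simp add: vec_eq_iff cw)
        show "u x \<bullet> curl ?w x = 0" if "x \<notin> K" for x using cz[OF that] by simp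
        show "u x \<bullet> curl ?w x = v x \<bullet> curl ?w x" if "x \<notin> N" for x
          using that cz[of x] KB(1) unfolding N_def by (cases "x \<in> K") auto
      qed
      moreover have "integral U (\<lambda>x. f x * (u x \<bullet> ?w x)) = (LBINT x. f x * (v x $ k * \<phi> x))"
      proof (rule integral_set_csupp[OF KB(2) _ i3 N])
        show "f x * (u x \<bullet> ?w x) = 0" if "x \<notin> K" for x using K(3)[OF that] by simp
        show "f x * (u x \<bullet> ?w x) = f x * (v x $ k * \<phi> x)" if "x \<notin> N" for x
          using that K(3)[of x] KB(1) unfolding N_def by (cases "x \<in> K") (auto simp: inner_axis mult.commute)
      qed
      ultimately show ?thesis using ic by simp
    qed
    moreover have "(LBINT x. v x $ j * partial i \<phi> x - v x $ i * partial j \<phi> x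
         + f x * (\<Sum>k\<in>UNIV. levi i j k * v x $ k) * \<phi> x) = 0"
    proof -
      \<comment> \<open>The equation for the pair (i, j) is the combination of the component
        equations with coefficients \<open>levi i j k\<close>.\<close>
      have eq: "v x $ j * partial i \<phi> x - v x $ i * partial j \<phi> x + f x * (\<Sum>k\<in>UNIV. levi i j k * v x $ k) * \<phi> x
          = (\<Sum>k\<in>UNIV. levi i j k * (f x * (v x $ k * \<phi> x) - v x \<bullet> curl (\<lambda>x. \<phi> x *\<^sub>R axis k 1) x))" for x
      proof -
        have "\<forall>i j. v x $ j * partial i \<phi> x - v x $ i * partial j \<phi> x + f x * (\<Sum>k\<in>UNIV. levi i j k * v x $ k) * \<phi> x
          = (\<Sum>k\<in>UNIV. levi i j k * (f x * (v x $ k * \<phi> x) - v x \<bullet> curl (\<lambda>x. \<phi> x *\<^sub>R axis k 1) x))"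
          unfolding inner_vec_def cw forall_3 sum_3 inner_real_def
          by (simp add: algebra_simps)
        then show ?thesis by blast
      qed
      show ?thesis unfolding eq using cu i3 by simp
    qed
    ultimately show ?thesis by simp
  qed
  have "weqs (ball p r) f v" unfolding weqs_def
  proof (intro allI impI conjI)
    fix \<phi> assume t: "test1 (ball p r) \<phi>"
    then have t': "Ck_on 1 UNIV \<phi>" "csupp (ball p r) \<phi>" by (auto simp: test1_def)
    have "(LBINT x. 0 * \<phi> x + (\<Sum>i\<in>UNIV. v x $ i * partial i \<phi> x)) = 0"
      by (rule test_C1_from_smooth[OF open_ball _ _ _ t']) (use test ind[OF vi] in auto)
    then show "(LBINT x. (\<Sum>i\<in>UNIV. v x $ i * partial i \<phi> x)) = 0" by simp
    fix i j
    let ?b = "\<lambda>l x. (if l = i then v x $ j else 0) - (if l = j then v x $ i else 0)"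
    have bi: "integrable lborel (?b l)" for l
      using vi by (cases "l = i"; cases "l = j") auto
    have rw: "f x * (\<Sum>k\<in>UNIV. levi i j k * v x $ k) * q x + (\<Sum>l\<in>UNIV. ?b l x * partial l q x)
       = v x $ j * partial i q x - v x $ i * partial j q x + f x * (\<Sum>k\<in>UNIV. levi i j k * v x $ k) * q x" for q x
      by (simp add: left_diff_distrib sum_subtractf if_distribR if_distrib[of "\<lambda>z. z * _"] cong: if_cong)
    have "(LBINT x. f x * (\<Sum>k\<in>UNIV. levi i j k * v x $ k) * \<phi> x + (\<Sum>l\<in>UNIV. ?b l x * partial l \<phi> x)) = 0"
      by (rule test_C1_from_smooth[OF open_ball ind[OF fv] ind[OF bi] _ t']) (use test in \<open>auto simp: rw\<close>)
    then show "(LBINT x. v x $ j * partial i \<phi> x - v x $ i * partial j \<phi> x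
         + f x * (\<Sum>k\<in>UNIV. levi i j k * v x $ k) * \<phi> x) = 0" by (simp only: rw)
  qed
  then show ?thesis using vi G(2) N unfolding N_def by (intro exI[of _ v]) (auto simp: v_def vec_eq_iff)
qed

subsection \<open>First order equations with variable coefficients\<close>

lemma csupp_out: "csupp W g \<Longrightarrow> x \<notin> W \<Longrightarrow> g x = 0"
  unfolding csupp_def by blast

lemma smooth_test1: "smooth \<phi> \<Longrightarrow> csupp W \<phi> \<Longrightarrow> test1 W \<phi>"
  unfolding smooth_def test1_def by blast

lemma smooth_partial: "smooth \<phi> \<Longrightarrow> smooth (partial i \<phi>)"
  unfolding smooth_def using Ck_on_partial[OF open_UNIV] by blast

text \<open>The integrand pairs the row \<open>\<Sum>\<^sub>i\<^sub>j a\<^sub>i\<^sub>j \<partial>\<^sub>i u\<^sub>j + \<Sum>\<^sub>j b\<^sub>j u\<^sub>j\<close> with a test function, up to sign.\<close>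

definition pairing :: "(real^3 \<Rightarrow> real^3) \<Rightarrow> (3 \<Rightarrow> 3 \<Rightarrow> real^3 \<Rightarrow> real) \<Rightarrow> (3 \<Rightarrow> real^3 \<Rightarrow> real)
    \<Rightarrow> (real^3 \<Rightarrow> real) \<Rightarrow> real^3 \<Rightarrow> real" where
  "pairing u a b \<phi> x = (\<Sum>j\<in>UNIV. u x $ j * ((\<Sum>i\<in>UNIV. partial i (\<lambda>y. a i j y * \<phi> y) x) - b j x * \<phi> x))"

definition row_sol :: "(real^3) set \<Rightarrow> (real^3 \<Rightarrow> real^3) \<Rightarrow> (3 \<Rightarrow> 3 \<Rightarrow> real^3 \<Rightarrow> real)
    \<Rightarrow> (3 \<Rightarrow> real^3 \<Rightarrow> real) \<Rightarrow> bool" where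
  "row_sol W u a b \<longleftrightarrow> (\<forall>\<phi>. test1 W \<phi> \<longrightarrow> (LBINT x. pairing u a b \<phi> x) = 0)"

lemma test1_sum_partial:
  assumes "open W" "\<And>i. Ck_on 1 W (a i)" "test1 W \<phi>"
  shows "continuous_on S (partial j (\<lambda>y. a i y * \<phi> y))" "csupp W (partial j (\<lambda>y. a i y * \<phi> y))"
  using test1_continuous[OF test1_mult[OF assms(1) assms(2)[of i] assms(3)]] by auto

lemma pairing_integrable:
  assumes W: "open W" and u: "continuous_on W u" and a: "\<And>i j. Ck_on 1 W (a i j)"
    and b: "\<And>j. continuous_on W (b j)" and t: "test1 W \<phi>"
  shows "integrable lborel (pairing u a b \<phi>)"
proof (rule integrable_csupp[of W])
  note tc = test1_continuous[OF t] and ts = test1_sum_partial[OF W _ t, of "\<lambda>_. a _ _"]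
  show "continuous_on W (pairing u a b \<phi>)"
    unfolding pairing_def[abs_def]
    by (intro continuous_intros u b tc ts a)
  show "csupp W (pairing u a b \<phi>)"
    unfolding pairing_def[abs_def]
    by (intro csupp_sum csupp_mult csupp_diff tc ts a)
qed

text \<open>The coefficient is absorbed into the test function, which is possible because test
  functions are required to be no better than C^1.\<close>

lemma row_sol_mult:
  assumes "open W" "Ck_on 1 W c" "row_sol W u a b"
  shows "row_sol W u (\<lambda>i j x. c x * a i j x) (\<lambda>j x. c x * b j x)"
  unfolding row_sol_def
proof (intro allI impI)
  fix \<phi> assume t: "test1 W \<phi>"
  have "(LBINT x. pairing u a b (\<lambda>y. c y * \<phi> y) x) = 0"
    using assms(3) test1_mult[OF assms(1,2) t] unfolding row_sol_def by blast
  moreover have "pairing u (\<lambda>i j x. c x * a i j x) (\<lambda>j x. c x * b j x) \<phi> = pairing u a b (\<lambda>y. c y * \<phi> y)"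
    by (simp add: pairing_def fun_eq_iff mult_ac)
  ultimately show "(LBINT x. pairing u (\<lambda>i j x. c x * a i j x) (\<lambda>j x. c x * b j x) \<phi> x) = 0" by simp
qed

lemma row_sol_diff:
  assumes W: "open W" and u: "continuous_on W u"
    and a: "\<And>i j. Ck_on 1 W (a i j)" "\<And>i j. Ck_on 1 W (a' i j)"
    and b: "\<And>j. continuous_on W (b j)" "\<And>j. continuous_on W (b' j)"
    and "row_sol W u a b" "row_sol W u a' b'"
  shows "row_sol W u (\<lambda>i j x. a i j x - a' i j x) (\<lambda>j x. b j x - b' j x)"
  unfolding row_sol_def
proof (intro allI impI)
  fix \<phi> assume t: "test1 W \<phi>"
  have d: "(\<lambda>y. c y * \<phi> y) differentiable (at x)" if "Ck_on 1 W c" for c x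
    using test1_continuous(5)[OF test1_mult[OF W that t]] .
  have "pairing u (\<lambda>i j x. a i j x - a' i j x) (\<lambda>j x. b j x - b' j x) \<phi> x = pairing u a b \<phi> x - pairing u a' b' \<phi> x" for x
    by (simp add: pairing_def left_diff_distrib right_diff_distrib partial_diff d[OF a(1)] d[OF a(2)] sum_subtractf)
  then show "(LBINT x. pairing u (\<lambda>i j x. a i j x - a' i j x) (\<lambda>j x. b j x - b' j x) \<phi> x) = 0"
    using assms(7,8) t pairing_integrable[OF W u a(1) b(1) t] pairing_integrable[OF W u a(2) b(2) t]
    unfolding row_sol_def by simp
qed

text \<open>Differentiating a row uses second derivatives of the test function, so it is first
  tested with smooth functions. Since u and the coefficients with their derivatives are continuous,
  the pairing has the shape treated by \<open>test_C1_from_smooth\<close>.\<close>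

lemma row_sol_smooth:
  assumes W: "open W" and u: "continuous_on W u" and a: "\<And>i j. Ck_on 1 W (a i j)"
    and b: "\<And>j. continuous_on W (b j)"
    and z: "\<And>\<phi>. smooth \<phi> \<Longrightarrow> csupp W \<phi> \<Longrightarrow> (LBINT x. pairing u a b \<phi> x) = 0"
  shows "row_sol W u a b"
  unfolding row_sol_def
proof (intro allI impI)
  fix \<phi> assume t: "test1 W \<phi>"
  let ?\<alpha> = "\<lambda>x. \<Sum>j\<in>UNIV. u x $ j * ((\<Sum>i\<in>UNIV. partial i (a i j) x) - b j x)"
  let ?\<beta> = "\<lambda>i x. \<Sum>j\<in>UNIV. u x $ j * a i j x"
  have ca: "continuous_on W (a i j)" "continuous_on W (partial l (a i j))" for i j l
    using Ck_on_continuous[OF a] Ck_on_continuous[OF Ck_on_partial[OF W, of 0]] a by simp_all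
  have c: "continuous_on W ?\<alpha>" "continuous_on W (?\<beta> i)" for i
    by (intro continuous_intros u b ca)+
  have ind: "integrable lborel (\<lambda>x. indicator K x * h x)" if "compact K" "K \<subseteq> W" "continuous_on W h" for K and h :: "real^3 \<Rightarrow> real"
    using borel_integrable_compact[of K h] that continuous_on_subset by auto
  have eq: "?\<alpha> x * \<psi> x + (\<Sum>i\<in>UNIV. ?\<beta> i x * partial i \<psi> x) = pairing u a b \<psi> x" if t: "test1 W \<psi>" for \<psi> x
  proof (cases "x \<in> W")
    case True
    have d: "a i j differentiable (at x)" for i j using Ck_on_differentiable_at[OF W a _ True] by simp
    show ?thesis unfolding pairing_def
      by (simp add: partial_mult d test1_continuous(5)[OF t] sum.distrib sum_distrib_left sum_distrib_right
          left_diff_distrib right_diff_distrib distrib_left sum_subtractf mult_ac)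
        (subst sum.swap, simp)
  next
    case False
    then show ?thesis
      using csupp_out[OF test1_continuous(3)[OF t] False] csupp_out[OF test1_continuous(4)[OF t] False]
        csupp_out[OF test1_continuous(4)[OF test1_mult[OF W a t]] False]
      by (simp add: pairing_def)
  qed
  have "(LBINT x. ?\<alpha> x * \<phi> x + (\<Sum>i\<in>UNIV. ?\<beta> i x * partial i \<phi> x)) = 0"
  proof (rule test_C1_from_smooth[OF W])
    show "Ck_on 1 UNIV \<phi>" "csupp W \<phi>" using t by (auto simp: test1_def)
    show "(LBINT x. ?\<alpha> x * \<psi> x + (\<Sum>i\<in>UNIV. ?\<beta> i x * partial i \<psi> x)) = 0"
      if "smooth \<psi>" "csupp W \<psi>" for \<psi>
      using z[OF that] eq[OF smooth_test1[OF that]] by simp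
  qed (intro ind c; assumption)+
  then show "(LBINT x. pairing u a b \<phi> x) = 0" using eq[OF t] by simp
qed

text \<open>The goal of the elimination: a row without first order part says that a continuous
  function is orthogonal to all tests, hence it is an equation at every point.\<close>

lemma row_sol_pointwise:
  assumes W: "open W" and u: "continuous_on W u" and r: "row_sol W u a b"
    and a: "\<And>i j x. x \<in> W \<Longrightarrow> a i j x = 0" and b: "\<And>j. continuous_on W (b j)" and p: "p \<in> W"
  shows "(\<Sum>j\<in>UNIV. b j p * u p $ j) = 0"
proof (rule continuous_zero_if_tests_zero[OF W _ _ p])
  show "continuous_on W (\<lambda>x. \<Sum>j\<in>UNIV. b j x * u x $ j)" by (intro continuous_intros b u)
  fix \<phi> assume "smooth \<phi>" "csupp W \<phi>"
  then have t: "test1 W \<phi>" by (rule smooth_test1)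
  have "pairing u a b \<phi> x = - ((\<Sum>j\<in>UNIV. b j x * u x $ j) * \<phi> x)" for x
  proof -
    have "a i j y * \<phi> y = 0" for i j y
      using a[of y] csupp_out[OF test1_continuous(3)[OF t]] by (cases "y \<in> W") auto
    note z = this
    show ?thesis unfolding pairing_def z by (simp add: sum_distrib_left sum_negf mult_ac)
  qed
  then have "(\<lambda>x. (\<Sum>j\<in>UNIV. b j x * u x $ j) * \<phi> x) = (\<lambda>x. - pairing u a b \<phi> x)" by (simp add: fun_eq_iff)
  then show "(LBINT x. (\<Sum>j\<in>UNIV. b j x * u x $ j) * \<phi> x) = 0"
    using r t unfolding row_sol_def by simp
qed

text \<open>Differentiating a row along \<open>n\<close>, where \<open>n \<cdot> \<nabla>u\<^sub>j = \<Sum>\<^sub>k A\<^sub>j\<^sub>k u\<^sub>k\<close>, gives again a first order row,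
  because the commutator of \<open>n \<cdot> \<nabla>\<close> and \<open>\<partial>\<^sub>i\<close> is of first order.\<close>

locale transport =
  fixes W :: "(real^3) set" and u :: "real^3 \<Rightarrow> real^3"
    and n :: "3 \<Rightarrow> real^3 \<Rightarrow> real" and A :: "3 \<Rightarrow> 3 \<Rightarrow> real^3 \<Rightarrow> real"
  assumes W: "open W" and u: "continuous_on W u"
    and n: "\<And>l. Ck_on 2 W (n l)" and A: "\<And>j k. Ck_on 1 W (A j k)"
    and N: "\<And>j \<eta>. test1 W \<eta> \<Longrightarrow>
      (LBINT x. u x $ j * (\<Sum>l\<in>UNIV. partial l (\<lambda>y. n l y * \<eta> y) x) + (\<Sum>k\<in>UNIV. A j k x * u x $ k) * \<eta> x) = 0"
begin

text \<open>The first order coefficients after differentiation along n. The three sums come from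
  differentiating the coefficients, from inserting A u for the derivative of u along n, and from the
  commutator of n . grad with the partial derivatives. \<open>along0\<close> collects the
  coefficients of u itself.\<close>

definition along :: "(3 \<Rightarrow> 3 \<Rightarrow> real^3 \<Rightarrow> real) \<Rightarrow> 3 \<Rightarrow> 3 \<Rightarrow> real^3 \<Rightarrow> real" where
  "along a i k x = (\<Sum>l\<in>UNIV. n l x * partial l (a i k) x) + (\<Sum>j\<in>UNIV. a i j x * A j k x)
     - (\<Sum>l\<in>UNIV. a l k x * partial l (n i) x)"

definition along0 :: "(3 \<Rightarrow> 3 \<Rightarrow> real^3 \<Rightarrow> real) \<Rightarrow> (3 \<Rightarrow> real^3 \<Rightarrow> real) \<Rightarrow> 3 \<Rightarrow> real^3 \<Rightarrow> real" where
  "along0 a b k x = (\<Sum>l\<in>UNIV. n l x * partial l (b k) x)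
     + (\<Sum>i\<in>UNIV. \<Sum>j\<in>UNIV. a i j x * partial i (A j k) x) + (\<Sum>j\<in>UNIV. b j x * A j k x)"

lemma n1: "Ck_on 1 W (n l)" and pn1: "Ck_on 1 W (partial i (n l))"
  using Ck_on_mono[OF n, of 1] Ck_on_partial[OF W, of 1] n by (auto simp: numeral_2_eq_2)

lemma along_C1: "(\<And>i j. Ck_on 2 W (a i j)) \<Longrightarrow> Ck_on 1 W (along a i k)"
  unfolding along_def[abs_def]
  using Ck_on_mono[of 2 W _ 1] Ck_on_partial[OF W, of 1]
  by (intro Ck_on_add Ck_on_diff Ck_on_sum Ck_on_mult W n1 pn1 A) (auto simp: numeral_2_eq_2)

lemma along0_cont:
  assumes "\<And>i j. continuous_on W (a i j)" "\<And>j. Ck_on 1 W (b j)"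
  shows "continuous_on W (along0 a b k)"
proof -
  have "continuous_on W (partial i (b j))" "continuous_on W (b j)" "continuous_on W (partial i (A j k))"
    "continuous_on W (A j k)" "continuous_on W (n l)" for i j k l
    using Ck_on_continuous[OF assms(2)] Ck_on_continuous[OF A] Ck_on_continuous[OF n1]
      Ck_on_continuous[OF Ck_on_partial[OF W, of 0]] assms(2) A by auto
  then show ?thesis unfolding along0_def[abs_def] by (intro continuous_intros assms)
qed

text \<open>The transposed form of the computation, with all derivatives on the test function
  \<open>\<psi>\<close>. The right-hand side contains two kinds of admissible tests:
  \<open>\<phi>\<close>, the divergence of n times \<open>\<psi>\<close>, for the given row, and
  X_k, the transposed row applied to \<open>\<psi>\<close>, for the transport equation of
  u_k.\<close>

lemma along_identity:
  assumes a: "\<And>i j. Ck_on 2 W (a i j)" and b: "\<And>j. Ck_on 1 W (b j)" and p: "Ck_on 2 W \<psi>"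
    and x: "x \<in> W"
  defines "\<phi> \<equiv> \<lambda>x. \<Sum>l\<in>UNIV. partial l (\<lambda>y. n l y * \<psi> y) x"
  defines "X \<equiv> \<lambda>j x. (\<Sum>i\<in>UNIV. partial i (\<lambda>y. a i j y * \<psi> y) x) - b j x * \<psi> x"
  shows "(\<Sum>i\<in>UNIV. partial i (\<lambda>y. along a i k y * \<psi> y) x) - along0 a b k x * \<psi> x
    = - ((\<Sum>i\<in>UNIV. partial i (\<lambda>y. a i k y * \<phi> y) x) - b k x * \<phi> x)
      + (\<Sum>l\<in>UNIV. partial l (\<lambda>y. n l y * X k y) x) + (\<Sum>j\<in>UNIV. A j k x * X j x)"
proof -
  note C = Ck_on_mult[OF W] Ck_on_add[OF W] Ck_on_diff[OF W] Ck_on_sum[OF W]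
  have lower: "Ck_on 2 W g \<Longrightarrow> Ck_on 1 W g" and pd: "Ck_on 2 W g \<Longrightarrow> Ck_on 1 W (partial i g)" for g i
    using Ck_on_mono[of 2 W g 1] Ck_on_partial[OF W, of 1 g] by (auto simp: numeral_2_eq_2)
  have D: "g differentiable (at y)" if "Ck_on 1 W g" "y \<in> W" for g y
    using Ck_on_differentiable_at[OF W that(1) _ that(2)] by simp
  note a1 = lower[OF a] and p1 = lower[OF p]
  have phi1: "Ck_on 1 W \<phi>" unfolding \<phi>_def by (intro C pd n p)
  have mc: "partial l (partial i g) y = partial i (partial l g) y" if "Ck_on 2 W g" "y \<in> W" for g i l y
    by (rule partial_commute[OF W that])
  have pcong: "partial i g x = partial i h x" if "\<And>y. y \<in> W \<Longrightarrow> g y = h y" for g h i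
    by (rule partial_cong_open[OF W x that])
  have psum: "partial i (\<lambda>y. \<Sum>l\<in>UNIV. g l y) x = (\<Sum>l\<in>UNIV. partial i (g l) x)" if "\<And>l. Ck_on 1 W (g l)" for i and g :: "3 \<Rightarrow> _"
    by (rule partial_sum) (use D that x in blast)
  \<comment> \<open>Interchanges the two divergence-type operators, by symmetry of the second
    derivatives of n_l times a_ik times \<open>\<psi>\<close>; the term with derivatives of n is the
    commutator.\<close>
  have key: "(\<Sum>l\<in>UNIV. partial l (\<lambda>y. n l y * partial i (\<lambda>z. a i k z * \<psi> z) y) x)
      = partial i (\<lambda>y. a i k y * \<phi> y) x + partial i (\<lambda>y. (\<Sum>l\<in>UNIV. n l y * partial l (a i k) y) * \<psi> y) x
        - (\<Sum>l\<in>UNIV. partial l (\<lambda>y. a i k y * partial i (n l) y * \<psi> y) x)" for i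
  proof -
    let ?g = "\<lambda>z. a i k z * \<psi> z"
    have g2: "Ck_on 2 W ?g" by (intro C a p)
    have "partial l (\<lambda>y. n l y * partial i ?g y) x
        = partial i (partial l (\<lambda>y. n l y * ?g y)) x - partial l (\<lambda>y. a i k y * partial i (n l) y * \<psi> y) x" for l
    proof -
      have ng2: "Ck_on 2 W (\<lambda>y. n l y * ?g y)" by (intro C n g2)
      have "partial l (\<lambda>y. n l y * partial i ?g y) x = partial l (\<lambda>y. partial i (\<lambda>y. n l y * ?g y) y - a i k y * partial i (n l) y * \<psi> y) x"
      proof (rule pcong)
        fix y assume y: "y \<in> W"
        have m: "partial i (\<lambda>y. n l y * ?g y) y = partial i (n l) y * ?g y + n l y * partial i ?g y"
          by (intro partial_mult D y n1 lower[OF g2])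
        show "n l y * partial i ?g y = partial i (\<lambda>y. n l y * ?g y) y - a i k y * partial i (n l) y * \<psi> y"
          unfolding m by (simp add: mult_ac)
      qed
      also have "\<dots> = partial l (partial i (\<lambda>y. n l y * ?g y)) x - partial l (\<lambda>y. a i k y * partial i (n l) y * \<psi> y) x"
        by (intro partial_diff D x pd ng2 C a1 pn1 p1)
      also have "partial l (partial i (\<lambda>y. n l y * ?g y)) x = partial i (partial l (\<lambda>y. n l y * ?g y)) x"
        by (rule mc[OF ng2 x])
      finally show ?thesis .
    qed
    then have "(\<Sum>l\<in>UNIV. partial l (\<lambda>y. n l y * partial i ?g y) x)
        = (\<Sum>l\<in>UNIV. partial i (partial l (\<lambda>y. n l y * ?g y)) x) - (\<Sum>l\<in>UNIV. partial l (\<lambda>y. a i k y * partial i (n l) y * \<psi> y) x)"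
      by (simp add: sum_subtractf)
    also have "(\<Sum>l\<in>UNIV. partial i (partial l (\<lambda>y. n l y * ?g y)) x)
        = partial i (\<lambda>y. \<Sum>l\<in>UNIV. partial l (\<lambda>y. n l y * ?g y) y) x"
      by (rule psum[symmetric]) (intro pd C n g2)
    also have "\<dots> = partial i (\<lambda>y. a i k y * \<phi> y + (\<Sum>l\<in>UNIV. n l y * partial l (a i k) y) * \<psi> y) x"
    proof (rule pcong)
      fix y assume y: "y \<in> W"
      have "partial l (\<lambda>y. n l y * ?g y) y = a i k y * partial l (\<lambda>y. n l y * \<psi> y) y + n l y * partial l (a i k) y * \<psi> y" for l
      proof -
        have "partial l (\<lambda>y. a i k y * (n l y * \<psi> y)) y
            = partial l (a i k) y * (n l y * \<psi> y) + a i k y * partial l (\<lambda>y. n l y * \<psi> y) y"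
          by (intro partial_mult D y C a1 n1 p1)
        moreover have "(\<lambda>y. a i k y * (n l y * \<psi> y)) = (\<lambda>y. n l y * ?g y)" by (simp add: mult_ac)
        ultimately show ?thesis by (simp add: mult_ac)
      qed
      then show "(\<Sum>l\<in>UNIV. partial l (\<lambda>y. n l y * ?g y) y) = a i k y * \<phi> y + (\<Sum>l\<in>UNIV. n l y * partial l (a i k) y) * \<psi> y"
        by (simp add: \<phi>_def sum.distrib sum_distrib_left sum_distrib_right)
    qed
    also have "\<dots> = partial i (\<lambda>y. a i k y * \<phi> y) x + partial i (\<lambda>y. (\<Sum>l\<in>UNIV. n l y * partial l (a i k) y) * \<psi> y) x"
      by (intro partial_add D x C a1 phi1 n1 pd a p1)
    finally show ?thesis by simp
  qed
  have pg1: "Ck_on 1 W (partial i (\<lambda>z. a i k z * \<psi> z))" for i by (intro pd C a p)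
  have nX: "(\<Sum>l\<in>UNIV. partial l (\<lambda>y. n l y * X k y) x)
      = (\<Sum>i\<in>UNIV. \<Sum>l\<in>UNIV. partial l (\<lambda>y. n l y * partial i (\<lambda>z. a i k z * \<psi> z) y) x)
        - b k x * \<phi> x - (\<Sum>l\<in>UNIV. n l x * partial l (b k) x) * \<psi> x"
  proof -
    have "partial l (\<lambda>y. n l y * X k y) x
        = (\<Sum>i\<in>UNIV. partial l (\<lambda>y. n l y * partial i (\<lambda>z. a i k z * \<psi> z) y) x)
          - b k x * partial l (\<lambda>y. n l y * \<psi> y) x - n l x * partial l (b k) x * \<psi> x" for l
    proof -
      have "(\<lambda>y. n l y * X k y) = (\<lambda>y. (\<Sum>i\<in>UNIV. n l y * partial i (\<lambda>z. a i k z * \<psi> z) y) - b k y * (n l y * \<psi> y))"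
        by (simp add: X_def fun_eq_iff right_diff_distrib sum_distrib_left mult_ac)
      then have "partial l (\<lambda>y. n l y * X k y) x
          = partial l (\<lambda>y. \<Sum>i\<in>UNIV. n l y * partial i (\<lambda>z. a i k z * \<psi> z) y) x - partial l (\<lambda>y. b k y * (n l y * \<psi> y)) x"
        by (simp add: partial_diff D x C n1 pg1 b p1 del: One_nat_def)
      also have "partial l (\<lambda>y. b k y * (n l y * \<psi> y)) x = partial l (b k) x * (n l x * \<psi> x) + b k x * partial l (\<lambda>y. n l y * \<psi> y) x"
        by (intro partial_mult D x C b n1 p1)
      also have "partial l (\<lambda>y. \<Sum>i\<in>UNIV. n l y * partial i (\<lambda>z. a i k z * \<psi> z) y) x = (\<Sum>i\<in>UNIV. partial l (\<lambda>y. n l y * partial i (\<lambda>z. a i k z * \<psi> z) y) x)"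
        by (intro psum C n1 pg1)
      finally show ?thesis by simp
    qed
    then show ?thesis
      by (simp add: \<phi>_def sum_subtractf sum_distrib_left sum_distrib_right) (rule sum.swap)
  qed
  have AX: "(\<Sum>j\<in>UNIV. A j k x * X j x)
      = (\<Sum>i\<in>UNIV. \<Sum>j\<in>UNIV. partial i (\<lambda>y. a i j y * A j k y * \<psi> y) x)
        - (\<Sum>i\<in>UNIV. \<Sum>j\<in>UNIV. a i j x * partial i (A j k) x) * \<psi> x - (\<Sum>j\<in>UNIV. b j x * A j k x) * \<psi> x"
  proof -
    have "A j k x * partial i (\<lambda>y. a i j y * \<psi> y) x
        = partial i (\<lambda>y. a i j y * A j k y * \<psi> y) x - a i j x * partial i (A j k) x * \<psi> x" for i j
    proof -
      have "partial i (\<lambda>y. A j k y * (a i j y * \<psi> y)) x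
          = partial i (A j k) x * (a i j x * \<psi> x) + A j k x * partial i (\<lambda>y. a i j y * \<psi> y) x"
        by (intro partial_mult D x C A a1 p1)
      moreover have "(\<lambda>y. A j k y * (a i j y * \<psi> y)) = (\<lambda>y. a i j y * A j k y * \<psi> y)" by (simp add: mult_ac)
      ultimately show ?thesis by (simp add: mult_ac)
    qed
    then have "A j k x * X j x = (\<Sum>i\<in>UNIV. partial i (\<lambda>y. a i j y * A j k y * \<psi> y) x)
        - (\<Sum>i\<in>UNIV. a i j x * partial i (A j k) x * \<psi> x) - b j x * A j k x * \<psi> x" for j
      by (simp add: X_def right_diff_distrib sum_distrib_left sum_subtractf mult_ac)
    then have "(\<Sum>j\<in>UNIV. A j k x * X j x) = (\<Sum>j\<in>UNIV. \<Sum>i\<in>UNIV. partial i (\<lambda>y. a i j y * A j k y * \<psi> y) x)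
        - (\<Sum>j\<in>UNIV. \<Sum>i\<in>UNIV. a i j x * partial i (A j k) x * \<psi> x) - (\<Sum>j\<in>UNIV. b j x * A j k x * \<psi> x)"
      by (simp add: sum_subtractf)
    then show ?thesis
      by (subst (1 2) sum.swap) (simp add: sum_distrib_right)
  qed
  have L: "(\<Sum>i\<in>UNIV. partial i (\<lambda>y. along a i k y * \<psi> y) x)
      = (\<Sum>i\<in>UNIV. partial i (\<lambda>y. (\<Sum>l\<in>UNIV. n l y * partial l (a i k) y) * \<psi> y) x)
        + (\<Sum>i\<in>UNIV. \<Sum>j\<in>UNIV. partial i (\<lambda>y. a i j y * A j k y * \<psi> y) x)
        - (\<Sum>i\<in>UNIV. \<Sum>l\<in>UNIV. partial l (\<lambda>y. a i k y * partial i (n l) y * \<psi> y) x)"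
  proof -
    have "partial i (\<lambda>y. along a i k y * \<psi> y) x
        = partial i (\<lambda>y. (\<Sum>l\<in>UNIV. n l y * partial l (a i k) y) * \<psi> y) x
          + (\<Sum>j\<in>UNIV. partial i (\<lambda>y. a i j y * A j k y * \<psi> y) x)
          - (\<Sum>l\<in>UNIV. partial i (\<lambda>y. a l k y * partial l (n i) y * \<psi> y) x)" for i
    proof -
      let ?p = "\<lambda>y. (\<Sum>l\<in>UNIV. n l y * partial l (a i k) y) * \<psi> y"
      let ?q = "\<lambda>y. \<Sum>j\<in>UNIV. a i j y * A j k y * \<psi> y"
      let ?r = "\<lambda>y. \<Sum>l\<in>UNIV. a l k y * partial l (n i) y * \<psi> y"
      have c: "Ck_on 1 W ?p" "Ck_on 1 W ?q" "Ck_on 1 W ?r" by (intro C n1 pd a a1 A p1 pn1)+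
      have "(\<lambda>y. along a i k y * \<psi> y) = (\<lambda>y. (?p y + ?q y) - ?r y)"
        by (simp add: along_def fun_eq_iff left_diff_distrib distrib_right sum_distrib_right)
      then have "partial i (\<lambda>y. along a i k y * \<psi> y) x = partial i ?p x + partial i ?q x - partial i ?r x"
        by (simp add: partial_diff partial_add D x C c del: One_nat_def)
      also have "partial i ?q x = (\<Sum>j\<in>UNIV. partial i (\<lambda>y. a i j y * A j k y * \<psi> y) x)"
        by (intro psum C a1 A p1)
      also have "partial i ?r x = (\<Sum>l\<in>UNIV. partial i (\<lambda>y. a l k y * partial l (n i) y * \<psi> y) x)"
        by (intro psum C a1 pn1 p1)
      finally show ?thesis .
    qed
    then have "(\<Sum>i\<in>UNIV. partial i (\<lambda>y. along a i k y * \<psi> y) x)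
        = (\<Sum>i\<in>UNIV. partial i (\<lambda>y. (\<Sum>l\<in>UNIV. n l y * partial l (a i k) y) * \<psi> y) x)
        + (\<Sum>i\<in>UNIV. \<Sum>j\<in>UNIV. partial i (\<lambda>y. a i j y * A j k y * \<psi> y) x)
        - (\<Sum>i\<in>UNIV. \<Sum>l\<in>UNIV. partial i (\<lambda>y. a l k y * partial l (n i) y * \<psi> y) x)"
      by (simp add: sum.distrib sum_subtractf)
    also have "(\<Sum>i\<in>UNIV. \<Sum>l\<in>UNIV. partial i (\<lambda>y. a l k y * partial l (n i) y * \<psi> y) x)
        = (\<Sum>i\<in>UNIV. \<Sum>l\<in>UNIV. partial l (\<lambda>y. a i k y * partial i (n l) y * \<psi> y) x)"
      by (rule sum.swap)
    finally show ?thesis .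
  qed
  have K: "(\<Sum>i\<in>UNIV. \<Sum>l\<in>UNIV. partial l (\<lambda>y. n l y * partial i (\<lambda>z. a i k z * \<psi> z) y) x)
      = (\<Sum>i\<in>UNIV. partial i (\<lambda>y. a i k y * \<phi> y) x) + (\<Sum>i\<in>UNIV. partial i (\<lambda>y. (\<Sum>l\<in>UNIV. n l y * partial l (a i k) y) * \<psi> y) x)
        - (\<Sum>i\<in>UNIV. \<Sum>l\<in>UNIV. partial l (\<lambda>y. a i k y * partial i (n l) y * \<psi> y) x)"
    by (simp add: key sum.distrib sum_subtractf)
  show ?thesis unfolding nX K AX L along0_def by (simp add: algebra_simps)
qed

text \<open>Pairing the differentiated row with \<open>\<psi>\<close> equals minus the pairing of
  the given row with \<open>\<phi>\<close> plus the transport equations tested with X_j, and each of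
  these integrals vanishes.\<close>

lemma row_sol_along:
  assumes a: "\<And>i j. Ck_on 2 W (a i j)" and b: "\<And>j. Ck_on 1 W (b j)" and r: "row_sol W u a b"
  shows "row_sol W u (along a) (along0 a b)"
proof (rule row_sol_smooth[OF W u])
  have a1: "Ck_on 1 W (a i j)" for i j using Ck_on_mono[OF a, of 1] by simp
  show "Ck_on 1 W (along a i j)" for i j by (rule along_C1[OF a])
  show "continuous_on W (along0 a b j)" for j by (intro along0_cont b Ck_on_continuous[OF a])
  fix \<psi> assume sm: "smooth \<psi>" and cs: "csupp W \<psi>"
  have p: "Ck_on 2 W \<psi>" using sm Ck_on_subset unfolding smooth_def by blast
  define \<phi> where "\<phi> = (\<lambda>x. \<Sum>l\<in>UNIV. partial l (\<lambda>y. n l y * \<psi> y) x)"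
  define X where "X = (\<lambda>j x. (\<Sum>i\<in>UNIV. partial i (\<lambda>y. a i j y * \<psi> y) x) - b j x * \<psi> x)"
  have pd: "Ck_on 2 W g \<Longrightarrow> Ck_on 1 W (partial i g)" for g i
    using Ck_on_partial[OF W, of 1 g] by (auto simp: numeral_2_eq_2)
  have p1: "Ck_on 1 W \<psi>" using Ck_on_mono[OF p, of 1] by simp
  have t: "test1 W g" if "Ck_on 1 W g" "csupp W g" for g
    unfolding test1_def using Ck_on_UNIV_csupp[OF W that] that by blast
  have tphi: "test1 W \<phi>" unfolding \<phi>_def
    by (rule t) (intro Ck_on_sum Ck_on_mult W pd n p csupp_sum csupp_partial csupp_mult cs)+
  have tX: "test1 W (X j)" for j unfolding X_def
    by (rule t) (intro Ck_on_diff Ck_on_sum Ck_on_mult W pd a p b p1 csupp_diff csupp_sum csupp_partial csupp_mult cs)+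
  have tpsi: "test1 W \<psi>" by (rule smooth_test1[OF sm cs])
  let ?N = "\<lambda>j x. u x $ j * (\<Sum>l\<in>UNIV. partial l (\<lambda>y. n l y * X j y) x) + (\<Sum>k\<in>UNIV. A j k x * u x $ k) * X j x"
  have eq: "pairing u (along a) (along0 a b) \<psi> x = - pairing u a b \<phi> x + (\<Sum>j\<in>UNIV. ?N j x)" for x
  proof (cases "x \<in> W")
    case True
    have "pairing u (along a) (along0 a b) \<psi> x = (\<Sum>k\<in>UNIV. u x $ k *
       (- ((\<Sum>i\<in>UNIV. partial i (\<lambda>y. a i k y * \<phi> y) x) - b k x * \<phi> x)
      + (\<Sum>l\<in>UNIV. partial l (\<lambda>y. n l y * X k y) x) + (\<Sum>j\<in>UNIV. A j k x * X j x)))"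
      unfolding pairing_def along_identity[OF a b p True] \<phi>_def X_def ..
    also have "\<dots> = - pairing u a b \<phi> x + (\<Sum>k\<in>UNIV. u x $ k * (\<Sum>l\<in>UNIV. partial l (\<lambda>y. n l y * X k y) x))
        + (\<Sum>k\<in>UNIV. \<Sum>j\<in>UNIV. u x $ k * (A j k x * X j x))"
      unfolding pairing_def
      by (simp add: distrib_left sum.distrib sum_negf[symmetric] sum_distrib_left right_diff_distrib sum_subtractf)
    also have "(\<Sum>k\<in>UNIV. \<Sum>j\<in>UNIV. u x $ k * (A j k x * X j x)) = (\<Sum>j\<in>UNIV. (\<Sum>k\<in>UNIV. A j k x * u x $ k) * X j x)"
      by (subst sum.swap) (simp add: sum_distrib_left sum_distrib_right mult_ac)
    finally show ?thesis by (simp add: sum.distrib)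
  next
    case False
    then show ?thesis
      using csupp_out[OF test1_continuous(3)[OF tpsi] False] csupp_out[OF test1_continuous(3)[OF tphi] False]
        csupp_out[OF test1_continuous(3)[OF tX] False]
        csupp_out[OF test1_continuous(4)[OF test1_mult[OF W along_C1[OF a] tpsi]] False]
        csupp_out[OF test1_continuous(4)[OF test1_mult[OF W a1 tphi]] False]
        csupp_out[OF test1_continuous(4)[OF test1_mult[OF W n1 tX]] False]
      by (simp add: pairing_def)
  qed
  have iN: "integrable lborel (?N j)" for j
  proof (rule integrable_csupp[of W])
    note tc = test1_continuous[OF tX] test1_continuous[OF test1_mult[OF W n1 tX]]
    show "continuous_on W (?N j)" by (intro continuous_intros u tc Ck_on_continuous[OF A])
    show "csupp W (?N j)" by (intro csupp_add csupp_mult csupp_sum tc)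
  qed
  show "(LBINT x. pairing u (along a) (along0 a b) \<psi> x) = 0"
    unfolding eq using r tphi N[OF tX] iN pairing_integrable[OF W u a1 Ck_on_continuous[OF b] tphi]
    unfolding row_sol_def by simp
qed

end

subsection \<open>The equations in terms of the gradient of the factor\<close>

text \<open>Weakly, the divergence of a curl vanishes because mixed derivatives of the test function
  cancel: the three curl equations are tested with the derivatives of \<open>\<phi>\<close>, the
  divergence equation with f times \<open>\<phi>\<close>, and their difference leaves grad f .
  u.\<close>

lemma weqs_tangent:
  assumes W: "open W" and u: "continuous_on W u" and f: "Ck_on 1 W f" and s: "weqs W f u" and p: "p \<in> W"
  shows "(\<Sum>i\<in>UNIV. partial i f p * u p $ i) = 0"
proof (rule continuous_zero_if_tests_zero[OF W _ _ p])
  have cf: "continuous_on W (partial i f)" "continuous_on W f" for i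
    using Ck_on_continuous[OF Ck_on_partial[OF W, of 0 f]] Ck_on_continuous[OF f] f by simp_all
  show "continuous_on W (\<lambda>x. \<Sum>i\<in>UNIV. partial i f x * u x $ i)" by (intro continuous_intros cf u)
  fix \<phi> assume sm: "smooth \<phi>" and cs: "csupp W \<phi>"
  have t: "test1 W (partial i \<phi>)" for i by (intro smooth_test1 smooth_partial sm csupp_partial cs)
  have tf: "test1 W (\<lambda>x. f x * \<phi> x)" by (intro test1_mult W f smooth_test1 sm cs)
  have com: "partial i (partial j \<phi>) x = partial j (partial i \<phi>) x" for i j x
    using partial_commute[OF open_UNIV, of \<phi> x i j] sm by (simp add: smooth_def)
  let ?E = "\<lambda>i j \<eta> x. u x $ j * partial i \<eta> x - u x $ i * partial j \<eta> x + f x * (\<Sum>k\<in>UNIV. levi i j k * u x $ k) * \<eta> x"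
  have E: "(LBINT x. ?E i j \<eta> x) = 0" if "test1 W \<eta>" for i j \<eta> using s that unfolding weqs_def by blast
  have Ei: "integrable lborel (?E i j \<eta>)" if "test1 W \<eta>" for i j \<eta>
  proof (rule integrable_csupp[of W])
    note tc = test1_continuous[OF that]
    show "continuous_on W (?E i j \<eta>)" by (intro continuous_intros u tc cf)
    show "csupp W (?E i j \<eta>)" by (intro csupp_add csupp_diff csupp_mult csupp_sum tc)
  qed
  let ?d = "\<lambda>x. \<Sum>i\<in>UNIV. u x $ i * partial i (\<lambda>x. f x * \<phi> x) x"
  have di: "integrable lborel ?d"
  proof (rule integrable_csupp[of W])
    note tc = test1_continuous[OF tf]
    show "continuous_on W ?d" by (intro continuous_intros u tc)
    show "csupp W ?d" by (intro csupp_mult csupp_sum tc)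
  qed
  have d0: "(LBINT x. ?d x) = 0" using s tf unfolding weqs_def by blast
  have "(\<Sum>i\<in>UNIV. partial i f x * u x $ i) * \<phi> x
      = ?d x - (?E 2 3 (partial 1 \<phi>) x + ?E 3 1 (partial 2 \<phi>) x + ?E 1 2 (partial 3 \<phi>) x)" for x
  proof (cases "x \<in> W")
    case True
    have fd: "f differentiable (at x)" using Ck_on_differentiable_at[OF W f _ True] by simp
    have pd: "\<phi> differentiable (at x)" using test1_continuous(5)[OF smooth_test1[OF sm cs]] .
    show ?thesis by (simp add: partial_mult fd pd sum_3 com[of 2 1] com[of 3 1] com[of 3 2] algebra_simps)
  next
    case False
    then show ?thesis
      using csupp_out[OF cs False] csupp_out[OF test1_continuous(4)[OF t] False]
        csupp_out[OF test1_continuous(3)[OF t] False] csupp_out[OF test1_continuous(4)[OF tf] False]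
      by simp
  qed
  then show "(LBINT x. (\<Sum>i\<in>UNIV. partial i f x * u x $ i) * \<phi> x) = 0"
    using d0 di E[OF t] Ei[OF t] by simp
qed

text \<open>The matrix A of the transport equation: A u is minus the Hessian of f applied to u,
  minus f times the cross product of grad f and u.\<close>

definition normal_matrix :: "(real^3 \<Rightarrow> real) \<Rightarrow> 3 \<Rightarrow> 3 \<Rightarrow> real^3 \<Rightarrow> real" where
  "normal_matrix f j k x = - partial j (partial k f) x - f x * (\<Sum>l\<in>UNIV. levi j l k * partial l f x)"

lemma levi_swap: "levi j i k = - levi i j k"
  using exhaust_3[of i] exhaust_3[of j] exhaust_3[of k] by auto

text \<open>The curl equations for the pairs (l, j) are tested with the l-th derivative of f times
  \<open>\<eta>\<close> and summed over l. The terms with u . grad f drop out by tangency, and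
  differentiating that constraint produces the Hessian.\<close>

lemma weqs_normal_derivative:
  assumes W: "open W" and u: "continuous_on W u" and f: "Ck_on 2 W f" and s: "weqs W f u" and t: "test1 W \<eta>"
  shows "(LBINT x. u x $ j * (\<Sum>l\<in>UNIV. partial l (\<lambda>y. partial l f y * \<eta> y) x)
    + (\<Sum>k\<in>UNIV. normal_matrix f j k x * u x $ k) * \<eta> x) = 0"
proof -
  have f1: "Ck_on 1 W f" "Ck_on 1 W (partial i f)" for i
    using Ck_on_mono[OF f, of 1] Ck_on_partial[OF W, of 1 f] f by (auto simp: numeral_2_eq_2)
  have cf: "continuous_on W f" "continuous_on W (partial i f)" for i
    using Ck_on_continuous f1 by auto
  have tl: "test1 W (\<lambda>y. partial l f y * \<eta> y)" for l by (intro test1_mult W f1 t)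
  let ?E = "\<lambda>l x. u x $ j * partial l (\<lambda>y. partial l f y * \<eta> y) x - u x $ l * partial j (\<lambda>y. partial l f y * \<eta> y) x
      + f x * (\<Sum>k\<in>UNIV. levi l j k * u x $ k) * (partial l f x * \<eta> x)"
  have E: "(LBINT x. ?E l x) = 0" for l using s tl unfolding weqs_def by blast
  have Ei: "integrable lborel (?E l)" for l
  proof (rule integrable_csupp[of W])
    note tc = test1_continuous[OF tl] test1_continuous[OF t]
    show "continuous_on W (?E l)" by (intro continuous_intros u tc cf)
    show "csupp W (?E l)" by (intro csupp_add csupp_diff csupp_mult csupp_sum tc)
  qed
  have "u x $ j * (\<Sum>l\<in>UNIV. partial l (\<lambda>y. partial l f y * \<eta> y) x)
    + (\<Sum>k\<in>UNIV. normal_matrix f j k x * u x $ k) * \<eta> x = (\<Sum>l\<in>UNIV. ?E l x)" for x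
  proof (cases "x \<in> W")
    case True
    have d: "partial l f differentiable (at x)" for l using Ck_on_differentiable_at[OF W f1(2) _ True] by simp
    have "(\<Sum>l\<in>UNIV. u x $ l * partial j (\<lambda>y. partial l f y * \<eta> y) x)
        = (\<Sum>l\<in>UNIV. partial j (partial l f) x * u x $ l) * \<eta> x + (\<Sum>l\<in>UNIV. partial l f x * u x $ l) * partial j \<eta> x"
      by (simp add: partial_mult d test1_continuous(5)[OF t] sum_distrib_left sum.distrib algebra_simps)
    also have "(\<Sum>l\<in>UNIV. partial l f x * u x $ l) = 0" by (rule weqs_tangent[OF W u f1(1) s True])
    finally have 1: "(\<Sum>l\<in>UNIV. u x $ l * partial j (\<lambda>y. partial l f y * \<eta> y) x)
        = (\<Sum>l\<in>UNIV. partial j (partial l f) x * u x $ l) * \<eta> x" by simp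
    have 2: "(\<Sum>l\<in>UNIV. f x * (\<Sum>k\<in>UNIV. levi l j k * u x $ k) * (partial l f x * \<eta> x))
        = - (\<Sum>k\<in>UNIV. f x * (\<Sum>l\<in>UNIV. levi j l k * partial l f x) * u x $ k) * \<eta> x"
      by (simp add: levi_swap[of _ j] sum_3 algebra_simps)
    show ?thesis unfolding sum.distrib sum_subtractf 1 2 normal_matrix_def
      by (simp add: sum_distrib_left left_diff_distrib sum_subtractf sum_negf algebra_simps)
  next
    case False
    then show ?thesis
      using csupp_out[OF test1_continuous(3)[OF t] False] csupp_out[OF test1_continuous(4)[OF tl] False] by simp
  qed
  then show ?thesis using E Ei by simp
qed

subsection \<open>Rows of differential operators\<close>

primrec dop :: "3 \<Rightarrow> diff_op \<Rightarrow> diff_op" where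
  "dop i (Const c) = Const 0"
| "dop i (Deriv is) = Deriv (i # is)"
| "dop i (Add P Q) = Add (dop i P) (dop i Q)"
| "dop i (Mult P Q) = Add (Mult (dop i P) Q) (Mult P (dop i Q))"

lemma op_order_dop: "op_order (dop i P) \<le> Suc (op_order P)"
  by (induction P) auto

lemma Ck_on_apply_op:
  assumes "open W" "Ck_on (k + op_order P) W f"
  shows "Ck_on k W (apply_op P f)"
  using assms(2)
proof (induction P)
  case (Const c)
  then show ?case using Ck_on_const[OF assms(1)] by simp
next
  case (Deriv "is")
  have "apply_op (Deriv is) f = partials is f" by (simp add: fun_eq_iff)
  then show ?case using Deriv Ck_on_partials by simp
next
  case (Add P Q)
  then have "Ck_on (k + op_order P) W f" "Ck_on (k + op_order Q) W f"
    by (auto elim!: Ck_on_mono)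
  then show ?case using Add Ck_on_add[OF assms(1)] by simp
next
  case (Mult P Q)
  then have "Ck_on (k + op_order P) W f" "Ck_on (k + op_order Q) W f"
    by (auto elim!: Ck_on_mono)
  then show ?case using Mult Ck_on_mult[OF assms(1)] by simp
qed

lemma apply_op_Deriv: "apply_op (Deriv is) f = partials is f"
  by (simp add: fun_eq_iff)

lemma apply_op_dop:
  assumes "open W" "Ck_on (Suc (op_order P)) W f" "x \<in> W"
  shows "apply_op (dop i P) f x = partial i (apply_op P f) x"
  using assms(2)
proof (induction P)
  case (Const c)
  then show ?case using partial_const[of i "of_rat c" x] by simp
next
  case (Deriv "is")
  then show ?case by (simp add: apply_op_Deriv partials_Cons)
next
  case (Add P Q)
  then have c: "Ck_on (Suc (op_order P)) W f" "Ck_on (Suc (op_order Q)) W f"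
    by (auto elim!: Ck_on_mono)
  have d: "apply_op P f differentiable (at x)" "apply_op Q f differentiable (at x)"
    using Ck_on_differentiable_at[OF assms(1) Ck_on_apply_op[OF assms(1), of 1] _ assms(3)] c by auto
  have "apply_op (Add P Q) f = (\<lambda>x. apply_op P f x + apply_op Q f x)" by (simp add: fun_eq_iff)
  then show ?case using Add.IH c by (simp add: partial_add d)
next
  case (Mult P Q)
  then have c: "Ck_on (Suc (op_order P)) W f" "Ck_on (Suc (op_order Q)) W f"
    by (auto elim!: Ck_on_mono)
  have d: "apply_op P f differentiable (at x)" "apply_op Q f differentiable (at x)"
    using Ck_on_differentiable_at[OF assms(1) Ck_on_apply_op[OF assms(1), of 1] _ assms(3)] c by auto
  have "apply_op (Mult P Q) f = (\<lambda>x. apply_op P f x * apply_op Q f x)" by (simp add: fun_eq_iff)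
  then show ?case using Mult.IH c by (simp add: partial_mult d)
qed

definition subop :: "diff_op \<Rightarrow> diff_op \<Rightarrow> diff_op" where
  "subop P Q = Add P (Mult (Const (- 1)) Q)"

definition sum3 :: "(3 \<Rightarrow> diff_op) \<Rightarrow> diff_op" where
  "sum3 g = Add (g 1) (Add (g 2) (g 3))"

lemma apply_subop [simp]: "apply_op (subop P Q) f x = apply_op P f x - apply_op Q f x"
  by (simp add: subop_def)

lemma apply_sum3 [simp]: "apply_op (sum3 g) f x = (\<Sum>i\<in>UNIV. apply_op (g i) f x)"
  by (simp add: sum3_def sum_3)

lemma op_order_subop: "op_order (subop P Q) = max (op_order P) (op_order Q)"
  by (simp add: subop_def)

lemma op_order_sum3_le: "(\<And>i. op_order (g i) \<le> m) \<Longrightarrow> op_order (sum3 g) \<le> m"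
  by (simp add: sum3_def)

text \<open>A row is a list of twelve entries: the nine coefficients of the derivatives \<open>\<partial>\<^sub>i u\<^sub>j\<close>,
  followed by the three coefficients of \<open>u\<^sub>j\<close>.\<close>

definition pos :: "3 \<Rightarrow> nat" where "pos i = (if i = 1 then 0 else if i = 2 then 1 else 2)"

definition mk_row :: "(3 \<Rightarrow> 3 \<Rightarrow> 'a) \<Rightarrow> (3 \<Rightarrow> 'a) \<Rightarrow> 'a list" where
  "mk_row a b = [a 1 1, a 1 2, a 1 3, a 2 1, a 2 2, a 2 3, a 3 1, a 3 2, a 3 3, b 1, b 2, b 3]"

definition ra :: "'a list \<Rightarrow> 3 \<Rightarrow> 3 \<Rightarrow> 'a" where "ra R i j = R ! (3 * pos i + pos j)"
definition rb :: "'a list \<Rightarrow> 3 \<Rightarrow> 'a" where "rb R j = R ! (9 + pos j)"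

lemma pos_simps [simp]: "pos 1 = 0" "pos 2 = 1" "pos 3 = 2" by (simp_all add: pos_def)

lemma pos_less: "pos i < 3" by (simp add: pos_def)

lemma ra_index: "3 * pos i + pos j < 9" using pos_less[of i] pos_less[of j] by linarith
lemma rb_index: "9 + pos j < 12" using pos_less[of j] by linarith

lemma ra_mk_row [simp]: "ra (mk_row a b) i j = a i j"
proof -
  have "\<forall>i j. ra (mk_row a b) i j = a i j" unfolding forall_3 by (simp add: ra_def mk_row_def)
  then show ?thesis by blast
qed

lemma rb_mk_row [simp]: "rb (mk_row a b) j = b j"
proof -
  have "\<forall>j. rb (mk_row a b) j = b j" unfolding forall_3 by (simp add: rb_def mk_row_def)
  then show ?thesis by blast
qed

lemma length_mk_row [simp]: "length (mk_row a b) = 12" by (simp add: mk_row_def)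

lemma map_mk_row: "map h (mk_row a b) = mk_row (\<lambda>i j. h (a i j)) (\<lambda>j. h (b j))"
  by (simp add: mk_row_def)

lemma mk_row_ra_rb: "length R = 12 \<Longrightarrow> mk_row (ra R) (rb R) = R"
  by (rule nth_equalityI) (auto simp: mk_row_def ra_def rb_def less_Suc_eq numeral_eq_Suc)

text \<open>A rational copy of \<open>levi\<close>, because the constants of \<open>diff_op\<close>
  are rational.\<close>

definition leviq :: "3 \<Rightarrow> 3 \<Rightarrow> 3 \<Rightarrow> rat" where
  "leviq i j k = (if (i, j, k) \<in> {(1, 2, 3), (2, 3, 1), (3, 1, 2)} then 1
     else if (i, j, k) \<in> {(1, 3, 2), (3, 2, 1), (2, 1, 3)} then - 1 else 0)"

lemma of_rat_leviq [simp]: "of_rat (leviq i j k) = levi i j k"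
  by (simp add: leviq_def levi_def)

definition normal_op :: "3 \<Rightarrow> 3 \<Rightarrow> diff_op" where
  "normal_op j k = subop (Mult (Const (- 1)) (Deriv [j, k]))
     (Mult (Deriv []) (sum3 (\<lambda>l. Mult (Const (leviq j l k)) (Deriv [l]))))"

lemma apply_normal_op: "apply_op (normal_op j k) f = normal_matrix f j k"
  by (simp add: fun_eq_iff normal_op_def normal_matrix_def partials_Cons)

lemma op_order_normal_op: "op_order (normal_op j k) = 2"
  by (simp add: normal_op_def op_order_subop sum3_def)

text \<open>Symbolic counterpart of \<open>along\<close> and \<open>along0\<close> for n = grad f
  and A = \<open>normal_matrix f\<close>, so that iterated rows remain differential expressions in
  f.\<close>

definition along_op :: "diff_op list \<Rightarrow> diff_op list" where
  "along_op R = mk_row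
     (\<lambda>i k. subop (Add (sum3 (\<lambda>l. Mult (Deriv [l]) (dop l (ra R i k))))
         (sum3 (\<lambda>j. Mult (ra R i j) (normal_op j k))))
       (sum3 (\<lambda>l. Mult (ra R l k) (Deriv [l, i]))))
     (\<lambda>k. Add (Add (sum3 (\<lambda>l. Mult (Deriv [l]) (dop l (rb R k))))
         (sum3 (\<lambda>i. sum3 (\<lambda>j. Mult (ra R i j) (dop i (normal_op j k))))))
       (sum3 (\<lambda>j. Mult (rb R j) (normal_op j k))))"

text \<open>The coefficients of u may contain one more derivative of f than those of its
  derivatives. This gap survives differentiation and elimination, and it fits the smoothness needed:
  with f in C^6 and s = 5 the former are continuous and the latter C^1.\<close>

definition row_order :: "diff_op list \<Rightarrow> nat \<Rightarrow> bool" where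
  "row_order R s \<longleftrightarrow> length R = 12 \<and> (\<forall>i j. op_order (ra R i j) \<le> s) \<and> (\<forall>j. op_order (rb R j) \<le> Suc s)"

definition row_of :: "(real^3 \<Rightarrow> real) \<Rightarrow> (real^3) set \<Rightarrow> (real^3 \<Rightarrow> real^3) \<Rightarrow> diff_op list \<Rightarrow> bool" where
  "row_of f W u R \<longleftrightarrow> row_sol W u (\<lambda>i j. apply_op (ra R i j) f) (\<lambda>j. apply_op (rb R j) f)"

lemma row_order_along:
  assumes "row_order R s" "1 \<le> s" shows "row_order (along_op R) (Suc s)"
proof -
  have a: "op_order (ra R i j) \<le> s" and b: "op_order (rb R j) \<le> Suc s" for i j
    using assms by (auto simp: row_order_def)
  have da: "op_order (dop l (ra R i j)) \<le> Suc s" for l i j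
    using op_order_dop[of l "ra R i j"] a[of i j] by linarith
  have db: "op_order (dop l (rb R j)) \<le> Suc (Suc s)" for l j
    using op_order_dop[of l "rb R j"] b[of j] by linarith
  have dn: "op_order (dop l (normal_op i j)) \<le> Suc (Suc s)" for l i j
    using op_order_dop[of l "normal_op i j"] op_order_normal_op[of i j] assms(2) by linarith
  have m: "op_order (Mult P Q) \<le> m" if "op_order P \<le> m" "op_order Q \<le> m" for P Q m using that by simp
  have ad: "op_order (Add P Q) \<le> m" if "op_order P \<le> m" "op_order Q \<le> m" for P Q m using that by simp
  have sb: "op_order (subop P Q) \<le> m" if "op_order P \<le> m" "op_order Q \<le> m" for P Q m
    using that by (simp add: op_order_subop)
  have e: "op_order (normal_op i j) \<le> Suc s" "op_order (Deriv [l]) \<le> Suc s" "op_order (Deriv [l, i]) \<le> Suc s" for l i j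
    using assms(2) by (simp_all add: op_order_normal_op)
  have "op_order (ra (along_op R) i j) \<le> Suc s" for i j
    unfolding along_op_def ra_mk_row
    by (intro sb ad op_order_sum3_le m e da le_SucI[OF a])
  moreover have "op_order (rb (along_op R) j) \<le> Suc (Suc s)" for j
    unfolding along_op_def rb_mk_row
    by (intro ad op_order_sum3_le m db dn le_SucI[OF e(1)] le_SucI[OF e(2)] le_SucI[OF le_SucI[OF a]] le_SucI[OF b])
  ultimately show ?thesis by (simp add: row_order_def along_op_def)
qed

lemma row_sol_cong:
  assumes W: "open W" and a: "\<And>i j x. x \<in> W \<Longrightarrow> a i j x = a' i j x" and b: "\<And>j x. x \<in> W \<Longrightarrow> b j x = b' j x"
  shows "row_sol W u a b \<longleftrightarrow> row_sol W u a' b'"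
proof -
  have "pairing u a b \<phi> = pairing u a' b' \<phi>" if t: "test1 W \<phi>" for \<phi>
  proof
    fix x
    show "pairing u a b \<phi> x = pairing u a' b' \<phi> x"
    proof (cases "x \<in> W")
      case True
      have "partial i (\<lambda>y. a i j y * \<phi> y) x = partial i (\<lambda>y. a' i j y * \<phi> y) x" for i j
        by (rule partial_cong_open[OF W True]) (simp add: a)
      then show ?thesis using b[OF True] by (simp add: pairing_def)
    next
      case False
      have "partial i (\<lambda>y. c y * \<phi> y) x = 0" for i c
        by (rule csupp_out[OF csupp_partial[OF csupp_mult(1)[OF test1_continuous(3)[OF t]]] False])
      moreover have "\<phi> x = 0" by (rule csupp_out[OF test1_continuous(3)[OF t] False])
      ultimately show ?thesis by (simp add: pairing_def)
    qed
  qed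
  then show ?thesis unfolding row_sol_def by simp
qed

text \<open>For s at most 4 and f in C^6 the first order coefficients are C^2 and the others C^1,
  exactly what \<open>row_sol_along\<close> asks for. The admissible last step, s = 4, is the one
  that produces \<open>along_iter 4\<close>.\<close>

lemma row_of_along:
  assumes W: "open W" and u: "continuous_on W u" and f: "Ck_on 6 W f" and s: "weqs W f u"
    and R: "row_order R s" "s \<le> 4" and r: "row_of f W u R"
  shows "row_of f W u (along_op R)"
proof -
  have Ck: "Ck_on k W (apply_op P f)" if "k + op_order P \<le> 6" for k P
    using Ck_on_mono[OF f that] Ck_on_apply_op[OF W] by blast
  have f2: "Ck_on 2 W f" and fp: "Ck_on 2 W (partial l f)" for l
    using Ck_on_mono[OF f] Ck_on_partial[OF W Ck_on_mono[OF f, of "Suc 2"]] by simp_all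
  interpret transport W u "\<lambda>l. partial l f" "normal_matrix f"
  proof
    show "Ck_on 1 W (normal_matrix f j k)" for j k
      using Ck[of 1 "normal_op j k"] by (simp add: apply_normal_op op_order_normal_op)
    show "(LBINT x. u x $ j * (\<Sum>l\<in>UNIV. partial l (\<lambda>y. partial l f y * \<eta> y) x)
        + (\<Sum>k\<in>UNIV. normal_matrix f j k x * u x $ k) * \<eta> x) = 0" if "test1 W \<eta>" for j \<eta>
      by (rule weqs_normal_derivative[OF W u f2 s that])
  qed (use W u fp in auto)
  have oa: "op_order (ra R i j) \<le> 4" and ob: "op_order (rb R j) \<le> 5" for i j
  proof -
    have "op_order (ra R i j) \<le> s" "op_order (rb R j) \<le> Suc s" using R(1) by (auto simp: row_order_def)
    then show "op_order (ra R i j) \<le> 4" "op_order (rb R j) \<le> 5" using R(2) by linarith+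
  qed
  have a2: "Ck_on 2 W (apply_op (ra R i j) f)" for i j using oa[of i j] by (intro Ck) simp
  have b1: "Ck_on 1 W (apply_op (rb R j) f)" for j using ob[of j] by (intro Ck) simp
  have dop: "apply_op (dop i P) f x = partial i (apply_op P f) x" if "x \<in> W" "op_order P \<le> 5" for i P x
    using apply_op_dop[OF W Ck_on_mono[OF f] that(1)] that(2) by simp
  have "row_sol W u (along (\<lambda>i j. apply_op (ra R i j) f)) (along0 (\<lambda>i j. apply_op (ra R i j) f) (\<lambda>j. apply_op (rb R j) f))"
    by (rule row_sol_along[OF _ _ r[unfolded row_of_def]]) (rule a2, rule b1)
  moreover have "along (\<lambda>i j. apply_op (ra R i j) f) i k x = apply_op (ra (along_op R) i k) f x" if "x \<in> W" for i k x
    using that oa[THEN order_trans, of 5] by (simp add: along_def along_op_def dop partials_Cons apply_normal_op)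
  moreover have "along0 (\<lambda>i j. apply_op (ra R i j) f) (\<lambda>j. apply_op (rb R j) f) k x = apply_op (rb (along_op R) k) f x"
    if "x \<in> W" for k x
    using that ob by (simp add: along0_def along_op_def dop partials_Cons apply_normal_op op_order_normal_op)
  ultimately show ?thesis unfolding row_of_def
    by (subst row_sol_cong[OF W, where a'="along (\<lambda>i j. apply_op (ra R i j) f)"
      and b'="along0 (\<lambda>i j. apply_op (ra R i j) f) (\<lambda>j. apply_op (rb R j) f)"]) auto
qed

section \<open>The rows of the curl, divergence and transport equations\<close>

definition curl_row :: "3 \<Rightarrow> diff_op list" where
  "curl_row k = mk_row (\<lambda>l m. Const (leviq k l m)) (\<lambda>m. if m = k then Mult (Const (- 1)) (Deriv []) else Const 0)"

definition div_row :: "diff_op list" where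
  "div_row = mk_row (\<lambda>l m. if l = m then Const 1 else Const 0) (\<lambda>m. Const 0)"

definition normal_row :: "3 \<Rightarrow> diff_op list" where
  "normal_row j = mk_row (\<lambda>l m. if m = j then Deriv [l] else Const 0) (\<lambda>m. Mult (Const (- 1)) (normal_op j m))"

lemma partial_cmult_test: "test1 W \<phi> \<Longrightarrow> partial i (\<lambda>y. c * \<phi> y) x = c * partial i \<phi> x"
  by (rule partial_cmult[OF test1_continuous(5)])

lemma row_of_div: "weqs W f u \<Longrightarrow> row_of f W u div_row"
proof -
  assume s: "weqs W f u"
  have "pairing u (\<lambda>i j. apply_op (ra div_row i j) f) (\<lambda>j. apply_op (rb div_row j) f) \<phi>
      = (\<lambda>x. \<Sum>i\<in>UNIV. u x $ i * partial i \<phi> x)" if "test1 W \<phi>" for \<phi>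
    using partial_cmult_test[OF that] by (simp add: fun_eq_iff pairing_def div_row_def sum_3)
  then show ?thesis using s unfolding row_of_def row_sol_def weqs_def by simp
qed

lemma row_of_curl: "weqs W f u \<Longrightarrow> row_of f W u (curl_row k)"
proof -
  assume s: "weqs W f u"
  \<comment> \<open>The pair for which (i, j, k) is cyclic; it turns the component k of the curl
    into the (i, j) equation of \<open>weqs\<close>.\<close>
  obtain i j where ij: "levi i j k = 1" "\<And>l m. levi k l m = (if l = i \<and> m = j then 1 else if l = j \<and> m = i then - 1 else 0)"
    "\<And>m. levi i j m = (if m = k then 1 else 0)" "i \<noteq> j"
  proof -
    consider "k = 1" | "k = 2" | "k = 3" using exhaust_3 by blast
    then show ?thesis
    proof cases
      case 1 show ?thesis by (rule that[of 2 3]) (auto simp: 1 levi_def)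
    next
      case 2 show ?thesis by (rule that[of 3 1]) (auto simp: 2 levi_def)
    next
      case 3 show ?thesis by (rule that[of 1 2]) (auto simp: 3 levi_def)
    qed
  qed
  have "pairing u (\<lambda>i j. apply_op (ra (curl_row k) i j) f) (\<lambda>j. apply_op (rb (curl_row k) j) f) \<phi> x
      = u x $ j * partial i \<phi> x - u x $ i * partial j \<phi> x + f x * (\<Sum>k\<in>UNIV. levi i j k * u x $ k) * \<phi> x"
    if "test1 W \<phi>" for \<phi> x
  proof -
    have "(\<Sum>m\<in>UNIV. u x $ m * (\<Sum>l\<in>UNIV. levi k l m * partial l \<phi> x)) = u x $ j * partial i \<phi> x - u x $ i * partial j \<phi> x"
    proof -
      have "(\<Sum>l\<in>UNIV. levi k l m * partial l \<phi> x) = (if m = j then partial i \<phi> x else if m = i then - partial j \<phi> x else 0)" for m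
      proof -
        have "levi k l m * partial l \<phi> x = (if l = i then (if m = j then partial i \<phi> x else 0) else 0)
            + (if l = j then (if m = i then - partial j \<phi> x else 0) else 0)" for l
          using ij(4) by (auto simp: ij(2))
        then show ?thesis using ij(4) by (auto simp: sum.distrib)
      qed
      then have "(\<Sum>m\<in>UNIV. u x $ m * (\<Sum>l\<in>UNIV. levi k l m * partial l \<phi> x))
          = (\<Sum>m\<in>UNIV. (if m = j then u x $ j * partial i \<phi> x else 0) + (if m = i then - u x $ i * partial j \<phi> x else 0))"
        using ij(4) by (intro sum.cong) auto
      then show ?thesis by (simp add: sum.distrib)
    qed
    moreover have "(\<Sum>l\<in>UNIV. partial l (\<lambda>y. apply_op (ra (curl_row k) l m) f y * \<phi> y) x)
        = (\<Sum>l\<in>UNIV. levi k l m * partial l \<phi> x)" for m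
      using partial_cmult_test[OF that] by (simp add: curl_row_def)
    moreover have "apply_op (rb (curl_row k) m) f x = (if m = k then - f x else 0)" for m
      by (simp add: curl_row_def)
    moreover have "(\<Sum>m\<in>UNIV. u x $ m * (S m - (if m = k then - f x else 0) * \<phi> x))
        = (\<Sum>m\<in>UNIV. u x $ m * S m) + f x * u x $ k * \<phi> x" for S
    proof -
      have "u x $ m * (S m - (if m = k then - f x else 0) * \<phi> x)
          = u x $ m * S m + (if m = k then f x * u x $ k * \<phi> x else 0)" for m
        by (simp add: algebra_simps)
      then show ?thesis by (simp add: sum.distrib)
    qed
    moreover have "(\<Sum>m\<in>UNIV. levi i j m * u x $ m) = u x $ k"
    proof -
      have "levi i j m * u x $ m = (if m = k then u x $ k else 0)" for m by (simp add: ij(3))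
      then show ?thesis by simp
    qed
    ultimately show ?thesis unfolding pairing_def by simp
  qed
  then have "pairing u (\<lambda>i j. apply_op (ra (curl_row k) i j) f) (\<lambda>j. apply_op (rb (curl_row k) j) f) \<phi>
      = (\<lambda>x. u x $ j * partial i \<phi> x - u x $ i * partial j \<phi> x + f x * (\<Sum>k\<in>UNIV. levi i j k * u x $ k) * \<phi> x)"
    if "test1 W \<phi>" for \<phi> using that by (intro ext)
  then show ?thesis using s unfolding row_of_def row_sol_def weqs_def by simp
qed

lemma row_of_normal:
  assumes W: "open W" and u: "continuous_on W u" and f: "Ck_on 2 W f" and s: "weqs W f u"
  shows "row_of f W u (normal_row j)"
proof -
  have eq: "pairing u (\<lambda>i k. apply_op (ra (normal_row j) i k) f) (\<lambda>k. apply_op (rb (normal_row j) k) f) \<phi> x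
      = u x $ j * (\<Sum>l\<in>UNIV. partial l (\<lambda>y. partial l f y * \<phi> y) x) + (\<Sum>k\<in>UNIV. normal_matrix f j k x * u x $ k) * \<phi> x" for \<phi> x
  proof -
    define T where "T = (\<Sum>l\<in>UNIV. partial l (\<lambda>y. partial l f y * \<phi> y) x)"
    have 1: "(\<Sum>i\<in>UNIV. partial i (\<lambda>y. apply_op (ra (normal_row j) i k) f y * \<phi> y) x) = (if k = j then T else 0)" for k
      by (cases "k = j") (simp_all add: T_def normal_row_def partials_Cons)
    have 2: "apply_op (rb (normal_row j) k) f x = - normal_matrix f j k x" for k
      by (simp add: normal_row_def apply_normal_op)
    have 3: "u x $ k * ((if k = j then T else 0) - (- normal_matrix f j k x) * \<phi> x)
        = (if k = j then u x $ j * T else 0) + normal_matrix f j k x * u x $ k * \<phi> x" for k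
      by (simp add: algebra_simps)
    show ?thesis unfolding pairing_def 1 2 3 sum.distrib T_def[symmetric] by (simp add: sum_distrib_right)
  qed
  show ?thesis unfolding row_of_def row_sol_def
  proof (intro allI impI)
    fix \<phi> assume "test1 W \<phi>"
    then show "(LBINT x. pairing u (\<lambda>i k. apply_op (ra (normal_row j) i k) f) (\<lambda>k. apply_op (rb (normal_row j) k) f) \<phi> x) = 0"
      unfolding eq by (rule weqs_normal_derivative[OF W u f s])
  qed
qed

lemma row_order_basic: "row_order div_row 1" "row_order (curl_row k) 5" "row_order (normal_row j) 5"
  by (auto simp: row_order_def div_row_def curl_row_def normal_row_def op_order_normal_op)

subsection \<open>Elimination\<close>

text \<open>Cross multiplication instead of division: the entries remain polynomial expressions, and
  the new row is valid also where the pivot vanishes.\<close>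

definition elim :: "nat \<Rightarrow> diff_op list \<Rightarrow> diff_op list \<Rightarrow> diff_op list" where
  "elim c R S = map2 (\<lambda>r s. subop (Mult (R ! c) s) (Mult (S ! c) r)) R S"

text \<open>Each pivot row clears its column in the rows after it and is then dropped. Columns are
  taken in a prescribed order without search, so that the outcome is one fixed expression, the same
  for all f.\<close>

fun gauss :: "nat list \<Rightarrow> diff_op list list \<Rightarrow> diff_op list list" where
  "gauss (c # cs) (R # Rs) = gauss cs (map (elim c R) Rs)"
| "gauss cs Rs = Rs"

lemma elim_nth:
  "length R = 12 \<Longrightarrow> length S = 12 \<Longrightarrow> k < 12 \<Longrightarrow> elim c R S ! k = subop (Mult (R ! c) (S ! k)) (Mult (S ! c) (R ! k))"
  by (simp add: elim_def)

lemma row_order_nth: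
  assumes "row_order R s" "c < 9" shows "op_order (R ! c) \<le> s"
proof -
  have "c \<in> {0,1,2,3,4,5,6,7,8}" using assms(2) by auto
  then obtain i j where "c = 3 * pos i + pos j"
    using that[of 1 1] that[of 1 2] that[of 1 3] that[of 2 1] that[of 2 2] that[of 2 3]
      that[of 3 1] that[of 3 2] that[of 3 3] by auto
  then show ?thesis using assms(1) unfolding row_order_def ra_def by auto
qed

text \<open>The order of a product is the maximum of the orders, so elimination costs no
  derivatives.\<close>

lemma row_order_elim:
  assumes "row_order R s" "row_order S s" "c < 9" shows "row_order (elim c R S) s"
proof -
  have l: "length R = 12" "length S = 12" using assms by (auto simp: row_order_def)
  have "op_order (R ! c) \<le> s" "op_order (S ! c) \<le> s" using row_order_nth assms by auto
  then show ?thesis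
    using assms(1,2) ra_index rb_index
    by (auto simp: row_order_def ra_def rb_def elim_nth[OF l] op_order_subop le_SucI elim_def[of c R S] less_le_trans[OF ra_index])
qed

lemma row_of_elim:
  assumes W: "open W" and u: "continuous_on W u" and f: "Ck_on 6 W f"
    and R: "row_order R 5" "row_of f W u R" and S: "row_order S 5" "row_of f W u S" and c: "c < 9"
  shows "row_of f W u (elim c R S)"
proof -
  have l: "length R = 12" "length S = 12" using R S by (auto simp: row_order_def)
  have Ck: "Ck_on k W (apply_op P f)" if "k + op_order P \<le> 6" for k P
    using Ck_on_mono[OF f that] Ck_on_apply_op[OF W] by blast
  have c1: "Ck_on 1 W (apply_op (R ! c) f)" "Ck_on 1 W (apply_op (S ! c) f)"
    using row_order_nth[OF R(1) c] row_order_nth[OF S(1) c] by (auto intro!: Ck)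
  have a1: "Ck_on 1 W (apply_op (ra R i j) f)" "Ck_on 1 W (apply_op (ra S i j) f)" for i j
    using R(1) S(1) unfolding row_order_def by (auto intro!: Ck)
  have b0: "continuous_on W (apply_op (rb R j) f)" "continuous_on W (apply_op (rb S j) f)" for j
    using R(1) S(1) unfolding row_order_def by (auto intro!: Ck simp flip: Ck_on_0)
  note cc = Ck_on_continuous[OF c1(1)] Ck_on_continuous[OF c1(2)]
  have "row_sol W u (\<lambda>i j x. apply_op (R ! c) f x * apply_op (ra S i j) f x - apply_op (S ! c) f x * apply_op (ra R i j) f x)
     (\<lambda>j x. apply_op (R ! c) f x * apply_op (rb S j) f x - apply_op (S ! c) f x * apply_op (rb R j) f x)"
    using R(2) S(2) unfolding row_of_def
    by (intro row_sol_diff[OF W u] row_sol_mult[OF W] Ck_on_mult[OF W] continuous_on_mult c1 a1 b0 cc)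
  moreover have "3 * pos i + pos j < 12" for i j using ra_index[of i j] by linarith
  ultimately show ?thesis unfolding row_of_def
    by (subst row_sol_cong[OF W, where a'="\<lambda>i j x. apply_op (R ! c) f x * apply_op (ra S i j) f x - apply_op (S ! c) f x * apply_op (ra R i j) f x"
      and b'="\<lambda>j x. apply_op (R ! c) f x * apply_op (rb S j) f x - apply_op (S ! c) f x * apply_op (rb R j) f x"])
      (auto simp: ra_def rb_def elim_nth[OF l] rb_index)
qed

text \<open>\<open>Z\<close> collects the columns already cleared. A combination of two rows that
  vanish in a column vanishes there too, so cleared columns stay cleared.\<close>

lemma gauss_sound:
  assumes W: "open W" and u: "continuous_on W u" and f: "Ck_on 6 W f"
  shows "(\<forall>R\<in>set Rs. row_order R 5 \<and> row_of f W u R \<and> (\<forall>c\<in>Z. \<forall>x. apply_op (R ! c) f x = 0)) \<Longrightarrow>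
    set cs \<subseteq> {..<9} \<Longrightarrow> Z \<subseteq> {..<9} \<Longrightarrow> length cs \<le> length Rs \<Longrightarrow>
    (\<forall>R\<in>set (gauss cs Rs). row_order R 5 \<and> row_of f W u R \<and> (\<forall>c\<in>Z \<union> set cs. \<forall>x. apply_op (R ! c) f x = 0))
    \<and> length (gauss cs Rs) = length Rs - length cs"
proof (induction cs Rs arbitrary: Z rule: gauss.induct)
  case (1 c cs R Rs)
  have c: "c < 9" using 1(3) by simp
  let ?Z = "insert c Z"
  have R: "row_order R 5" "row_of f W u R" "\<And>d x. d \<in> Z \<Longrightarrow> apply_op (R ! d) f x = 0" using 1(2) by auto
  have "row_order (elim c R S) 5 \<and> row_of f W u (elim c R S) \<and> (\<forall>d\<in>?Z. \<forall>x. apply_op (elim c R S ! d) f x = 0)"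
    if "S \<in> set Rs" for S
  proof -
    have S: "row_order S 5" "row_of f W u S" "\<And>d x. d \<in> Z \<Longrightarrow> apply_op (S ! d) f x = 0" using 1(2) that by auto
    have l: "length R = 12" "length S = 12" using R S by (auto simp: row_order_def)
    have "apply_op (elim c R S ! d) f x = 0" if "d \<in> ?Z" for d x
    proof -
      have "d < 12" using that c 1(4) by force
      then show ?thesis using that R(3) S(3) by (auto simp: elim_nth[OF l])
    qed
    then show ?thesis using row_order_elim[OF R(1) S(1) c] row_of_elim[OF W u f R(1,2) S(1,2) c] by blast
  qed
  then have "\<forall>S\<in>set (map (elim c R) Rs). row_order S 5 \<and> row_of f W u S \<and> (\<forall>d\<in>?Z. \<forall>x. apply_op (S ! d) f x = 0)" by simp
  from 1(1)[OF this] show ?case using 1(3-5) c by simp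
qed auto

text \<open>Positions in the layout of \<open>mk_row\<close>: entry 3 (i - 1) + (j - 1) is the
  coefficient of the derivative of u_j in direction i. The list is a permutation of 0 to 8, matched
  with the first nine rows of \<open>all_rows\<close>.\<close>

definition pivots :: "nat list" where "pivots = [1, 5, 2, 6, 7, 8, 0, 3, 4]"

definition along_iter :: "nat \<Rightarrow> diff_op list" where "along_iter s = (along_op ^^ s) div_row"

text \<open>In this order every pivot is nonzero for \<open>sample\<close> at the origin. The third
  derivative of the divergence row stands before the second because it supplies the last pivot
  there; the second and fourth have by then lost their first order part and remain as the two
  equations for u.\<close>

definition all_rows :: "diff_op list list" where
  "all_rows = [curl_row 3, curl_row 1, curl_row 2, normal_row 1, normal_row 2, normal_row 3, div_row,
     along_iter 1, along_iter 3, along_iter 2, along_iter 4]"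

definition det3 :: "(3 \<Rightarrow> diff_op) \<Rightarrow> (3 \<Rightarrow> diff_op) \<Rightarrow> (3 \<Rightarrow> diff_op) \<Rightarrow> diff_op" where
  "det3 a b c = Add (Mult (a 1) (subop (Mult (b 2) (c 3)) (Mult (b 3) (c 2))))
     (Add (Mult (a 2) (subop (Mult (b 3) (c 1)) (Mult (b 1) (c 3))))
       (Mult (a 3) (subop (Mult (b 1) (c 2)) (Mult (b 2) (c 1)))))"

definition obstruction :: diff_op where
  "obstruction = det3 (\<lambda>i. Deriv [i]) (rb (gauss pivots all_rows ! 0)) (rb (gauss pivots all_rows ! 1))"

lemma along_iter_sound:
  assumes W: "open W" and u: "continuous_on W u" and f: "Ck_on 6 W f" and s: "weqs W f u"
  shows "s \<le> 4 \<Longrightarrow> row_order (along_iter s) (Suc s) \<and> row_of f W u (along_iter s)"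
proof (induction s)
  case 0
  then show ?case using row_order_basic(1) row_of_div[OF s] by (simp add: along_iter_def)
next
  case (Suc k)
  then have "row_order (along_iter k) (Suc k)" "row_of f W u (along_iter k)" by auto
  then show ?case
    using row_order_along[of "along_iter k" "Suc k"] row_of_along[OF W u f s, of "along_iter k" "Suc k"] Suc.prems
    by (simp add: along_iter_def)
qed

lemma row_order_mono: "row_order R s \<Longrightarrow> s \<le> t \<Longrightarrow> row_order R t"
  unfolding row_order_def by (meson Suc_le_mono order_trans)

lemma row_order_along_iter: "row_order (along_iter s) (Suc s)"
  by (induction s) (auto simp: along_iter_def row_order_basic[unfolded One_nat_def] intro: row_order_along)

lemma all_rows_order: "R \<in> set all_rows \<Longrightarrow> row_order R 5"
  unfolding all_rows_def
  using row_order_basic row_order_mono[OF row_order_basic(1), of 5] row_order_mono[OF row_order_along_iter, of _ 5]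
  by auto

lemma gauss_row_order:
  "(\<forall>R\<in>set Rs. row_order R 5) \<Longrightarrow> set cs \<subseteq> {..<9} \<Longrightarrow> length cs \<le> length Rs \<Longrightarrow>
    (\<forall>R\<in>set (gauss cs Rs). row_order R 5) \<and> length (gauss cs Rs) = length Rs - length cs"
  by (induction cs Rs rule: gauss.induct) (auto intro: row_order_elim)

lemma pivots_set: "set pivots = {..<9}" "length pivots = 9"
  by (auto simp: pivots_def)

lemma length_all_rows: "length all_rows = 11" by (simp add: all_rows_def)

lemma op_order_obstruction: "op_order obstruction \<le> 6"
proof -
  have "(\<forall>R\<in>set (gauss pivots all_rows). row_order R 5) \<and> length (gauss pivots all_rows) = 2"
    using gauss_row_order[of all_rows pivots] all_rows_order by (simp add: pivots_set length_all_rows)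
  then have "row_order (gauss pivots all_rows ! k) 5" if "k < 2" for k using that by simp
  from this[of 0] this[of 1] have "op_order (rb (gauss pivots all_rows ! 0) j) \<le> 6" "op_order (rb (gauss pivots all_rows ! 1) j) \<le> 6" for j
    by (auto simp: row_order_def)
  then show ?thesis unfolding obstruction_def det3_def by (simp add: op_order_subop)
qed

theorem solution_zero_if_obstruction:
  assumes W: "open W" and u: "continuous_on W u" and f: "Ck_on 6 W f" and s: "weqs W f u"
    and x: "x \<in> W" and ne: "apply_op obstruction f x \<noteq> 0"
  shows "u x = 0"
proof -
  have ok: "row_order R 5 \<and> row_of f W u R" if "R \<in> set all_rows" for R
    using that all_rows_order[OF that] row_of_curl[OF s] row_of_div[OF s] row_of_normal[OF W u Ck_on_mono[OF f] s]
      along_iter_sound[OF W u f s] unfolding all_rows_def by auto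
  let ?G = "gauss pivots all_rows"
  have G: "(\<forall>R\<in>set ?G. row_order R 5 \<and> row_of f W u R \<and> (\<forall>c\<in>{} \<union> set pivots. \<forall>x. apply_op (R ! c) f x = 0))
    \<and> length ?G = length all_rows - length pivots"
    by (rule gauss_sound[OF W u f]) (use ok in \<open>auto simp: pivots_set length_all_rows\<close>)
  have eq: "(\<Sum>j\<in>UNIV. apply_op (rb (?G ! k) j) f x * u x $ j) = 0" if "k < 2" for k
  proof -
    have mem: "?G ! k \<in> set ?G" using G that by (simp add: pivots_set length_all_rows)
    show ?thesis
    proof (rule row_sol_pointwise[OF W u])
      show "row_sol W u (\<lambda>i j. apply_op (ra (?G ! k) i j) f) (\<lambda>j. apply_op (rb (?G ! k) j) f)"
        using G mem unfolding row_of_def by blast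
      show "apply_op (ra (?G ! k) i j) f y = 0" for i j y
        using G mem ra_index[of i j] by (auto simp: ra_def pivots_set)
      show "continuous_on W (apply_op (rb (?G ! k) j) f)" for j
        using Ck_on_apply_op[OF W Ck_on_mono[OF f], of 0 "rb (?G ! k) j"] G mem by (auto simp: Ck_on_0 row_order_def)
    qed (rule x)
  qed
  have n: "(\<Sum>i\<in>UNIV. partial i f x * u x $ i) = 0"
    by (rule weqs_tangent[OF W u Ck_on_mono[OF f] s x]) simp
  define b where "b j = apply_op (rb (?G ! 0) j) f x" for j
  define c where "c j = apply_op (rb (?G ! 1) j) f x" for j
  define a where "a j = partial j f x" for j
  have e: "a 1 * u x $ 1 + a 2 * u x $ 2 + a 3 * u x $ 3 = 0"
    "b 1 * u x $ 1 + b 2 * u x $ 2 + b 3 * u x $ 3 = 0" "c 1 * u x $ 1 + c 2 * u x $ 2 + c 3 * u x $ 3 = 0"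
    using n eq[of 0] eq[of 1] by (simp_all add: a_def b_def c_def sum_3)
  let ?D = "a 1 * (b 2 * c 3 - b 3 * c 2) + (a 2 * (b 3 * c 1 - b 1 * c 3) + a 3 * (b 1 * c 2 - b 2 * c 1))"
  have D: "?D \<noteq> 0" using ne by (simp add: obstruction_def det3_def a_def b_def c_def partials_Cons)
  \<comment> \<open>Cramer's rule: each product is a combination of the three equations.\<close>
  have "?D * u x $ 1 = 0" "?D * u x $ 2 = 0" "?D * u x $ 3 = 0" using e by algebra+
  then show ?thesis using D by (simp add: vec_eq_iff forall_3)
qed

subsection \<open>The obstruction does not vanish identically\<close>

text \<open>The axis \<open>x\<^sub>1 = x\<^sub>2 = 0\<close> is an integral curve of the gradient of the following function, so
  that along it the rows are obtained by differentiating polynomials in \<open>t = x\<^sub>3\<close>.\<close>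

definition sample :: "real^3 \<Rightarrow> real" where
  "sample x = x $ 3 + x $ 1 * x $ 2 + x $ 1 * x $ 1 * x $ 1 / 6"

lemma partial_coord_poly:
  "partial i (\<lambda>x::real^3. x $ 2 + x $ 1 * x $ 1 / 2) = (\<lambda>x. (if i = 2 then 1 else 0) + (if i = 1 then x $ 1 else 0))"
proof -
  have "((\<lambda>x::real^3. x $ 2 + x $ 1 * x $ 1 / 2) has_derivative (\<lambda>h. h $ 2 + x $ 1 * h $ 1)) (at x)" for x
    by (auto intro!: derivative_eq_intros has_derivative_nth)
  from partial_eqI[OF this] show ?thesis by (auto simp: fun_eq_iff axis_def)
qed

lemma partial_sample:
  "partial 1 sample = (\<lambda>x. x $ 2 + x $ 1 * x $ 1 / 2)" "partial 2 sample = (\<lambda>x. x $ 1)" "partial 3 sample = (\<lambda>x. 1)"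
proof -
  have d: "(sample has_derivative (\<lambda>h. h $ 3 + (x $ 1 * h $ 2 + h $ 1 * x $ 2) + x $ 1 * x $ 1 * h $ 1 / 2)) (at x)" for x
    unfolding sample_def[abs_def]
    by (auto intro!: derivative_eq_intros has_derivative_nth simp: algebra_simps)
  show "partial 1 sample = (\<lambda>x. x $ 2 + x $ 1 * x $ 1 / 2)" "partial 2 sample = (\<lambda>x. x $ 1)" "partial 3 sample = (\<lambda>x. 1)"
    using partial_eqI[OF d] by (auto simp: fun_eq_iff axis_def)
qed

lemma partial_nth_fun: "partial i (\<lambda>x. x $ j) = (\<lambda>x. if i = j then 1 else 0)"
  by (simp add: fun_eq_iff partial_nth)

lemma partial_const_fun: "partial i (\<lambda>x. c) = (\<lambda>x. 0)"
  by (simp add: fun_eq_iff)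

lemma smooth_sample: "smooth sample"
  unfolding smooth_def sample_def[abs_def] divide_inverse
  by (intro allI Ck_on_add Ck_on_mult Ck_on_nth Ck_on_const open_UNIV)

definition axis_pt :: "real \<Rightarrow> real^3" where "axis_pt t = t *\<^sub>R axis 3 1"

lemma axis_pt_nth [simp]: "axis_pt t $ 1 = 0" "axis_pt t $ 2 = 0" "axis_pt t $ 3 = t"
  by (simp_all add: axis_pt_def axis_def)

definition ev :: "diff_op \<Rightarrow> real \<Rightarrow> real" where "ev P t = apply_op P sample (axis_pt t)"

lemma ev_simps [simp]:
  "ev (Const c) t = of_rat c" "ev (Add P Q) t = ev P t + ev Q t" "ev (Mult P Q) t = ev P t * ev Q t"
  "ev (subop P Q) t = ev P t - ev Q t" "ev (sum3 g) t = (\<Sum>i\<in>UNIV. ev (g i) t)"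
  by (simp_all add: ev_def)

text \<open>Derivatives up to order three are enough: the higher ones enter the rows only through
  differentiation along the axis, which is done on polynomials in t.\<close>

lemma ev_Deriv:
  "ev (Deriv []) t = t"
  "ev (Deriv [l]) t = (if l = 3 then 1 else 0)"
  "ev (Deriv [i, j]) t = (if i = 1 \<and> j = 2 \<or> i = 2 \<and> j = 1 then 1 else 0)"
  "ev (Deriv [i, j, k]) t = (if i = 1 \<and> j = 1 \<and> k = 1 then 1 else 0)"
proof -
  have "\<forall>i j k. ev (Deriv [l]) t = (if l = 3 then 1 else 0) \<and>
    ev (Deriv [i, j]) t = (if i = 1 \<and> j = 2 \<or> i = 2 \<and> j = 1 then 1 else 0) \<and>
    ev (Deriv [i, j, k]) t = (if i = 1 \<and> j = 1 \<and> k = 1 then 1 else 0)"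
    unfolding ev_def apply_op_Deriv partials_Cons forall_3 partials_Nil using exhaust_3[of l]
    by (auto simp: partial_sample partial_coord_poly partial_nth_fun partial_const_fun)
  then show "ev (Deriv [l]) t = (if l = 3 then 1 else 0)"
    "ev (Deriv [i, j]) t = (if i = 1 \<and> j = 2 \<or> i = 2 \<and> j = 1 then 1 else 0)"
    "ev (Deriv [i, j, k]) t = (if i = 1 \<and> j = 1 \<and> k = 1 then 1 else 0)" by blast+
  show "ev (Deriv []) t = t" by (simp add: ev_def sample_def)
qed

text \<open>On the axis the gradient of \<open>sample\<close> is the third unit vector, so the
  derivative along the gradient is the derivative with respect to t.\<close>

lemma ev_dop3: "((\<lambda>t. ev P t) has_real_derivative ev (dop 3 P) t) (at t)"
proof -
  have C: "Ck_on k UNIV sample" for k using smooth_sample by (simp add: smooth_def)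
  have "apply_op P sample differentiable (at (axis_pt t))"
    by (rule Ck_on_differentiable_at[OF open_UNIV Ck_on_apply_op[OF open_UNIV C, of 1]]) auto
  from partial_along_line[of _ 0, simplified, OF this[unfolded axis_pt_def]] show ?thesis
    by (simp add: ev_def axis_pt_def apply_op_dop[OF open_UNIV C])
qed

definition normal_poly :: "3 \<Rightarrow> 3 \<Rightarrow> real poly" where
  "normal_poly j k = (if j = 1 \<and> k = 2 then [:-1, 1:] else if j = 2 \<and> k = 1 then [:-1, -1:] else 0)"

definition dnormal_poly :: "3 \<Rightarrow> 3 \<Rightarrow> 3 \<Rightarrow> real poly" where
  "dnormal_poly i j k =
    (if i = 1 then if j = 1 \<and> k = 1 then [:-1:] else if j = 1 \<and> k = 3 then [:0, -1:] else if j = 3 \<and> k = 1 then [:0, 1:] else 0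
     else if i = 2 then if j = 2 \<and> k = 3 then [:0, 1:] else if j = 3 \<and> k = 2 then [:0, -1:] else 0
     else if j = 1 \<and> k = 2 then [:1:] else if j = 2 \<and> k = 1 then [:-1:] else 0)"

definition hess_poly :: "3 \<Rightarrow> 3 \<Rightarrow> real poly" where
  "hess_poly i j = (if i = 1 \<and> j = 2 \<or> i = 2 \<and> j = 1 then 1 else 0)"

lemma ev_hess: "ev (Deriv [i, j]) t = poly (hess_poly i j) t"
  by (auto simp: ev_Deriv hess_poly_def)

lemma ev_normal_op: "ev (normal_op j k) t = poly (normal_poly j k) t"
proof -
  have "\<forall>j k. ev (normal_op j k) t = poly (normal_poly j k) t"
    unfolding forall_3 by (simp add: normal_op_def normal_poly_def ev_Deriv sum_3)
  then show ?thesis by blast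
qed

lemma ev_dop_normal_op: "ev (dop i (normal_op j k)) t = poly (dnormal_poly i j k) t"
proof -
  have "\<forall>i j k. ev (dop i (normal_op j k)) t = poly (dnormal_poly i j k) t"
    unfolding forall_3 by (simp add: normal_op_def subop_def sum3_def dnormal_poly_def ev_Deriv sum_3)
  then show ?thesis by blast
qed

text \<open>The row is recorded on the whole axis and not only at the origin, since the next
  derivative along the gradient needs its t-dependence.\<close>

definition poly_row :: "diff_op list \<Rightarrow> real poly list \<Rightarrow> bool" where
  "poly_row R L \<longleftrightarrow> (\<forall>i j t. ev (ra R i j) t = poly (ra L i j) t) \<and> (\<forall>j t. ev (rb R j) t = poly (rb L j) t)"

text \<open>\<open>along_op\<close> on the axis: the derivative along the gradient becomes
  \<open>pderiv\<close>, while the Hessian, the transport matrix and its derivatives are known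
  polynomials.\<close>

definition along_poly :: "real poly list \<Rightarrow> real poly list" where
  "along_poly L = mk_row
     (\<lambda>i k. pderiv (ra L i k) + (\<Sum>j\<in>UNIV. ra L i j * normal_poly j k) - (\<Sum>l\<in>UNIV. ra L l k * hess_poly l i))
     (\<lambda>k. pderiv (rb L k) + (\<Sum>i\<in>UNIV. \<Sum>j\<in>UNIV. ra L i j * dnormal_poly i j k) + (\<Sum>j\<in>UNIV. rb L j * normal_poly j k))"

lemma poly_row_along:
  assumes "poly_row R L" shows "poly_row (along_op R) (along_poly L)"
proof -
  have d: "ev (dop 3 P) t = poly (pderiv p) t" if "\<And>t. ev P t = poly p t" for P p t
  proof -
    have "((\<lambda>t. ev P t) has_real_derivative poly (pderiv p) t) (at t)"
      unfolding that by (rule poly_DERIV)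
    then show ?thesis using ev_dop3 DERIV_unique by blast
  qed
  have a: "\<And>i j t. ev (ra R i j) t = poly (ra L i j) t" and b: "\<And>j t. ev (rb R j) t = poly (rb L j) t"
    using assms by (auto simp: poly_row_def)
  have s: "(\<Sum>l\<in>UNIV. (if l = 3 then 1 else 0) * g l) = g 3" for g :: "3 \<Rightarrow> real" by (simp add: sum_3)
  show ?thesis unfolding poly_row_def along_op_def along_poly_def
    by (simp add: ev_Deriv(2) s d[OF a] d[OF b] a b ev_hess ev_normal_op ev_dop_normal_op poly_sum)
qed

lemma poly_rows:
  "poly_row (along_iter 1) (mk_row (\<lambda>i j. if i = 1 \<and> j = 2 then [:-2, 1:] else if i = 2 \<and> j = 1 then [:-2, -1:] else 0)
     (\<lambda>j. if j = 1 then [:-1:] else 0))"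
  "poly_row (along_iter 2) (mk_row (\<lambda>i j. if i = 1 \<and> j = 1 then [:4, 2, -1:] else if i = 1 \<and> j = 2 then [:1:]
       else if i = 2 \<and> j = 1 then [:-1:] else if i = 2 \<and> j = 2 then [:4, -2, -1:] else 0)
     (\<lambda>j. if j = 2 then [:1, -1:] else 0))"
  "poly_row (along_iter 3) (mk_row (\<lambda>i j. if i = 1 \<and> j = 1 then [:2, -3:] else if i = 1 \<and> j = 2 then [:-8, 4, 4, -1:]
       else if i = 2 \<and> j = 1 then [:-8, -4, 4, 1:] else if i = 2 \<and> j = 2 then [:-2, -3:] else 0)
     (\<lambda>j. if j = 1 then [:-5, -2, 2:] else if j = 2 then [:-1:] else [:0, 0, -4:]))"
  "poly_row (along_iter 4) (mk_row (\<lambda>i j. if i = 1 \<and> j = 1 then [:13, 8, -12, -4, 1:] else if i = 1 \<and> j = 2 then [:4, 16, -6:]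
       else if i = 2 \<and> j = 1 then [:-4, 16, 6:] else if i = 2 \<and> j = 2 then [:13, -8, -12, 4, 1:] else 0)
     (\<lambda>j. if j = 1 then [:-3, 8:] else if j = 2 then [:5, -3, -4, 2:] else [:0, -12:]))"
  (is "poly_row _ ?L4")
proof -
  have step: "poly_row (along_iter (Suc s)) L'" if "poly_row (along_iter s) L" "along_poly L = L'" for s L L'
    using poly_row_along[OF that(1)] that(2) by (simp add: along_iter_def)
  have mk: "mk_row a b = mk_row a' b'" if "\<forall>i j. a i j = a' i j" "\<forall>j. b j = b' j" for a a' :: "3 \<Rightarrow> 3 \<Rightarrow> real poly" and b b'
    using that by (simp add: mk_row_def)
  note ss = ra_mk_row rb_mk_row forall_3 sum_3 normal_poly_def hess_poly_def dnormal_poly_def pderiv_pCons one_pCons numeral_poly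
  have 0: "poly_row (along_iter 0) (mk_row (\<lambda>i j. if i = j then 1 else 0) (\<lambda>j. 0))"
    by (simp add: poly_row_def along_iter_def div_row_def)
  show 1: "poly_row (along_iter 1) (mk_row (\<lambda>i j. if i = 1 \<and> j = 2 then [:-2, 1:] else if i = 2 \<and> j = 1 then [:-2, -1:] else 0)
     (\<lambda>j. if j = 1 then [:-1:] else 0))"
    unfolding One_nat_def by (rule step[OF 0], unfold along_poly_def, rule mk) (simp_all add: ss)
  show 2: "poly_row (along_iter 2) (mk_row (\<lambda>i j. if i = 1 \<and> j = 1 then [:4, 2, -1:] else if i = 1 \<and> j = 2 then [:1:]
       else if i = 2 \<and> j = 1 then [:-1:] else if i = 2 \<and> j = 2 then [:4, -2, -1:] else 0)
     (\<lambda>j. if j = 2 then [:1, -1:] else 0))"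
    unfolding numeral_2_eq_2 by (rule step[OF 1[unfolded One_nat_def]], unfold along_poly_def, rule mk) (simp_all add: ss)
  show 3: "poly_row (along_iter 3) (mk_row (\<lambda>i j. if i = 1 \<and> j = 1 then [:2, -3:] else if i = 1 \<and> j = 2 then [:-8, 4, 4, -1:]
       else if i = 2 \<and> j = 1 then [:-8, -4, 4, 1:] else if i = 2 \<and> j = 2 then [:-2, -3:] else 0)
     (\<lambda>j. if j = 1 then [:-5, -2, 2:] else if j = 2 then [:-1:] else [:0, 0, -4:]))"
    unfolding numeral_3_eq_3 by (rule step[OF 2[unfolded numeral_2_eq_2]], unfold along_poly_def, rule mk) (simp_all add: ss)
  have e: "(4::nat) = Suc (Suc (Suc (Suc 0)))" by simp
  show "poly_row (along_iter 4) ?L4"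
    unfolding e by (rule step[OF 3[unfolded numeral_3_eq_3]], unfold along_poly_def, rule mk) (simp_all add: ss)
qed

section \<open>Numerical elimination at the origin\<close>

definition relim :: "nat \<Rightarrow> real list \<Rightarrow> real list \<Rightarrow> real list" where
  "relim c R S = map2 (\<lambda>r s. R ! c * s - S ! c * r) R S"

fun rgauss :: "nat list \<Rightarrow> real list list \<Rightarrow> real list list" where
  "rgauss (c # cs) (R # Rs) = rgauss cs (map (relim c R) Rs)"
| "rgauss cs Rs = Rs"

lemma map_elim:
  assumes "length R = 12" "length S = 12" "c < 12"
  shows "map (\<lambda>P. ev P t) (elim c R S) = relim c (map (\<lambda>P. ev P t) R) (map (\<lambda>P. ev P t) S)"
  using assms by (intro nth_equalityI) (auto simp: elim_def relim_def)

lemma map_gauss: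
  "(\<forall>R\<in>set Rs. length R = 12) \<Longrightarrow> set cs \<subseteq> {..<12} \<Longrightarrow>
    map (map (\<lambda>P. ev P t)) (gauss cs Rs) = rgauss cs (map (map (\<lambda>P. ev P t)) Rs)"
proof (induction cs Rs rule: gauss.induct)
  case (1 c cs R Rs)
  have "map (map (\<lambda>P. ev P t)) (gauss cs (map (elim c R) Rs)) = rgauss cs (map (map (\<lambda>P. ev P t)) (map (elim c R) Rs))"
    by (rule 1(1)) (use 1(2,3) in \<open>auto simp: elim_def\<close>)
  also have "map (map (\<lambda>P. ev P t)) (map (elim c R) Rs) = map (relim c (map (\<lambda>P. ev P t) R)) (map (map (\<lambda>P. ev P t)) Rs)"
    using 1(2,3) by (auto simp: map_elim)
  finally show ?case by simp
qed auto

lemma row_values: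
  "map (\<lambda>P. ev P 0) (curl_row 3) = [0, 1, 0, -1, 0, 0, 0, 0, 0, 0, 0, 0]"
  "map (\<lambda>P. ev P 0) (curl_row 1) = [0, 0, 0, 0, 0, 1, 0, -1, 0, 0, 0, 0]"
  "map (\<lambda>P. ev P 0) (curl_row 2) = [0, 0, -1, 0, 0, 0, 1, 0, 0, 0, 0, 0]"
  "map (\<lambda>P. ev P 0) (normal_row 1) = [0, 0, 0, 0, 0, 0, 1, 0, 0, 0, 1, 0]"
  "map (\<lambda>P. ev P 0) (normal_row 2) = [0, 0, 0, 0, 0, 0, 0, 1, 0, 1, 0, 0]"
  "map (\<lambda>P. ev P 0) (normal_row 3) = [0, 0, 0, 0, 0, 0, 0, 0, 1, 0, 0, 0]"
  "map (\<lambda>P. ev P 0) div_row = [1, 0, 0, 0, 1, 0, 0, 0, 1, 0, 0, 0]"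
  by (simp_all add: curl_row_def normal_row_def div_row_def map_mk_row)
    (simp_all add: mk_row_def ev_Deriv ev_normal_op normal_poly_def)

lemma along_values:
  "map (\<lambda>P. ev P 0) (along_iter 1) = [0, -2, 0, -2, 0, 0, 0, 0, 0, -1, 0, 0]"
  "map (\<lambda>P. ev P 0) (along_iter 2) = [4, 1, 0, -1, 4, 0, 0, 0, 0, 0, 1, 0]"
  "map (\<lambda>P. ev P 0) (along_iter 3) = [2, -8, 0, -8, -2, 0, 0, 0, 0, -5, -1, 0]"
  "map (\<lambda>P. ev P 0) (along_iter 4) = [13, 4, 0, -4, 13, 0, 0, 0, 0, -3, 5, 0]"
proof -
  have conv: "map (\<lambda>P. ev P t) R = map (\<lambda>p. poly p t) L" if "length R = 12" "length L = 12" "poly_row R L" for R L t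
  proof -
    have "map (\<lambda>P. ev P t) (mk_row (ra R) (rb R)) = map (\<lambda>p. poly p t) (mk_row (ra L) (rb L))"
      unfolding map_mk_row using that(3) by (simp add: poly_row_def)
    then show ?thesis using that by (simp add: mk_row_ra_rb)
  qed
  have l: "length (along_iter s) = 12" for s
    using row_order_along_iter by (simp add: row_order_def)
  show "map (\<lambda>P. ev P 0) (along_iter 1) = [0, -2, 0, -2, 0, 0, 0, 0, 0, -1, 0, 0]"
    by (subst conv[OF l length_mk_row poly_rows(1)]) (simp add: mk_row_def)
  show "map (\<lambda>P. ev P 0) (along_iter 2) = [4, 1, 0, -1, 4, 0, 0, 0, 0, 0, 1, 0]"
    by (subst conv[OF l length_mk_row poly_rows(2)]) (simp add: mk_row_def)
  show "map (\<lambda>P. ev P 0) (along_iter 3) = [2, -8, 0, -8, -2, 0, 0, 0, 0, -5, -1, 0]"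
    by (subst conv[OF l length_mk_row poly_rows(3)]) (simp add: mk_row_def)
  show "map (\<lambda>P. ev P 0) (along_iter 4) = [13, 4, 0, -4, 13, 0, 0, 0, 0, -3, 5, 0]"
    by (subst conv[OF l length_mk_row poly_rows(4)]) (simp add: mk_row_def)
qed

lemma gauss_values:
  "map (map (\<lambda>P. ev P 0)) (gauss pivots all_rows)
    = [[0, 0, 0, 0, 0, 0, 0, 0, 0, 0, -64, 0], [0, 0, 0, 0, 0, 0, 0, 0, 0, 192, -320, 0]]"
proof -
  have g: "map (map (\<lambda>P. ev P 0)) (gauss pivots all_rows) = rgauss pivots (map (map (\<lambda>P. ev P 0)) all_rows)"
    by (rule map_gauss) (use all_rows_order in \<open>auto simp: pivots_set row_order_def\<close>)
  \<comment> \<open>The facts \<open>s0\<close> to \<open>s8\<close> record the nine stages, each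
    with its pivot row as argument of \<open>relim\<close>. The pivots are 1, 1, -1, -1, 1, 1, 1, -4
    and 16.\<close>
  have s0: "map (relim 1 [0, 1, 0, -1, 0, 0, 0, 0, 0, 0, 0, 0])
    [[0, 0, 0, 0, 0, 1, 0, -1, 0, 0, 0, 0],
     [0, 0, -1, 0, 0, 0, 1, 0, 0, 0, 0, 0],
     [0, 0, 0, 0, 0, 0, 1, 0, 0, 0, 1, 0],
     [0, 0, 0, 0, 0, 0, 0, 1, 0, 1, 0, 0],
     [0, 0, 0, 0, 0, 0, 0, 0, 1, 0, 0, 0],
     [1, 0, 0, 0, 1, 0, 0, 0, 1, 0, 0, 0],
     [0, -2, 0, -2, 0, 0, 0, 0, 0, -1, 0, 0],
     [2, -8, 0, -8, -2, 0, 0, 0, 0, -5, -1, 0],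
     [4, 1, 0, -1, 4, 0, 0, 0, 0, 0, 1, 0],
     [13, 4, 0, -4, 13, 0, 0, 0, 0, -3, 5, 0]]
    = [[0, 0, 0, 0, 0, 1, 0, -1, 0, 0, 0, 0],
     [0, 0, -1, 0, 0, 0, 1, 0, 0, 0, 0, 0],
     [0, 0, 0, 0, 0, 0, 1, 0, 0, 0, 1, 0],
     [0, 0, 0, 0, 0, 0, 0, 1, 0, 1, 0, 0],
     [0, 0, 0, 0, 0, 0, 0, 0, 1, 0, 0, 0],
     [1, 0, 0, 0, 1, 0, 0, 0, 1, 0, 0, 0],
     [0, 0, 0, -4, 0, 0, 0, 0, 0, -1, 0, 0],
     [2, 0, 0, -16, -2, 0, 0, 0, 0, -5, -1, 0],
     [4, 0, 0, 0, 4, 0, 0, 0, 0, 0, 1, 0],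
     [13, 0, 0, 0, 13, 0, 0, 0, 0, -3, 5, 0]]"
    by (simp add: relim_def)
  have s1: "map (relim 5 [0, 0, 0, 0, 0, 1, 0, -1, 0, 0, 0, 0])
    [[0, 0, -1, 0, 0, 0, 1, 0, 0, 0, 0, 0],
     [0, 0, 0, 0, 0, 0, 1, 0, 0, 0, 1, 0],
     [0, 0, 0, 0, 0, 0, 0, 1, 0, 1, 0, 0],
     [0, 0, 0, 0, 0, 0, 0, 0, 1, 0, 0, 0],
     [1, 0, 0, 0, 1, 0, 0, 0, 1, 0, 0, 0],
     [0, 0, 0, -4, 0, 0, 0, 0, 0, -1, 0, 0],
     [2, 0, 0, -16, -2, 0, 0, 0, 0, -5, -1, 0],
     [4, 0, 0, 0, 4, 0, 0, 0, 0, 0, 1, 0],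
     [13, 0, 0, 0, 13, 0, 0, 0, 0, -3, 5, 0]]
    = [[0, 0, -1, 0, 0, 0, 1, 0, 0, 0, 0, 0],
     [0, 0, 0, 0, 0, 0, 1, 0, 0, 0, 1, 0],
     [0, 0, 0, 0, 0, 0, 0, 1, 0, 1, 0, 0],
     [0, 0, 0, 0, 0, 0, 0, 0, 1, 0, 0, 0],
     [1, 0, 0, 0, 1, 0, 0, 0, 1, 0, 0, 0],
     [0, 0, 0, -4, 0, 0, 0, 0, 0, -1, 0, 0],
     [2, 0, 0, -16, -2, 0, 0, 0, 0, -5, -1, 0],
     [4, 0, 0, 0, 4, 0, 0, 0, 0, 0, 1, 0],
     [13, 0, 0, 0, 13, 0, 0, 0, 0, -3, 5, 0]]"
    by (simp add: relim_def)
  have s2: "map (relim 2 [0, 0, -1, 0, 0, 0, 1, 0, 0, 0, 0, 0])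
    [[0, 0, 0, 0, 0, 0, 1, 0, 0, 0, 1, 0],
     [0, 0, 0, 0, 0, 0, 0, 1, 0, 1, 0, 0],
     [0, 0, 0, 0, 0, 0, 0, 0, 1, 0, 0, 0],
     [1, 0, 0, 0, 1, 0, 0, 0, 1, 0, 0, 0],
     [0, 0, 0, -4, 0, 0, 0, 0, 0, -1, 0, 0],
     [2, 0, 0, -16, -2, 0, 0, 0, 0, -5, -1, 0],
     [4, 0, 0, 0, 4, 0, 0, 0, 0, 0, 1, 0],
     [13, 0, 0, 0, 13, 0, 0, 0, 0, -3, 5, 0]]
    = [[0, 0, 0, 0, 0, 0, -1, 0, 0, 0, -1, 0],
     [0, 0, 0, 0, 0, 0, 0, -1, 0, -1, 0, 0],
     [0, 0, 0, 0, 0, 0, 0, 0, -1, 0, 0, 0],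
     [-1, 0, 0, 0, -1, 0, 0, 0, -1, 0, 0, 0],
     [0, 0, 0, 4, 0, 0, 0, 0, 0, 1, 0, 0],
     [-2, 0, 0, 16, 2, 0, 0, 0, 0, 5, 1, 0],
     [-4, 0, 0, 0, -4, 0, 0, 0, 0, 0, -1, 0],
     [-13, 0, 0, 0, -13, 0, 0, 0, 0, 3, -5, 0]]"
    by (simp add: relim_def)
  have s3: "map (relim 6 [0, 0, 0, 0, 0, 0, -1, 0, 0, 0, -1, 0])
    [[0, 0, 0, 0, 0, 0, 0, -1, 0, -1, 0, 0],
     [0, 0, 0, 0, 0, 0, 0, 0, -1, 0, 0, 0],
     [-1, 0, 0, 0, -1, 0, 0, 0, -1, 0, 0, 0],
     [0, 0, 0, 4, 0, 0, 0, 0, 0, 1, 0, 0],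
     [-2, 0, 0, 16, 2, 0, 0, 0, 0, 5, 1, 0],
     [-4, 0, 0, 0, -4, 0, 0, 0, 0, 0, -1, 0],
     [-13, 0, 0, 0, -13, 0, 0, 0, 0, 3, -5, 0]]
    = [[0, 0, 0, 0, 0, 0, 0, 1, 0, 1, 0, 0],
     [0, 0, 0, 0, 0, 0, 0, 0, 1, 0, 0, 0],
     [1, 0, 0, 0, 1, 0, 0, 0, 1, 0, 0, 0],
     [0, 0, 0, -4, 0, 0, 0, 0, 0, -1, 0, 0],
     [2, 0, 0, -16, -2, 0, 0, 0, 0, -5, -1, 0],
     [4, 0, 0, 0, 4, 0, 0, 0, 0, 0, 1, 0],
     [13, 0, 0, 0, 13, 0, 0, 0, 0, -3, 5, 0]]"
    by (simp add: relim_def)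
  have s4: "map (relim 7 [0, 0, 0, 0, 0, 0, 0, 1, 0, 1, 0, 0])
    [[0, 0, 0, 0, 0, 0, 0, 0, 1, 0, 0, 0],
     [1, 0, 0, 0, 1, 0, 0, 0, 1, 0, 0, 0],
     [0, 0, 0, -4, 0, 0, 0, 0, 0, -1, 0, 0],
     [2, 0, 0, -16, -2, 0, 0, 0, 0, -5, -1, 0],
     [4, 0, 0, 0, 4, 0, 0, 0, 0, 0, 1, 0],
     [13, 0, 0, 0, 13, 0, 0, 0, 0, -3, 5, 0]]
    = [[0, 0, 0, 0, 0, 0, 0, 0, 1, 0, 0, 0],
     [1, 0, 0, 0, 1, 0, 0, 0, 1, 0, 0, 0],
     [0, 0, 0, -4, 0, 0, 0, 0, 0, -1, 0, 0],
     [2, 0, 0, -16, -2, 0, 0, 0, 0, -5, -1, 0],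
     [4, 0, 0, 0, 4, 0, 0, 0, 0, 0, 1, 0],
     [13, 0, 0, 0, 13, 0, 0, 0, 0, -3, 5, 0]]"
    by (simp add: relim_def)
  have s5: "map (relim 8 [0, 0, 0, 0, 0, 0, 0, 0, 1, 0, 0, 0])
    [[1, 0, 0, 0, 1, 0, 0, 0, 1, 0, 0, 0],
     [0, 0, 0, -4, 0, 0, 0, 0, 0, -1, 0, 0],
     [2, 0, 0, -16, -2, 0, 0, 0, 0, -5, -1, 0],
     [4, 0, 0, 0, 4, 0, 0, 0, 0, 0, 1, 0],
     [13, 0, 0, 0, 13, 0, 0, 0, 0, -3, 5, 0]]
    = [[1, 0, 0, 0, 1, 0, 0, 0, 0, 0, 0, 0],
     [0, 0, 0, -4, 0, 0, 0, 0, 0, -1, 0, 0],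
     [2, 0, 0, -16, -2, 0, 0, 0, 0, -5, -1, 0],
     [4, 0, 0, 0, 4, 0, 0, 0, 0, 0, 1, 0],
     [13, 0, 0, 0, 13, 0, 0, 0, 0, -3, 5, 0]]"
    by (simp add: relim_def)
  have s6: "map (relim 0 [1, 0, 0, 0, 1, 0, 0, 0, 0, 0, 0, 0])
    [[0, 0, 0, -4, 0, 0, 0, 0, 0, -1, 0, 0],
     [2, 0, 0, -16, -2, 0, 0, 0, 0, -5, -1, 0],
     [4, 0, 0, 0, 4, 0, 0, 0, 0, 0, 1, 0],
     [13, 0, 0, 0, 13, 0, 0, 0, 0, -3, 5, 0]]
    = [[0, 0, 0, -4, 0, 0, 0, 0, 0, -1, 0, 0],
     [0, 0, 0, -16, -4, 0, 0, 0, 0, -5, -1, 0],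
     [0, 0, 0, 0, 0, 0, 0, 0, 0, 0, 1, 0],
     [0, 0, 0, 0, 0, 0, 0, 0, 0, -3, 5, 0]]"
    by (simp add: relim_def)
  have s7: "map (relim 3 [0, 0, 0, -4, 0, 0, 0, 0, 0, -1, 0, 0])
    [[0, 0, 0, -16, -4, 0, 0, 0, 0, -5, -1, 0],
     [0, 0, 0, 0, 0, 0, 0, 0, 0, 0, 1, 0],
     [0, 0, 0, 0, 0, 0, 0, 0, 0, -3, 5, 0]]
    = [[0, 0, 0, 0, 16, 0, 0, 0, 0, 4, 4, 0],
     [0, 0, 0, 0, 0, 0, 0, 0, 0, 0, -4, 0],
     [0, 0, 0, 0, 0, 0, 0, 0, 0, 12, -20, 0]]"
    by (simp add: relim_def)
  have s8: "map (relim 4 [0, 0, 0, 0, 16, 0, 0, 0, 0, 4, 4, 0])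
    [[0, 0, 0, 0, 0, 0, 0, 0, 0, 0, -4, 0],
     [0, 0, 0, 0, 0, 0, 0, 0, 0, 12, -20, 0]]
    = [[0, 0, 0, 0, 0, 0, 0, 0, 0, 0, -64, 0],
     [0, 0, 0, 0, 0, 0, 0, 0, 0, 192, -320, 0]]"
    by (simp add: relim_def)
  have rows: "map (map (\<lambda>P. ev P 0)) all_rows = [[0, 1, 0, -1, 0, 0, 0, 0, 0, 0, 0, 0],
     [0, 0, 0, 0, 0, 1, 0, -1, 0, 0, 0, 0],
     [0, 0, -1, 0, 0, 0, 1, 0, 0, 0, 0, 0],
     [0, 0, 0, 0, 0, 0, 1, 0, 0, 0, 1, 0],
     [0, 0, 0, 0, 0, 0, 0, 1, 0, 1, 0, 0],
     [0, 0, 0, 0, 0, 0, 0, 0, 1, 0, 0, 0],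
     [1, 0, 0, 0, 1, 0, 0, 0, 1, 0, 0, 0],
     [0, -2, 0, -2, 0, 0, 0, 0, 0, -1, 0, 0],
     [2, -8, 0, -8, -2, 0, 0, 0, 0, -5, -1, 0],
     [4, 1, 0, -1, 4, 0, 0, 0, 0, 0, 1, 0],
     [13, 4, 0, -4, 13, 0, 0, 0, 0, -3, 5, 0]]"
    by (simp only: all_rows_def list.map row_values along_values)
  have "rgauss pivots (map (map (\<lambda>P. ev P 0)) all_rows)
    = [[0, 0, 0, 0, 0, 0, 0, 0, 0, 0, -64, 0], [0, 0, 0, 0, 0, 0, 0, 0, 0, 192, -320, 0]]"
    unfolding rows pivots_def by (simp only: rgauss.simps s0 s1 s2 s3 s4 s5 s6 s7 s8)
  with g show ?thesis by simp
qed

lemma obstruction_sample: "apply_op obstruction sample 0 \<noteq> 0"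
proof -
  have "(\<forall>R\<in>set (gauss pivots all_rows). row_order R 5) \<and> length (gauss pivots all_rows) = length all_rows - length pivots"
    by (rule gauss_row_order) (simp_all add: all_rows_order pivots_set length_all_rows)
  then have G: "length (gauss pivots all_rows) = 2" "\<forall>R\<in>set (gauss pivots all_rows). length R = 12"
    by (simp_all add: pivots_set length_all_rows row_order_def)
  have v: "ev (rb (gauss pivots all_rows ! k) j) 0 = rb (map (map (\<lambda>P. ev P 0)) (gauss pivots all_rows) ! k) j" if "k < 2" for k j
    using that G rb_index[of j] by (simp add: rb_def)
  have v0: "ev (rb (gauss pivots all_rows ! 0) j) 0 = rb (map (map (\<lambda>P. ev P 0)) (gauss pivots all_rows) ! 0) j"
    and v1: "ev (rb (gauss pivots all_rows ! 1) j) 0 = rb (map (map (\<lambda>P. ev P 0)) (gauss pivots all_rows) ! 1) j" for j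
    by (rule v, simp)+
  have 0: "axis_pt 0 = 0" by (simp add: axis_pt_def)
  \<comment> \<open>The gradient is the third unit vector, so the determinant is the minor of the
    first two columns of the remaining rows, 0 . (-320) - (-64) . 192.\<close>
  have "ev obstruction 0 = 12288"
    unfolding obstruction_def det3_def by (simp only: ev_simps v0 v1 gauss_values)
      (simp add: rb_def ev_Deriv)
  then show ?thesis by (simp add: ev_def 0)
qed

text \<open>Operators have constant coefficients, hence commute with translations; the nonvanishing
  at the origin can be carried to any point of any domain.\<close>

lemma apply_op_shift: "apply_op P (\<lambda>x. f (x + c)) x = apply_op P f (x + c)"
proof (induction P)
  case (Deriv "is")
  have "partials is (\<lambda>x. f (x + c)) = (\<lambda>x. partials is f (x + c))"
    by (induction "is") (auto simp: partials_Cons partial_shift)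
  then show ?case by simp
qed auto

lemma nonzero_op_obstruction: "nonzero_op obstruction"
  unfolding nonzero_op_def using obstruction_sample smooth_sample smooth_def by blast

subsection \<open>A Carleman estimate\<close>

lemma Ck_on_powr:
  assumes "open U" "\<And>x. x \<in> U \<Longrightarrow> 0 < g x" "Ck_on k U g"
  shows "Ck_on k U (\<lambda>x. g x powr s)"
proof -
  define h where "h n t = (\<Prod>j<n. s - real j) * t powr (s - real n)" for n t
  have "(h n has_real_derivative h (Suc n) t) (at t)" if "t \<in> {0<..}" for n t
  proof -
    have "((\<lambda>t. t powr (s - real n)) has_real_derivative (s - real n) * t powr (s - real n - 1)) (at t)"
      using that by (intro has_real_derivative_powr) auto
    from DERIV_cmult[OF this, of "\<Prod>j<n. s - real j"] show ?thesis
      unfolding h_def[abs_def] by (simp add: algebra_simps)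
  qed
  from Ck_on_compose[of U "{0<..}" h g k 0, OF assms(1) this _ assms(3)] assms(2)
  show ?thesis by (simp add: h_def)
qed

lemma Ck_on_exp:
  assumes "open U" "Ck_on k U g" shows "Ck_on k U (\<lambda>x. exp (g x))"
proof -
  define h :: "nat \<Rightarrow> real \<Rightarrow> real" where "h n = exp" for n
  have d: "(h n has_real_derivative h (Suc n) t) (at t)" for n t
    unfolding h_def by (rule DERIV_exp)
  have "Ck_on k U (\<lambda>x. h 0 (g x))"
    by (rule Ck_on_compose[of U UNIV h g k 0, OF assms(1) d UNIV_I assms(2)])
  then show ?thesis by (simp add: h_def)
qed

text \<open>The reciprocal of the norm, written as a power of x . x so that smoothness away from 0
  follows from \<open>Ck_on_powr\<close>. At 0 it takes the value 0.\<close>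

definition nu :: "real^3 \<Rightarrow> real" where "nu x = (x \<bullet> x) powr (- 1 / 2)"

lemma nu_eq: "nu x = 1 / norm x"
proof -
  have "nu x = inverse ((x \<bullet> x) powr (1 / 2))"
    unfolding nu_def using powr_minus[of "x \<bullet> x" "1 / 2"] by simp
  also have "\<dots> = 1 / norm x"
    unfolding norm_eq_sqrt_inner by (subst powr_half_sqrt) (auto simp: divide_inverse)
  finally show ?thesis .
qed

lemma Ck_on_nu: "Ck_on k (- {0}) nu"
  unfolding nu_def[abs_def] by (intro Ck_on_powr Ck_on_inner_self) auto

lemma partial_nu:
  assumes "x \<noteq> 0" shows "partial i nu x = - x $ i * nu x ^ 3"
proof -
  have "((\<lambda>t. t powr (- 1 / 2)) has_real_derivative (- 1 / 2) * (x \<bullet> x) powr (- 1 / 2 - 1)) (at (x \<bullet> x))"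
    using assms by (intro has_real_derivative_powr) auto
  from partial_compose[OF differentiable_inner_self this, of i]
  have "partial i nu x = - x $ i * (x \<bullet> x) powr (- 1 / 2 - 1)"
    by (simp add: nu_def[abs_def] partial_inner_self)
  also have "(x \<bullet> x) powr (- 1 / 2 - 1) = nu x ^ 3"
    using assms by (simp add: nu_def powr_realpow[symmetric] powr_powr)
  finally show ?thesis .
qed

lemma nu_sq: "x \<noteq> 0 \<Longrightarrow> nu x ^ 2 * (x \<bullet> x) = 1"
  by (simp add: nu_eq dot_square_norm power_divide)

lemma conv_moll_one:
  assumes r: "0 < r" and g: "\<And>y. dist x y \<le> r \<Longrightarrow> g y = 1"
  shows "conv (moll r) g x = 1"
proof -
  have "(\<lambda>y. moll r (x - y) * g y) = (\<lambda>y. moll r (x - y))"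
  proof
    fix y show "moll r (x - y) * g y = moll r (x - y)"
      using g[of y] moll_support[OF r, of "x - y"] by (cases "dist x y \<le> r") (auto simp: dist_norm)
  qed
  moreover have "(LBINT y. moll r (x - y)) = 1"
    using integral_lborel_reflect[of "moll r" x] integrable_moll[OF r] integral_moll[OF r] by simp
  ultimately show ?thesis by (simp add: conv_def)
qed

lemma cutoff_exists:
  assumes "0 < r" "r < R"
  shows "\<exists>\<theta>. smooth \<theta> \<and> (\<forall>x. dist p x \<le> r \<longrightarrow> \<theta> x = 1) \<and> (\<forall>x. R \<le> dist p x \<longrightarrow> \<theta> x = 0)"
proof -
  \<comment> \<open>The piecewise linear profile falls from 1 at radius r + e to 0 at radius r + 2
    e; mollification with radius e spreads this at most to the interval from r to R.\<close>
  define e where "e = (R - r) / 3"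
  have "3 * e = R - r" by (simp add: e_def)
  then have e: "0 < e" "r + 3 * e = R" using assms by linarith+
  define g where "g x = max 0 (min 1 ((r + 2 * e - dist p x) / e))" for x
  have gc: "continuous_on UNIV g" unfolding g_def[abs_def] using e by (intro continuous_intros) auto
  have g1: "g x = 1" if "dist p x \<le> r + e" for x
    using that e by (simp add: g_def min_def max_def field_simps)
  have g0: "g x = 0" if "r + 2 * e \<le> dist p x" for x
  proof -
    have "(r + 2 * e - dist p x) / e \<le> 0" using that e by (simp add: divide_nonpos_pos)
    then show ?thesis by (simp add: g_def)
  qed
  have gs: "csupp UNIV g" unfolding csupp_def
    by (rule exI[of _ "cball p (r + 2 * e)"]) (use g0 in \<open>auto simp: not_le less_imp_le\<close>)
  have gi: "integrable lborel g" by (rule integrable_csupp[OF gc gs])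
  have "smooth (conv (moll e) g)"
    using Ck_on_conv[OF _ gi gs] smooth_moll unfolding smooth_def by blast
  moreover have "conv (moll e) g x = 1" if "dist p x \<le> r" for x
  proof (rule conv_moll_one[OF e(1)])
    fix y assume "dist x y \<le> e"
    then show "g y = 1" using that dist_triangle[of p y x] by (intro g1) linarith
  qed
  moreover have "conv (moll e) g x = 0" if "R \<le> dist p x" for x
  proof (rule conv_moll_zero[OF e(1)])
    fix y assume "dist x y \<le> e"
    then show "g y = 0" using that e dist_triangle[of p x y] by (intro g0) (simp add: dist_commute)
  qed
  ultimately show ?thesis by blast
qed

text \<open>The Euler field \<open>x \<cdot> \<nabla>\<close> and the operator \<open>M z = (\<Sum>\<^sub>j x\<^sub>j \<partial>\<^sub>i z\<^sub>j - x\<^sub>i \<partial>\<^sub>j z\<^sub>j)\<^sub>i\<close>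
  commute, the first is antisymmetric up to the shift by \<open>3/2\<close> and the second is symmetric; hence
  their pairing is a divergence.\<close>

lemma euler_rotation_divergence:
  fixes z :: "3 \<Rightarrow> real^3 \<Rightarrow> real"
  assumes z: "\<And>j. Ck_on 2 UNIV (z j)"
  defines "y \<equiv> \<lambda>j x. \<Sum>k\<in>UNIV. x $ k * partial k (z j) x"
  defines "m \<equiv> \<lambda>i x. \<Sum>j\<in>UNIV. x $ j * partial i (z j) x - x $ i * partial j (z j) x"
  shows "2 * (\<Sum>i\<in>UNIV. (y i x + 3 / 2 * z i x) * m i x)
    = (\<Sum>k\<in>UNIV. partial k (\<lambda>x. x $ k * (\<Sum>i\<in>UNIV. z i x * m i x)) x)
      - (\<Sum>i\<in>UNIV. \<Sum>j\<in>UNIV. partial i (\<lambda>x. x $ j * z i x * y j x) x - partial j (\<lambda>x. x $ i * z i x * y j x) x)"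
proof -
  have z1: "Ck_on 1 UNIV (z j)" and p1: "Ck_on 1 UNIV (partial k (z j))" for j k
    using Ck_on_mono[OF z, of 1] Ck_on_partial[OF open_UNIV, of 1] z by (auto simp: numeral_2_eq_2)
  have dz: "z j differentiable (at x)" and dp: "partial k (z j) differentiable (at x)" for j k x
    using Ck_on_differentiable_at[OF open_UNIV z1] Ck_on_differentiable_at[OF open_UNIV p1] by auto
  have dm: "m i differentiable (at x)" and dy: "y j differentiable (at x)" for i j x
    unfolding m_def y_def by (intro differentiable_sum differentiable_diff differentiable_mult differentiable_nth dp finite_UNIV ballI | simp)+
  define s where "s i k j = partial i (partial k (z j)) x" for i k j
  have sym: "s i k j = s k i j" for i k j
    unfolding s_def by (rule partial_commute[OF open_UNIV z]) simp
  have ite: "(if P then 1 else 0) * a = (if P then a else 0)" for P and a :: real by simp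
  have py: "partial i (y j) x = partial i (z j) x + (\<Sum>k\<in>UNIV. x $ k * s i k j)" for i j
  proof -
    have "partial i (y j) x = (\<Sum>k\<in>UNIV. partial i (\<lambda>x. x $ k * partial k (z j) x) x)"
      unfolding y_def by (intro partial_sum differentiable_mult differentiable_nth dp)
    also have "\<dots> = (\<Sum>k\<in>UNIV. (if i = k then partial k (z j) x else 0) + x $ k * s i k j)"
      by (simp add: partial_mult dp partial_nth s_def ite)
    finally show ?thesis by (simp add: sum.distrib)
  qed
  have pm: "partial k (m i) x = (\<Sum>j\<in>UNIV. (if k = j then partial i (z j) x else 0) + x $ j * s k i j
      - ((if k = i then partial j (z j) x else 0) + x $ i * s k j j))" for k i
  proof -
    have "partial k (m i) x = (\<Sum>j\<in>UNIV. partial k (\<lambda>x. x $ j * partial i (z j) x - x $ i * partial j (z j) x) x)"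
      unfolding m_def by (intro partial_sum differentiable_mult differentiable_diff differentiable_nth dp)
    also have "\<dots> = (\<Sum>j\<in>UNIV. (if k = j then partial i (z j) x else 0) + x $ j * s k i j
      - ((if k = i then partial j (z j) x else 0) + x $ i * s k j j))"
      by (simp add: partial_mult partial_diff dp partial_nth s_def ite)
    finally show ?thesis .
  qed
  have pQ: "partial k (\<lambda>x. x $ k * (\<Sum>i\<in>UNIV. z i x * m i x)) x
     = (\<Sum>i\<in>UNIV. z i x * m i x) + x $ k * (\<Sum>i\<in>UNIV. partial k (z i) x * m i x + z i x * partial k (m i) x)" for k
    by (simp add: partial_mult partial_sum partial_nth dz dm differentiable_sum)
  have p3: "partial l (\<lambda>x. x $ a * z i x * y j x) x
     = (if l = a then z i x * y j x else 0) + x $ a * partial l (z i) x * y j x + x $ a * z i x * partial l (y j) x" for l a i j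
    by (simp add: partial_mult partial_nth dz dy algebra_simps)
  define P where "P i j = partial i (z j) x" for i j
  define Z where "Z i = z i x" for i
  have yx: "y j x = (\<Sum>k\<in>UNIV. x $ k * P k j)" and mx: "m i x = (\<Sum>j\<in>UNIV. x $ j * P i j - x $ i * P j j)" for i j
    by (simp_all add: y_def m_def P_def)
  show ?thesis
    unfolding pQ p3 py pm yx mx P_def[symmetric] Z_def[symmetric]
    by (simp add: sum_3 sym[of 2 1] sym[of 3 1] sym[of 3 2]) algebra
qed

text \<open>\<open>F\<close> contracts the curl and divergence of w with x. For z =
  exp(\<open>\<tau>\<close> \<open>nu\<close>) w the weighted \<open>F\<close> equals -(y + 3/2 z) +
  (m + h z), an antisymmetric plus a symmetric part. The square of a sum is at least twice the
  product; here twice the product is a divergence plus \<open>\<tau>\<close> \<open>nu\<close>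
  |z|^2, and the divergence integrates to 0 because w vanishes near the origin and near
  infinity.\<close>

lemma carleman:
  fixes w :: "3 \<Rightarrow> real^3 \<Rightarrow> real"
  assumes w: "\<And>j. Ck_on 2 UNIV (w j)" and s: "\<And>j. csupp (- {0}) (w j)"
  defines "F \<equiv> \<lambda>i x. (\<Sum>j\<in>UNIV. x $ j * (partial i (w j) x - partial j (w i) x)) - x $ i * (\<Sum>j\<in>UNIV. partial j (w j) x)"
  shows "\<tau> * (LBINT x. exp (2 * \<tau> * nu x) * nu x * (\<Sum>i\<in>UNIV. (w i x)\<^sup>2))
    \<le> (LBINT x. exp (2 * \<tau> * nu x) * (\<Sum>i\<in>UNIV. (F i x)\<^sup>2))"
proof -
  let ?U = "- {0} :: (real^3) set"
  have U: "open ?U" by (intro open_Compl closed_singleton)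
  define E where "E x = exp (\<tau> * nu x)" for x
  define z where "z j x = E x * w j x" for j x
  \<comment> \<open>Half the divergence of the field x, which makes y + 3/2 z antisymmetric, minus
    the term that arises from differentiating the weight.\<close>
  define h where "h x = 3 / 2 - \<tau> * nu x" for x
  have CE: "Ck_on k ?U E" for k unfolding E_def[abs_def] by (intro Ck_on_exp Ck_on_cmult Ck_on_nu U)
  have Ch: "Ck_on k ?U h" for k unfolding h_def[abs_def] by (intro Ck_on_diff Ck_on_const Ck_on_cmult Ck_on_nu U)
  have zs: "csupp ?U (z j)" for j unfolding z_def[abs_def] by (intro csupp_mult s)
  have z2: "Ck_on 2 UNIV (z j)" for j
  proof (rule Ck_on_UNIV_csupp[OF U _ zs])
    show "Ck_on 2 ?U (z j)" unfolding z_def[abs_def]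
      using Ck_on_subset[OF w] by (intro Ck_on_mult CE U) auto
  qed
  have z1: "Ck_on 1 UNIV (z j)" and p1: "Ck_on 1 UNIV (partial k (z j))" for j k
    using Ck_on_mono[OF z2, of 1] Ck_on_partial[OF open_UNIV, of 1] z2 by (auto simp: numeral_2_eq_2)
  have w1: "Ck_on 1 UNIV (w j)" for j using Ck_on_mono[OF w, of 1] by simp
  define y where "y = (\<lambda>j x. \<Sum>k\<in>UNIV. x $ k * partial k (z j) x)"
  define m where "m = (\<lambda>i x. \<Sum>j\<in>UNIV. x $ j * partial i (z j) x - x $ i * partial j (z j) x)"
  define T1 where "T1 k x = x $ k * (\<Sum>i\<in>UNIV. z i x * m i x)" for k x
  define T2 where "T2 a i j x = x $ a * z i x * y j x" for a i j x
  define T3 where "T3 k x = x $ k * (h x * (\<Sum>i\<in>UNIV. z i x * z i x))" for k x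
  note CC = Ck_on_mult Ck_on_add Ck_on_diff Ck_on_sum Ck_on_nth open_UNIV
  have my1: "Ck_on 1 UNIV (y j)" "Ck_on 1 UNIV (m i)" for i j
    unfolding y_def m_def by (intro CC p1)+
  have mys: "csupp ?U (y j)" "csupp ?U (m i)" for i j
    unfolding y_def m_def by (intro csupp_sum csupp_mult csupp_diff csupp_partial zs)+
  have zz1: "Ck_on 1 ?U (\<lambda>x. z i x * z i x)" for i using Ck_on_subset[OF z1] by (intro Ck_on_mult U) auto
  have T: "Ck_on 1 UNIV (T1 k)" "csupp ?U (T1 k)" "Ck_on 1 UNIV (T2 a i j)" "csupp ?U (T2 a i j)"
    "Ck_on 1 UNIV (T3 k)" "csupp ?U (T3 k)" for a i j k
  proof -
    show "Ck_on 1 UNIV (T1 k)" unfolding T1_def[abs_def] by (intro CC z1 my1)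
    show "Ck_on 1 UNIV (T2 a i j)" unfolding T2_def[abs_def] by (intro CC z1 my1)
    show "csupp ?U (T1 k)" unfolding T1_def[abs_def] by (intro csupp_mult csupp_sum zs)
    show "csupp ?U (T2 a i j)" unfolding T2_def[abs_def] by (intro csupp_mult(1) mys)
    show "csupp ?U (T3 k)" unfolding T3_def[abs_def] by (intro csupp_mult(1) csupp_sum zs)
    then show "Ck_on 1 UNIV (T3 k)"
      by (rule Ck_on_UNIV_csupp[OF U, rotated])
        (unfold T3_def[abs_def], intro Ck_on_mult Ck_on_nth Ck_on_sum zz1 Ch U)
  qed
  \<comment> \<open>All boundary terms of the pointwise inequality, gathered as one divergence; its
    integral is 0.\<close>
  define D where "D x = (\<Sum>k\<in>UNIV. partial k (T1 k) x) - (\<Sum>i\<in>UNIV. \<Sum>j\<in>UNIV. partial i (T2 j i j) x - partial j (T2 i i j) x)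
     + (\<Sum>k\<in>UNIV. partial k (T3 k) x)" for x
  have Uz: "csupp UNIV g" if "csupp ?U g" for g :: "real^3 \<Rightarrow> real" using csupp_subset[OF that] by simp
  have pint: "integrable lborel (partial k g)" "(LBINT x. partial k g x) = 0" if "Ck_on 1 UNIV g" "csupp ?U g" for g k
  proof -
    have "continuous_on UNIV (partial k g)" using Ck_on_continuous[OF Ck_on_partial[OF open_UNIV, of 0 g]] that by simp
    then show "integrable lborel (partial k g)" by (rule integrable_csupp[OF _ csupp_partial[OF Uz[OF that(2)]]])
    show "(LBINT x. partial k g x) = 0" by (rule integral_partial_zero[OF that(1) Uz[OF that(2)]])
  qed
  have D0: "(LBINT x. D x) = 0" and Di: "integrable lborel D"
    unfolding D_def[abs_def] using pint T by simp_all
  have key: "\<tau> * (exp (2 * \<tau> * nu x) * nu x * (\<Sum>i\<in>UNIV. (w i x)\<^sup>2)) - D x \<le> exp (2 * \<tau> * nu x) * (\<Sum>i\<in>UNIV. (F i x)\<^sup>2)" for x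
  proof (cases "x = 0")
    case True
    have x: "x \<notin> ?U" using True by simp
    have "D x = 0" unfolding D_def
      using csupp_out[OF csupp_partial[OF T(2)] x] csupp_out[OF csupp_partial[OF T(4)] x] csupp_out[OF csupp_partial[OF T(6)] x] by simp
    moreover have "w i x = 0" for i using csupp_out[OF s x] .
    ultimately show ?thesis by (simp add: sum_nonneg)
  next
    case False
    then have xU: "x \<in> ?U" by simp
    have dE: "E differentiable (at x)" and dh: "h differentiable (at x)"
      using Ck_on_differentiable_at[OF U CE[of 1] _ xU] Ck_on_differentiable_at[OF U Ch[of 1] _ xU] by auto
    have dn: "nu differentiable (at x)" using Ck_on_differentiable_at[OF U Ck_on_nu[of 1] _ xU] by simp
    have dw: "w j differentiable (at x)" and dz: "z j differentiable (at x)" for j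
      using Ck_on_differentiable_at[OF open_UNIV w1] Ck_on_differentiable_at[OF open_UNIV z1] by auto
    have pE: "partial i E x = - E x * \<tau> * x $ i * nu x ^ 3" for i
    proof -
      have "(\<lambda>x. \<tau> * nu x) differentiable (at x)" using dn by simp
      from partial_compose[OF this DERIV_exp, of i] show ?thesis
        unfolding E_def[abs_def] by (simp add: partial_cmult dn partial_nu[OF False])
    qed
    have ph: "partial i h x = \<tau> * x $ i * nu x ^ 3" for i
      unfolding h_def[abs_def] using dn by (simp add: partial_diff partial_cmult partial_nu[OF False])
    have pz: "partial i (z j) x = E x * (partial i (w j) x - \<tau> * x $ i * nu x ^ 3 * w j x)" for i j
      unfolding z_def[abs_def] by (simp add: partial_mult dE dw pE algebra_simps)
    have xx: "x $ 1 * x $ 1 + x $ 2 * x $ 2 + x $ 3 * x $ 3 = x \<bullet> x" by (simp add: inner_self_sum sum_3)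
    have n3: "nu x ^ 3 * (x $ 1 * x $ 1 + x $ 2 * x $ 2 + x $ 3 * x $ 3) = nu x"
      using nu_sq[OF False] unfolding xx by (simp add: power3_eq_cube power2_eq_square mult.assoc)
    have EF: "E x * F i x = - (y i x + 3 / 2 * z i x) + (m i x + h x * z i x)" for i
    proof -
      have "m i x - y i x = E x * F i x + E x * \<tau> * (nu x ^ 3 * (x $ 1 * x $ 1 + x $ 2 * x $ 2 + x $ 3 * x $ 3)) * w i x"
        unfolding m_def y_def pz F_def sum_3 using exhaust_3[of i] by (auto simp: algebra_simps)
      then show ?thesis unfolding n3 by (simp add: h_def z_def algebra_simps)
    qed
    have sq: "exp (2 * \<tau> * nu x) = E x * E x" by (simp add: E_def flip: exp_add)
    have "exp (2 * \<tau> * nu x) * (\<Sum>i\<in>UNIV. (F i x)\<^sup>2) = (\<Sum>i\<in>UNIV. (E x * F i x)\<^sup>2)"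
      unfolding sq by (simp add: sum_distrib_left power2_eq_square mult_ac)
    also have "\<dots> \<ge> (\<Sum>i\<in>UNIV. - 2 * (y i x + 3 / 2 * z i x) * (m i x + h x * z i x))"
    proof (rule sum_mono)
      fix i
      \<comment> \<open>This is 2 a b \<le> (a + b)^2 for the antisymmetric part a = -(y + 3/2 z)
        and the symmetric part b = m + h z.\<close>
      have "0 \<le> (y i x + 3 / 2 * z i x)\<^sup>2 + (m i x + h x * z i x)\<^sup>2" by simp
      then show "- 2 * (y i x + 3 / 2 * z i x) * (m i x + h x * z i x) \<le> (E x * F i x)\<^sup>2"
        unfolding EF by (simp add: power2_eq_square algebra_simps)
    qed
    also have "(\<Sum>i\<in>UNIV. - 2 * (y i x + 3 / 2 * z i x) * (m i x + h x * z i x))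
        = - (2 * (\<Sum>i\<in>UNIV. (y i x + 3 / 2 * z i x) * m i x)) - h x * (\<Sum>i\<in>UNIV. 2 * y i x * z i x + 3 * z i x * z i x)"
      by (simp add: sum_3 algebra_simps)
    also have "2 * (\<Sum>i\<in>UNIV. (y i x + 3 / 2 * z i x) * m i x)
        = (\<Sum>k\<in>UNIV. partial k (T1 k) x) - (\<Sum>i\<in>UNIV. \<Sum>j\<in>UNIV. partial i (T2 j i j) x - partial j (T2 i i j) x)"
      unfolding T1_def[abs_def] T2_def[abs_def] y_def m_def by (rule euler_rotation_divergence[OF z2])
    \<comment> \<open>The source of the gain: the Euler field applied to h gives
      \<open>\<tau>\<close> |x|^2 \<open>nu\<close>^3, which is \<open>\<tau>\<close>
      \<open>nu\<close>.\<close>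
    also have "h x * (\<Sum>i\<in>UNIV. 2 * y i x * z i x + 3 * z i x * z i x) = (\<Sum>k\<in>UNIV. partial k (T3 k) x) - \<tau> * nu x * (\<Sum>i\<in>UNIV. z i x * z i x)"
    proof -
      have dq: "(\<lambda>x. \<Sum>i\<in>UNIV. z i x * z i x) differentiable (at x)"
        by (intro differentiable_sum differentiable_mult dz finite_UNIV ballI | simp add: dz)+
      have "partial k (T3 k) x = h x * (\<Sum>i\<in>UNIV. z i x * z i x)
          + x $ k * (partial k h x * (\<Sum>i\<in>UNIV. z i x * z i x) + h x * (\<Sum>i\<in>UNIV. 2 * (z i x * partial k (z i) x)))" for k
        unfolding T3_def[abs_def] by (simp add: partial_mult partial_nth dh dq partial_sum dz)
      then have "(\<Sum>k\<in>UNIV. partial k (T3 k) x) = 3 * h x * (\<Sum>i\<in>UNIV. z i x * z i x)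
          + \<tau> * (nu x ^ 3 * (x $ 1 * x $ 1 + x $ 2 * x $ 2 + x $ 3 * x $ 3)) * (\<Sum>i\<in>UNIV. z i x * z i x)
          + h x * (\<Sum>i\<in>UNIV. 2 * y i x * z i x)"
        unfolding y_def ph by (simp add: sum_3 algebra_simps)
      then show ?thesis unfolding n3 by (simp add: sum.distrib sum_distrib_left algebra_simps)
    qed
    finally have "\<tau> * nu x * (\<Sum>i\<in>UNIV. z i x * z i x) - D x \<le> exp (2 * \<tau> * nu x) * (\<Sum>i\<in>UNIV. (F i x)\<^sup>2)"
      unfolding D_def by linarith
    moreover have "\<tau> * nu x * (\<Sum>i\<in>UNIV. z i x * z i x) = \<tau> * (exp (2 * \<tau> * nu x) * nu x * (\<Sum>i\<in>UNIV. (w i x)\<^sup>2))"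
      unfolding z_def sq by (simp add: sum_distrib_left power2_eq_square mult_ac)
    ultimately show ?thesis by simp
  qed
  have wc: "continuous_on ?U (w i)" "continuous_on ?U (partial k (w i))" for i k
    using Ck_on_continuous[OF w1] Ck_on_continuous[OF Ck_on_partial[OF open_UNIV, of 0]] w1 continuous_on_subset by (metis One_nat_def subset_UNIV)+
  have nc: "continuous_on ?U nu" by (rule Ck_on_continuous[OF Ck_on_nu])
  have iL: "integrable lborel (\<lambda>x. exp (2 * \<tau> * nu x) * nu x * (\<Sum>i\<in>UNIV. (w i x)\<^sup>2))"
    unfolding power2_eq_square
    by (rule integrable_csupp[of ?U]) (intro continuous_intros wc nc csupp_mult(1) csupp_sum s)+
  have iR: "integrable lborel (\<lambda>x. exp (2 * \<tau> * nu x) * (\<Sum>i\<in>UNIV. (F i x)\<^sup>2))"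
    unfolding power2_eq_square F_def
    by (rule integrable_csupp[of ?U]) (intro continuous_intros wc nc csupp_mult(1) csupp_sum csupp_diff csupp_partial s)+
  have "\<tau> * (LBINT x. exp (2 * \<tau> * nu x) * nu x * (\<Sum>i\<in>UNIV. (w i x)\<^sup>2))
      = (LBINT x. \<tau> * (exp (2 * \<tau> * nu x) * nu x * (\<Sum>i\<in>UNIV. (w i x)\<^sup>2)) - D x)"
    using iL Di D0 by simp
  also have "\<dots> \<le> (LBINT x. exp (2 * \<tau> * nu x) * (\<Sum>i\<in>UNIV. (F i x)\<^sup>2))"
    by (rule Bochner_Integration.integral_mono) (use iL iR Di key in auto)
  finally show ?thesis .
qed

subsection \<open>Unique continuation\<close>

text \<open>Dominated convergence with a weight A that is controlled only on K; in the application
  the weight is singular at the origin, outside K.\<close>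

lemma tendsto_integral_compact:
  fixes A h :: "real^3 \<Rightarrow> real"
  assumes K: "compact K" and A: "continuous_on K A"
    and m: "\<And>n. (\<lambda>x. A x * hn n x) \<in> borel_measurable borel"
    and b: "\<And>n x. x \<in> K \<Longrightarrow> \<bar>hn n x\<bar> \<le> C" and z: "\<And>n x. x \<notin> K \<Longrightarrow> hn n x = 0"
    and l: "\<And>x. (\<lambda>n. hn n x) \<longlonglongrightarrow> h x" and hm: "(\<lambda>x. A x * h x) \<in> borel_measurable borel"
  shows "(\<lambda>n. LBINT x. A x * hn n x) \<longlonglongrightarrow> (LBINT x. A x * h x)"
proof -
  obtain B where B: "\<And>x. x \<in> K \<Longrightarrow> \<bar>A x\<bar> \<le> B"
    using compact_imp_bounded[OF compact_continuous_image[OF A K]] by (auto simp: bounded_iff)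
  have fin: "emeasure lborel K < \<infinity>" by (rule emeasure_compact_finite[OF K])
  show ?thesis
  proof (rule integral_dominated_convergence[where w="\<lambda>x. indicator K x * (B * C)"])
    show "(\<lambda>x. A x * h x) \<in> borel_measurable lborel" using hm by simp
    show "(\<lambda>x. A x * hn n x) \<in> borel_measurable lborel" for n using m by simp
    show "integrable lborel (\<lambda>x. indicator K x * (B * C))"
      using fin K by (intro integrable_mult_left integrable_real_indicator) (auto simp: borel_compact)
    show "AE x in lborel. (\<lambda>n. A x * hn n x) \<longlonglongrightarrow> A x * h x" by (intro always_eventually allI tendsto_mult_left l)
    have "\<bar>A x * hn n x\<bar> \<le> indicator K x * (B * C)" for n x
    proof (cases "x \<in> K")
      case True
      have "\<bar>A x\<bar> * \<bar>hn n x\<bar> \<le> B * C"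
        using B[OF True] b[OF True] by (intro mult_mono) (auto intro: order_trans[OF abs_ge_zero])
      then show ?thesis using True by (simp add: abs_mult)
    qed (simp add: z)
    then show "AE x in lborel. norm (A x * hn n x) \<le> indicator K x * (B * C)" for n by simp
  qed
qed

definition cut_field :: "(real^3 \<Rightarrow> real^3) \<Rightarrow> (real^3 \<Rightarrow> real) \<Rightarrow> 3 \<Rightarrow> real^3 \<Rightarrow> real" where
  "cut_field u \<theta> i x = \<theta> x * u x $ i"

text \<open>The curl of \<open>\<theta>\<close> u in antisymmetric form, as the equations dictate
  it: no derivative of u occurs. \<open>cut_div\<close> is the divergence of \<open>\<theta>\<close>
  u in the same sense.\<close>

definition cut_curl :: "(real^3 \<Rightarrow> real) \<Rightarrow> (real^3 \<Rightarrow> real^3) \<Rightarrow> (real^3 \<Rightarrow> real) \<Rightarrow> 3 \<Rightarrow> 3 \<Rightarrow> real^3 \<Rightarrow> real" where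
  "cut_curl f u \<theta> i j x = \<theta> x * (f x * (\<Sum>k\<in>UNIV. levi i j k * u x $ k)) + u x $ j * partial i \<theta> x - u x $ i * partial j \<theta> x"

definition cut_div :: "(real^3 \<Rightarrow> real^3) \<Rightarrow> (real^3 \<Rightarrow> real) \<Rightarrow> real^3 \<Rightarrow> real" where
  "cut_div u \<theta> x = (\<Sum>i\<in>UNIV. u x $ i * partial i \<theta> x)"

lemma cut_csupp:
  assumes "csupp W \<theta>"
  shows "csupp W (cut_field u \<theta> i)" "csupp W (cut_curl f u \<theta> i j)" "csupp W (cut_div u \<theta>)"
  unfolding cut_field_def[abs_def] cut_curl_def[abs_def] cut_div_def[abs_def]
  by (intro csupp_mult csupp_add csupp_diff csupp_sum csupp_partial assms)+

lemma conv_cut_kernel: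
  assumes s: "weqs W f v" and th: "smooth \<theta>" "csupp W \<theta>"
    and int: "\<And>i. integrable lborel (cut_field v \<theta> i)" "\<And>i j. integrable lborel (cut_curl f v \<theta> i j)" "integrable lborel (cut_div v \<theta>)"
    and k: "Ck_on 1 UNIV k"
  shows "conv (partial i k) (cut_field v \<theta> j) x - conv (partial j k) (cut_field v \<theta> i) x = conv k (cut_curl f v \<theta> i j) x"
    and "(\<Sum>i\<in>UNIV. conv (partial i k) (cut_field v \<theta> i) x) = conv k (cut_div v \<theta>) x"
proof -
  note csupp = cut_csupp[OF th(2), THEN csupp_subset[OF _ subset_UNIV]]
  have kc: "continuous_on UNIV k" "continuous_on UNIV (partial i k)" for i
    using Ck_on_continuous[OF k] Ck_on_continuous[OF Ck_on_partial[OF open_UNIV, of 0 k]] k by simp_all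
  have kd: "k differentiable (at y)" for y using Ck_on_differentiable_at[OF open_UNIV k] by simp
  have td: "\<theta> differentiable (at y)" for y using Ck_on_differentiable_at[OF open_UNIV, of 1 \<theta>] th by (simp add: smooth_def)
  let ?\<phi> = "\<lambda>y. k (x - y) * \<theta> y"
  have t: "test1 W ?\<phi>"
    using th Ck_on_reflect[OF k] unfolding test1_def smooth_def by (intro conjI Ck_on_mult csupp_mult) auto
  have p\<phi>: "partial i ?\<phi> y = - partial i k (x - y) * \<theta> y + k (x - y) * partial i \<theta> y" for i y
    by (simp add: partial_mult differentiable_reflect kd td partial_reflect)
  note i1 = integrable_conv[OF kc(2)] integrable_conv[OF kc(1)]
  note I = i1[OF int(1) csupp(1)] i1[OF int(2) csupp(2)] i1[OF int(3) csupp(3)]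
  have "(LBINT y. v y $ j * partial i ?\<phi> y - v y $ i * partial j ?\<phi> y + f y * (\<Sum>k\<in>UNIV. levi i j k * v y $ k) * ?\<phi> y) = 0"
    using s t unfolding weqs_def by blast
  also have "(\<lambda>y. v y $ j * partial i ?\<phi> y - v y $ i * partial j ?\<phi> y + f y * (\<Sum>k\<in>UNIV. levi i j k * v y $ k) * ?\<phi> y)
      = (\<lambda>y. k (x - y) * cut_curl f v \<theta> i j y - (partial i k (x - y) * cut_field v \<theta> j y - partial j k (x - y) * cut_field v \<theta> i y))"
    unfolding p\<phi> by (simp add: fun_eq_iff cut_curl_def cut_field_def algebra_simps)
  finally show "conv (partial i k) (cut_field v \<theta> j) x - conv (partial j k) (cut_field v \<theta> i) x = conv k (cut_curl f v \<theta> i j) x"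
    using I by (simp add: conv_def)
  have "(LBINT y. (\<Sum>i\<in>UNIV. v y $ i * partial i ?\<phi> y)) = 0" using s t unfolding weqs_def by blast
  also have "(\<lambda>y. \<Sum>i\<in>UNIV. v y $ i * partial i ?\<phi> y)
      = (\<lambda>y. k (x - y) * cut_div v \<theta> y - (\<Sum>i\<in>UNIV. partial i k (x - y) * cut_field v \<theta> i y))"
    unfolding p\<phi> by (simp add: fun_eq_iff cut_div_def cut_field_def algebra_simps sum.distrib sum_distrib_left sum_negf sum_subtractf)
  finally show "(\<Sum>i\<in>UNIV. conv (partial i k) (cut_field v \<theta> i) x) = conv k (cut_div v \<theta>) x"
    using I by (simp add: conv_def)
qed

context
  fixes W :: "(real^3) set" and f :: "real^3 \<Rightarrow> real" and u :: "real^3 \<Rightarrow> real^3" and \<theta> :: "real^3 \<Rightarrow> real"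
  assumes W: "open W" and u: "continuous_on W u" and f: "continuous_on W f" and s: "weqs W f u"
    and th: "smooth \<theta>" "csupp W \<theta>"
begin

abbreviation "cfield \<equiv> cut_field u \<theta>"
abbreviation "ccurl \<equiv> cut_curl f u \<theta>"
abbreviation "cdiv \<equiv> cut_div u \<theta>"

lemma cut_cont: "continuous_on UNIV (cfield i)" "continuous_on UNIV (ccurl i j)" "continuous_on UNIV cdiv"
proof -
  have c: "continuous_on W \<theta>" "continuous_on W (partial i \<theta>)" for i
    using smooth_continuous[OF th(1)] smooth_continuous[OF smooth_partial[OF th(1)]] continuous_on_subset by blast+
  show "continuous_on UNIV (cfield i)" "continuous_on UNIV (ccurl i j)" "continuous_on UNIV cdiv"
    by (rule continuous_on_UNIV_csupp[OF W _ cut_csupp(1)[OF th(2)]], unfold cut_field_def[abs_def], intro continuous_intros u c)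
      (rule continuous_on_UNIV_csupp[OF W _ cut_csupp(2)[OF th(2)]], unfold cut_curl_def[abs_def], intro continuous_intros u c f,
       rule continuous_on_UNIV_csupp[OF W _ cut_csupp(3)[OF th(2)]], unfold cut_div_def[abs_def], intro continuous_intros u c)
qed

lemma cut_integrable: "integrable lborel (cfield i)" "integrable lborel (ccurl i j)" "integrable lborel cdiv"
  and cut_csupp_UNIV: "csupp UNIV (cfield i)" "csupp UNIV (ccurl i j)" "csupp UNIV cdiv"
  using integrable_csupp[OF cut_cont(1)] integrable_csupp[OF cut_cont(2)] integrable_csupp[OF cut_cont(3)]
    csupp_subset[OF cut_csupp(1)[OF th(2)] subset_UNIV] csupp_subset[OF cut_csupp(2)[OF th(2)] subset_UNIV] csupp_subset[OF cut_csupp(3)[OF th(2)] subset_UNIV]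
  by blast+

lemma conv_cut:
  assumes e: "0 < e"
  shows "partial i (conv (moll e) (cfield j)) x - partial j (conv (moll e) (cfield i)) x = conv (moll e) (ccurl i j) x"
    and "(\<Sum>i\<in>UNIV. partial i (conv (moll e) (cfield i)) x) = conv (moll e) cdiv x"
proof -
  have mk: "Ck_on 1 UNIV (moll e)" using smooth_moll by (simp add: smooth_def)
  note p = partial_conv[OF mk cut_integrable(1) cut_csupp_UNIV(1)]
  show "partial i (conv (moll e) (cfield j)) x - partial j (conv (moll e) (cfield i)) x = conv (moll e) (ccurl i j) x"
    and "(\<Sum>i\<in>UNIV. partial i (conv (moll e) (cfield i)) x) = conv (moll e) cdiv x"
    unfolding p by (rule conv_cut_kernel[OF s th cut_integrable mk])+
qed

text \<open>The cut-off field is only continuous, so \<open>carleman\<close> is applied to its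
  mollifications, whose curl and divergence are the mollified \<open>ccurl\<close> and
  \<open>cdiv\<close>. Since u vanishes near the origin, all supports avoid the singularity of the
  weight and the limit can be taken.\<close>

lemma carleman_cut:
  assumes d: "0 < d" and z: "\<And>x. x \<in> ball 0 d \<Longrightarrow> x \<in> W \<Longrightarrow> u x = 0"
  defines "F \<equiv> \<lambda>i x. (\<Sum>j\<in>UNIV. x $ j * ccurl i j x) - x $ i * cdiv x"
  shows "\<tau> * (LBINT x. exp (2 * \<tau> * nu x) * nu x * (\<Sum>i\<in>UNIV. (cfield i x)\<^sup>2))
    \<le> (LBINT x. exp (2 * \<tau> * nu x) * (\<Sum>i\<in>UNIV. (F i x)\<^sup>2))"
proof -
  let ?U = "- {0} :: (real^3) set"
  have zero: "cfield i x = 0" "ccurl i j x = 0" "cdiv x = 0" if "norm x < d" for i j x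
  proof -
    have "cfield i x = 0 \<and> ccurl i j x = 0 \<and> cdiv x = 0"
    proof (cases "x \<in> W")
      case True
      then have "u x = 0" using z that by simp
      then show ?thesis by (simp add: cut_field_def cut_curl_def cut_div_def)
    next
      case False
      then show ?thesis using cut_csupp[OF th(2)] csupp_out by blast
    qed
    then show "cfield i x = 0" "ccurl i j x = 0" "cdiv x = 0" by auto
  qed
  obtain K0 where K0: "compact K0" "\<And>x. x \<notin> K0 \<Longrightarrow> \<theta> x = 0" using th(2) unfolding csupp_def by blast
  obtain R0 where R0: "\<And>x. x \<in> K0 \<Longrightarrow> norm x \<le> R0" using compact_imp_bounded[OF K0(1)] bounded_iff by metis
  have out: "cfield i x = 0" "ccurl i j x = 0" "cdiv x = 0" if "norm x > R0" for i j x
  proof -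
    have x: "x \<notin> K0" using R0[of x] that by auto
    have o: "open (- K0)" using K0(1) by (simp add: compact_imp_closed open_Compl)
    have "\<theta> x = 0" "partial i \<theta> x = 0" for i
      using K0(2)[OF x] partial_cong_open[OF o, of x \<theta> "\<lambda>_. 0" i] x K0(2) by auto
    then show "cfield i x = 0" "ccurl i j x = 0" "cdiv x = 0"
      by (simp_all add: cut_field_def cut_curl_def cut_div_def)
  qed
  \<comment> \<open>A closed shell that contains the supports of all mollifications of radius below
    d / 2.\<close>
  define K where "K = cball 0 (R0 + d) - ball (0::real^3) (d / 2)"
  have K: "compact K" unfolding K_def by (intro compact_diff compact_cball open_ball)
  have KU: "K \<subseteq> ?U" using d by (auto simp: K_def)
  have cz: "conv (moll e) g x = 0" if e: "0 < e" "e < d / 2" and x: "x \<notin> K"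
    and g: "\<And>x. norm x < d \<Longrightarrow> g x = 0" "\<And>x. norm x > R0 \<Longrightarrow> g x = 0" for g :: "real^3 \<Rightarrow> real" and e x
  proof (rule conv_moll_zero[OF e(1)])
    fix y assume y: "dist x y \<le> e"
    have t: "norm y \<le> norm x + dist x y" "norm x \<le> norm y + dist x y"
      using dist_triangle[of 0 y x] dist_triangle[of 0 x y] by (simp_all add: dist_commute)
    from x have "norm x < d / 2 \<or> norm x > R0 + d" by (auto simp: K_def)
    then show "g y = 0"
    proof
      assume "norm x < d / 2"
      then show ?thesis using t y e(2) by (intro g(1)) linarith
    next
      assume "norm x > R0 + d"
      then show ?thesis using t y e(2) d by (intro g(2)) linarith
    qed
  qed
  \<comment> \<open>One radius that serves all of the finitely many components with error at most 1
    / (n + 1).\<close>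
  define good where "good n e \<longleftrightarrow> 0 < e \<and> e < d / 2 \<and> (\<forall>i x. \<bar>conv (moll e) (cfield i) x - cfield i x\<bar> \<le> 1 / real (Suc n))
      \<and> (\<forall>i j x. \<bar>conv (moll e) (ccurl i j) x - ccurl i j x\<bar> \<le> 1 / real (Suc n)) \<and> (\<forall>x. \<bar>conv (moll e) cdiv x - cdiv x\<bar> \<le> 1 / real (Suc n))" for n e
  have ev: "\<forall>\<^sub>F r in at_right 0. \<forall>x. \<bar>conv (moll r) g x - g x\<bar> \<le> 1 / real (Suc n)"
    if "continuous_on UNIV g" "csupp UNIV g" for g n
    using conv_moll_uniform[OF that, of "1 / real (Suc n)"] unfolding eventually_at_right_field by auto
  have "\<forall>\<^sub>F r in at_right 0. r < d / 2" using d unfolding eventually_at_right_field by (intro exI[of _ "d / 2"]) simp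
  then have "\<forall>\<^sub>F r in at_right 0. good n r" for n
    unfolding good_def by (intro eventually_conj eventually_all_finite ev cut_cont cut_csupp_UNIV eventually_at_right_less)
  from eventually_happens'[OF trivial_limit_at_right_real this] have "\<exists>e. good n e" for n .
  then obtain e where e: "\<And>n. good n (e n)" by metis
  have e0: "0 < e n" "e n < d / 2" for n using e[of n] by (auto simp: good_def)
  define w where "w n i = conv (moll (e n)) (cfield i)" for n i
  define G where "G n i j = conv (moll (e n)) (ccurl i j)" for n i j
  define g where "g n = conv (moll (e n)) cdiv" for n
  have near: "\<bar>w n i x - cfield i x\<bar> \<le> 1 / real (Suc n)" "\<bar>G n i j x - ccurl i j x\<bar> \<le> 1 / real (Suc n)"
    "\<bar>g n x - cdiv x\<bar> \<le> 1 / real (Suc n)" for n i j x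
    using e[of n] by (auto simp: good_def w_def G_def g_def)
  have lim: "(\<lambda>n. a n) \<longlonglongrightarrow> b" if "\<And>n. \<bar>a n - b\<bar> \<le> 1 / real (Suc n)" for a :: "nat \<Rightarrow> real" and b
    by (rule LIM_zero_cancel, rule Lim_null_comparison[OF _ LIMSEQ_inverse_real_of_nat]) (use that in \<open>simp add: inverse_eq_divide\<close>)
  have lims: "(\<lambda>n. w n i x) \<longlonglongrightarrow> cfield i x" "(\<lambda>n. G n i j x) \<longlonglongrightarrow> ccurl i j x" "(\<lambda>n. g n x) \<longlonglongrightarrow> cdiv x" for i j x
    using near by (auto intro: lim)
  have wK: "w n i x = 0" "G n i j x = 0" "g n x = 0" if "x \<notin> K" for n i j x
    unfolding w_def G_def g_def by (rule cz[OF e0 that]; use zero out in blast)+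
  have w2: "Ck_on 2 UNIV (w n i)" for n i
    unfolding w_def using smooth_moll Ck_on_conv[OF _ cut_integrable(1) cut_csupp_UNIV(1)] by (auto simp: smooth_def)
  have Gc: "continuous_on UNIV (G n i j)" "continuous_on UNIV (g n)" "continuous_on UNIV (w n i)" for n i j
    unfolding G_def g_def w_def
    by (intro continuous_conv smooth_continuous[OF smooth_moll] cut_integrable cut_csupp_UNIV)+
  define Fn where "Fn n i x = (\<Sum>j\<in>UNIV. x $ j * G n i j x) - x $ i * g n x" for n i x
  have C: "\<tau> * (LBINT x. exp (2 * \<tau> * nu x) * nu x * (\<Sum>i\<in>UNIV. (w n i x)\<^sup>2))
    \<le> (LBINT x. exp (2 * \<tau> * nu x) * (\<Sum>i\<in>UNIV. (Fn n i x)\<^sup>2))" for n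
  proof -
    have "csupp ?U (w n i)" for i unfolding csupp_def using K KU wK(1) by blast
    from carleman[of "w n" \<tau>, OF w2 this] show ?thesis
      unfolding Fn_def G_def g_def w_def conv_cut(1)[OF e0(1)] conv_cut(2)[OF e0(1)] .
  qed
  obtain B where B: "\<And>i j x. x \<in> K \<Longrightarrow> \<bar>cfield i x\<bar> \<le> B \<and> \<bar>ccurl i j x\<bar> \<le> B \<and> \<bar>cdiv x\<bar> \<le> B \<and> norm x \<le> B"
  proof -
    have "continuous_on K (\<lambda>x. (\<Sum>i\<in>UNIV. \<bar>cfield i x\<bar>) + (\<Sum>i\<in>UNIV. \<Sum>j\<in>UNIV. \<bar>ccurl i j x\<bar>) + \<bar>cdiv x\<bar> + norm x)"
      using cut_cont continuous_on_subset by (intro continuous_intros) blast+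
    then obtain B where B: "\<And>x. x \<in> K \<Longrightarrow> \<bar>(\<Sum>i\<in>UNIV. \<bar>cfield i x\<bar>) + (\<Sum>i\<in>UNIV. \<Sum>j\<in>UNIV. \<bar>ccurl i j x\<bar>) + \<bar>cdiv x\<bar> + norm x\<bar> \<le> B"
      using compact_imp_bounded[OF compact_continuous_image[OF _ K]] by (fastforce simp: bounded_iff)
    show ?thesis
    proof (rule that[of B])
      fix i j x assume "x \<in> K"
      from B[OF this] have 1: "(\<Sum>i\<in>UNIV. \<bar>cfield i x\<bar>) + (\<Sum>i\<in>UNIV. \<Sum>j\<in>UNIV. \<bar>ccurl i j x\<bar>) + \<bar>cdiv x\<bar> + norm x \<le> B" by linarith
      have 2: "\<bar>cfield i x\<bar> \<le> (\<Sum>i\<in>UNIV. \<bar>cfield i x\<bar>)" by (rule member_le_sum) auto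
      have 3: "\<bar>ccurl i j x\<bar> \<le> (\<Sum>j\<in>UNIV. \<bar>ccurl i j x\<bar>)" by (rule member_le_sum) auto
      have 4: "(\<Sum>j\<in>UNIV. \<bar>ccurl i j x\<bar>) \<le> (\<Sum>i\<in>UNIV. \<Sum>j\<in>UNIV. \<bar>ccurl i j x\<bar>)"
        by (rule member_le_sum[of i UNIV "\<lambda>i. \<Sum>j\<in>UNIV. \<bar>ccurl i j x\<bar>"]) (auto intro: sum_nonneg)
      have 5: "0 \<le> (\<Sum>i\<in>UNIV. \<bar>cfield i x\<bar>)" "0 \<le> (\<Sum>i\<in>UNIV. \<Sum>j\<in>UNIV. \<bar>ccurl i j x\<bar>)" by (auto intro: sum_nonneg)
      show "\<bar>cfield i x\<bar> \<le> B \<and> \<bar>ccurl i j x\<bar> \<le> B \<and> \<bar>cdiv x\<bar> \<le> B \<and> norm x \<le> B"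
        using 1 2 3 4 5 abs_ge_zero[of "cdiv x"] norm_ge_zero[of x] by linarith
    qed
  qed
  have inv1: "1 / real (Suc n) \<le> 1" for n by simp
  have wB: "\<bar>w n i x\<bar> \<le> B + 1" "\<bar>G n i j x\<bar> \<le> B + 1" "\<bar>g n x\<bar> \<le> B + 1" if "x \<in> K" for n i j x
    using near(1)[of n i x] near(2)[of n i j x] near(3)[of n x] B[OF that, of i j] inv1[of n] by linarith+
  have FB: "\<bar>Fn n i x\<bar> \<le> 4 * (B * (B + 1))" if x: "x \<in> K" for n i x
  proof -
    have B0: "0 \<le> B" using B[OF x] norm_ge_zero[of x] by (meson order_trans)
    have p: "\<bar>x $ j * a\<bar> \<le> B * (B + 1)" if "\<bar>a\<bar> \<le> B + 1" for j a
      unfolding abs_mult using that B[OF x] component_le_norm_cart[of x j] B0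
      by (intro mult_mono) (auto intro: order_trans)
    have "\<bar>Fn n i x\<bar> \<le> (\<Sum>j\<in>UNIV. \<bar>x $ j * G n i j x\<bar>) + \<bar>x $ i * g n x\<bar>"
      unfolding Fn_def by (intro order_trans[OF abs_triangle_ineq4] add_mono sum_abs order_refl)
    also have "\<dots> \<le> (\<Sum>j\<in>(UNIV::3 set). B * (B + 1)) + B * (B + 1)"
      by (intro add_mono sum_mono p wB x)
    finally show ?thesis by simp
  qed
  have nc: "continuous_on ?U nu" by (rule Ck_on_continuous[OF Ck_on_nu])
  have A1: "continuous_on K (\<lambda>x. exp (2 * \<tau> * nu x) * nu x)" and A2: "continuous_on K (\<lambda>x. exp (2 * \<tau> * nu x))"
    by (intro continuous_intros continuous_on_subset[OF nc KU])+
  have meas: "(\<lambda>x. A x * h x) \<in> borel_measurable borel"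
    if A: "continuous_on K A" and h: "continuous_on UNIV h" "\<And>x. x \<notin> K \<Longrightarrow> h x = 0" for A h :: "real^3 \<Rightarrow> real"
  proof -
    have "integrable lborel (\<lambda>x. A x * h x)"
      by (rule integrable_csupp[of K]) (use A h K in \<open>auto intro!: continuous_on_mult simp: csupp_def intro: continuous_on_subset exI[of _ K]\<close>)
    then show ?thesis by auto
  qed
  have Fc: "continuous_on UNIV (Fn n i)" "continuous_on UNIV (F i)" for n i
    unfolding Fn_def[abs_def] F_def by (intro continuous_intros Gc cut_cont)+
  have FK: "Fn n i x = 0" "F i x = 0" "cfield i x = 0" if "x \<notin> K" for n i x
  proof -
    show "Fn n i x = 0" using wK(2,3)[OF that] by (simp add: Fn_def)
    from that have "norm x < d \<or> norm x > R0" using d by (auto simp: K_def)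
    then show "F i x = 0" "cfield i x = 0" using zero[of x] out[of x] by (auto simp: F_def)
  qed
  have L1: "(\<lambda>n. LBINT x. exp (2 * \<tau> * nu x) * nu x * (\<Sum>i\<in>UNIV. (w n i x)\<^sup>2))
      \<longlonglongrightarrow> (LBINT x. exp (2 * \<tau> * nu x) * nu x * (\<Sum>i\<in>UNIV. (cfield i x)\<^sup>2))"
  proof (rule tendsto_integral_compact[OF K A1, where C="3 * (B + 1)\<^sup>2"])
    show "\<bar>\<Sum>i\<in>UNIV. (w n i x)\<^sup>2\<bar> \<le> 3 * (B + 1)\<^sup>2" if "x \<in> K" for n x
    proof -
      have "\<bar>\<Sum>i\<in>UNIV. (w n i x)\<^sup>2\<bar> = (\<Sum>i\<in>UNIV. \<bar>w n i x\<bar>\<^sup>2)" by (simp add: sum_nonneg)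
      also have "\<dots> \<le> (\<Sum>i\<in>(UNIV::3 set). (B + 1)\<^sup>2)" by (intro sum_mono power_mono wB that) auto
      finally show ?thesis by simp
    qed
    show "(\<lambda>n. \<Sum>i\<in>UNIV. (w n i x)\<^sup>2) \<longlonglongrightarrow> (\<Sum>i\<in>UNIV. (cfield i x)\<^sup>2)" for x by (intro tendsto_intros lims)
  qed (use wK FK in \<open>auto intro!: meas A1 continuous_intros Gc cut_cont\<close>)
  have L2: "(\<lambda>n. LBINT x. exp (2 * \<tau> * nu x) * (\<Sum>i\<in>UNIV. (Fn n i x)\<^sup>2))
      \<longlonglongrightarrow> (LBINT x. exp (2 * \<tau> * nu x) * (\<Sum>i\<in>UNIV. (F i x)\<^sup>2))"
  proof (rule tendsto_integral_compact[OF K A2, where C="3 * (4 * (B * (B + 1)))\<^sup>2"])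
    show "\<bar>\<Sum>i\<in>UNIV. (Fn n i x)\<^sup>2\<bar> \<le> 3 * (4 * (B * (B + 1)))\<^sup>2" if "x \<in> K" for n x
    proof -
      have "\<bar>\<Sum>i\<in>UNIV. (Fn n i x)\<^sup>2\<bar> = (\<Sum>i\<in>UNIV. \<bar>Fn n i x\<bar>\<^sup>2)" by (simp add: sum_nonneg)
      also have "\<dots> \<le> (\<Sum>i\<in>(UNIV::3 set). (4 * (B * (B + 1)))\<^sup>2)" by (intro sum_mono power_mono FB that) auto
      finally show ?thesis by simp
    qed
    show "(\<lambda>n. \<Sum>i\<in>UNIV. (Fn n i x)\<^sup>2) \<longlonglongrightarrow> (\<Sum>i\<in>UNIV. (F i x)\<^sup>2)" for x
      unfolding Fn_def F_def by (intro tendsto_intros lims)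
  qed (use FK in \<open>auto intro!: meas A2 continuous_intros Fc\<close>)
  show ?thesis
    by (rule LIMSEQ_le[OF tendsto_mult_left[OF L1] L2]) (use C in blast)
qed

end

text \<open>Inside radius R / 2 the right-hand side of the Carleman estimate is at most M |u|^2 and
  is absorbed once \<open>\<tau>\<close> is large. Outside, the weight is at most exp(4
  \<open>\<tau>\<close> / R). If u did not vanish at x0, the part inside some radius r < R / 2 would
  contribute at least a multiple of exp(2 \<open>\<tau>\<close> / r), which is larger for large
  \<open>\<tau>\<close>.\<close>

lemma unique_continuation_origin:
  assumes W: "open W" and u: "continuous_on W u" and f: "continuous_on W f" and s: "weqs W f u"
    and R: "0 < R" "cball 0 R \<subseteq> W" and d: "0 < d" "\<And>x. x \<in> ball 0 d \<Longrightarrow> x \<in> W \<Longrightarrow> u x = 0"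
    and x0: "norm x0 < R / 2"
  shows "u x0 = 0"
proof (rule ccontr)
  assume ne: "u x0 \<noteq> 0"
  obtain \<theta> where th: "smooth \<theta>" "\<And>x. dist 0 x \<le> R / 2 \<Longrightarrow> \<theta> x = 1" "\<And>x. 3 * R / 4 \<le> dist 0 x \<Longrightarrow> \<theta> x = 0"
    using cutoff_exists[of "R / 2" "3 * R / 4" 0] R(1) by auto
  have thW: "csupp W \<theta>" unfolding csupp_def
  proof (intro exI[of _ "cball 0 R"] conjI allI impI)
    show "\<theta> x = 0" if "x \<notin> cball 0 R" for x using th(3)[of x] that R(1) by simp
  qed (use R in auto)
  define w where "w = cut_field u \<theta>"
  define F where "F = (\<lambda>i x. (\<Sum>j\<in>UNIV. x $ j * cut_curl f u \<theta> i j x) - x $ i * cut_div u \<theta> x)"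
  define S where "S x = (\<Sum>i\<in>UNIV. (w i x)\<^sup>2)" for x
  define Q where "Q x = (\<Sum>i\<in>UNIV. (F i x)\<^sup>2)" for x
  note loc = W u f s th(1) thW
  have wc: "continuous_on UNIV (w i)" "csupp UNIV (w i)" for i
    unfolding w_def using cut_cont(1)[OF loc] cut_csupp_UNIV(1)[OF loc] by auto
  have Fc: "continuous_on UNIV (F i)" "csupp UNIV (F i)" for i
    unfolding F_def
    by (intro continuous_intros cut_cont[OF loc] csupp_diff csupp_sum csupp_mult(1) cut_csupp_UNIV[OF loc])+
  have Sc: "continuous_on UNIV S" "csupp UNIV S" and Qc: "continuous_on UNIV Q" "csupp UNIV Q"
    unfolding S_def[abs_def] Q_def[abs_def] power2_eq_square
    by (intro continuous_intros wc Fc csupp_sum csupp_mult(1))+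
  have S0: "0 \<le> S x" and Q0: "0 \<le> Q x" for x by (auto simp: S_def Q_def intro: sum_nonneg)
  have zero: "w i x = 0" "F i x = 0" if "norm x < d" for i x
  proof -
    have "w i x = 0 \<and> F i x = 0"
    proof (cases "x \<in> W")
      case True
      then have "u x = 0" using d(2) that by simp
      then show ?thesis by (simp add: w_def F_def cut_field_def cut_curl_def cut_div_def)
    next
      case False
      then have "cut_field u \<theta> i x = 0" "cut_curl f u \<theta> i j x = 0" "cut_div u \<theta> x = 0" for i j
        by (auto intro: csupp_out[OF cut_csupp(1)[OF thW]] csupp_out[OF cut_csupp(2)[OF thW]] csupp_out[OF cut_csupp(3)[OF thW]])
      then show ?thesis by (simp add: w_def F_def)
    qed
    then show "w i x = 0" "F i x = 0" by auto
  qed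
  have "bounded (f ` cball 0 R)"
    by (rule compact_imp_bounded[OF compact_continuous_image[OF continuous_on_subset[OF f R(2)] compact_cball]])
  then obtain m where "\<forall>y\<in>f ` cball 0 R. norm y \<le> m" unfolding bounded_iff by blast
  then have m: "\<And>x. x \<in> cball 0 R \<Longrightarrow> \<bar>f x\<bar> \<le> m" by simp
  define M where "M = m\<^sup>2 * R\<^sup>2"
  \<comment> \<open>Where the cutoff is 1, \<open>F\<close> is f times the cross product of x and u,
    and Lagrange's identity bounds its length.\<close>
  have QS: "Q x \<le> M * S x" if x: "norm x < R / 2" for x
  proof -
    have o: "open (ball 0 (R/2))" "x \<in> ball 0 (R / 2)" using x by auto
    have p0: "partial i \<theta> x = 0" for i
      using partial_cong_open[OF o, of \<theta> "\<lambda>_. 1" i] th(2) by (simp add: less_imp_le)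
    have t1: "\<theta> x = 1" using th(2)[of x] x by simp
    have wi: "w i x = u x $ i" for i by (simp add: w_def cut_field_def t1)
    have Fi: "F i x = f x * (\<Sum>j\<in>UNIV. \<Sum>k\<in>UNIV. x $ j * (levi i j k * u x $ k))" for i
      by (simp add: F_def cut_curl_def cut_div_def p0 t1 sum_distrib_left mult_ac)
    have "Q x = (f x)\<^sup>2 * ((x \<bullet> x) * S x - (x \<bullet> u x)\<^sup>2)"
      unfolding Q_def S_def wi Fi inner_vec_def inner_real_def by (simp add: sum_3 power2_eq_square algebra_simps)
    also have "\<dots> \<le> (f x)\<^sup>2 * ((x \<bullet> x) * S x)" by (intro mult_left_mono) auto
    also have "\<dots> \<le> m\<^sup>2 * (R\<^sup>2 * S x)"
    proof (intro mult_mono)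
      have "norm x \<le> R" using x R(1) by linarith
      then show "x \<bullet> x \<le> R\<^sup>2" by (simp add: dot_square_norm power_mono)
      have "\<bar>f x\<bar> \<le> m" using m \<open>norm x \<le> R\<close> by simp
      then show "(f x)\<^sup>2 \<le> m\<^sup>2" by (metis abs_ge_zero power2_abs power_mono)
    qed (use S0 in auto)
    finally show ?thesis by (simp add: M_def)
  qed
  obtain r where r: "norm x0 < r" "r < R / 2" using dense x0 by blast
  have r0: "0 < r" using r(1) norm_ge_zero[of x0] by linarith
  \<comment> \<open>A continuous substitute for the indicator of the ball of radius r, so that the
    positivity of c follows from \<open>integral_pos_continuous\<close>.\<close>
  define \<kappa> where "\<kappa> x = max 0 ((r - norm x) / r)" for x :: "real^3"
  have k: "continuous_on UNIV \<kappa>" unfolding \<kappa>_def[abs_def] using r0 by (intro continuous_intros) auto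
  have k01: "0 \<le> \<kappa> x" "\<kappa> x \<le> 1" for x using r0 by (auto simp: \<kappa>_def field_simps)
  have kz: "\<kappa> x = 0" if "r \<le> norm x" for x
  proof -
    have "(r - norm x) / r \<le> 0" using that r0 by (simp add: divide_nonpos_pos)
    then show ?thesis by (simp add: \<kappa>_def)
  qed
  define c where "c = (LBINT x. \<kappa> x * S x)"
  have ci: "integrable lborel (\<lambda>x. \<kappa> x * S x)"
    by (rule integrable_csupp[of UNIV]) (intro continuous_on_mult k Sc csupp_mult)+
  have c: "0 < c" unfolding c_def
  proof (rule integral_pos_continuous[where p=x0])
    show "0 < \<kappa> x0 * S x0"
    proof (rule mult_pos_pos)
      show "0 < \<kappa> x0" using r r0 by (simp add: \<kappa>_def)
      obtain i where "u x0 $ i \<noteq> 0" using ne by (auto simp: vec_eq_iff)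
      then have "0 < (w i x0)\<^sup>2" using th(2)[of x0] x0 by (simp add: w_def cut_field_def)
      also have "\<dots> \<le> S x0" unfolding S_def by (rule member_le_sum) auto
      finally show "0 < S x0" .
    qed
  qed (use k Sc k01 S0 in \<open>auto intro!: continuous_on_mult csupp_mult(1)\<close>)
  have Qi: "integrable lborel Q" by (rule integrable_csupp[OF Qc])
  define q where "q = (LBINT x. Q x)"
  \<comment> \<open>The lower bound on \<open>\<tau>\<close> ensures \<open>\<tau>\<close>
    \<open>nu\<close> \<ge> M + 1 inside radius R / 2, where \<open>nu\<close> \<ge> 2 / R. One copy
    of |u|^2 is thereby left over for the lower bound.\<close>
  have bound: "exp (2 * \<tau> / r) * c \<le> exp (4 * \<tau> / R) * q" if tau: "0 \<le> \<tau>" "(M + 1) * R / 2 \<le> \<tau>" for \<tau>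
  proof -
    let ?U = "- {0} :: (real^3) set"
    have nc: "continuous_on ?U nu" by (rule Ck_on_continuous[OF Ck_on_nu])
    have sU: "csupp ?U S" "csupp ?U Q"
    proof -
      have g: "csupp ?U g" if "csupp UNIV g" "\<And>x. norm x < d \<Longrightarrow> g x = 0" for g :: "real^3 \<Rightarrow> real"
      proof -
        obtain K where K: "compact K" "\<And>x. x \<notin> K \<Longrightarrow> g x = 0" using \<open>csupp UNIV g\<close> unfolding csupp_def by blast
        show ?thesis unfolding csupp_def
          by (rule exI[of _ "K - ball 0 d"]) (use K that(2) d(1) in \<open>auto intro: compact_diff\<close>)
      qed
      show "csupp ?U S" "csupp ?U Q" using g[OF Sc(2)] g[OF Qc(2)] zero by (auto simp: S_def Q_def)
    qed
    have ScU: "continuous_on ?U S" "continuous_on ?U Q" using Sc(1) Qc(1) continuous_on_subset by blast+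
    have i1: "integrable lborel (\<lambda>x. exp (2 * \<tau> * nu x) * nu x * S x)" "integrable lborel (\<lambda>x. exp (2 * \<tau> * nu x) * Q x)"
      by (rule integrable_csupp[of ?U]; intro continuous_intros nc ScU csupp_mult(1) sU)+
    have "\<tau> * (LBINT x. exp (2 * \<tau> * nu x) * nu x * S x) \<le> (LBINT x. exp (2 * \<tau> * nu x) * Q x)"
      unfolding S_def Q_def w_def F_def by (rule carleman_cut[OF loc d])
    then have "0 \<le> (LBINT x. exp (2 * \<tau> * nu x) * Q x - \<tau> * (exp (2 * \<tau> * nu x) * nu x * S x))"
      using i1 by simp
    also have "\<dots> \<le> (LBINT x. exp (4 * \<tau> / R) * Q x - exp (2 * \<tau> / r) * (\<kappa> x * S x))"
    proof (rule Bochner_Integration.integral_mono)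
      fix x
      show "exp (2 * \<tau> * nu x) * Q x - \<tau> * (exp (2 * \<tau> * nu x) * nu x * S x) \<le> exp (4 * \<tau> / R) * Q x - exp (2 * \<tau> / r) * (\<kappa> x * S x)"
      proof (cases "norm x < d")
        case True
        then show ?thesis using zero by (simp add: S_def Q_def)
      next
        case nd: False
        then have np: "0 < norm x" using d(1) by linarith
        show ?thesis
        proof (cases "norm x < R / 2")
          case True
          have nu: "2 / R \<le> nu x" using True np R(1) by (simp add: nu_eq field_simps)
          have "(M + 1) * S x \<le> \<tau> * nu x * S x"
          proof (rule mult_right_mono[OF _ S0])
            have "M + 1 = (M + 1) * R / 2 * (2 / R)" using R(1) by simp
            also have "\<dots> \<le> \<tau> * nu x" using tau nu R(1) by (intro mult_mono) auto
            finally show "M + 1 \<le> \<tau> * nu x" .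
          qed
          then have "Q x - \<tau> * nu x * S x \<le> - S x" using QS[OF True] by (simp add: distrib_right)
          then have "exp (2 * \<tau> * nu x) * (Q x - \<tau> * nu x * S x) \<le> exp (2 * \<tau> * nu x) * (- S x)" by (intro mult_left_mono) auto
          moreover have "exp (2 * \<tau> / r) * (\<kappa> x * S x) \<le> exp (2 * \<tau> * nu x) * S x"
          proof (cases "r \<le> norm x")
            case True then show ?thesis using S0 by (simp add: kz)
          next
            case False
            have "2 * \<tau> / r \<le> 2 * \<tau> * nu x" unfolding nu_eq using False tau(1) np by (simp add: frac_le)
            moreover have "\<kappa> x * S x \<le> 1 * S x" by (intro mult_right_mono k01 S0)
            ultimately show ?thesis using k01 S0 by (intro mult_mono) auto
          qed
          moreover have "0 \<le> exp (4 * \<tau> / R) * Q x" using Q0 by simp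
          ultimately show ?thesis by (simp add: right_diff_distrib mult_ac)
        next
          case False
          have "nu x \<le> 2 / R" using False np R(1) by (simp add: nu_eq field_simps)
          then have "2 * \<tau> * nu x \<le> 2 * \<tau> * (2 / R)" using tau(1) by (intro mult_left_mono) auto
          then have "exp (2 * \<tau> * nu x) * Q x \<le> exp (4 * \<tau> / R) * Q x" using Q0 by (intro mult_right_mono) auto
          moreover have "0 \<le> \<tau> * (exp (2 * \<tau> * nu x) * nu x * S x)" using tau(1) S0 np by (simp add: nu_eq)
          moreover have "\<kappa> x = 0" using False r by (intro kz) simp
          ultimately show ?thesis by simp
        qed
      qed
    qed (use i1 ci Qi in auto)
    also have "\<dots> = exp (4 * \<tau> / R) * q - exp (2 * \<tau> / r) * c" using ci Qi by (simp add: q_def c_def)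
    finally show ?thesis by simp
  qed
  define a where "a = 2 / r - 4 / R"
  have a: "0 < a" using r r0 R(1) by (simp add: a_def field_simps)
  \<comment> \<open>Large enough for \<open>bound\<close>, and such that a \<open>\<tau>\<close>
    exceeds q / c; then so does exp(a \<open>\<tau>\<close>), a contradiction.\<close>
  define \<tau> where "\<tau> = max 0 ((M + 1) * R / 2) + (q / c) / a + 1"
  have q0: "0 \<le> q" unfolding q_def using Q0 by (intro Bochner_Integration.integral_nonneg) auto
  have t: "0 \<le> \<tau>" "(M + 1) * R / 2 \<le> \<tau>" "(q / c) / a < \<tau>"
    using divide_nonneg_pos[OF divide_nonneg_pos[OF q0 c] a]
      max.cobounded2[of "(M + 1) * R / 2" 0] max.cobounded1[of 0 "(M + 1) * R / 2"]
    unfolding \<tau>_def by linarith+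
  have "exp (2 * \<tau> / r) = exp (4 * \<tau> / R) * exp (a * \<tau>)"
    by (simp add: a_def algebra_simps flip: exp_add)
  with bound[OF t(1,2)] have "exp (4 * \<tau> / R) * (exp (a * \<tau>) * c) \<le> exp (4 * \<tau> / R) * q" by (simp add: mult_ac)
  then have "exp (a * \<tau>) * c \<le> q" by simp
  moreover have "a * \<tau> \<le> exp (a * \<tau>)" using exp_ge_add_one_self[of "a * \<tau>"] by linarith
  moreover have "q / c < a * \<tau>" using t(3) pos_divide_less_eq[OF a, of "q / c" \<tau>] by (simp add: mult.commute)
  moreover have "exp (a * \<tau>) \<le> q / c"
    using \<open>exp (a * \<tau>) * c \<le> q\<close> pos_le_divide_eq[OF c] by blast
  ultimately show False by linarith
qed

section \<open>Unique continuation on balls and on connected sets\<close>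

lemma weqs_translate:
  assumes W: "open W" and u: "continuous_on W u" and f: "continuous_on W f" and s: "weqs W f u"
  shows "weqs {x. x + q \<in> W} (\<lambda>x. f (x + q)) (\<lambda>x. u (x + q))"
  unfolding weqs_def
proof (intro allI impI conjI)
  fix \<phi> assume t: "test1 {x. x + q \<in> W} \<phi>"
  define p where "p y = \<phi> (y + (- q))" for y
  have tp: "test1 W p"
  proof -
    obtain K where K: "compact K" "K \<subseteq> {x. x + q \<in> W}" "\<And>x. x \<notin> K \<Longrightarrow> \<phi> x = 0"
      using t unfolding test1_def csupp_def by blast
    have "csupp W p" unfolding csupp_def p_def
    proof (intro exI[of _ "(\<lambda>x. x + q) ` K"] conjI allI impI)
      show "compact ((\<lambda>x. x + q) ` K)" by (intro compact_continuous_image continuous_intros K)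
      show "(\<lambda>x. x + q) ` K \<subseteq> W" using K(2) by auto
      fix x assume "x \<notin> (\<lambda>x. x + q) ` K"
      then have "x + - q \<notin> K" using image_eqI[of x "\<lambda>x. x + q" "x + - q" K] by auto
      then show "\<phi> (x + - q) = 0" by (rule K(3))
    qed
    then show ?thesis using t Ck_on_shift[of 1 \<phi> "- q"] unfolding test1_def p_def by blast
  qed
  note tc = test1_continuous[OF tp]
  have uc: "continuous_on W (\<lambda>x. u x $ i)" for i by (intro continuous_on_component u)
  have px: "p (x + q) = \<phi> x" "partial i p (x + q) = partial i \<phi> x" for x i
  proof -
    have "partial i p (x + q) = partial i \<phi> (x + q + - q)" unfolding p_def by (rule partial_shift)
    then show "p (x + q) = \<phi> x" "partial i p (x + q) = partial i \<phi> x" by (simp_all add: p_def)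
  qed
  have shift: "(LBINT x. h (x + q)) = (LBINT x. h x)" if "continuous_on W h" "csupp W h" for h :: "real^3 \<Rightarrow> real"
    using integrable_csupp[OF that] by (intro integral_lborel_shift) auto
  have "(LBINT x. (\<lambda>x. \<Sum>i\<in>UNIV. u x $ i * partial i p x) (x + q)) = (LBINT x. (\<Sum>i\<in>UNIV. u x $ i * partial i p x))"
    by (rule shift) (intro continuous_intros uc tc csupp_sum csupp_mult)+
  then show "(LBINT x. (\<Sum>i\<in>UNIV. u (x + q) $ i * partial i \<phi> x)) = 0"
    using s tp unfolding weqs_def px by simp
  fix i j
  let ?h = "\<lambda>x. u x $ j * partial i p x - u x $ i * partial j p x + f x * (\<Sum>k\<in>UNIV. levi i j k * u x $ k) * p x"
  have "(LBINT x. ?h (x + q)) = (LBINT x. ?h x)"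
    by (rule shift) (intro continuous_intros uc f tc csupp_sum csupp_mult csupp_add csupp_diff)+
  then show "(LBINT x. u (x + q) $ j * partial i \<phi> x - u (x + q) $ i * partial j \<phi> x
      + f (x + q) * (\<Sum>k\<in>UNIV. levi i j k * u (x + q) $ k) * \<phi> x) = 0"
    using s tp unfolding weqs_def px by simp
qed

lemma unique_continuation_ball:
  assumes W: "open W" and u: "continuous_on W u" and f: "continuous_on W f" and s: "weqs W f u"
    and R: "0 < R" "cball q R \<subseteq> W" and d: "0 < d" "\<And>x. x \<in> ball q d \<Longrightarrow> x \<in> W \<Longrightarrow> u x = 0"
    and p: "p \<in> ball q (R / 2)"
  shows "u p = 0"
proof -
  let ?W = "{x. x + q \<in> W}"
  have o: "open ?W"
    using open_vimage[OF W, of "\<lambda>x. x + q"] by (simp add: vimage_def continuous_intros)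
  have c: "continuous_on ?W (\<lambda>x. g (x + q))" if "continuous_on W g" for g :: "real^3 \<Rightarrow> 'b::topological_space"
    by (rule continuous_on_compose2[OF that]) (auto intro!: continuous_intros)
  have "(\<lambda>x. u (x + q)) (p - q) = 0"
  proof (rule unique_continuation_origin[OF o c[OF u] c[OF f] weqs_translate[OF W u f s] R(1) _ d(1)])
    show "cball 0 R \<subseteq> ?W"
    proof
      fix x assume "x \<in> cball (0::real^3) R"
      then have "x + q \<in> cball q R" by (simp add: dist_norm norm_minus_commute)
      then show "x \<in> ?W" using R(2) by blast
    qed
    show "u (x + q) = 0" if "x \<in> ball 0 d" "x \<in> ?W" for x
      using d(2)[of "x + q"] that by (simp add: dist_norm)
    show "norm (p - q) < R / 2" using p by (simp add: dist_norm norm_minus_commute)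
  qed
  then show ?thesis by simp
qed

text \<open>The common form to which classical and weak solutions are reduced. The continuous
  representative may vary with the point, so nothing has to be glued.\<close>

definition local_sol :: "(real^3) set \<Rightarrow> (real^3 \<Rightarrow> real) \<Rightarrow> (real^3 \<Rightarrow> real^3) \<Rightarrow> bool" where
  "local_sol U f u \<longleftrightarrow> (\<forall>p\<in>U. \<exists>r v. 0 < r \<and> ball p r \<subseteq> U \<and> continuous_on (ball p r) v \<and> weqs (ball p r) f v
     \<and> negligible {x \<in> ball p r. u x \<noteq> v x})"

lemma continuous_negligible_zero:
  fixes v :: "real^3 \<Rightarrow> real^3"
  assumes S: "open S" and v: "continuous_on S v" and n: "negligible {x \<in> S. v x \<noteq> 0}" and x: "x \<in> S"
  shows "v x = 0"
proof (rule ccontr)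
  assume "v x \<noteq> 0"
  have "open {x \<in> S. v x \<noteq> 0}"
    using continuous_open_preimage[OF v S, of "- {0}"] by (simp add: vimage_def Int_def open_Compl)
  then show False
    using n x \<open>v x \<noteq> 0\<close> open_not_negligible by blast
qed

text \<open>The points near which u vanishes almost everywhere form a nonempty subset of U that is
  open and relatively closed, hence all of U by connectedness.\<close>

theorem unique_continuation:
  assumes U: "open U" "connected U" and f: "continuous_on U f" and s: "local_sol U f u"
    and p: "p \<in> U" "0 < e" "negligible {x \<in> ball p e. u x \<noteq> 0}"
  shows "negligible {x \<in> U. u x \<noteq> 0}"
proof -
  define Z where "Z = {q \<in> U. \<exists>e>0. negligible {x \<in> ball q e. u x \<noteq> 0}}"
  have sub: "\<exists>e>0. negligible {x \<in> ball y e. u x \<noteq> 0}" if "y \<in> ball q e" "negligible {x \<in> ball q e. u x \<noteq> 0}" for y q e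
  proof -
    note yq = that(1)
    obtain e' where e': "e' > 0" "ball y e' \<subseteq> ball q e" by (rule openE[OF open_ball yq])
    have "negligible {x \<in> ball y e'. u x \<noteq> 0}"
      by (rule negligible_subset[OF that(2)]) (use e'(2) in blast)
    then show ?thesis using e'(1) by blast
  qed
  have oZ: "open Z" unfolding open_contains_ball
  proof
    fix q assume "q \<in> Z"
    then obtain e where q: "q \<in> U" "e > 0" "negligible {x \<in> ball q e. u x \<noteq> 0}" by (auto simp: Z_def)
    obtain e' where e': "e' > 0" "ball q e' \<subseteq> U" using U(1) q(1) open_contains_ball by blast
    have "ball q (min e e') \<subseteq> Z"
    proof
      fix y assume "y \<in> ball q (min e e')"
      then have y: "y \<in> ball q e" "y \<in> U" using e'(2) by auto
      then show "y \<in> Z" using sub[OF y(1) q(3)] by (simp add: Z_def)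
    qed
    then show "\<exists>e>0. ball q e \<subseteq> Z" using q(2) e'(1) by (intro exI[of _ "min e e'"]) auto
  qed
  have step: "x \<in> Z" if x: "x \<in> U" and cl: "x \<in> closure Z" for x
  proof -
    obtain r v where r: "0 < r" "ball x r \<subseteq> U" "continuous_on (ball x r) v" "weqs (ball x r) f v"
      "negligible {y \<in> ball x r. u y \<noteq> v y}" using s x unfolding local_sol_def by blast
    \<comment> \<open>With q this close to x, the closed ball of radius r / 2 about q lies in
      \<open>ball x r\<close>, and its concentric half contains
      \<open>ball x (r / 8)\<close>.\<close>
    obtain q where q: "q \<in> Z" "dist q x < r / 8"
      using cl[unfolded closure_approachable, rule_format, of "r / 8"] r(1) by auto
    obtain e where e: "e > 0" "negligible {y \<in> ball q e. u y \<noteq> 0}" using q(1) by (auto simp: Z_def)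
    define e' where "e' = min e (r / 8)"
    have e': "0 < e'" "e' \<le> e" "e' \<le> r / 8" using e(1) r(1) by (auto simp: e'_def)
    have in_x: "ball q e' \<subseteq> ball x r"
    proof
      fix y assume "y \<in> ball q e'"
      then show "y \<in> ball x r" using q(2) e'(3) dist_triangle[of x y q] r(1) by (simp add: dist_commute)
    qed
    have n1: "negligible {y \<in> ball q e'. v y \<noteq> 0}"
      by (rule negligible_subset[OF negligible_Un[OF e(2) r(5)]]) (use in_x e'(2) in auto)
    have v0: "v y = 0" if "y \<in> ball q e'" for y
      by (rule continuous_negligible_zero[OF open_ball continuous_on_subset[OF r(3) in_x] n1 that])
    have "v y = 0" if y: "y \<in> ball x (r / 8)" for y
    proof (rule unique_continuation_ball[OF open_ball r(3) continuous_on_subset[OF f r(2)] r(4), of "r / 2" q e' y])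
      show "cball q (r / 2) \<subseteq> ball x r"
      proof
        fix y assume "y \<in> cball q (r / 2)"
        then show "y \<in> ball x r" using q(2) dist_triangle[of x y q] r(1) by (simp add: dist_commute)
      qed
      show "y \<in> ball q (r / 2 / 2)" using y q(2) dist_triangle[of q y x] by (simp add: dist_commute)
    qed (use r(1) e'(1) v0 in auto)
    then have "negligible {y \<in> ball x (r / 8). u y \<noteq> 0}"
      using r(1) by (intro negligible_subset[OF r(5)]) auto
    then show ?thesis using x r(1) unfolding Z_def by (intro CollectI conjI exI[of _ "r / 8"]) auto
  qed
  have "Z = U"
  proof (rule ccontr)
    assume "Z \<noteq> U"
    moreover have "Z \<subseteq> U" by (auto simp: Z_def)
    moreover have "p \<in> Z" using p by (auto simp: Z_def)
    moreover have "openin (top_of_set U) Z" using oZ \<open>Z \<subseteq> U\<close> U(1) by (simp add: openin_open_eq)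
    moreover have "closedin (top_of_set U) Z"
      unfolding closedin_closed using step \<open>Z \<subseteq> U\<close> closure_subset by (intro exI[of _ "closure Z"]) auto
    ultimately show False using U(2) unfolding connected_clopen by blast
  qed
  show ?thesis
  proof (subst locally_negligible_alt, intro ballI)
    fix x assume x: "x \<in> {x \<in> U. u x \<noteq> 0}"
    then obtain e where e: "e > 0" "negligible {y \<in> ball x e. u y \<noteq> 0}" using \<open>Z = U\<close> by (auto simp: Z_def)
    show "\<exists>V. openin (top_of_set {x \<in> U. u x \<noteq> 0}) V \<and> x \<in> V \<and> negligible V"
    proof (intro exI conjI)
      show "openin (top_of_set {x \<in> U. u x \<noteq> 0}) ({x \<in> U. u x \<noteq> 0} \<inter> ball x e)" by (simp add: openin_open_Int)
      show "negligible ({x \<in> U. u x \<noteq> 0} \<inter> ball x e)" by (rule negligible_subset[OF e(2)]) auto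
    qed (use x e(1) in auto)
  qed
qed

subsection \<open>The Newton potential and its regularization\<close>

text \<open>The size of the gradient of the Newton kernel; at 0 it takes the value 0.\<close>

definition nk :: "real^3 \<Rightarrow> real" where "nk x = 1 / (x \<bullet> x)"

lemma nk_nonneg: "0 \<le> nk x" by (simp add: nk_def)

lemma nk_measurable [measurable]: "nk \<in> borel_measurable borel"
  unfolding nk_def by measurable

lemma emeasure_cball_3:
  assumes "0 \<le> r"
  shows "emeasure lborel (cball (c::real^3) r) = ennreal (unit_ball_vol 3 * r ^ 3)"
proof -
  have "emeasure lborel (cball c r) = ennreal (unit_ball_vol (real DIM(real^3)) * r ^ DIM(real^3))"
    by (rule emeasure_cball[OF assms])
  then show ?thesis by simp
qed

text \<open>Dyadic balls replace polar coordinates: the n-th term is at most a constant times R /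
  2^n, and the geometric series converges.\<close>

lemma nn_integral_nk:
  assumes R: "0 < R"
  shows "(\<integral>\<^sup>+x. ennreal (indicator (cball 0 R) x * nk x) \<partial>lborel) \<le> ennreal (8 * unit_ball_vol 3 * R)"
proof -
  define V where "V = unit_ball_vol 3"
  have V: "0 \<le> V" unfolding V_def by (rule unit_ball_vol_nonneg) simp
  \<comment> \<open>Bounds the kernel for R / 2^(n+1) < |x| \<le> R / 2^n by its largest value
    there, and extends this bound to the whole ball.\<close>
  define g where "g = (\<lambda>n x. ennreal (4 * 4 ^ n / R\<^sup>2) * indicator (cball (0::real^3) (R / 2 ^ n)) x)"
  have point: "ennreal (indicator (cball 0 R) x * nk x) \<le> (\<Sum>n. g n x)" for x :: "real^3"
  proof (cases "x \<noteq> 0 \<and> norm x \<le> R")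
    case True
    have "\<exists>n. R / 2 ^ n < norm x"
    proof -
      obtain n where "R / norm x < 2 ^ n" using real_arch_pow[of 2 "R / norm x"] by auto
      then show ?thesis using True by (intro exI[of _ n]) (simp add: field_simps)
    qed
    define m where "m = (LEAST n. R / 2 ^ n < norm x)"
    have m: "R / 2 ^ m < norm x" unfolding m_def by (rule LeastI_ex) fact
    have "m \<noteq> 0"
    proof
      assume "m = 0" then show False using m True by simp
    qed
    then obtain n where n: "m = Suc n" using not0_implies_Suc by blast
    have n1: "\<not> R / 2 ^ n < norm x" using not_less_Least[of n "\<lambda>n. R / 2 ^ n < norm x"] n unfolding m_def by simp
    have "R\<^sup>2 \<le> 4 * 4 ^ n * (norm x)\<^sup>2"
    proof -
      have "R \<le> 2 * 2 ^ n * norm x" using m n by (simp add: field_simps)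
      then have "R\<^sup>2 \<le> (2 * 2 ^ n * norm x)\<^sup>2" using R by (intro power_mono) auto
      also have "\<dots> = 4 * 4 ^ n * (norm x)\<^sup>2"
        by (simp add: power_mult_distrib flip: power_mult power2_eq_square) (simp add: power_mult mult.commute[of n])
      finally show ?thesis .
    qed
    then have "nk x \<le> 4 * 4 ^ n / R\<^sup>2" using True R by (simp add: nk_def power2_norm_eq_inner field_simps)
    then have "ennreal (indicator (cball 0 R) x * nk x) \<le> g n x"
      using n1 True by (simp add: g_def ennreal_leI)
    also have "\<dots> \<le> (\<Sum>n. g n x)" using sum_le_suminf[OF summableI, of "{n}" "\<lambda>n. g n x"] by simp
    finally show ?thesis .
  next
    case False
    then show ?thesis by (auto simp: nk_def indicator_def)
  qed
  have "(\<integral>\<^sup>+x. ennreal (indicator (cball 0 R) x * nk x) \<partial>lborel) \<le> (\<integral>\<^sup>+x. (\<Sum>n. g n x) \<partial>lborel)"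
    by (rule nn_integral_mono) (rule point)
  also have "\<dots> = (\<Sum>n. \<integral>\<^sup>+x. g n x \<partial>lborel)"
    by (rule nn_integral_suminf) (auto simp: g_def intro!: borel_measurable_times_ennreal borel_measurable_indicator)
  also have "\<dots> = (\<Sum>n. ennreal (4 * V * R * (1 / 2) ^ n))"
  proof (rule suminf_cong)
    fix n
    have "(\<integral>\<^sup>+x. g n x \<partial>lborel) = ennreal (4 * 4 ^ n / R\<^sup>2) * ennreal (V * (R / 2 ^ n) ^ 3)"
      using R by (simp add: g_def nn_integral_cmult_indicator emeasure_cball_3 V_def)
    also have "\<dots> = ennreal (4 * 4 ^ n / R\<^sup>2 * (V * (R / 2 ^ n) ^ 3))"
      by (rule ennreal_mult[symmetric]) (use R V in auto)
    also have "4 * 4 ^ n / R\<^sup>2 * (V * (R / 2 ^ n) ^ 3) = 4 * V * R * (1 / 2) ^ n"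
    proof -
      have "(4::real) ^ n = 2 ^ n * 2 ^ n" by (simp flip: power_mult_distrib)
      then show ?thesis using R by (simp add: field_simps power2_eq_square power3_eq_cube)
    qed
    finally show "(\<integral>\<^sup>+x. g n x \<partial>lborel) = ennreal (4 * V * R * (1 / 2) ^ n)" .
  qed
  also have "\<dots> = ennreal (\<Sum>n. 4 * V * R * (1 / 2) ^ n)"
    by (rule suminf_ennreal2) (use R V in \<open>auto intro!: summable_mult summable_geometric\<close>)
  also have "(\<Sum>n. 4 * V * R * (1 / 2) ^ n) = 4 * V * R * (\<Sum>n. (1 / 2) ^ n)"
    by (rule suminf_mult) (auto intro!: summable_geometric)
  also have "\<dots> = 8 * V * R" by (subst suminf_geometric) auto
  finally show ?thesis unfolding V_def .
qed

lemma powr_square: "0 < n \<Longrightarrow> (n\<^sup>2) powr (- 3 / 2) = 1 / n ^ 3" "0 < n \<Longrightarrow> (n\<^sup>2) powr (- 5 / 2) = 1 / n ^ 5" for n :: real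
proof -
  assume n: "0 < n"
  have p: "n\<^sup>2 = n powr 2" using n by (simp add: powr_numeral)
  have "(n\<^sup>2) powr (- 3 / 2) = n powr (- 3)" unfolding p powr_powr by simp
  also have "\<dots> = 1 / n ^ 3" using n powr_numeral[of n "num.Bit1 num.One"] by (simp add: powr_minus_divide)
  finally show "(n\<^sup>2) powr (- 3 / 2) = 1 / n ^ 3" .
  have "(n\<^sup>2) powr (- 5 / 2) = n powr (- 5)" unfolding p powr_powr by simp
  also have "\<dots> = 1 / n ^ 5" using n by (simp add: powr_minus_divide powr_numeral)
  finally show "(n\<^sup>2) powr (- 5 / 2) = 1 / n ^ 5" .
qed

text \<open>\<open>hreg e\<close> is \<open>s\<^bsup>-3/2\<^esup>\<close>, continued below \<open>e\<^sup>2\<close> by its tangent. Hence \<open>kern e\<close> is a \<open>C\<^sup>1\<close> gradient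
  field that equals the gradient of \<open>1 / norm x\<close> outside the ball of radius \<open>e\<close>, and its divergence
  \<open>- dens e\<close> lives on that ball.\<close>

definition hreg :: "real \<Rightarrow> real \<Rightarrow> real" where
  "hreg e s = (if s \<le> e\<^sup>2 then 5 / 2 / e ^ 3 - 3 / 2 / e ^ 5 * s else s powr (- 3 / 2))"

definition hreg' :: "real \<Rightarrow> real \<Rightarrow> real" where
  "hreg' e s = (if s \<le> e\<^sup>2 then - 3 / 2 / e ^ 5 else - 3 / 2 * s powr (- 5 / 2))"

definition kern :: "real \<Rightarrow> 3 \<Rightarrow> real^3 \<Rightarrow> real" where
  "kern e j x = - x $ j * hreg e (x \<bullet> x)"

definition dens :: "real \<Rightarrow> real^3 \<Rightarrow> real" where
  "dens e x = 15 / 2 / e ^ 5 * max 0 (e\<^sup>2 - x \<bullet> x)"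

lemma hreg_deriv:
  assumes e: "0 < e" shows "(hreg e has_real_derivative hreg' e s) (at s)"
proof -
  have U: "{..e\<^sup>2} \<union> {e\<^sup>2<..} = (UNIV::real set)" by auto
  have "((\<lambda>x. if x \<in> {..e\<^sup>2} then 5 / 2 / e ^ 3 - 3 / 2 / e ^ 5 * x else x powr (- 3 / 2)) has_derivative
      (if s \<in> {..e\<^sup>2} then (*) (- 3 / 2 / e ^ 5) else (*) (- 3 / 2 * s powr (- 5 / 2)))) (at s within {..e\<^sup>2} \<union> {e\<^sup>2<..})"
  proof (rule has_derivative_If_within_closures)
    show "((\<lambda>x. 5 / 2 / e ^ 3 - 3 / 2 / e ^ 5 * x) has_derivative (*) (- 3 / 2 / e ^ 5)) (at s within {..e\<^sup>2} \<union> closure {..e\<^sup>2} \<inter> closure {e\<^sup>2<..})"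
      unfolding has_field_derivative_def[symmetric]
      by (rule DERIV_cong[OF DERIV_diff[OF DERIV_const DERIV_cmult[OF DERIV_ident]]]) simp
    show "((\<lambda>x. x powr (- 3 / 2)) has_derivative (*) (- 3 / 2 * s powr (- 5 / 2))) (at s within {e\<^sup>2<..} \<union> closure {..e\<^sup>2} \<inter> closure {e\<^sup>2<..})"
      if "s \<in> {e\<^sup>2<..} \<union> closure {..e\<^sup>2} \<inter> closure {e\<^sup>2<..}"
    proof -
      have "e\<^sup>2 \<le> s" using that by auto
      then have "0 < s" using e zero_less_power[OF e, of 2] by linarith
      then have "((\<lambda>x. x powr (- 3 / 2)) has_real_derivative - 3 / 2 * s powr (- 5 / 2)) (at s)"
        using has_real_derivative_powr[of s "- 3 / 2"] by simp
      then show ?thesis unfolding has_field_derivative_def by (rule has_derivative_at_withinI)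
    qed
    assume "s \<in> closure {..e\<^sup>2}" "s \<in> closure {e\<^sup>2<..}"
    then have s: "s = e\<^sup>2" by auto
    show "5 / 2 / e ^ 3 - 3 / 2 / e ^ 5 * s = s powr (- 3 / 2)"
      unfolding s powr_square[OF e] using e by (simp add: field_simps eval_nat_numeral)
    show "(*) (- 3 / 2 / e ^ 5) = (*) (- 3 / 2 * s powr (- 5 / 2))"
      using powr_square(2)[OF e] unfolding s by (simp add: powr_minus)
  qed (use U in auto)
  then show ?thesis unfolding U has_field_derivative_def hreg_def[abs_def] hreg'_def by (simp split: if_splits)
qed

lemma continuous_hreg': assumes e: "0 < e" shows "continuous_on UNIV (hreg' e)"
proof -
  have eq: "hreg' e = (\<lambda>s. - 3 / 2 * max s (e\<^sup>2) powr (- 5 / 2))"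
    using powr_square(2)[OF e] by (auto simp: hreg'_def fun_eq_iff max_def)
  have nz: "max s (e\<^sup>2) \<noteq> 0" for s using zero_less_power[OF e, of 2] by (auto simp: max_def)
  show ?thesis unfolding eq by (intro continuous_intros ballI nz)
qed

lemma partial_hreg: "0 < e \<Longrightarrow> partial i (\<lambda>x. hreg e (x \<bullet> x)) x = hreg' e (x \<bullet> x) * (2 * x $ i)"
  using partial_compose[OF differentiable_inner_self hreg_deriv] by (simp add: partial_inner_self)

lemma partial_kern:
  assumes "0 < e"
  shows "partial i (kern e j) x = - (if i = j then hreg e (x \<bullet> x) else 0) - 2 * x $ i * x $ j * hreg' e (x \<bullet> x)"
    and "kern e j differentiable (at x)"
proof -
  have d: "(\<lambda>x. hreg e (x \<bullet> x)) differentiable (at x)"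
    by (rule differentiable_compose_real[OF differentiable_inner_self hreg_deriv[OF assms]])
  have k: "kern e j = (\<lambda>x. - (x $ j * hreg e (x \<bullet> x)))" by (simp add: fun_eq_iff kern_def)
  show "kern e j differentiable (at x)" unfolding k by (intro derivative_intros differentiable_nth d)
  show "partial i (kern e j) x = - (if i = j then hreg e (x \<bullet> x) else 0) - 2 * x $ i * x $ j * hreg' e (x \<bullet> x)"
    unfolding k by (subst partial_uminus, intro derivative_intros differentiable_nth d)
      (simp add: partial_mult[OF differentiable_nth d] partial_nth partial_hreg[OF assms])
qed

lemma Ck_on_kern: assumes e: "0 < e" shows "Ck_on 1 UNIV (kern e j)"
proof -
  have c: "continuous_on UNIV (hreg e)"
    using hreg_deriv[OF e] DERIV_isCont continuous_at_imp_continuous_on by blast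
  have "continuous_on UNIV (partial i (kern e j))" for i
  proof -
    have p: "partial i (kern e j) = (\<lambda>x. - (if i = j then hreg e (x \<bullet> x) else 0) - 2 * x $ i * x $ j * hreg' e (x \<bullet> x))"
      using partial_kern(1)[OF e] by blast
    show ?thesis unfolding p
      by (cases "i = j") (auto intro!: continuous_intros continuous_on_compose2[OF c] continuous_on_compose2[OF continuous_hreg'[OF e]])
  qed
  then have "Ck_on (Suc 0) UNIV (kern e j)"
    unfolding Ck_on_Suc[OF open_UNIV] Ck_on_0 differentiable_on_def
    using partial_kern(2)[OF e] by auto
  then show ?thesis by simp
qed

lemma kern_sym: "0 < e \<Longrightarrow> partial i (kern e j) x = partial j (kern e i) x"
  by (simp add: partial_kern)

lemma kern_divergence:
  assumes e: "0 < e" shows "(\<Sum>j\<in>UNIV. partial j (kern e j) x) = - dens e x"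
proof -
  define s where "s = x \<bullet> x"
  have "(\<Sum>j\<in>UNIV. partial j (kern e j) x) = - 3 * hreg e s - 2 * s * hreg' e s"
    by (simp add: partial_kern[OF e] sum_3 s_def inner_self_sum algebra_simps)
  also have "\<dots> = - dens e x"
  proof (cases "s \<le> e\<^sup>2")
    case True
    then show ?thesis using e by (simp add: hreg_def hreg'_def dens_def s_def[symmetric] field_simps eval_nat_numeral)
  next
    case False
    then have "0 < s" using zero_less_power[OF e, of 2] by linarith
    then have "s * s powr (- 5 / 2) = s powr (- 3 / 2)"
      using powr_add[of s 1 "- 5 / 2"] by simp
    then have "3 * s powr (- 3 / 2) = 3 * (s * s powr (- 5 / 2))" by simp
    then show ?thesis using False by (simp add: hreg_def hreg'_def dens_def s_def[symmetric])
  qed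
  finally show ?thesis .
qed

text \<open>The factor of -x_j in the kernel is at most 5/2 times the inverse cube of |x|; 5/2 comes
  from the value of the tangent at s = 0. The bound is uniform in the regularization radius.\<close>

lemma kern_bound:
  assumes e: "0 < e" shows "\<bar>kern e j x\<bar> \<le> 5 / 2 * nk x"
proof (cases "x = 0")
  case False
  then have n: "0 < norm x" by simp
  have h0: "0 \<le> hreg e (x \<bullet> x)" and h: "hreg e (x \<bullet> x) \<le> 5 / 2 * (1 / norm x ^ 3)"
  proof -
    have *: "0 \<le> hreg e (x \<bullet> x) \<and> hreg e (x \<bullet> x) \<le> 5 / 2 * (1 / norm x ^ 3)"
    proof (cases "x \<bullet> x \<le> e\<^sup>2")
      case True
      then have l: "norm x \<le> e" using e by (simp flip: power2_norm_eq_inner)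
      have "3 / 2 / e ^ 5 * (x \<bullet> x) \<le> 3 / 2 / e ^ 5 * e\<^sup>2" using True e by (intro mult_left_mono) auto
      also have "\<dots> = 3 / 2 / e ^ 3" using e by (simp add: field_simps eval_nat_numeral)
      finally have 1: "3 / 2 / e ^ 5 * (x \<bullet> x) \<le> 3 / 2 / e ^ 3" .
      have pos: "0 \<le> 1 / e ^ 3" using e by simp
      have "1 / e ^ 3 \<le> 1 / norm x ^ 3" using l n e by (intro divide_left_mono power_mono mult_pos_pos zero_less_power) auto
      moreover have "0 \<le> 3 / 2 / e ^ 5 * (x \<bullet> x)" using e by simp
      moreover have "hreg e (x \<bullet> x) = 5 / 2 * (1 / e ^ 3) - 3 / 2 / e ^ 5 * (x \<bullet> x)" using True by (simp add: hreg_def)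
      moreover have "3 / 2 / e ^ 3 = 3 / 2 * (1 / e ^ 3)" by simp
      ultimately show ?thesis using 1 pos by linarith
    next
      case False
      then show ?thesis using n powr_square(1)[OF n] by (simp add: hreg_def divide_simps flip: power2_norm_eq_inner)
    qed
    show "0 \<le> hreg e (x \<bullet> x)" "hreg e (x \<bullet> x) \<le> 5 / 2 * (1 / norm x ^ 3)" using * by auto
  qed
  have "\<bar>kern e j x\<bar> = \<bar>x $ j\<bar> * hreg e (x \<bullet> x)" using h0 by (simp add: kern_def abs_mult)
  also have "\<dots> \<le> norm x * (5 / 2 * (1 / norm x ^ 3))" using h h0 by (intro mult_mono component_le_norm_cart) auto
  also have "\<dots> = 5 / 2 * nk x" using n by (simp add: nk_def eval_nat_numeral flip: power2_norm_eq_inner)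
  finally show ?thesis .
qed (simp add: kern_def nk_def)

definition kern0 :: "3 \<Rightarrow> real^3 \<Rightarrow> real" where "kern0 j x = - x $ j * (x \<bullet> x) powr (- 3 / 2)"

lemma kern0_measurable [measurable]: "kern0 j \<in> borel_measurable borel"
  unfolding kern0_def by measurable

lemma kern_measurable: "0 < e \<Longrightarrow> kern e j \<in> borel_measurable borel"
  using Ck_on_continuous[OF Ck_on_kern] borel_measurable_continuous_onI by blast

lemma kern_outside: "0 < e \<Longrightarrow> e < norm x \<Longrightarrow> kern e j x = kern0 j x"
proof -
  assume "0 < e" "e < norm x"
  then have "\<not> x \<bullet> x \<le> e\<^sup>2" by (simp flip: power2_norm_eq_inner)
  then show ?thesis by (simp add: kern_def kern0_def hreg_def)
qed

lemma kern0_bound: "\<bar>kern0 j x\<bar> \<le> 5 / 2 * nk x"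
proof (cases "x = 0")
  case False
  then show ?thesis using kern_bound[of "norm x / 2" j x] kern_outside[of "norm x / 2" x j] by simp
qed (simp add: kern0_def nk_def)

lemma kern_approx:
  assumes e: "0 < e" shows "\<bar>kern e j x - kern0 j x\<bar> \<le> 5 * (indicator (cball 0 e) x * nk x)"
proof (cases "norm x \<le> e")
  case True
  then show ?thesis using kern_bound[OF e, of j x] kern0_bound[of j x] by simp
qed (simp add: kern_outside[OF e])

lemma continuous_dens: "continuous_on UNIV (dens e)"
  unfolding dens_def by (intro continuous_intros)

lemma dens_nonneg: "0 < e \<Longrightarrow> 0 \<le> dens e x" by (simp add: dens_def)

lemma dens_support: "0 < e \<Longrightarrow> e < norm x \<Longrightarrow> dens e x = 0"
  by (simp add: dens_def flip: power2_norm_eq_inner)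

lemma csupp_dens: assumes "0 < e" shows "csupp UNIV (dens e)"
  unfolding csupp_def using dens_support[OF assms] by (intro exI[of _ "cball 0 e"]) auto

lemma integrable_dens: "0 < e \<Longrightarrow> integrable lborel (dens e)"
  by (rule integrable_csupp[OF continuous_dens csupp_dens])

text \<open>Equal to 4 pi, but only its positivity and its independence of the radius enter.\<close>

definition mass :: real where "mass = (LBINT x. dens 1 x)"

lemma mass_pos: "0 < mass"
  unfolding mass_def
  by (rule integral_pos_continuous[OF continuous_dens csupp_dens dens_nonneg, of 1 0]) (simp_all add: dens_def)

text \<open>The kernels of radius e and 1 agree far out, so their difference has compact support and
  its divergence integrates to 0. This replaces the evaluation of the integral.\<close>

lemma integral_dens:
  assumes e: "0 < e" shows "(LBINT x. dens e x) = mass"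
proof -
  define b where "b = (\<lambda>j x. kern e j x - kern 1 j x)"
  have C: "Ck_on 1 UNIV (b j)" for j
    unfolding b_def by (intro Ck_on_diff open_UNIV Ck_on_kern e zero_less_one)
  have s: "csupp UNIV (b j)" for j
    unfolding csupp_def b_def
    by (rule exI[of _ "cball 0 (max e 1)"]) (use e in \<open>auto simp: kern_outside\<close>)
  have "0 = (\<Sum>j\<in>UNIV. LBINT x. partial j (b j) x)"
    using integral_partial_zero[OF C s] by simp
  also have "\<dots> = (LBINT x. (\<Sum>j\<in>UNIV. partial j (b j) x))"
    by (rule Bochner_Integration.integral_sum[symmetric], rule integrable_csupp[of UNIV])
      (use Ck_on_continuous[OF Ck_on_partial[OF open_UNIV, of 0]] C csupp_partial[OF s] in auto)
  also have "(\<lambda>x. \<Sum>j\<in>UNIV. partial j (b j) x) = (\<lambda>x. dens 1 x - dens e x)"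
  proof
    fix x
    have "(\<Sum>j\<in>UNIV. partial j (b j) x) = (\<Sum>j\<in>UNIV. partial j (kern e j) x - partial j (kern 1 j) x)"
      unfolding b_def by (intro sum.cong refl partial_diff partial_kern(2) e zero_less_one)
    then show "(\<Sum>j\<in>UNIV. partial j (b j) x) = dens 1 x - dens e x"
      unfolding sum_subtractf by (simp add: kern_divergence[OF e] kern_divergence[OF zero_less_one])
  qed
  also have "(LBINT x. dens 1 x - dens e x) = mass - (LBINT x. dens e x)"
    unfolding mass_def using integrable_dens[OF e] integrable_dens[OF zero_less_one] by simp
  finally show ?thesis by simp
qed

lemma conv_dens_uniform:
  assumes g: "continuous_on UNIV g" "csupp UNIV g" and e: "0 < e"
  shows "\<exists>d>0. \<forall>r x. 0 < r \<and> r < d \<longrightarrow> \<bar>conv (dens r) g x - mass * g x\<bar> \<le> e * mass"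
proof -
  from conv_concentrated[OF g e] obtain d where d: "d > 0" "\<And>k r x. integrable lborel k \<and> (\<forall>y. 0 \<le> k y) \<and> (\<forall>y. r < norm y \<longrightarrow> k y = 0) \<and> r < d
    \<Longrightarrow> \<bar>conv k g x - (LBINT y. k y) * g x\<bar> \<le> e * (LBINT y. k y)" by blast
  have "\<bar>conv (dens r) g x - mass * g x\<bar> \<le> e * mass" if "0 < r" "r < d" for r x
    using d(2)[of "dens r" r x] that by (simp add: integrable_dens dens_nonneg dens_support integral_dens)
  then show ?thesis using d(1) by blast
qed

subsection \<open>Testing against continuous functions\<close>

text \<open>Continuous tests approximate the indicator of a compact set T inside B. Applied to
  compact subsets of the set where d is positive this makes them null sets, and inner regularity
  passes to the whole set.\<close>

lemma AE_nonpos_if_tests: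
  fixes d :: "real^3 \<Rightarrow> real"
  assumes B: "open B" "bounded B" and d: "integrable lborel d"
    and test: "\<And>\<phi>. continuous_on UNIV \<phi> \<Longrightarrow> csupp B \<phi> \<Longrightarrow> (\<And>x. 0 \<le> \<phi> x) \<Longrightarrow> (LBINT x. d x * \<phi> x) \<le> 0"
  shows "AE x in lborel. x \<in> B \<longrightarrow> d x \<le> 0"
proof -
  have dm [measurable]: "d \<in> borel_measurable borel" using d by auto
  have Bm [measurable]: "B \<in> sets borel" using B(1) by simp
  have neg: "(LBINT x. d x * indicator T x) \<le> 0" if T: "compact T" "T \<subseteq> B" "T \<noteq> {}" for T
  proof -
    obtain e where e: "e > 0" "(\<Union>x\<in>T. ball x e) \<subseteq> B" by (rule compact_subset_open_imp_ball_epsilon_subset[OF T(1) B(1) T(2)])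
    \<comment> \<open>Tent functions over T whose slope grows with n; the summand 2 / e already
      confines the support of the first to distance e / 2 from T.\<close>
    define \<phi> where "\<phi> = (\<lambda>n x. max 0 (1 - (real n + 2 / e) * infdist x T))"
    have cont: "continuous_on UNIV (\<phi> n)" for n unfolding \<phi>_def by (intro continuous_intros)
    have nn: "0 \<le> \<phi> n x" "\<phi> n x \<le> 1" for n x
      using e infdist_nonneg[of x T] by (auto simp: \<phi>_def)
    have sub: "{x. infdist x T \<le> e / 2} \<subseteq> B"
    proof
      fix x assume "x \<in> {x. infdist x T \<le> e / 2}"
      moreover obtain y where y: "y \<in> T" "infdist x T = dist x y"
        by (rule infdist_attains_inf[OF compact_imp_closed[OF T(1)] T(3)])
      ultimately have "x \<in> ball y e" using e by (simp add: dist_commute)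
      then show "x \<in> B" using e(2) y(1) by blast
    qed
    have out: "\<phi> n x = 0" if "x \<notin> {x. infdist x T \<le> e / 2}" for n x
    proof -
      have "1 = 2 / e * (e / 2)" using e by simp
      also have "\<dots> \<le> (real n + 2 / e) * infdist x T" using that e by (intro mult_mono) auto
      finally show ?thesis by (simp add: \<phi>_def)
    qed
    have supp: "csupp B (\<phi> n)" for n
      unfolding csupp_def using compact_infdist_le[OF T(3,1), of "e / 2"] e(1) sub out
      by (intro exI[of _ "{x. infdist x T \<le> e / 2}"]) auto
    have lim: "(\<lambda>n. \<phi> n x) \<longlonglongrightarrow> indicator T x" for x
    proof (cases "x \<in> T")
      case True
      then have "\<phi> n x = 1" for n by (simp add: \<phi>_def)
      then show ?thesis using True by simp
    next
      case False
      then have pos: "0 < infdist x T" by (rule infdist_pos_not_in_closed[OF compact_imp_closed[OF T(1)] T(3)])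
      obtain N where N: "1 / infdist x T \<le> real N" using real_arch_simple by blast
      have "\<phi> n x = 0" if "n \<ge> N" for n
      proof -
        have "1 / infdist x T \<le> real n + 2 / e" using N that e by (smt (verit) divide_pos_pos of_nat_mono)
        then have "1 \<le> (real n + 2 / e) * infdist x T" using pos by (simp add: field_simps)
        then show ?thesis by (simp add: \<phi>_def)
      qed
      then have "eventually (\<lambda>n. \<phi> n x = 0) sequentially" unfolding eventually_sequentially by blast
      then show ?thesis using False by (simp add: tendsto_eventually)
    qed
    have [measurable]: "\<phi> n \<in> borel_measurable borel" "T \<in> sets borel" for n
      using borel_measurable_continuous_onI[OF cont] T(1) borel_compact by auto
    have "(\<lambda>n. LBINT x. d x * \<phi> n x) \<longlonglongrightarrow> (LBINT x. d x * indicator T x)"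
    proof (rule integral_dominated_convergence[where w = "\<lambda>x. \<bar>d x\<bar>"])
      show "AE x in lborel. (\<lambda>n. d x * \<phi> n x) \<longlonglongrightarrow> d x * indicator T x" using lim by (intro AE_I2 tendsto_intros)
      show "AE x in lborel. norm (d x * \<phi> n x) \<le> \<bar>d x\<bar>" for n
        using nn by (intro AE_I2) (simp add: abs_mult mult_left_le)
    qed (use d in auto)
    then show ?thesis by (rule LIMSEQ_le_const2) (use test[OF cont supp nn(1)] in auto)
  qed
  define A where "A = {x \<in> B. 0 < d x}"
  have Am [measurable]: "A \<in> sets borel" unfolding A_def by measurable
  have null: "emeasure lborel T = 0" if T: "compact T" "T \<subseteq> A" for T
  proof (cases "T = {}")
    case False
    have [measurable]: "T \<in> sets borel" using T(1) borel_compact by auto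
    have i: "integrable lborel (\<lambda>x. d x * indicator T x)"
      by (rule Bochner_Integration.integrable_bound[OF d]) (auto simp: indicator_def)
    have nn: "0 \<le> d x * indicator T x" for x using T(2) by (auto simp: A_def indicator_def intro: less_imp_le)
    have "(LBINT x. d x * indicator T x) \<ge> 0" using nn by (intro Bochner_Integration.integral_nonneg)
    with neg[of T] T False have "(LBINT x. d x * indicator T x) = 0" by (auto simp: A_def)
    then have "AE x in lborel. d x * indicator T x = 0"
      using integral_nonneg_eq_0_iff_AE[OF i] nn by simp
    then have "AE x in lborel. x \<notin> T"
      by (rule AE_mp) (use T(2) in \<open>intro AE_I2, auto simp: A_def indicator_def\<close>)
    then show ?thesis using AE_iff_measurable[of T lborel "\<lambda>x. x \<notin> T"] by simp
  qed simp
  have small: "emeasure lborel A \<le> ennreal e" if e: "e > 0" for e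
  proof -
    obtain T where T: "closed T" "T \<subseteq> A" "A - T \<in> lmeasurable" "emeasure lebesgue (A - T) < ennreal e"
      by (rule sets_lebesgue_inner_closed[of A e]) (use e Am in auto)
    have "bounded T" using T(2) B(2) bounded_subset unfolding A_def by blast
    then have c: "compact T" using T(1) by (simp add: compact_eq_bounded_closed)
    have [measurable]: "T \<in> sets borel" using T(1) by simp
    have "emeasure lborel A = emeasure lborel T + emeasure lborel (A - T)"
      using T(2) by (subst plus_emeasure) (auto intro: arg_cong[where f = "emeasure lborel"])
    also have "\<dots> \<le> ennreal e" using null[OF c T(2)] T(4) by (simp add: less_imp_le)
    finally show ?thesis .
  qed
  have "emeasure lborel A \<le> 0"
    by (rule ennreal_le_epsilon) (simp only: add_0 small)
  then have "A \<in> null_sets lborel" by (auto simp: null_sets_def)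
  then show ?thesis by (rule AE_I') (auto simp: A_def)
qed

lemma integrable_mult_csupp:
  fixes c g :: "real^3 \<Rightarrow> real"
  assumes c: "continuous_on UNIV c" and g: "integrable lborel g" "csupp UNIV g"
  shows "integrable lborel (\<lambda>x. c x * g x)"
proof -
  obtain K where "compact K" "\<And>x. x \<notin> K \<Longrightarrow> g x = 0" using g(2) unfolding csupp_def by blast
  then show ?thesis by (intro integrable_mult_compact[OF continuous_on_subset[OF c subset_UNIV] _ g(1)])
qed

text \<open>Fubini's theorem for an even kernel. The integrability required holds because k is
  bounded on the differences of points of the two compact supports.\<close>

lemma conv_adjoint:
  assumes k: "continuous_on UNIV k" "\<And>x. k (- x) = k x"
    and g: "integrable lborel g" "csupp UNIV g" and p: "continuous_on UNIV \<phi>" "csupp UNIV \<phi>"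
  shows "(LBINT x. \<phi> x * conv k g x) = (LBINT x. conv k \<phi> x * g x)"
proof -
  obtain K where K: "compact K" "\<And>x. x \<notin> K \<Longrightarrow> g x = 0" using g(2) unfolding csupp_def by blast
  obtain L where L: "compact L" "\<And>x. x \<notin> L \<Longrightarrow> \<phi> x = 0" using p(2) unfolding csupp_def by blast
  have pi: "integrable lborel \<phi>" by (rule integrable_csupp[OF p])
  have [measurable]: "k \<in> borel_measurable borel" "g \<in> borel_measurable borel" "\<phi> \<in> borel_measurable borel"
    using borel_measurable_continuous_onI[OF k(1)] g(1) pi by auto
  have "continuous_on (L \<times> K) (\<lambda>(x, y). x - y)"
    unfolding split_beta by (intro continuous_intros)
  from compact_continuous_image[OF continuous_on_subset[OF k(1) subset_UNIV] compact_continuous_image[OF this compact_Times[OF L(1) K(1)]]]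
  have "compact (k ` (\<lambda>(x, y). x - y) ` (L \<times> K))" .
  from compact_imp_bounded[OF this]
  obtain M where M': "\<And>z. z \<in> k ` (\<lambda>(x, y). x - y) ` (L \<times> K) \<Longrightarrow> norm z \<le> M"
    unfolding bounded_iff by blast
  have M: "\<bar>k (x - y)\<bar> \<le> M" if "x \<in> L" "y \<in> K" for x y
  proof -
    have "k (x - y) \<in> k ` (\<lambda>(x, y). x - y) ` (L \<times> K)"
      by (rule imageI, rule image_eqI[of _ _ "(x, y)"]) (use that in auto)
    from M'[OF this] show ?thesis by simp
  qed
  have prod: "integrable (lborel \<Otimes>\<^sub>M lborel) (\<lambda>(x, y). \<phi> x * g y)"
    by (rule lborel_pair.Fubini_integrable) (use pi g in \<open>auto simp: abs_mult\<close>)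
  have i: "integrable (lborel \<Otimes>\<^sub>M lborel) (\<lambda>(x, y). \<phi> x * (k (x - y) * g y))"
  proof (rule Bochner_Integration.integrable_bound)
    show "integrable (lborel \<Otimes>\<^sub>M lborel) (\<lambda>z. M * norm (case z of (x, y) \<Rightarrow> \<phi> x * g y))"
      using prod by (intro integrable_mult_right integrable_norm)
    show "(\<lambda>(x, y). \<phi> x * (k (x - y) * g y)) \<in> borel_measurable (lborel \<Otimes>\<^sub>M lborel)" by measurable
    have "\<bar>\<phi> x * (k (x - y) * g y)\<bar> \<le> \<bar>M * \<bar>\<phi> x * g y\<bar>\<bar>" for x y
    proof (cases "x \<in> L \<and> y \<in> K")
      case True
      then have "\<bar>k (x - y)\<bar> * \<bar>\<phi> x * g y\<bar> \<le> M * \<bar>\<phi> x * g y\<bar>" using M by (intro mult_right_mono) auto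
      also have "\<dots> \<le> \<bar>M * \<bar>\<phi> x * g y\<bar>\<bar>" by (rule abs_ge_self)
      finally show ?thesis by (simp add: abs_mult algebra_simps)
    qed (use K L in auto)
    then show "AE z in lborel \<Otimes>\<^sub>M lborel. norm (case z of (x, y) \<Rightarrow> \<phi> x * (k (x - y) * g y)) \<le> norm (M * norm (case z of (x, y) \<Rightarrow> \<phi> x * g y))"
      by (intro AE_I2) (auto simp: split_beta)
  qed
  have "(LBINT x. \<phi> x * conv k g x) = (LBINT x. (LBINT y. \<phi> x * (k (x - y) * g y)))"
    by (simp add: conv_def)
  also have "\<dots> = (LBINT y. (LBINT x. \<phi> x * (k (x - y) * g y)))"
    by (rule lborel_pair.Fubini_integral[symmetric, OF i])
  also have "\<dots> = (LBINT y. conv k \<phi> y * g y)"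
  proof (rule Bochner_Integration.integral_cong[OF refl])
    fix y
    have "k (x - y) = k (y - x)" for x using k(2)[of "x - y"] by simp
    then have "(\<lambda>x. \<phi> x * (k (x - y) * g y)) = (\<lambda>x. k (y - x) * \<phi> x * g y)" by (auto simp: algebra_simps)
    then show "(LBINT x. \<phi> x * (k (x - y) * g y)) = conv k \<phi> y * g y" by (simp add: conv_def)
  qed
  finally show ?thesis .
qed

text \<open>The convolution is moved from the merely integrable g to the continuous test, where it
  converges uniformly.\<close>

lemma conv_dens_weak:
  assumes g: "integrable lborel g" "csupp UNIV g" and p: "continuous_on UNIV \<phi>" "csupp UNIV \<phi>"
  shows "(\<lambda>n. LBINT x. \<phi> x * conv (dens (1 / Suc n)) g x) \<longlonglongrightarrow> mass * (LBINT x. g x * \<phi> x)"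
proof (rule LIMSEQ_I)
  fix \<epsilon> :: real assume \<epsilon>: "0 < \<epsilon>"
  define G where "G = (LBINT x. \<bar>g x\<bar>)"
  have G: "0 \<le> G" by (simp add: G_def)
  define \<eta> where "\<eta> = \<epsilon> / 2 / (mass * G + 1)"
  have \<eta>: "0 < \<eta>" using \<epsilon> G mass_pos by (simp add: \<eta>_def add_nonneg_pos)
  obtain d where d: "d > 0" "\<And>r x. 0 < r \<Longrightarrow> r < d \<Longrightarrow> \<bar>conv (dens r) \<phi> x - mass * \<phi> x\<bar> \<le> \<eta> * mass"
    using conv_dens_uniform[OF p \<eta>] by blast
  obtain N where N: "1 / real (Suc N) < d" using nat_approx_posE[OF d(1)] by blast
  have gp: "integrable lborel (\<lambda>x. \<phi> x * g x)"
    by (rule integrable_mult_csupp[OF p(1) g])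
  show "\<exists>no. \<forall>n\<ge>no. norm ((LBINT x. \<phi> x * conv (dens (1 / Suc n)) g x) - mass * (LBINT x. g x * \<phi> x)) < \<epsilon>"
  proof (intro exI[of _ N] allI impI)
    fix n assume n: "n \<ge> N"
    define r where "r = 1 / real (Suc n)"
    have r: "0 < r" "r < d" using N n frac_le[of 1 1 "real (Suc N)" "real (Suc n)"] unfolding r_def by auto
    have even: "dens r (- x) = dens r x" for x by (simp add: dens_def)
    have pd: "continuous_on UNIV (conv (dens r) \<phi>)"
      by (rule continuous_conv[OF continuous_dens integrable_csupp[OF p] p(2)])
    have i: "integrable lborel (\<lambda>x. conv (dens r) \<phi> x * g x)"
      by (rule integrable_mult_csupp[OF pd g])
    have "(LBINT x. \<phi> x * conv (dens r) g x) - mass * (LBINT x. g x * \<phi> x)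
        = (LBINT x. conv (dens r) \<phi> x * g x) - (LBINT x. mass * (\<phi> x * g x))"
      unfolding conv_adjoint[OF continuous_dens even g p] by (simp add: mult.commute)
    also have "\<dots> = (LBINT x. conv (dens r) \<phi> x * g x - mass * (\<phi> x * g x))"
      using i gp by (subst Bochner_Integration.integral_diff) auto
    also have "\<bar>\<dots>\<bar> \<le> (LBINT x. \<bar>conv (dens r) \<phi> x * g x - mass * (\<phi> x * g x)\<bar>)" by (rule integral_abs_bound)
    also have "\<dots> \<le> (LBINT x. \<eta> * mass * \<bar>g x\<bar>)"
    proof (rule Bochner_Integration.integral_mono)
      fix x
      have "\<bar>conv (dens r) \<phi> x * g x - mass * (\<phi> x * g x)\<bar> = \<bar>conv (dens r) \<phi> x - mass * \<phi> x\<bar> * \<bar>g x\<bar>"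
        by (simp add: algebra_simps flip: abs_mult)
      also have "\<dots> \<le> \<eta> * mass * \<bar>g x\<bar>" using d(2)[OF r] by (intro mult_right_mono) auto
      finally show "\<bar>conv (dens r) \<phi> x * g x - mass * (\<phi> x * g x)\<bar> \<le> \<eta> * mass * \<bar>g x\<bar>" .
    qed (use i gp g in auto)
    also have "\<dots> = \<eta> * (mass * G)" by (simp add: G_def)
    also have "\<dots> \<le> \<epsilon> / 2" unfolding \<eta>_def by (rule scaled_le) (use G \<epsilon> mass_pos in auto)
    also have "\<dots> < \<epsilon>" using \<epsilon> by simp
    finally show "norm ((LBINT x. \<phi> x * conv (dens (1 / Suc n)) g x) - mass * (LBINT x. g x * \<phi> x)) < \<epsilon>"
      by (simp add: r_def)
  qed
qed

subsection \<open>Absorption for potentials\<close>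

text \<open>The Riesz potential of order one of the positive part of g. Values in
  \<open>ennreal\<close> allow it to be iterated and interchanged before anything is known to be
  finite.\<close>

definition pot :: "(real^3 \<Rightarrow> real) \<Rightarrow> real^3 \<Rightarrow> ennreal" where
  "pot g x = (\<integral>\<^sup>+y. ennreal (nk (x - y)) * ennreal (g y) \<partial>lborel)"

lemma nk_minus: "nk (x - y) = nk (y - x)"
  by (simp add: nk_def inner_commute flip: dot_norm_neg power2_norm_eq_inner) (simp add: norm_minus_commute)

lemma pot_measurable [measurable]:
  assumes [measurable]: "g \<in> borel_measurable borel"
  shows "pot g \<in> borel_measurable borel"
  unfolding pot_def by measurable

text \<open>Seen from y, the ball lies in the ball of radius 2 R, which doubles the constant of
  \<open>nn_integral_nk\<close>.\<close>

lemma nn_integral_nk_ball: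
  assumes R: "0 < R" and y: "dist p y \<le> R"
  shows "(\<integral>\<^sup>+x. indicator (cball p R) x * ennreal (nk (x - y)) \<partial>lborel) \<le> ennreal (16 * unit_ball_vol 3 * R)"
proof -
  have [measurable]: "cball (0 :: real^3) (2 * R) \<in> sets borel" by simp
  have "(\<integral>\<^sup>+x. indicator (cball p R) x * ennreal (nk (x - y)) \<partial>lborel)
      \<le> (\<integral>\<^sup>+x. ennreal (indicator (cball 0 (2 * R)) (y - x) * nk (y - x)) \<partial>lborel)"
  proof (rule nn_integral_mono)
    fix x
    have "dist p x \<le> R \<Longrightarrow> norm (y - x) \<le> 2 * R"
      using y dist_triangle[of y x p] by (simp add: dist_norm norm_minus_commute)
    then show "indicator (cball p R) x * ennreal (nk (x - y)) \<le> ennreal (indicator (cball 0 (2 * R)) (y - x) * nk (y - x))"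
      by (simp add: indicator_def nk_minus[of x y])
  qed
  also have "\<dots> = (\<integral>\<^sup>+x. ennreal (indicator (cball 0 (2 * R)) x * nk x) \<partial>lborel)"
    by (rule nn_integral_lborel_reflect) measurable
  also have "\<dots> \<le> ennreal (8 * unit_ball_vol 3 * (2 * R))" by (rule nn_integral_nk) (use R in simp)
  finally show ?thesis by (simp add: mult.assoc)
qed

lemma nn_integral_pot:
  assumes R: "0 < R" and [measurable]: "g \<in> borel_measurable borel" and g: "\<And>y. R < dist p y \<Longrightarrow> g y = 0"
  shows "(\<integral>\<^sup>+x. indicator (cball p R) x * pot g x \<partial>lborel) \<le> ennreal (16 * unit_ball_vol 3 * R) * (\<integral>\<^sup>+y. ennreal (g y) \<partial>lborel)"
proof -
  have [measurable]: "cball p R \<in> sets borel" by simp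
  have "(\<integral>\<^sup>+x. indicator (cball p R) x * pot g x \<partial>lborel)
      = (\<integral>\<^sup>+x. (\<integral>\<^sup>+y. indicator (cball p R) x * (ennreal (nk (x - y)) * ennreal (g y)) \<partial>lborel) \<partial>lborel)"
    unfolding pot_def by (intro nn_integral_cong nn_integral_cmult[symmetric]) measurable
  also have "\<dots> = (\<integral>\<^sup>+y. (\<integral>\<^sup>+x. indicator (cball p R) x * (ennreal (nk (x - y)) * ennreal (g y)) \<partial>lborel) \<partial>lborel)"
    by (rule lborel_pair.Fubini') measurable
  also have "\<dots> \<le> (\<integral>\<^sup>+y. ennreal (16 * unit_ball_vol 3 * R) * ennreal (g y) \<partial>lborel)"
  proof (rule nn_integral_mono)
    fix y
    have "(\<integral>\<^sup>+x. indicator (cball p R) x * (ennreal (nk (x - y)) * ennreal (g y)) \<partial>lborel)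
        = (\<integral>\<^sup>+x. indicator (cball p R) x * ennreal (nk (x - y)) \<partial>lborel) * ennreal (g y)"
      unfolding mult.assoc[symmetric] by (rule nn_integral_multc) measurable
    also have "\<dots> \<le> ennreal (16 * unit_ball_vol 3 * R) * ennreal (g y)"
    proof (cases "R < dist p y")
      case False
      then show ?thesis by (intro mult_right_mono nn_integral_nk_ball[OF R]) auto
    qed (simp add: g)
    finally show "(\<integral>\<^sup>+x. indicator (cball p R) x * (ennreal (nk (x - y)) * ennreal (g y)) \<partial>lborel)
      \<le> ennreal (16 * unit_ball_vol 3 * R) * ennreal (g y)" .
  qed
  also have "\<dots> = ennreal (16 * unit_ball_vol 3 * R) * (\<integral>\<^sup>+y. ennreal (g y) \<partial>lborel)"
    by (rule nn_integral_cmult) measurable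
  finally show ?thesis .
qed

text \<open>The triangle inequality gives c^2 \<le> 4 (a^2 + b^2) for the three distances; division
  by a^2 b^2 c^2 is the claim. It decouples the product of two kernels. For x = z the right-hand
  side would be 0 because of the value of \<open>nk\<close> at 0.\<close>

lemma nk_product: assumes "x \<noteq> z" shows "nk (x - y) * nk (y - z) \<le> 4 * nk (x - z) * (nk (x - y) + nk (y - z))"
proof (cases "x = y \<or> y = z")
  case True
  then have "nk (x - y) * nk (y - z) = 0" by (auto simp: nk_def)
  moreover have "0 \<le> 4 * nk (x - z) * (nk (x - y) + nk (y - z))"
    by (intro mult_nonneg_nonneg add_nonneg_nonneg nk_nonneg) simp
  ultimately show ?thesis by linarith
next
  case False
  define a b c where "a = norm (x - y)" and "b = norm (y - z)" and "c = norm (x - z)"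
  have pos: "0 < a" "0 < b" "0 < c" using False assms by (auto simp: a_def b_def c_def)
  have "c \<le> a + b" using norm_triangle_ineq[of "x - y" "y - z"] by (simp add: a_def b_def c_def)
  then have "c\<^sup>2 \<le> (a + b)\<^sup>2" using pos by (intro power_mono) auto
  also have "\<dots> \<le> 4 * (a\<^sup>2 + b\<^sup>2)"
    using sum_squares_bound[of a b] by (simp add: power2_sum)
      (use zero_le_power2[of a] zero_le_power2[of b] in linarith)
  finally have "c\<^sup>2 \<le> 4 * (a\<^sup>2 + b\<^sup>2)" .
  then have "1 / a\<^sup>2 * (1 / b\<^sup>2) \<le> 4 * (1 / c\<^sup>2) * (1 / a\<^sup>2 + 1 / b\<^sup>2)"
    using pos by (simp add: field_simps)
  then show ?thesis by (simp add: nk_def a_def b_def c_def power2_norm_eq_inner)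
qed

text \<open>Inside a ball, the kernel applied to a potential is again the same potential, times a
  factor proportional to the radius. The constant is 128 = 4 (16 + 16), from
  \<open>nk_product\<close> and two uses of \<open>nn_integral_nk_ball\<close>.\<close>

lemma nn_integral_nk_pot:
  assumes R: "0 < R" and [measurable]: "g \<in> borel_measurable borel" and g: "\<And>y. R < dist p y \<Longrightarrow> g y = 0" and x: "dist p x \<le> R"
  shows "(\<integral>\<^sup>+y. indicator (cball p R) y * (ennreal (nk (x - y)) * pot g y) \<partial>lborel) \<le> ennreal (128 * unit_ball_vol 3 * R) * pot g x"
proof -
  define V where "V = unit_ball_vol 3"
  have V: "0 \<le> V" unfolding V_def by (rule unit_ball_vol_nonneg) simp
  have [measurable]: "cball p R \<in> sets borel" by simp
  have "(\<integral>\<^sup>+y. indicator (cball p R) y * (ennreal (nk (x - y)) * pot g y) \<partial>lborel)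
      = (\<integral>\<^sup>+y. (\<integral>\<^sup>+z. indicator (cball p R) y * ennreal (nk (x - y)) * (ennreal (nk (y - z)) * ennreal (g z)) \<partial>lborel) \<partial>lborel)"
  proof (rule nn_integral_cong)
    fix y
    have "(\<integral>\<^sup>+z. indicator (cball p R) y * ennreal (nk (x - y)) * (ennreal (nk (y - z)) * ennreal (g z)) \<partial>lborel)
        = indicator (cball p R) y * ennreal (nk (x - y)) * pot g y"
      unfolding pot_def by (rule nn_integral_cmult) measurable
    then show "indicator (cball p R) y * (ennreal (nk (x - y)) * pot g y)
        = (\<integral>\<^sup>+z. indicator (cball p R) y * ennreal (nk (x - y)) * (ennreal (nk (y - z)) * ennreal (g z)) \<partial>lborel)"
      by (simp add: mult.assoc)
  qed
  also have "\<dots> = (\<integral>\<^sup>+z. (\<integral>\<^sup>+y. indicator (cball p R) y * ennreal (nk (x - y)) * (ennreal (nk (y - z)) * ennreal (g z)) \<partial>lborel) \<partial>lborel)"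
    by (rule lborel_pair.Fubini') measurable
  also have "\<dots> \<le> (\<integral>\<^sup>+z. ennreal (128 * V * R) * (ennreal (nk (x - z)) * ennreal (g z)) \<partial>lborel)"
  proof (rule nn_integral_mono_AE)
    have "AE z in lborel. z \<noteq> x" by (rule AE_lborel_singleton)
    then show "AE z in lborel. (\<integral>\<^sup>+y. indicator (cball p R) y * ennreal (nk (x - y)) * (ennreal (nk (y - z)) * ennreal (g z)) \<partial>lborel)
        \<le> ennreal (128 * V * R) * (ennreal (nk (x - z)) * ennreal (g z))"
    proof (rule AE_mp, intro AE_I2 impI)
      fix z assume z: "z \<noteq> x"
      show "(\<integral>\<^sup>+y. indicator (cball p R) y * ennreal (nk (x - y)) * (ennreal (nk (y - z)) * ennreal (g z)) \<partial>lborel)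
        \<le> ennreal (128 * V * R) * (ennreal (nk (x - z)) * ennreal (g z))"
      proof (cases "R < dist p z")
        case False
        let ?i = "\<lambda>y. indicator (cball p R) y :: ennreal"
        have "(\<integral>\<^sup>+y. ?i y * ennreal (nk (x - y)) * (ennreal (nk (y - z)) * ennreal (g z)) \<partial>lborel)
            \<le> (\<integral>\<^sup>+y. ennreal (4 * nk (x - z)) * ennreal (g z) * (?i y * ennreal (nk (y - x)) + ?i y * ennreal (nk (y - z))) \<partial>lborel)"
        proof (rule nn_integral_mono)
          fix y
          have "ennreal (nk (x - y)) * ennreal (nk (y - z)) \<le> ennreal (4 * nk (x - z)) * (ennreal (nk (y - x)) + ennreal (nk (y - z)))"
            using nk_product[OF z[symmetric], of y] nk_minus[of x y]
            by (simp add: nk_nonneg ennreal_leI flip: ennreal_mult ennreal_plus)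
          from mult_left_mono[OF this, of "?i y * ennreal (g z)"]
          show "?i y * ennreal (nk (x - y)) * (ennreal (nk (y - z)) * ennreal (g z))
            \<le> ennreal (4 * nk (x - z)) * ennreal (g z) * (?i y * ennreal (nk (y - x)) + ?i y * ennreal (nk (y - z)))"
            by (simp add: algebra_simps)
        qed
        also have "\<dots> = ennreal (4 * nk (x - z)) * ennreal (g z) * ((\<integral>\<^sup>+y. ?i y * ennreal (nk (y - x)) \<partial>lborel) + (\<integral>\<^sup>+y. ?i y * ennreal (nk (y - z)) \<partial>lborel))"
          by (subst nn_integral_cmult, measurable, subst nn_integral_add) measurable
        also have "\<dots> \<le> ennreal (4 * nk (x - z)) * ennreal (g z) * (ennreal (16 * V * R) + ennreal (16 * V * R))"
          using False x unfolding V_def by (intro mult_left_mono add_mono nn_integral_nk_ball[OF R]) auto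
        also have "\<dots> = ennreal (128 * V * R) * (ennreal (nk (x - z)) * ennreal (g z))"
        proof -
          have "ennreal (16 * V * R) + ennreal (16 * V * R) = ennreal (32 * V * R)"
            using V R by (simp flip: ennreal_plus)
          moreover have "ennreal (4 * nk (x - z)) * ennreal (32 * V * R) = ennreal (128 * V * R) * ennreal (nk (x - z))"
            using V R nk_nonneg[of "x - z"] by (subst (1 2) ennreal_mult[symmetric]) (auto simp: algebra_simps)
          ultimately show ?thesis by (metis mult.assoc mult.commute)
        qed
        finally show ?thesis .
      qed (simp add: g)
    qed
  qed
  also have "\<dots> = ennreal (128 * V * R) * pot g x"
    unfolding pot_def by (rule nn_integral_cmult) measurable
  finally show ?thesis unfolding V_def .
qed

text \<open>Applying the potential once more to the hypothesis bounds the potential of a by half of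
  itself plus a multiple of that of b. It is finite almost everywhere, so the half can be
  subtracted. The potential of b is bounded near p because b vanishes there, and the hypothesis then
  bounds a.\<close>

lemma pot_absorb:
  fixes a b :: "real^3 \<Rightarrow> real"
  assumes R: "0 < R" and r: "0 < r" "r \<le> R"
    and a: "integrable lborel a" "\<And>y. 0 \<le> a y" "\<And>y. R < dist p y \<Longrightarrow> a y = 0"
    and b: "integrable lborel b" "\<And>y. 0 \<le> b y" "\<And>y. R < dist p y \<Longrightarrow> b y = 0" "\<And>y. dist p y < r \<Longrightarrow> b y = 0"
    and A: "0 \<le> A" "256 * unit_ball_vol 3 * R * A \<le> 1" and C: "0 \<le> C"
    and le: "AE x in lborel. x \<in> cball p R \<longrightarrow> ennreal (a x) \<le> ennreal A * pot a x + ennreal C * pot b x"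
  shows "\<exists>M. AE x in lborel. x \<in> ball p (r / 2) \<longrightarrow> a x \<le> M"
proof -
  define V where "V = unit_ball_vol 3"
  have V: "0 \<le> V" unfolding V_def by (rule unit_ball_vol_nonneg) simp
  have [measurable]: "a \<in> borel_measurable borel" "b \<in> borel_measurable borel" "cball p R \<in> sets borel"
    using a(1) b(1) by auto
  let ?i = "\<lambda>y. indicator (cball p R) y :: ennreal"
  let ?D = "ennreal (128 * V * R)"
  \<comment> \<open>For x within r / 2 of p and y outside the ball of radius r, |x - y| is at least
    r / 2 and the kernel at most 4 / r^2.\<close>
  define N where "N = 4 / r\<^sup>2 * (LBINT y. b y)"
  have N: "0 \<le> N" unfolding N_def using b(2) by (intro mult_nonneg_nonneg Bochner_Integration.integral_nonneg) auto
  have pb: "pot b x \<le> ennreal N" if x: "dist p x < r / 2" for x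
  proof -
    have "pot b x \<le> (\<integral>\<^sup>+y. ennreal (4 / r\<^sup>2 * b y) \<partial>lborel)"
      unfolding pot_def
    proof (rule nn_integral_mono)
      fix y
      show "ennreal (nk (x - y)) * ennreal (b y) \<le> ennreal (4 / r\<^sup>2 * b y)"
      proof (cases "dist p y < r")
        case False
        then have "r / 2 \<le> norm (x - y)" using x dist_triangle[of p y x] by (simp add: dist_norm)
        then have "(r / 2)\<^sup>2 \<le> (norm (x - y))\<^sup>2" using r by (intro power_mono) auto
        then have "1 / (norm (x - y))\<^sup>2 \<le> 1 / (r / 2)\<^sup>2" using r by (intro divide_left_mono mult_pos_pos) (auto intro: less_le_trans)
        then have "nk (x - y) \<le> 4 / r\<^sup>2" by (simp add: nk_def power2_norm_eq_inner power_divide)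
        then have "nk (x - y) * b y \<le> 4 / r\<^sup>2 * b y" using b(2) by (rule mult_right_mono)
        then show ?thesis using b(2) nk_nonneg by (simp add: ennreal_leI flip: ennreal_mult)
      qed (simp add: b(4))
    qed
    also have "\<dots> = ennreal (LBINT y. 4 / r\<^sup>2 * b y)"
      by (rule nn_integral_eq_integral) (use b in auto)
    finally show ?thesis by (simp add: N_def)
  qed
  \<comment> \<open>The hypothesis is integrated against the kernel, and
    \<open>nn_integral_nk_pot\<close> turns the iterated potentials into single ones.\<close>
  have bound: "pot a x \<le> ennreal A * (?D * pot a x) + ennreal C * (?D * pot b x)" if x: "dist p x \<le> R" for x
  proof -
    have "pot a x \<le> (\<integral>\<^sup>+y. ennreal A * (?i y * (ennreal (nk (x - y)) * pot a y)) + ennreal C * (?i y * (ennreal (nk (x - y)) * pot b y)) \<partial>lborel)"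
      unfolding pot_def[of a x]
    proof (rule nn_integral_mono_AE, rule AE_mp[OF le], intro AE_I2 impI)
      fix y assume y: "y \<in> cball p R \<longrightarrow> ennreal (a y) \<le> ennreal A * pot a y + ennreal C * pot b y"
      show "ennreal (nk (x - y)) * ennreal (a y)
        \<le> ennreal A * (?i y * (ennreal (nk (x - y)) * pot a y)) + ennreal C * (?i y * (ennreal (nk (x - y)) * pot b y))"
      proof (cases "y \<in> cball p R")
        case True
        then have "ennreal (nk (x - y)) * ennreal (a y) \<le> ennreal (nk (x - y)) * (ennreal A * pot a y + ennreal C * pot b y)"
          using y by (intro mult_left_mono) auto
        then show ?thesis using True by (simp add: algebra_simps)
      qed (simp add: a(3))
    qed
    also have "\<dots> = ennreal A * (\<integral>\<^sup>+y. ?i y * (ennreal (nk (x - y)) * pot a y) \<partial>lborel) + ennreal C * (\<integral>\<^sup>+y. ?i y * (ennreal (nk (x - y)) * pot b y) \<partial>lborel)"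
      by (subst nn_integral_add, measurable, subst nn_integral_cmult, measurable, subst nn_integral_cmult) measurable
    also have "\<dots> \<le> ennreal A * (?D * pot a x) + ennreal C * (?D * pot b x)"
      unfolding V_def using a(3) b(3) by (intro add_mono mult_left_mono nn_integral_nk_pot[OF R _ _ x]) (simp_all add: measurable)
    finally show ?thesis .
  qed
  have "(\<integral>\<^sup>+x. ?i x * pot a x \<partial>lborel) \<le> ennreal (16 * V * R) * (\<integral>\<^sup>+y. ennreal (a y) \<partial>lborel)"
    unfolding V_def using a(3) by (intro nn_integral_pot[OF R]) auto
  also have "\<dots> = ennreal (16 * V * R) * ennreal (LBINT y. a y)"
    using a by (subst nn_integral_eq_integral) auto
  also have "\<dots> < \<infinity>" by (simp add: ennreal_mult_less_top)
  finally have "(\<integral>\<^sup>+x. ?i x * pot a x \<partial>lborel) \<noteq> \<infinity>" by simp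
  \<comment> \<open>Finiteness almost everywhere comes from integrability of the potential over the
    ball; without it the absorption would be void.\<close>
  then have fin: "AE x in lborel. ?i x * pot a x \<noteq> \<infinity>"
    by (intro nn_integral_noteq_infinite) measurable
  define M where "M = A * (2 * (C * (128 * V * R * N))) + C * N"
  have "AE x in lborel. x \<in> ball p (r / 2) \<longrightarrow> a x \<le> M"
    using fin le
  proof eventually_elim
    fix x assume x: "?i x * pot a x \<noteq> \<infinity>" "x \<in> cball p R \<longrightarrow> ennreal (a x) \<le> ennreal A * pot a x + ennreal C * pot b x"
    show "x \<in> ball p (r / 2) \<longrightarrow> a x \<le> M"
    proof
      assume "x \<in> ball p (r / 2)"
      then have xr: "dist p x < r / 2" "dist p x \<le> R" using r by auto
      then have "pot a x \<noteq> \<infinity>" using x(1) by simp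
      then obtain t where t: "0 \<le> t" "pot a x = ennreal t" by (cases "pot a x") auto
      obtain s where s: "0 \<le> s" "pot b x = ennreal s" "s \<le> N"
        using pb[OF xr(1)] N by (cases "pot b x") (auto simp: top_unique)
      have nn: "0 \<le> 128 * V * R" "0 \<le> 128 * V * R * t" "0 \<le> 128 * V * R * s" using V R t s by simp_all
      then have "0 \<le> A * (128 * V * R * t)" "0 \<le> C * (128 * V * R * s)" using A C by simp_all
      then have "ennreal t \<le> ennreal (A * (128 * V * R * t) + C * (128 * V * R * s))"
        using bound[OF xr(2)]
        by (simp only: t(2) s(2) ennreal_plus ennreal_mult[OF A(1) nn(2)] ennreal_mult[OF C nn(3)] ennreal_mult[OF nn(1) t(1)] ennreal_mult[OF nn(1) s(1)])
      moreover have "0 \<le> A * (128 * V * R * t) + C * (128 * V * R * s)" using A C V R t s by simp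
      ultimately have "t \<le> A * (128 * V * R * t) + C * (128 * V * R * s)" using ennreal_le_iff by blast
      moreover have "A * (128 * V * R * t) \<le> t / 2"
        using mult_right_mono[OF A(2) t(1)] unfolding V_def[symmetric] by (simp add: algebra_simps)
      moreover have "C * (128 * V * R * s) \<le> C * (128 * V * R * N)"
        using C V R s by (intro mult_left_mono) auto
      ultimately have tb: "t \<le> 2 * (C * (128 * V * R * N))" by linarith
      have "ennreal (a x) \<le> ennreal (A * t + C * s)"
        using x(2) xr A C t s by (simp add: ennreal_mult)
      then have "a x \<le> A * t + C * s" using A C t s by (subst (asm) ennreal_le_iff) auto
      also have "\<dots> \<le> M" unfolding M_def using tb s A C by (intro add_mono mult_left_mono) auto
      finally show "a x \<le> M" .
    qed
  qed
  then show ?thesis by blast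
qed

section \<open>From regularized convolutions to bounds almost everywhere\<close>

lemma csupp_bounded:
  fixes c :: "real^3 \<Rightarrow> real"
  assumes c: "continuous_on UNIV c" "csupp W c"
  shows "\<exists>M. \<forall>x. \<bar>c x\<bar> \<le> M"
proof -
  obtain K where K: "compact K" "\<And>x. x \<notin> K \<Longrightarrow> c x = 0" using c(2) unfolding csupp_def by blast
  from compact_imp_bounded[OF compact_continuous_image[OF continuous_on_subset[OF c(1) subset_UNIV] K(1)]]
  obtain M where M: "\<And>z. z \<in> c ` K \<Longrightarrow> norm z \<le> M" unfolding bounded_iff by blast
  have "\<bar>c x\<bar> \<le> max M 0" for x
  proof (cases "x \<in> K")
    case True
    then show ?thesis using M[OF imageI[OF True]] by simp
  qed (simp add: K(2))
  then show ?thesis by blast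
qed

text \<open>The convolutions tend to mass times w only weakly, but weak limits preserve
  inequalities. The factor s will be 1 and -1, so that absolute values are covered.\<close>

lemma AE_le_if_weak_le:
  fixes w h :: "real^3 \<Rightarrow> real"
  assumes R: "0 < R" and w: "integrable lborel w" "csupp UNIV w"
    and h: "integrable lborel (\<lambda>x. indicator (ball p R) x * h x)"
    and le: "\<And>n. N \<le> n \<Longrightarrow> AE x in lborel. x \<in> ball p R \<longrightarrow> s * conv (dens (1 / Suc n)) w x \<le> h x"
  shows "AE x in lborel. x \<in> ball p R \<longrightarrow> s * mass * w x \<le> h x"
proof -
  define d where "d = (\<lambda>x. s * mass * w x - indicator (ball p R) x * h x)"
  have d: "integrable lborel d" unfolding d_def using w(1) h by auto
  have "AE x in lborel. x \<in> ball p R \<longrightarrow> d x \<le> 0"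
  proof (rule AE_nonpos_if_tests[OF open_ball bounded_ball d])
    fix \<phi> :: "real^3 \<Rightarrow> real" assume p: "continuous_on UNIV \<phi>" "csupp (ball p R) \<phi>" and nn: "\<And>x. 0 \<le> \<phi> x"
    have pU: "csupp UNIV \<phi>" by (rule csupp_subset[OF p(2) subset_UNIV])
    obtain K where K: "compact K" "K \<subseteq> ball p R" "\<And>x. x \<notin> K \<Longrightarrow> \<phi> x = 0" using p(2) unfolding csupp_def by blast
    have pz: "\<phi> x = 0" if "x \<notin> ball p R" for x using K(2,3) that by blast
    obtain M where M: "\<And>x. \<bar>\<phi> x\<bar> \<le> M" using csupp_bounded[OF p] by blast
    have [measurable]: "\<phi> \<in> borel_measurable borel" by (rule borel_measurable_continuous_onI[OF p(1)])
    have hi: "integrable lborel (\<lambda>x. \<phi> x * (indicator (ball p R) x * h x))"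
    proof -
      have "integrable lborel (\<lambda>x. indicator K x *\<^sub>R (indicator (ball p R) x * h x))"
        by (rule integrable_mult_indicator[OF _ h]) (simp add: borel_compact[OF K(1)])
      then have "integrable lborel (\<lambda>x. indicator K x * (indicator (ball p R) x * h x))" by simp
      from integrable_locally_mult[OF K(1) this p(1) K(3)] show ?thesis by (simp add: mult.commute)
    qed
    have wi: "integrable lborel (\<lambda>x. \<phi> x * w x)" by (rule integrable_mult_csupp[OF p(1) w])
    have ci: "integrable lborel (\<lambda>x. \<phi> x * conv (dens (1 / Suc n)) w x)" for n
      by (rule integrable_csupp[of UNIV], intro continuous_on_mult p(1) continuous_conv[OF continuous_dens w])
        (rule csupp_mult(2)[OF pU])
    have "(\<lambda>n. s * (LBINT x. \<phi> x * conv (dens (1 / Suc n)) w x)) \<longlonglongrightarrow> s * (mass * (LBINT x. w x * \<phi> x))"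
      by (intro tendsto_intros conv_dens_weak w p pU)
    moreover have "s * (LBINT x. \<phi> x * conv (dens (1 / Suc n)) w x) \<le> (LBINT x. \<phi> x * (indicator (ball p R) x * h x))" if n: "N \<le> n" for n
    proof -
      have "(LBINT x. s * (\<phi> x * conv (dens (1 / Suc n)) w x)) \<le> (LBINT x. \<phi> x * (indicator (ball p R) x * h x))"
      proof (rule Bochner_Integration.integral_mono_AE)
        show "AE x in lborel. s * (\<phi> x * conv (dens (1 / Suc n)) w x) \<le> \<phi> x * (indicator (ball p R) x * h x)"
          using le[OF n]
        proof eventually_elim
          fix x assume x: "x \<in> ball p R \<longrightarrow> s * conv (dens (1 / Suc n)) w x \<le> h x"
          show "s * (\<phi> x * conv (dens (1 / Suc n)) w x) \<le> \<phi> x * (indicator (ball p R) x * h x)"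
          proof (cases "x \<in> ball p R")
            case True
            then have "\<phi> x * (s * conv (dens (1 / Suc n)) w x) \<le> \<phi> x * h x" using x nn by (intro mult_left_mono) auto
            then show ?thesis using True by (simp add: algebra_simps)
          qed (simp add: pz)
        qed
      qed (use ci hi in auto)
      then show ?thesis by simp
    qed
    ultimately have "s * (mass * (LBINT x. w x * \<phi> x)) \<le> (LBINT x. \<phi> x * (indicator (ball p R) x * h x))"
      by (intro LIMSEQ_le_const2) auto
    moreover have "(LBINT x. d x * \<phi> x) = (LBINT x. s * mass * (\<phi> x * w x) - \<phi> x * (indicator (ball p R) x * h x))"
      by (simp add: d_def algebra_simps)
    moreover have "\<dots> = s * mass * (LBINT x. \<phi> x * w x) - (LBINT x. \<phi> x * (indicator (ball p R) x * h x))"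
      using wi hi by (subst Bochner_Integration.integral_diff) auto
    ultimately show "(LBINT x. d x * \<phi> x) \<le> 0" by (simp add: mult.commute[of "w _"])
  qed
  then show ?thesis by eventually_elim (simp add: d_def)
qed

text \<open>The bound is uniform in the regularization, and the potential, finite almost everywhere
  and integrable on the ball, serves as a fixed majorant for both signs of w.\<close>

lemma AE_dominated_by_pot:
  fixes w g :: "real^3 \<Rightarrow> real"
  assumes R: "0 < R" and w: "integrable lborel w" "csupp UNIV w"
    and g: "integrable lborel g" "\<And>y. 0 \<le> g y" "\<And>y. R < dist p y \<Longrightarrow> g y = 0" and c: "0 \<le> c"
    and le: "\<And>n x. ennreal \<bar>conv (dens (1 / Suc n)) w x\<bar> \<le> ennreal c * pot g x"
  shows "AE x in lborel. x \<in> ball p R \<longrightarrow> ennreal (mass * \<bar>w x\<bar>) \<le> ennreal c * pot g x"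
proof -
  have [measurable]: "g \<in> borel_measurable borel" "ball p R \<in> sets borel" "cball p R \<in> sets borel" using g(1) by auto
  define h where "h = (\<lambda>x. c * enn2real (pot g x))"
  have "(\<integral>\<^sup>+x. indicator (cball p R) x * pot g x \<partial>lborel) \<le> ennreal (16 * unit_ball_vol 3 * R) * (\<integral>\<^sup>+y. ennreal (g y) \<partial>lborel)"
    using g(3) by (intro nn_integral_pot[OF R]) auto
  also have "\<dots> = ennreal (16 * unit_ball_vol 3 * R) * ennreal (LBINT y. g y)"
    using g by (subst nn_integral_eq_integral) auto
  also have "\<dots> < \<infinity>" by (simp add: ennreal_mult_less_top)
  finally have lt: "(\<integral>\<^sup>+x. indicator (cball p R) x * pot g x \<partial>lborel) < \<infinity>" .
  then have fin: "AE x in lborel. indicator (cball p R) x * pot g x \<noteq> \<infinity>"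
    by (intro nn_integral_noteq_infinite) auto
  have hm: "(\<lambda>x. indicator (ball p R) x * h x) \<in> borel_measurable lborel" unfolding h_def by measurable
  have h: "integrable lborel (\<lambda>x. indicator (ball p R) x * h x)"
  proof (rule integrableI_nonneg[OF hm])
    show "AE x in lborel. 0 \<le> indicator (ball p R) x * h x" using c by (simp add: h_def)
    have "(\<integral>\<^sup>+x. ennreal (indicator (ball p R) x * h x) \<partial>lborel) \<le> (\<integral>\<^sup>+x. ennreal c * (indicator (cball p R) x * pot g x) \<partial>lborel)"
    proof (rule nn_integral_mono)
      fix x
      have "ennreal (h x) \<le> ennreal c * pot g x"
        unfolding h_def using c by (simp add: ennreal_mult ennreal_enn2real_if mult_left_mono)
      then show "ennreal (indicator (ball p R) x * h x) \<le> ennreal c * (indicator (cball p R) x * pot g x)"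
        by (auto simp: indicator_def)
    qed
    also have "\<dots> = ennreal c * (\<integral>\<^sup>+x. indicator (cball p R) x * pot g x \<partial>lborel)"
      by (rule nn_integral_cmult) measurable
    also have "\<dots> < \<infinity>" using lt by (simp add: ennreal_mult_less_top)
    finally show "(\<integral>\<^sup>+x. ennreal (indicator (ball p R) x * h x) \<partial>lborel) < \<infinity>" .
  qed
  have hle: "\<bar>conv (dens (1 / Suc n)) w x\<bar> \<le> h x" if "indicator (cball p R) x * pot g x \<noteq> \<infinity>" "x \<in> ball p R" for x n
  proof -
    have "pot g x \<noteq> \<infinity>" using that by simp
    then obtain t where t: "0 \<le> t" "pot g x = ennreal t" by (cases "pot g x") auto
    have "ennreal \<bar>conv (dens (1 / Suc n)) w x\<bar> \<le> ennreal (c * t)" using le[of n x] t c by (simp add: ennreal_mult)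
    then show ?thesis using t c by (simp add: h_def)
  qed
  have 1: "AE x in lborel. x \<in> ball p R \<longrightarrow> 1 * conv (dens (1 / Suc n)) w x \<le> h x" for n
    using fin
  proof eventually_elim
    case (elim x) then show ?case using hle[of x n] by (auto simp: abs_le_iff)
  qed
  have 2: "AE x in lborel. x \<in> ball p R \<longrightarrow> (- 1) * conv (dens (1 / Suc n)) w x \<le> h x" for n
    using fin
  proof eventually_elim
    case (elim x) then show ?case using hle[of x n] by (auto simp: abs_le_iff)
  qed
  show ?thesis using AE_le_if_weak_le[OF R w h 1] AE_le_if_weak_le[OF R w h 2] fin
  proof eventually_elim
    fix x assume x: "x \<in> ball p R \<longrightarrow> 1 * mass * w x \<le> h x" "x \<in> ball p R \<longrightarrow> - 1 * mass * w x \<le> h x"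
      "indicator (cball p R) x * pot g x \<noteq> \<infinity>"
    show "x \<in> ball p R \<longrightarrow> ennreal (mass * \<bar>w x\<bar>) \<le> ennreal c * pot g x"
    proof
      assume xb: "x \<in> ball p R"
      then obtain t where t: "0 \<le> t" "pot g x = ennreal t" using x(3) by (cases "pot g x") auto
      have "mass * \<bar>w x\<bar> \<le> c * t" using x(1,2) xb t mass_pos unfolding h_def by (cases "0 \<le> w x") auto
      then show "ennreal (mass * \<bar>w x\<bar>) \<le> ennreal c * pot g x"
        using t c by (simp add: ennreal_leI flip: ennreal_mult)
    qed
  qed
qed

text \<open>A uniform limit of continuous functions is continuous, and it must agree with the weak
  limit mass times w; the two inequalities for s = 1 and s = -1 give equality.\<close>

lemma AE_eq_uniform_limit:
  fixes w F :: "real^3 \<Rightarrow> real"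
  assumes R: "0 < R" and w: "integrable lborel w" "csupp UNIV w" and C: "0 \<le> C"
    and le: "\<And>e x. 0 < e \<Longrightarrow> \<bar>conv (dens e) w x - F x\<bar> \<le> C * e"
  shows "continuous_on UNIV F" "AE x in lborel. x \<in> ball p R \<longrightarrow> mass * w x = F x"
proof -
  let ?e = "\<lambda>n. 1 / real (Suc n)"
  have small: "\<exists>N. \<forall>n\<ge>N. \<forall>x. \<bar>conv (dens (?e n)) w x - F x\<bar> \<le> e" if e: "0 < e" for e
  proof -
    have "0 < e / (C + 1)" using e C by simp
    then obtain N where N: "1 / real (Suc N) < e / (C + 1)" using nat_approx_posE by blast
    have "\<bar>conv (dens (?e n)) w x - F x\<bar> \<le> e" if n: "n \<ge> N" for n x
    proof -
      have "\<bar>conv (dens (?e n)) w x - F x\<bar> \<le> C * ?e n" by (rule le) simp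
      also have "\<dots> \<le> C * (e / (C + 1))"
        using N n frac_le[of 1 1 "real (Suc N)" "real (Suc n)"] C by (intro mult_left_mono) auto
      also have "\<dots> \<le> e" using scaled_le[of C e] C e by (simp add: mult.commute)
      finally show ?thesis .
    qed
    then show ?thesis by blast
  qed
  have "uniform_limit UNIV (\<lambda>n. conv (dens (?e n)) w) F sequentially"
    unfolding uniform_limit_sequentially_iff
  proof (intro allI impI)
    fix e :: real assume "0 < e"
    then obtain N where "\<forall>n\<ge>N. \<forall>x. \<bar>conv (dens (?e n)) w x - F x\<bar> \<le> e / 2" using small[of "e / 2"] by auto
    moreover have "e / 2 < e" using \<open>0 < e\<close> by simp
    ultimately have "\<forall>n\<ge>N. \<forall>x. dist (conv (dens (?e n)) w x) (F x) < e"
      unfolding dist_real_def by (meson le_less_trans)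
    then show "\<exists>N. \<forall>n\<ge>N. \<forall>x\<in>UNIV. dist (conv (dens (?e n)) w x) (F x) < e" by blast
  qed
  then show cF: "continuous_on UNIV F"
    by (rule uniform_limit_theorem[rotated]) (simp_all add: continuous_conv[OF continuous_dens w])
  have main: "AE x in lborel. x \<in> ball p R \<longrightarrow> s * mass * w x \<le> s * F x" if s: "\<bar>s\<bar> = 1" for s
  proof -
    have i: "integrable lborel (\<lambda>x. indicator (ball p R) x * (s * F x + e))" for e
    proof -
      have "integrable lborel (\<lambda>x. indicator (cball p R) x *\<^sub>R (s * F x + e))"
        by (rule borel_integrable_compact) (auto intro!: continuous_intros continuous_on_subset[OF cF])
      then have "integrable lborel (\<lambda>x. indicator (ball p R) x *\<^sub>R (indicator (cball p R) x *\<^sub>R (s * F x + e)))"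
        by (rule integrable_mult_indicator[rotated]) simp
      also have "(\<lambda>x. indicator (ball p R) x *\<^sub>R (indicator (cball p R) x *\<^sub>R (s * F x + e)))
          = (\<lambda>x. indicator (ball p R) x * (s * F x + e))"
        by (auto simp: indicator_def fun_eq_iff)
      finally show ?thesis .
    qed
    have "AE x in lborel. x \<in> ball p R \<longrightarrow> s * mass * w x \<le> s * F x + e" if e: "0 < e" for e
    proof -
      obtain N where N: "\<And>n x. n \<ge> N \<Longrightarrow> \<bar>conv (dens (?e n)) w x - F x\<bar> \<le> e" using small[OF e] by blast
      show ?thesis
      proof (rule AE_le_if_weak_le[OF R w i])
        have "s * conv (dens (?e n)) w x \<le> s * F x + e" if "n \<ge> N" for n x
        proof -
          have "s * (conv (dens (?e n)) w x - F x) \<le> \<bar>s\<bar> * \<bar>conv (dens (?e n)) w x - F x\<bar>"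
            unfolding abs_mult[symmetric] by (rule abs_ge_self)
          then show ?thesis using N[OF that, of x] s by (simp add: algebra_simps)
        qed
        then show "AE x in lborel. x \<in> ball p R \<longrightarrow> s * conv (dens (?e n)) w x \<le> s * F x + e" if "n \<ge> N" for n
          using that by simp
      qed
    qed
    then have "AE x in lborel. \<forall>n. x \<in> ball p R \<longrightarrow> s * mass * w x \<le> s * F x + ?e n"
      unfolding AE_all_countable by simp
    then show ?thesis
    proof eventually_elim
      fix x assume x: "\<forall>n. x \<in> ball p R \<longrightarrow> s * mass * w x \<le> s * F x + ?e n"
      show "x \<in> ball p R \<longrightarrow> s * mass * w x \<le> s * F x"
      proof
        assume xb: "x \<in> ball p R"
        show "s * mass * w x \<le> s * F x"
        proof (rule field_le_epsilon)
          fix e :: real assume "0 < e"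
          then obtain n where "?e n < e" using nat_approx_posE by blast
          then show "s * mass * w x \<le> s * F x + e" using x xb by (smt (verit))
        qed
      qed
    qed
  qed
  show "AE x in lborel. x \<in> ball p R \<longrightarrow> mass * w x = F x"
    using main[of 1] main[of "- 1"] by auto
qed

text \<open>The two kernels differ only inside the ball of radius e, by at most 5 \<open>nk\<close>,
  hence by at most 5 times 8 \<open>unit_ball_vol 3\<close> e in L^1.\<close>

lemma conv_kern0_approx:
  assumes G: "integrable lborel G" "csupp UNIV G" and M: "\<And>x. \<bar>G x\<bar> \<le> M" and e: "0 < e"
  shows "\<bar>conv (kern e j) G x - conv (kern0 j) G x\<bar> \<le> 40 * unit_ball_vol 3 * M * e"
proof -
  define k where "k = (\<lambda>z. kern e j z - kern0 j z)"
  have [measurable]: "G \<in> borel_measurable borel" "cball (0::real^3) e \<in> sets borel" using G(1) by auto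
  have km [measurable]: "k \<in> borel_measurable borel"
    unfolding k_def using kern_measurable[OF e] by measurable
  have M0: "0 \<le> M" using M[of 0] by linarith
  have "(\<integral>\<^sup>+z. ennreal \<bar>k z\<bar> \<partial>lborel) \<le> (\<integral>\<^sup>+z. ennreal 5 * ennreal (indicator (cball 0 e) z * nk z) \<partial>lborel)"
  proof (rule nn_integral_mono)
    fix z
    have "ennreal \<bar>k z\<bar> \<le> ennreal (5 * (indicator (cball 0 e) z * nk z))"
      unfolding k_def by (rule ennreal_leI[OF kern_approx[OF e]])
    also have "\<dots> = ennreal 5 * ennreal (indicator (cball 0 e) z * nk z)"
      by (rule ennreal_mult) (simp_all add: nk_nonneg)
    finally show "ennreal \<bar>k z\<bar> \<le> ennreal 5 * ennreal (indicator (cball 0 e) z * nk z)" .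
  qed
  also have "\<dots> = ennreal 5 * (\<integral>\<^sup>+z. ennreal (indicator (cball 0 e) z * nk z) \<partial>lborel)"
    by (rule nn_integral_cmult) measurable
  also have "\<dots> \<le> ennreal 5 * ennreal (8 * unit_ball_vol 3 * e)"
    by (intro mult_left_mono nn_integral_nk[OF e]) simp
  also have "\<dots> = ennreal (40 * unit_ball_vol 3 * e)"
    using e unit_ball_vol_nonneg[of 3] by (subst ennreal_mult[symmetric]) (auto simp: algebra_simps)
  finally have kb: "(\<integral>\<^sup>+z. ennreal \<bar>k z\<bar> \<partial>lborel) \<le> ennreal (40 * unit_ball_vol 3 * e)" .
  have ki: "integrable lborel k"
    by (rule integrableI_bounded) (use km kb in \<open>auto simp: less_top[symmetric] top_unique intro: le_less_trans\<close>)
  have "ennreal (LBINT z. \<bar>k z\<bar>) \<le> ennreal (40 * unit_ball_vol 3 * e)"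
    using kb nn_integral_eq_integral[of lborel "\<lambda>z. \<bar>k z\<bar>"] ki by simp
  then have kI: "(LBINT z. \<bar>k z\<bar>) \<le> 40 * unit_ball_vol 3 * e"
    using e unit_ball_vol_nonneg[of 3] by (subst (asm) ennreal_le_iff) auto
  have ri: "integrable lborel (\<lambda>y. k (x - y))" by (rule integrable_lborel_reflect[OF ki])
  have kG: "integrable lborel (\<lambda>y. k (x - y) * G y)"
  proof (rule Bochner_Integration.integrable_bound)
    show "integrable lborel (\<lambda>y. M * \<bar>k (x - y)\<bar>)" using ri by auto
    show "(\<lambda>y. k (x - y) * G y) \<in> borel_measurable lborel" by measurable
    have "\<bar>k (x - y) * G y\<bar> \<le> \<bar>M * \<bar>k (x - y)\<bar>\<bar>" for y
      using mult_left_mono[OF M[of y], of "\<bar>k (x - y)\<bar>"] M0 by (simp add: abs_mult mult.commute)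
    then show "AE y in lborel. norm (k (x - y) * G y) \<le> norm (M * \<bar>k (x - y)\<bar>)" by simp
  qed
  have i1: "integrable lborel (\<lambda>y. kern e j (x - y) * G y)"
    by (rule integrable_conv[OF Ck_on_continuous[OF Ck_on_kern[OF e]] G])
  have "integrable lborel (\<lambda>y. kern e j (x - y) * G y - k (x - y) * G y)" using i1 kG by auto
  then have i0: "integrable lborel (\<lambda>y. kern0 j (x - y) * G y)" by (simp add: k_def algebra_simps)
  have "conv (kern e j) G x - conv (kern0 j) G x = (LBINT y. kern e j (x - y) * G y - kern0 j (x - y) * G y)"
    unfolding conv_def using i1 i0 by simp
  also have "\<dots> = (LBINT y. k (x - y) * G y)" by (simp add: k_def algebra_simps)
  also have "\<bar>\<dots>\<bar> \<le> (LBINT y. \<bar>k (x - y) * G y\<bar>)" by (rule integral_abs_bound)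
  also have "\<dots> \<le> (LBINT y. M * \<bar>k (x - y)\<bar>)"
  proof (rule Bochner_Integration.integral_mono)
    show "\<bar>k (x - y) * G y\<bar> \<le> M * \<bar>k (x - y)\<bar>" for y
      using mult_left_mono[OF M[of y], of "\<bar>k (x - y)\<bar>"] by (simp add: abs_mult mult.commute)
  qed (use kG ri in auto)
  also have "\<dots> = M * (LBINT y. \<bar>k (x - y)\<bar>)" by simp
  also have "(LBINT y. \<bar>k (x - y)\<bar>) = (LBINT z. \<bar>k z\<bar>)"
    by (rule integral_lborel_reflect) measurable
  also have "M * \<dots> \<le> M * (40 * unit_ball_vol 3 * e)" by (intro mult_left_mono kI M0)
  finally show ?thesis by (simp add: algebra_simps)
qed

subsection \<open>Regularity of weak solutions\<close>

text \<open>A bound for curl and divergence of the cut-off field. The first summand is linear in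
  that field and can be absorbed on small balls; the second contains derivatives of the cutoff and
  therefore vanishes wherever the cutoff is locally constant.\<close>

definition cut_major :: "real \<Rightarrow> (real^3 \<Rightarrow> real^3) \<Rightarrow> (real^3 \<Rightarrow> real) \<Rightarrow> real^3 \<Rightarrow> real" where
  "cut_major F u \<theta> x = 3 * F * (\<Sum>k\<in>UNIV. \<bar>cut_field u \<theta> k x\<bar>) + 3 * ((\<Sum>k\<in>UNIV. \<bar>u x $ k\<bar>) * (\<Sum>k\<in>UNIV. \<bar>partial k \<theta> x\<bar>))"

context
  fixes p :: "real^3" and R :: real and f :: "real^3 \<Rightarrow> real" and v :: "real^3 \<Rightarrow> real^3" and \<theta> :: "real^3 \<Rightarrow> real" and F :: real
  assumes R: "0 < R" and v: "\<And>i. integrable lborel (\<lambda>x. v x $ i)"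
    and f: "continuous_on (ball p R) f" and s: "weqs (ball p R) f v" and F: "0 \<le> F" "\<And>x. x \<in> ball p R \<Longrightarrow> \<bar>f x\<bar> \<le> F"
    and th: "smooth \<theta>" "csupp (ball p R) \<theta>"
begin

lemma cut_weak_cont:
  "continuous_on UNIV \<theta>" "continuous_on UNIV (partial i \<theta>)" "continuous_on UNIV (\<lambda>x. f x * \<theta> x)"
  "csupp UNIV \<theta>" "csupp UNIV (partial i \<theta>)" "csupp UNIV (\<lambda>x. f x * \<theta> x)"
proof -
  show c: "continuous_on UNIV \<theta>" "continuous_on UNIV (partial i \<theta>)"
    using smooth_continuous[OF th(1)] smooth_continuous[OF smooth_partial[OF th(1)]] by auto
  show "continuous_on UNIV (\<lambda>x. f x * \<theta> x)"
    by (rule continuous_on_UNIV_csupp[OF open_ball _ csupp_mult(1)[OF th(2)]])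
      (intro continuous_intros f continuous_on_subset[OF c(1)] subset_UNIV)
  show "csupp UNIV \<theta>" "csupp UNIV (partial i \<theta>)" "csupp UNIV (\<lambda>x. f x * \<theta> x)"
    using csupp_subset[OF th(2) subset_UNIV] csupp_subset[OF csupp_partial[OF th(2)] subset_UNIV]
      csupp_subset[OF csupp_mult(1)[OF th(2)] subset_UNIV] by auto
qed

lemma integrable_field_mult:
  assumes c: "continuous_on UNIV c" "csupp UNIV c" shows "integrable lborel (\<lambda>x. v x $ i * c x)"
proof -
  obtain K where K: "compact K" "\<And>x. x \<notin> K \<Longrightarrow> c x = 0" using c(2) unfolding csupp_def by blast
  have "integrable lborel (\<lambda>x. indicator K x *\<^sub>R v x $ i)"
    by (rule integrable_mult_indicator[OF _ v]) (simp add: borel_compact[OF K(1)])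
  then have "integrable lborel (\<lambda>x. indicator K x * v x $ i)" by simp
  from integrable_locally_mult[OF K(1) this c(1) K(2)] show ?thesis .
qed

lemma cut_weak_integrable:
  "integrable lborel (cut_field v \<theta> i)" "integrable lborel (cut_curl f v \<theta> i j)" "integrable lborel (cut_div v \<theta>)"
proof -
  note I = integrable_field_mult[OF cut_weak_cont(1,4)] integrable_field_mult[OF cut_weak_cont(2,5)] integrable_field_mult[OF cut_weak_cont(3,6)]
  show "integrable lborel (cut_field v \<theta> i)" using I(1)[of i] by (simp add: cut_field_def[abs_def] mult.commute)
  show "integrable lborel (cut_div v \<theta>)" unfolding cut_div_def[abs_def] by (intro Bochner_Integration.integrable_sum I)
  have "integrable lborel (\<lambda>x. (\<Sum>k\<in>UNIV. levi i j k * (v x $ k * (f x * \<theta> x))) + v x $ j * partial i \<theta> x - v x $ i * partial j \<theta> x)"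
    by (intro Bochner_Integration.integrable_add Bochner_Integration.integrable_diff Bochner_Integration.integrable_sum integrable_mult_right I)
  then show "integrable lborel (cut_curl f v \<theta> i j)"
    by (simp add: cut_curl_def[abs_def] sum_distrib_left algebra_simps)
qed

lemmas cut_weak_csupp_UNIV = cut_csupp[OF th(2), THEN csupp_subset[OF _ subset_UNIV]]

lemmas conv_cut_weak = conv_cut_kernel[OF s th cut_weak_integrable]

text \<open>A regularized Helmholtz representation: the divergence of \<open>kern e\<close> is
  -\<open>dens e\<close>, and \<open>kern_sym\<close> says that the kernel is curl-free, so
  derivative and component indices can be exchanged to produce the curl and the divergence of the
  field.\<close>

lemma conv_dens_cut:
  assumes e: "0 < e"
  shows "conv (dens e) (cut_field v \<theta> i) x
    = - (\<Sum>j\<in>UNIV. conv (kern e j) (cut_curl f v \<theta> j i) x) - conv (kern e i) (cut_div v \<theta>) x"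
proof -
  have k: "Ck_on 1 UNIV (kern e j)" for j by (rule Ck_on_kern[OF e])
  have kc: "continuous_on UNIV (partial i (kern e j))" for i j
    using Ck_on_continuous[OF Ck_on_partial[OF open_UNIV, of 0]] k by simp
  have sym: "partial i (kern e j) = partial j (kern e i)" for j
    by (rule ext) (rule kern_sym[OF e])
  have "(\<Sum>j\<in>UNIV. conv (kern e j) (cut_curl f v \<theta> j i) x)
      = (\<Sum>j\<in>UNIV. conv (partial j (kern e j)) (cut_field v \<theta> i) x - conv (partial j (kern e i)) (cut_field v \<theta> j) x)"
    unfolding conv_cut_weak(1)[OF k, symmetric] sym ..
  also have "\<dots> = (\<Sum>j\<in>UNIV. conv (partial j (kern e j)) (cut_field v \<theta> i) x) - conv (kern e i) (cut_div v \<theta>) x"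
    unfolding sum_subtractf conv_cut_weak(2)[OF k] ..
  also have "(\<Sum>j\<in>UNIV. conv (partial j (kern e j)) (cut_field v \<theta> i) x)
      = (LBINT y. (\<Sum>j\<in>UNIV. partial j (kern e j) (x - y) * cut_field v \<theta> i y))"
    unfolding conv_def
    by (rule Bochner_Integration.integral_sum[symmetric]) (rule integrable_conv[OF kc cut_weak_integrable(1) cut_weak_csupp_UNIV(1)])
  also have "\<dots> = - conv (dens e) (cut_field v \<theta> i) x"
    unfolding conv_def sum_distrib_right[symmetric] kern_divergence[OF e] by simp
  finally show ?thesis by simp
qed

lemma cut_bound: "(\<Sum>j\<in>UNIV. \<bar>cut_curl f v \<theta> j i x\<bar>) + \<bar>cut_div v \<theta> x\<bar> \<le> cut_major F v \<theta> x"
proof -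
  define S T A where "S = (\<Sum>k\<in>UNIV. \<bar>v x $ k\<bar>)" and "T = (\<Sum>k\<in>UNIV. \<bar>partial k \<theta> x\<bar>)" and "A = (\<Sum>k\<in>UNIV. \<bar>cut_field v \<theta> k x\<bar>)"
  have vS: "\<bar>v x $ j\<bar> \<le> S" and tT: "\<bar>partial j \<theta> x\<bar> \<le> T" for j
    unfolding S_def T_def by (rule member_le_sum; simp)+
  have ST: "0 \<le> S" "0 \<le> T" "0 \<le> A" unfolding S_def T_def A_def by (simp_all add: sum_nonneg)
  have fb: "\<bar>\<theta> x * (f x * (\<Sum>k\<in>UNIV. levi j i k * v x $ k))\<bar> \<le> F * A" for j
  proof (cases "\<theta> x = 0")
    case False
    then have "x \<in> ball p R" using th(2) unfolding csupp_def by blast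
    have l: "\<bar>levi j i k\<bar> \<le> 1" for k by (simp add: levi_def)
    have "\<theta> x * (f x * (\<Sum>k\<in>UNIV. levi j i k * v x $ k)) = f x * (\<Sum>k\<in>UNIV. levi j i k * cut_field v \<theta> k x)"
      by (simp add: cut_field_def sum_distrib_left algebra_simps)
    also have "\<bar>\<dots>\<bar> \<le> F * A" unfolding abs_mult A_def
    proof (intro mult_mono F(2) \<open>x \<in> ball p R\<close> order_trans[OF sum_abs sum_mono] F(1))
      show "\<bar>levi j i k * cut_field v \<theta> k x\<bar> \<le> \<bar>cut_field v \<theta> k x\<bar>" for k
        using mult_right_mono[OF l[of k], of "\<bar>cut_field v \<theta> k x\<bar>"] by (simp add: abs_mult)
    qed simp
    finally show ?thesis .
  qed (use F(1) ST in simp)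
  have "\<bar>cut_curl f v \<theta> j i x\<bar> \<le> F * A + \<bar>v x $ i\<bar> * \<bar>partial j \<theta> x\<bar> + \<bar>v x $ j\<bar> * \<bar>partial i \<theta> x\<bar>" for j
    using fb[of j] unfolding cut_curl_def abs_mult[symmetric] by linarith
  also have "\<dots> j \<le> F * A + S * \<bar>partial j \<theta> x\<bar> + \<bar>v x $ j\<bar> * T" for j
    by (intro add_mono order_refl mult_mono vS tT ST) auto
  finally have "(\<Sum>j\<in>UNIV. \<bar>cut_curl f v \<theta> j i x\<bar>) \<le> (\<Sum>j\<in>UNIV. F * A + S * \<bar>partial j \<theta> x\<bar> + \<bar>v x $ j\<bar> * T)"
    by (intro sum_mono)
  also have "\<dots> = 3 * F * A + S * T + S * T"
    unfolding sum.distrib S_def T_def sum_distrib_left[symmetric] sum_distrib_right[symmetric] by simp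
  finally have 1: "(\<Sum>j\<in>UNIV. \<bar>cut_curl f v \<theta> j i x\<bar>) \<le> 3 * F * A + S * T + S * T" .
  have "\<bar>cut_div v \<theta> x\<bar> \<le> (\<Sum>k\<in>UNIV. \<bar>v x $ k\<bar> * T)"
    unfolding cut_div_def by (intro order_trans[OF sum_abs sum_mono]) (simp add: abs_mult mult_left_mono tT)
  also have "\<dots> = S * T" by (simp add: S_def sum_distrib_right)
  finally show ?thesis using 1 unfolding cut_major_def S_def[symmetric] T_def[symmetric] A_def[symmetric] by linarith
qed

lemma cut_rest_integrable: "integrable lborel (\<lambda>x. (\<Sum>k\<in>UNIV. \<bar>v x $ k\<bar>) * (\<Sum>k\<in>UNIV. \<bar>partial k \<theta> x\<bar>))"
proof -
  have "integrable lborel (\<lambda>x. \<bar>v x $ k * partial l \<theta> x\<bar>)" for k l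
    using integrable_field_mult[OF cut_weak_cont(2,5)] by (rule integrable_abs)
  then show ?thesis unfolding sum_product abs_mult[symmetric] by (intro Bochner_Integration.integrable_sum)
qed

lemma cut_pot_bound:
  assumes e: "0 < e"
  shows "ennreal \<bar>conv (dens e) (cut_field v \<theta> i) x\<bar> \<le> ennreal (5 / 2) * pot (cut_major F v \<theta>) x"
proof -
  let ?h = "\<lambda>y. (\<Sum>j\<in>UNIV. kern e j (x - y) * cut_curl f v \<theta> j i y) + kern e i (x - y) * cut_div v \<theta> y"
  have kc: "continuous_on UNIV (kern e j)" for j by (rule Ck_on_continuous[OF Ck_on_kern[OF e]])
  have I: "integrable lborel (\<lambda>y. kern e j (x - y) * cut_curl f v \<theta> l i y)" "integrable lborel (\<lambda>y. kern e j (x - y) * cut_div v \<theta> y)" for j l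
    by (rule integrable_conv[OF kc cut_weak_integrable(2) cut_weak_csupp_UNIV(2)], rule integrable_conv[OF kc cut_weak_integrable(3) cut_weak_csupp_UNIV(3)])
  have hi: "integrable lborel ?h" by (intro Bochner_Integration.integrable_add Bochner_Integration.integrable_sum I)
  have "conv (dens e) (cut_field v \<theta> i) x = - (LBINT y. ?h y)"
  proof -
    have "(LBINT y. ?h y) = (LBINT y. (\<Sum>j\<in>UNIV. kern e j (x - y) * cut_curl f v \<theta> j i y)) + (LBINT y. kern e i (x - y) * cut_div v \<theta> y)"
      by (intro Bochner_Integration.integral_add Bochner_Integration.integrable_sum I)
    also have "(LBINT y. (\<Sum>j\<in>UNIV. kern e j (x - y) * cut_curl f v \<theta> j i y))
        = (\<Sum>j\<in>UNIV. LBINT y. kern e j (x - y) * cut_curl f v \<theta> j i y)"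
      by (rule Bochner_Integration.integral_sum[OF I(1)])
    finally show ?thesis using conv_dens_cut[OF e, of i x] unfolding conv_def by linarith
  qed
  then have "ennreal \<bar>conv (dens e) (cut_field v \<theta> i) x\<bar> = ennreal (norm (LBINT y. ?h y))" by simp
  also have "\<dots> \<le> (\<integral>\<^sup>+y. ennreal (norm (?h y)) \<partial>lborel)" by (rule integral_norm_bound_ennreal[OF hi])
  also have "\<dots> \<le> (\<integral>\<^sup>+y. ennreal (5 / 2) * (ennreal (nk (x - y)) * ennreal (cut_major F v \<theta> y)) \<partial>lborel)"
  proof (rule nn_integral_mono)
    fix y
    have c0: "0 \<le> cut_major F v \<theta> y" by (rule order_trans[OF _ cut_bound[of i]]) (simp add: sum_nonneg add_nonneg_nonneg)
    have k0: "0 \<le> 5 / 2 * nk (x - y)" by (simp add: nk_nonneg)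
    have "\<bar>?h y\<bar> \<le> (\<Sum>j\<in>UNIV. 5 / 2 * nk (x - y) * \<bar>cut_curl f v \<theta> j i y\<bar>) + 5 / 2 * nk (x - y) * \<bar>cut_div v \<theta> y\<bar>"
    proof (intro order_trans[OF abs_triangle_ineq] add_mono order_trans[OF sum_abs sum_mono])
      show "\<bar>kern e j (x - y) * cut_curl f v \<theta> j i y\<bar> \<le> 5 / 2 * nk (x - y) * \<bar>cut_curl f v \<theta> j i y\<bar>" for j
        unfolding abs_mult by (intro mult_right_mono kern_bound e) simp
      show "\<bar>kern e i (x - y) * cut_div v \<theta> y\<bar> \<le> 5 / 2 * nk (x - y) * \<bar>cut_div v \<theta> y\<bar>"
        unfolding abs_mult by (intro mult_right_mono kern_bound e) simp
    qed
    also have "\<dots> = 5 / 2 * nk (x - y) * ((\<Sum>j\<in>UNIV. \<bar>cut_curl f v \<theta> j i y\<bar>) + \<bar>cut_div v \<theta> y\<bar>)"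
      by (simp add: sum_distrib_left distrib_left)
    also have "\<dots> \<le> 5 / 2 * nk (x - y) * cut_major F v \<theta> y" by (intro mult_left_mono cut_bound k0)
    finally have "ennreal \<bar>?h y\<bar> \<le> ennreal (5 / 2 * nk (x - y) * cut_major F v \<theta> y)" by (rule ennreal_leI)
    also have "\<dots> = ennreal (5 / 2) * (ennreal (nk (x - y)) * ennreal (cut_major F v \<theta> y))"
      unfolding mult.assoc by (subst ennreal_mult, simp, simp add: nk_nonneg c0, subst ennreal_mult) (simp_all add: nk_nonneg c0)
    finally show "ennreal (norm (?h y)) \<le> ennreal (5 / 2) * (ennreal (nk (x - y)) * ennreal (cut_major F v \<theta> y))" by simp
  qed
  also have "\<dots> = ennreal (5 / 2) * pot (cut_major F v \<theta>) x"
    unfolding pot_def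
  proof (rule nn_integral_cmult)
    have [measurable]: "(cut_major F v \<theta>) \<in> borel_measurable borel"
      unfolding cut_major_def[abs_def] using cut_rest_integrable cut_weak_integrable(1) by measurable
    show "(\<lambda>y. ennreal (nk (x - y)) * ennreal (cut_major F v \<theta> y)) \<in> borel_measurable lborel" by measurable
  qed
  finally show ?thesis .
qed

text \<open>For bounded fields the right-hand sides of \<open>conv_dens_cut\<close> converge uniformly as \<open>e\<close> tends to 0.\<close>

lemma cut_field_continuous:
  assumes b: "\<And>x i. \<bar>v x $ i\<bar> \<le> M"
  shows "\<exists>G. continuous_on UNIV G \<and> (AE x in lborel. x \<in> ball p R \<longrightarrow> cut_field v \<theta> i x = G x)"
proof -
  obtain T where T: "\<And>k x. \<bar>partial k \<theta> x\<bar> \<le> T"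
  proof -
    have "\<forall>k. \<exists>T. \<forall>x. \<bar>partial k \<theta> x\<bar> \<le> T" using csupp_bounded[OF cut_weak_cont(2,5)] by blast
    then obtain t where t: "\<And>k x. \<bar>partial k \<theta> x\<bar> \<le> t k" by (auto simp: choice_iff)
    have "\<bar>partial k \<theta> x\<bar> \<le> (\<Sum>l\<in>UNIV. \<bar>t l\<bar>)" for k x
      using t[of k x] member_le_sum[of k UNIV "\<lambda>l. \<bar>t l\<bar>"] by simp
    then show ?thesis by (rule that)
  qed
  obtain Q where Q: "\<And>x. \<bar>\<theta> x\<bar> \<le> Q" using csupp_bounded[OF cut_weak_cont(1,4)] by blast
  have M0: "0 \<le> M" "0 \<le> T" "0 \<le> Q" using b[of 0 1] T[of 1 0] Q[of 0] by linarith+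
  define B where "B = 3 * F * (3 * (Q * M)) + 3 * ((3 * M) * (3 * T))"
  have B0: "0 \<le> B" unfolding B_def using M0 F(1) by (intro add_nonneg_nonneg mult_nonneg_nonneg) auto
  have mb: "cut_major F v \<theta> x \<le> B" for x
  proof -
    have 1: "(\<Sum>k\<in>UNIV. \<bar>cut_field v \<theta> k x\<bar>) \<le> (\<Sum>k\<in>(UNIV::3 set). Q * M)"
      unfolding cut_field_def abs_mult by (intro sum_mono mult_mono Q b M0) auto
    have 2: "(\<Sum>k\<in>UNIV. \<bar>v x $ k\<bar>) \<le> (\<Sum>k\<in>(UNIV::3 set). M)" "(\<Sum>k\<in>UNIV. \<bar>partial k \<theta> x\<bar>) \<le> (\<Sum>k\<in>(UNIV::3 set). T)"
      by (intro sum_mono b T)+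
    show ?thesis unfolding cut_major_def B_def
      using 1 2 M0 F(1) by (intro add_mono mult_left_mono mult_mono) (auto simp: sum_nonneg)
  qed
  have cb: "\<bar>cut_curl f v \<theta> j i x\<bar> \<le> B" for j x
  proof -
    have "\<bar>cut_curl f v \<theta> j i x\<bar> \<le> (\<Sum>j\<in>UNIV. \<bar>cut_curl f v \<theta> j i x\<bar>)" by (rule member_le_sum) auto
    then show ?thesis using cut_bound[of i x] mb[of x] by linarith
  qed
  have db: "\<bar>cut_div v \<theta> x\<bar> \<le> B" for x
  proof -
    have "0 \<le> (\<Sum>j\<in>UNIV. \<bar>cut_curl f v \<theta> j i x\<bar>)" by (simp add: sum_nonneg)
    then show ?thesis using cut_bound[of i x] mb[of x] by linarith
  qed
  define G where "G = (\<lambda>x. - (\<Sum>j\<in>UNIV. conv (kern0 j) (cut_curl f v \<theta> j i) x) - conv (kern0 i) (cut_div v \<theta>) x)"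
  define D where "D = 40 * unit_ball_vol 3 * B"
  have D0: "0 \<le> D" unfolding D_def using unit_ball_vol_nonneg[of 3] B0 by simp
  have close: "\<bar>conv (dens e) (cut_field v \<theta> i) x - G x\<bar> \<le> 4 * D * e" if e: "0 < e" for e x
  proof -
    have 1: "\<bar>conv (kern e j) (cut_curl f v \<theta> j i) x - conv (kern0 j) (cut_curl f v \<theta> j i) x\<bar> \<le> D * e" for j
      unfolding D_def by (rule conv_kern0_approx[OF cut_weak_integrable(2) cut_weak_csupp_UNIV(2) cb e])
    have 2: "\<bar>conv (kern e i) (cut_div v \<theta>) x - conv (kern0 i) (cut_div v \<theta>) x\<bar> \<le> D * e"
      unfolding D_def by (rule conv_kern0_approx[OF cut_weak_integrable(3) cut_weak_csupp_UNIV(3) db e])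
    have "conv (dens e) (cut_field v \<theta> i) x - G x
        = - (\<Sum>j\<in>UNIV. conv (kern e j) (cut_curl f v \<theta> j i) x - conv (kern0 j) (cut_curl f v \<theta> j i) x)
          - (conv (kern e i) (cut_div v \<theta>) x - conv (kern0 i) (cut_div v \<theta>) x)"
      unfolding conv_dens_cut[OF e] G_def sum_subtractf by simp
    moreover have "\<bar>\<Sum>j\<in>UNIV. conv (kern e j) (cut_curl f v \<theta> j i) x - conv (kern0 j) (cut_curl f v \<theta> j i) x\<bar> \<le> (\<Sum>j\<in>(UNIV::3 set). D * e)"
      by (intro order_trans[OF sum_abs sum_mono] 1)
    ultimately show ?thesis using 2 by simp
  qed
  have "0 \<le> 4 * D" using D0 by simp
  note L = AE_eq_uniform_limit[OF R cut_weak_integrable(1) cut_weak_csupp_UNIV(1) this]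
  have L1: "continuous_on UNIV G" by (rule L(1)) (rule close)
  have L2: "AE x in lborel. x \<in> ball p R \<longrightarrow> mass * cut_field v \<theta> i x = G x" by (rule L(2)) (rule close)
  show ?thesis
  proof (intro exI conjI)
    show "continuous_on UNIV (\<lambda>x. G x / mass)" using L1 mass_pos by (intro continuous_intros) auto
    show "AE x in lborel. x \<in> ball p R \<longrightarrow> cut_field v \<theta> i x = G x / mass"
      using L2 by eventually_elim (use mass_pos in \<open>auto simp: field_simps\<close>)
  qed
qed

end

lemma pot_lincomb:
  assumes [measurable]: "a \<in> borel_measurable borel" "b \<in> borel_measurable borel"
    and nn: "\<And>y. 0 \<le> a y" "\<And>y. 0 \<le> b y" "0 \<le> c" "0 \<le> d"
  shows "pot (\<lambda>y. c * a y + d * b y) x = ennreal c * pot a x + ennreal d * pot b x"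
proof -
  have "ennreal (nk (x - y)) * ennreal (c * a y + d * b y)
      = ennreal c * (ennreal (nk (x - y)) * ennreal (a y)) + ennreal d * (ennreal (nk (x - y)) * ennreal (b y))" for y
    using nn by (simp add: ennreal_mult algebra_simps)
  then have "pot (\<lambda>y. c * a y + d * b y) x
      = (\<integral>\<^sup>+y. ennreal c * (ennreal (nk (x - y)) * ennreal (a y)) + ennreal d * (ennreal (nk (x - y)) * ennreal (b y)) \<partial>lborel)"
    by (simp add: pot_def)
  also have "\<dots> = ennreal c * pot a x + ennreal d * pot b x"
    unfolding pot_def
    by (subst nn_integral_add, measurable, subst nn_integral_cmult, measurable, subst nn_integral_cmult) measurable
  finally show ?thesis .
qed

lemma weqs_cong_AE:
  assumes W: "open W" and f: "continuous_on W f"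
    and m: "\<And>i. (\<lambda>x. v x $ i) \<in> borel_measurable borel" "\<And>i. (\<lambda>x. v' x $ i) \<in> borel_measurable borel"
    and eq: "AE x in lborel. x \<in> W \<longrightarrow> v x = v' x" and s: "weqs W f v"
  shows "weqs W f v'"
  unfolding weqs_def
proof (intro allI impI)
  fix \<phi> assume t: "test1 W \<phi>"
  note tc = test1_continuous[OF t]
  have z: "\<phi> x = 0" "partial i \<phi> x = 0" if "x \<notin> W" for x i
    using tc(3) tc(4)[of i] that unfolding csupp_def by blast+
  have fc: "continuous_on UNIV (\<lambda>x. f x * \<phi> x)"
    by (rule continuous_on_UNIV_csupp[OF W _ csupp_mult(1)[OF tc(3)]]) (intro continuous_on_mult f tc(1))
  have [measurable]: "(\<lambda>x. f x * \<phi> x) \<in> borel_measurable borel" "partial i \<phi> \<in> borel_measurable borel" for i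
    using borel_measurable_continuous_onI[OF fc] borel_measurable_continuous_onI[OF tc(2)] by auto
  note [measurable] = m
  have re: "f x * (\<Sum>k\<in>UNIV. levi i j k * w x $ k) * \<phi> x = (f x * \<phi> x) * (\<Sum>k\<in>UNIV. levi i j k * w x $ k)" for i j x and w :: "real^3 \<Rightarrow> real^3"
    by simp
  have "(LBINT x. (\<Sum>i\<in>UNIV. v x $ i * partial i \<phi> x)) = (LBINT x. (\<Sum>i\<in>UNIV. v' x $ i * partial i \<phi> x))"
  proof (rule integral_cong_AE)
    show "AE x in lborel. (\<Sum>i\<in>UNIV. v x $ i * partial i \<phi> x) = (\<Sum>i\<in>UNIV. v' x $ i * partial i \<phi> x)"
      using eq
    proof eventually_elim
      case (elim x) then show ?case by (cases "x \<in> W") (simp_all add: z)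
    qed
  qed measurable
  then show "(LBINT x. (\<Sum>i\<in>UNIV. v' x $ i * partial i \<phi> x)) = 0 \<and>
     (\<forall>i j. (LBINT x. v' x $ j * partial i \<phi> x - v' x $ i * partial j \<phi> x + f x * (\<Sum>k\<in>UNIV. levi i j k * v' x $ k) * \<phi> x) = 0)"
  proof (intro conjI allI)
    fix i j
    have "(LBINT x. v x $ j * partial i \<phi> x - v x $ i * partial j \<phi> x + f x * (\<Sum>k\<in>UNIV. levi i j k * v x $ k) * \<phi> x)
      = (LBINT x. v' x $ j * partial i \<phi> x - v' x $ i * partial j \<phi> x + f x * (\<Sum>k\<in>UNIV. levi i j k * v' x $ k) * \<phi> x)"
      unfolding re
    proof (rule integral_cong_AE)
      show "AE x in lborel. v x $ j * partial i \<phi> x - v x $ i * partial j \<phi> x + (f x * \<phi> x) * (\<Sum>k\<in>UNIV. levi i j k * v x $ k)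
        = v' x $ j * partial i \<phi> x - v' x $ i * partial j \<phi> x + (f x * \<phi> x) * (\<Sum>k\<in>UNIV. levi i j k * v' x $ k)"
        using eq
      proof eventually_elim
        case (elim x) then show ?case by (cases "x \<in> W") (simp_all add: z)
      qed
    qed measurable
    then show "(LBINT x. v' x $ j * partial i \<phi> x - v' x $ i * partial j \<phi> x + f x * (\<Sum>k\<in>UNIV. levi i j k * v' x $ k) * \<phi> x) = 0"
      using s[unfolded weqs_def, THEN spec, THEN mp, OF t, THEN conjunct2, THEN spec[of _ i], THEN spec[of _ j]] by simp
  qed (use s[unfolded weqs_def, THEN spec, THEN mp, OF t, THEN conjunct1] in simp)
qed

lemma cutoff_ball:
  assumes "0 < R"
  shows "\<exists>\<theta>. smooth \<theta> \<and> csupp (ball p R) \<theta> \<and> (\<forall>x. dist p x \<le> R / 3 \<longrightarrow> \<theta> x = 1)"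
proof -
  have "0 < R / 3" "R / 3 < 2 * R / 3" using assms by auto
  then obtain \<theta> where th: "smooth \<theta>" "\<And>x. dist p x \<le> R / 3 \<Longrightarrow> \<theta> x = 1" "\<And>x. 2 * R / 3 \<le> dist p x \<Longrightarrow> \<theta> x = 0"
    using cutoff_exists[of "R / 3" "2 * R / 3" p] by blast
  have "csupp (ball p R) \<theta>"
    unfolding csupp_def by (rule exI[of _ "cball p (2 * R / 3)"]) (use assms th(3) in auto)
  then show ?thesis using th by blast
qed

text \<open>Applies \<open>pot_absorb\<close> to the cut-off field as a and to the terms with
  derivatives of the cutoff as b, which vanish within R / 3 of the centre. The assumption
  \<open>small\<close> is the absorption condition on the radius.\<close>

lemma weak_solution_bounded:
  assumes R: "0 < R" and v: "\<And>i. integrable lborel (\<lambda>x. v x $ i)"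
    and f: "continuous_on (ball p R) f" and s: "weqs (ball p R) f v" and F: "0 \<le> F" "\<And>x. x \<in> ball p R \<Longrightarrow> \<bar>f x\<bar> \<le> F"
    and small: "256 * unit_ball_vol 3 * R * (15 / 2 / mass * (3 * F)) \<le> 1"
  shows "\<exists>M. AE x in lborel. x \<in> ball p (R / 6) \<longrightarrow> (\<Sum>k\<in>UNIV. \<bar>v x $ k\<bar>) \<le> M"
proof -
  obtain \<theta> where th: "smooth \<theta>" "csupp (ball p R) \<theta>" and th1: "\<And>x. dist p x \<le> R / 3 \<Longrightarrow> \<theta> x = 1"
    using cutoff_ball[OF R] by blast
  define a where "a = (\<lambda>x. \<Sum>k\<in>UNIV. \<bar>cut_field v \<theta> k x\<bar>)"
  define b where "b = (\<lambda>x. (\<Sum>k\<in>UNIV. \<bar>v x $ k\<bar>) * (\<Sum>k\<in>UNIV. \<bar>partial k \<theta> x\<bar>))"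
  let ?g = "cut_major F v \<theta>"
  \<comment> \<open>The kernel bound 5/2 summed over three components and divided by
    \<open>mass\<close>.\<close>
  define Q where "Q = 15 / 2 / mass"
  have Q: "0 < Q" using mass_pos by (simp add: Q_def)
  have wi: "integrable lborel (cut_field v \<theta> k)" for k by (rule cut_weak_integrable(1)[OF R v f s F th])
  have ws: "csupp UNIV (cut_field v \<theta> k)" for k by (rule cut_weak_csupp_UNIV(1)[OF R v f s F th])
  have ai: "integrable lborel a" unfolding a_def by (intro Bochner_Integration.integrable_sum integrable_abs wi)
  have bi: "integrable lborel b" unfolding b_def by (rule cut_rest_integrable[OF R v f s F th])
  have nn: "0 \<le> a y" "0 \<le> b y" for y by (simp_all add: a_def b_def sum_nonneg)
  have g: "?g = (\<lambda>y. 3 * F * a y + 3 * b y)" by (simp add: fun_eq_iff cut_major_def a_def b_def)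
  have out: "a y = 0" "b y = 0" if "y \<notin> ball p R" for y
  proof -
    have "\<theta> y = 0" "\<And>k. partial k \<theta> y = 0" using th(2) csupp_partial[OF th(2)] that unfolding csupp_def by blast+
    then show "a y = 0" "b y = 0" by (simp_all add: a_def b_def cut_field_def)
  qed
  have b0: "b y = 0" if "dist p y < R / 3" for y
  proof -
    have "partial k \<theta> y = partial k (\<lambda>_. 1) y" for k
      by (rule partial_cong_open[OF open_ball[of p "R / 3"]]) (use that th1 in auto)
    then show ?thesis by (simp add: b_def)
  qed
  have gi: "integrable lborel ?g" unfolding g using ai bi by auto
  have dom: "AE x in lborel. x \<in> ball p R \<longrightarrow> ennreal (mass * \<bar>cut_field v \<theta> k x\<bar>) \<le> ennreal (5 / 2) * pot ?g x" for k
  proof (rule AE_dominated_by_pot[OF R wi ws gi])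
    show "0 \<le> ?g y" for y unfolding g using nn F(1) by simp
    show "?g y = 0" if "R < dist p y" for y unfolding g using out[of y] that by simp
    show "ennreal \<bar>conv (dens (1 / real (Suc n))) (cut_field v \<theta> k) x\<bar> \<le> ennreal (5 / 2) * pot ?g x" for n x
      by (rule cut_pot_bound[OF R v f s F th]) simp_all
  qed simp
  have "AE x in lborel. \<forall>k. x \<in> ball p R \<longrightarrow> ennreal (mass * \<bar>cut_field v \<theta> k x\<bar>) \<le> ennreal (5 / 2) * pot ?g x"
    by (rule eventually_all_finite) (rule dom)
  then have le: "AE x in lborel. x \<in> cball p R \<longrightarrow> ennreal (a x) \<le> ennreal (Q * (3 * F)) * pot a x + ennreal (Q * 3) * pot b x"
  proof eventually_elim
    fix x assume x: "\<forall>k. x \<in> ball p R \<longrightarrow> ennreal (mass * \<bar>cut_field v \<theta> k x\<bar>) \<le> ennreal (5 / 2) * pot ?g x"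
    have "ennreal (a x) \<le> ennreal Q * pot ?g x"
    proof (cases "x \<in> ball p R \<and> pot ?g x \<noteq> top")
      case True
      then obtain t where t: "0 \<le> t" "pot ?g x = ennreal t" by (cases "pot ?g x") auto
      have "mass * \<bar>cut_field v \<theta> k x\<bar> \<le> 5 / 2 * t" for k
        using x True t by (auto simp flip: ennreal_mult)
      then have "(\<Sum>k\<in>UNIV. mass * \<bar>cut_field v \<theta> k x\<bar>) \<le> (\<Sum>k\<in>(UNIV::3 set). 5 / 2 * t)" by (intro sum_mono)
      then have "mass * a x \<le> 15 / 2 * t" by (simp add: a_def sum_distrib_left)
      then have "a x \<le> Q * t" using mass_pos by (simp add: Q_def field_simps)
      then show ?thesis using t Q by (simp add: ennreal_leI flip: ennreal_mult)
    next
      case False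
      then show ?thesis using out[of x] Q by (auto simp: ennreal_mult_top)
    qed
    also have "pot ?g x = ennreal (3 * F) * pot a x + ennreal 3 * pot b x"
      unfolding g by (rule pot_lincomb) (use ai bi nn F(1) in auto)
    also have "ennreal Q * (ennreal (3 * F) * pot a x + ennreal 3 * pot b x) = ennreal (Q * (3 * F)) * pot a x + ennreal (Q * 3) * pot b x"
      using Q F(1) ennreal_mult[of Q "3 * F"] ennreal_mult[of Q 3] by (simp add: distrib_left mult.assoc)
    finally show "x \<in> cball p R \<longrightarrow> ennreal (a x) \<le> ennreal (Q * (3 * F)) * pot a x + ennreal (Q * 3) * pot b x" by simp
  qed
  have "\<exists>M. AE x in lborel. x \<in> ball p (R / 3 / 2) \<longrightarrow> a x \<le> M"
  proof (rule pot_absorb[OF R _ _ ai nn(1) _ bi nn(2) _ b0 _ _ _ le])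
    show "a y = 0" "b y = 0" if "R < dist p y" for y using out[of y] that by auto
    show "256 * unit_ball_vol 3 * R * (Q * (3 * F)) \<le> 1" using small by (simp add: Q_def)
  qed (use R Q F(1) in auto)
  then obtain M where "AE x in lborel. x \<in> ball p (R / 6) \<longrightarrow> a x \<le> M" by auto
  then have "AE x in lborel. x \<in> ball p (R / 6) \<longrightarrow> (\<Sum>k\<in>UNIV. \<bar>v x $ k\<bar>) \<le> M"
  proof eventually_elim
    fix x assume x: "x \<in> ball p (R / 6) \<longrightarrow> a x \<le> M"
    have "a x = (\<Sum>k\<in>UNIV. \<bar>v x $ k\<bar>)" if "x \<in> ball p (R / 6)"
    proof -
      have "dist p x \<le> R / 3" using that R by simp
      then show ?thesis by (simp add: a_def cut_field_def th1)
    qed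
    then show "x \<in> ball p (R / 6) \<longrightarrow> (\<Sum>k\<in>UNIV. \<bar>v x $ k\<bar>) \<le> M" using x by simp
  qed
  then show ?thesis by blast
qed

text \<open>The field is set to 0 on the null set where its bound fails and outside the ball; it is
  then bounded everywhere, as \<open>cut_field_continuous\<close> demands. Where the cutoff is 1 the
  continuous function found there represents v.\<close>

lemma weak_solution_continuous:
  assumes R: "0 < R" and v: "\<And>i. integrable lborel (\<lambda>x. v x $ i)"
    and f: "continuous_on (ball p R) f" and s: "weqs (ball p R) f v" and F: "0 \<le> F" "\<And>x. x \<in> ball p R \<Longrightarrow> \<bar>f x\<bar> \<le> F"
    and b: "AE x in lborel. x \<in> ball p R \<longrightarrow> (\<Sum>k\<in>UNIV. \<bar>v x $ k\<bar>) \<le> M"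
  shows "\<exists>w. continuous_on UNIV w \<and> weqs (ball p (R / 3)) f w \<and> (AE x in lborel. x \<in> ball p (R / 3) \<longrightarrow> v x = w x)"
proof -
  have [measurable]: "(\<lambda>x. v x $ i) \<in> borel_measurable borel" for i using v[of i] by auto
  define A where "A = {x \<in> ball p R. (\<Sum>k\<in>UNIV. \<bar>v x $ k\<bar>) \<le> M}"
  have Am: "A \<in> sets borel" unfolding A_def by measurable
  define v' where "v' = (\<lambda>x. if x \<in> A then v x else 0)"
  have v'i: "integrable lborel (\<lambda>x. v' x $ i)" for i
  proof -
    have "integrable lborel (\<lambda>x. indicator A x *\<^sub>R v x $ i)"
      by (rule integrable_mult_indicator[OF _ v]) (simp add: Am)
    also have "(\<lambda>x. indicator A x *\<^sub>R v x $ i) = (\<lambda>x. v' x $ i)" by (auto simp: v'_def indicator_def)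
    finally show ?thesis .
  qed
  have eq: "AE x in lborel. x \<in> ball p R \<longrightarrow> v x = v' x" using b by eventually_elim (auto simp: v'_def A_def)
  have m: "(\<lambda>x. v x $ i) \<in> borel_measurable borel" "(\<lambda>x. v' x $ i) \<in> borel_measurable borel" for i
    using v[of i] v'i[of i] by auto
  have s': "weqs (ball p R) f v'" by (rule weqs_cong_AE[OF open_ball f m eq s])
  have bd: "\<bar>v' x $ i\<bar> \<le> max M 0" for x i
  proof (cases "x \<in> A")
    case True
    have "\<bar>v x $ i\<bar> \<le> (\<Sum>k\<in>UNIV. \<bar>v x $ k\<bar>)" by (rule member_le_sum) auto
    then show ?thesis using True by (auto simp: v'_def A_def)
  qed (simp add: v'_def)
  obtain \<theta> where th: "smooth \<theta>" "csupp (ball p R) \<theta>" and th1: "\<And>x. dist p x \<le> R / 3 \<Longrightarrow> \<theta> x = 1"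
    using cutoff_ball[OF R] by blast
  define P where "P = (\<lambda>i G. continuous_on UNIV G \<and> (AE x in lborel. x \<in> ball p R \<longrightarrow> cut_field v' \<theta> i x = G x))"
  have "\<exists>G. P i G" for i unfolding P_def by (rule cut_field_continuous[OF R v'i f s' F th bd])
  then obtain G where G: "\<And>i. P i (G i)" by metis
  define w where "w = (\<lambda>x. \<chi> i. G i x)"
  have wc: "continuous_on UNIV w"
    unfolding w_def using G unfolding P_def by (intro continuous_on_vec_lambda) auto
  have "AE x in lborel. \<forall>i. x \<in> ball p R \<longrightarrow> cut_field v' \<theta> i x = G i x"
    by (rule eventually_all_finite) (use G in \<open>auto simp: P_def\<close>)
  then have eq2: "AE x in lborel. x \<in> ball p (R / 3) \<longrightarrow> v x = w x"
    using eq
  proof eventually_elim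
    fix x assume x: "\<forall>i. x \<in> ball p R \<longrightarrow> cut_field v' \<theta> i x = G i x" "x \<in> ball p R \<longrightarrow> v x = v' x"
    show "x \<in> ball p (R / 3) \<longrightarrow> v x = w x"
    proof
      assume xb: "x \<in> ball p (R / 3)"
      then have "x \<in> ball p R" "\<theta> x = 1" using R th1[of x] by auto
      then have "v' x $ i = G i x" for i using x(1) by (simp add: cut_field_def)
      then show "v x = w x" using x(2) \<open>x \<in> ball p R\<close> by (simp add: vec_eq_iff w_def)
    qed
  qed
  have sub: "ball p (R / 3) \<subseteq> ball p R" using R by (intro subset_ball) simp
  have wm: "(\<lambda>x. w x $ i) \<in> borel_measurable borel" for i
    by (rule borel_measurable_continuous_onI) (intro continuous_intros wc)
  have "weqs (ball p (R / 3)) f w"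
    by (rule weqs_cong_AE[OF open_ball continuous_on_subset[OF f sub] m(1) wm eq2 weqs_subset[OF s sub]])
  then show ?thesis using wc eq2 by blast
qed

theorem weak_solution_local_sol:
  assumes U: "open U" and f: "continuous_on U f" and s: "weak_solution U f u"
  shows "local_sol U f u"
  unfolding local_sol_def
proof
  fix p assume p: "p \<in> U"
  obtain R0 where R0: "0 < R0" "cball p R0 \<subseteq> U" using U p open_contains_cball by blast
  obtain F where F: "0 \<le> F" "\<And>x. x \<in> cball p R0 \<Longrightarrow> \<bar>f x\<bar> \<le> F"
  proof -
    from compact_imp_bounded[OF compact_continuous_image[OF continuous_on_subset[OF f R0(2)] compact_cball]]
    obtain M where M: "\<And>z. z \<in> f ` cball p R0 \<Longrightarrow> norm z \<le> M" unfolding bounded_iff by blast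
    have "\<bar>f x\<bar> \<le> max M 0" if "x \<in> cball p R0" for x using M[OF imageI[OF that]] by simp
    then show ?thesis using that[of "max M 0"] by simp
  qed
  define A where "A = 256 * unit_ball_vol 3 * (15 / 2 / mass * (3 * F))"
  have A: "0 \<le> A" unfolding A_def using unit_ball_vol_nonneg[of 3] mass_pos F(1) by simp
  \<comment> \<open>A R \<le> A / (A + 1) \<le> 1 gives the absorption condition, also when A =
    0.\<close>
  define R where "R = min R0 (1 / (A + 1))"
  have R: "0 < R" "R \<le> R0" using R0(1) A by (auto simp: R_def)
  have small: "256 * unit_ball_vol 3 * R * (15 / 2 / mass * (3 * F)) \<le> 1"
  proof -
    have "A * R \<le> A * (1 / (A + 1))" using A by (intro mult_left_mono) (auto simp: R_def)
    also have "\<dots> \<le> 1" using A by simp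
    finally show ?thesis unfolding A_def by (simp only: mult.assoc mult.commute[of R] mult.left_commute[of R])
  qed
  have sub: "cball p R \<subseteq> U" using subset_cball[OF R(2), of p] R0(2) by blast
  then have subb: "ball p R \<subseteq> U" using ball_subset_cball by blast
  obtain v where v: "\<And>i. integrable lborel (\<lambda>x. v x $ i)" "negligible {x \<in> cball p R. u x \<noteq> v x}" "weqs (ball p R) f v"
    using weak_solution_weqs[OF U f s sub] by blast
  have fR: "continuous_on (ball p R) f" by (rule continuous_on_subset[OF f subb])
  have Fb: "\<bar>f x\<bar> \<le> F" if "x \<in> ball p R" for x using that R(2) by (intro F(2)) auto
  obtain M where M: "AE x in lborel. x \<in> ball p (R / 6) \<longrightarrow> (\<Sum>k\<in>UNIV. \<bar>v x $ k\<bar>) \<le> M"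
    using weak_solution_bounded[OF R(1) v(1) fR v(3) F(1) Fb small] by blast
  have R6: "0 < R / 6" "ball p (R / 6) \<subseteq> ball p R" using R(1) by (auto intro: subset_ball)
  have Fb6: "\<bar>f x\<bar> \<le> F" if "x \<in> ball p (R / 6)" for x using Fb R6(2) that by blast
  have "\<exists>w. continuous_on UNIV w \<and> weqs (ball p (R / 6 / 3)) f w \<and> (AE x in lborel. x \<in> ball p (R / 6 / 3) \<longrightarrow> v x = w x)"
    by (rule weak_solution_continuous[OF R6(1) v(1) continuous_on_subset[OF fR R6(2)] weqs_subset[OF v(3) R6(2)] F(1) Fb6 M])
  then obtain w where w: "continuous_on UNIV w" "weqs (ball p (R / 6 / 3)) f w" "AE x in lborel. x \<in> ball p (R / 6 / 3) \<longrightarrow> v x = w x"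
    by (elim exE conjE)
  define r where "r = R / 6 / 3"
  have r: "0 < r" "ball p r \<subseteq> cball p R" using R(1) by (auto simp: r_def)
  obtain N where N: "{x \<in> space lborel. \<not> (x \<in> ball p r \<longrightarrow> v x = w x)} \<subseteq> N" "emeasure lborel N = 0" "N \<in> sets lborel"
    by (rule AE_E[OF w(3)[folded r_def]])
  have "negligible N" using null_setsI[OF N(2,3)] by (simp add: negligible_iff_null_sets null_sets_completionI)
  then have "negligible (N \<union> {x \<in> cball p R. u x \<noteq> v x})" using v(2) by (rule negligible_Un)
  then have "negligible {x \<in> ball p r. u x \<noteq> w x}"
    by (rule negligible_subset) (use N(1) r(2) in auto)
  then show "\<exists>r v. 0 < r \<and> ball p r \<subseteq> U \<and> continuous_on (ball p r) v \<and> weqs (ball p r) f v \<and> negligible {x \<in> ball p r. u x \<noteq> v x}"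
    using r sub w(2) continuous_on_subset[OF w(1) subset_UNIV] unfolding r_def by blast
qed

subsection \<open>Open dense sets of factors\<close>

text \<open>By continuity the operator is nonzero on a whole ball, so the local representative
  vanishes there, and unique continuation extends this to U.\<close>

lemma solution_zero_if_op_nonzero:
  assumes U: "open U" "connected U" and f: "Ck_on 6 U f" and s: "local_sol U f u"
    and x0: "x0 \<in> U" "apply_op obstruction f x0 \<noteq> 0"
  shows "negligible {x \<in> U. u x \<noteq> 0}"
proof -
  have "Ck_on (0 + op_order obstruction) U f" using Ck_on_mono[OF f op_order_obstruction] by simp
  from Ck_on_apply_op[OF U(1) this] have "continuous_on U (apply_op obstruction f)" unfolding Ck_on_0 .
  then have "open (U \<inter> apply_op obstruction f -` (- {0}))" by (rule continuous_open_preimage[OF _ U(1) open_Compl]) simp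
  then obtain d where d: "0 < d" "ball x0 d \<subseteq> U \<inter> apply_op obstruction f -` (- {0})"
    using x0 openE[of "U \<inter> apply_op obstruction f -` (- {0})" x0] by auto
  obtain r v where v: "0 < r" "ball x0 r \<subseteq> U" "continuous_on (ball x0 r) v" "weqs (ball x0 r) f v"
    "negligible {x \<in> ball x0 r. u x \<noteq> v x}"
    using s x0(1) unfolding local_sol_def by blast
  have z: "v x = 0" if "x \<in> ball x0 (min d r)" for x
    by (rule solution_zero_if_obstruction[OF open_ball v(3) Ck_on_subset[OF f v(2)] v(4)]) (use that d(2) in auto)
  have "negligible {x \<in> ball x0 (min d r). u x \<noteq> 0}"
    by (rule negligible_subset[OF v(5)]) (use z in auto)
  from unique_continuation[OF U Ck_on_continuous[OF f] s x0(1) _ this]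
  show ?thesis using d(1) v(1) by simp
qed

lemma classical_solution_local_sol:
  assumes U: "open U" and f: "continuous_on U f" and s: "classical_solution U f u"
  shows "local_sol U f u"
  unfolding local_sol_def
proof
  fix p assume "p \<in> U"
  then obtain r where r: "0 < r" "ball p r \<subseteq> U" using U openE by blast
  note c = classical_solution_weqs[OF U f s]
  have "continuous_on (ball p r) u" "weqs (ball p r) f u" by (rule continuous_on_subset[OF c(1) r(2)], rule weqs_subset[OF c(2) r(2)])
  moreover have "{x \<in> ball p r. u x \<noteq> u x} = {}" by simp
  ultimately show "\<exists>r v. 0 < r \<and> ball p r \<subseteq> U \<and> continuous_on (ball p r) v \<and> weqs (ball p r) f v \<and> negligible {x \<in> ball p r. u x \<noteq> v x}"
    using r by (intro exI[of _ r] exI[of _ u]) simp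
qed

lemma only_trivial_solution_if_op_nonzero:
  assumes U: "open U" "connected U" and f: "Ck_on 6 U f" and x0: "x0 \<in> U" "apply_op obstruction f x0 \<noteq> 0"
  shows "only_trivial_solution U f"
  unfolding only_trivial_solution_def
proof (intro conjI allI impI ballI)
  note fc = Ck_on_continuous[OF f]
  fix u
  show "negligible {x \<in> U. u x \<noteq> 0}" if "weak_solution U f u"
    by (rule solution_zero_if_op_nonzero[OF U f weak_solution_local_sol[OF U(1) fc that] x0])
  show "u x = 0" if "classical_solution U f u" "x \<in> U" for x
    using continuous_negligible_zero[OF U(1) classical_solution_weqs(1)[OF U(1) fc that(1)]
        solution_zero_if_op_nonzero[OF U f classical_solution_local_sol[OF U(1) fc that(1)] x0] that(2)] .
qed

section \<open>Openness and density of the nonvanishing condition\<close>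

lemma partials_lincomb:
  assumes U: "open U" and f: "Ck_on k U f" and g: "Ck_on k U g" and l: "length is \<le> k" and x: "x \<in> U"
  shows "partials is (\<lambda>x. a * f x + b * g x) x = a * partials is f x + b * partials is g x"
  using l x
proof (induction "is" arbitrary: x)
  case (Cons i "is")
  have d: "partials is h differentiable (at x)" if "Ck_on k U h" for h
  proof -
    have "partials is h differentiable_on U" using that Cons.prems(1) unfolding Ck_on_def by simp
    then show ?thesis using Cons.prems(2) U by (simp add: differentiable_on_eq_differentiable_at)
  qed
  have "partials (i # is) (\<lambda>x. a * f x + b * g x) x = partial i (\<lambda>y. a * partials is f y + b * partials is g y) x"
    unfolding partials_Cons by (rule partial_cong_open[OF U Cons.prems(2)]) (use Cons in simp)
  also have "\<dots> = a * partial i (partials is f) x + b * partial i (partials is g) x"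
    by (subst partial_add) (simp_all add: d f g partial_cmult differentiable_mult)
  finally show ?case by (simp add: partials_Cons)
qed simp

lemma tendsto_apply_op:
  assumes "\<And>is. length is \<le> op_order P \<Longrightarrow> ((\<lambda>n. partials is (g n) x) \<longlongrightarrow> partials is f x) F"
  shows "((\<lambda>n. apply_op P (g n) x) \<longlongrightarrow> apply_op P f x) F"
  using assms by (induction P) (auto intro!: tendsto_intros)

lemma apply_op_path_poly:
  assumes U: "open U" and f: "Ck_on k U f" and g: "Ck_on k U g" and x: "x \<in> U" and P: "op_order P \<le> k"
  shows "\<exists>p. \<forall>t. apply_op P (\<lambda>x. (1 - t) * f x + t * g x) x = poly p t"
  using P
proof (induction P)
  case (Const c)
  then show ?case by (intro exI[of _ "[:of_rat c:]"]) simp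
next
  case (Deriv "is")
  then have "partials is (\<lambda>x. (1 - t) * f x + t * g x) x = (1 - t) * partials is f x + t * partials is g x" for t
    by (intro partials_lincomb[OF U f g _ x]) simp
  then show ?case
    by (intro exI[of _ "[:partials is f x, partials is g x - partials is f x:]"]) (simp add: algebra_simps)
next
  case (Add P Q)
  then obtain p q where "\<forall>t. apply_op P (\<lambda>x. (1 - t) * f x + t * g x) x = poly p t" "\<forall>t. apply_op Q (\<lambda>x. (1 - t) * f x + t * g x) x = poly q t"
    by auto
  then show ?case by (intro exI[of _ "p + q"]) simp
next
  case (Mult P Q)
  then obtain p q where "\<forall>t. apply_op P (\<lambda>x. (1 - t) * f x + t * g x) x = poly p t" "\<forall>t. apply_op Q (\<lambda>x. (1 - t) * f x + t * g x) x = poly q t"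
    by auto
  then show ?case by (intro exI[of _ "p * q"]) simp
qed

lemma openin_Ck_ball:
  "compact K \<Longrightarrow> K \<subseteq> U \<Longrightarrow> 0 < e \<Longrightarrow> f \<in> Ck_space k U \<Longrightarrow> openin (Ck_topology k U) (Ck_ball k U K e f)"
  unfolding Ck_topology_def by (rule topology_generated_by_Basis) blast

lemma apply_op_cong_open:
  assumes "open U" "x \<in> U" "\<And>y. y \<in> U \<Longrightarrow> f y = g y" shows "apply_op P f x = apply_op P g x"
  using partials_cong_open[OF assms] by (induction P) simp_all

text \<open>The value at x depends continuously on finitely many derivatives at x, so the seminorm
  ball for the compact set {x} suffices.\<close>

lemma openin_op_nonzero:
  assumes U: "open U" and P: "op_order P \<le> k"
  shows "openin (Ck_topology k U) {f \<in> Ck_space k U. \<exists>x\<in>U. apply_op P f x \<noteq> 0}"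
  unfolding openin_subopen[of _ "{f \<in> Ck_space k U. \<exists>x\<in>U. apply_op P f x \<noteq> 0}"]
proof
  fix f assume "f \<in> {f \<in> Ck_space k U. \<exists>x\<in>U. apply_op P f x \<noteq> 0}"
  then obtain x where f: "f \<in> Ck_space k U" and x: "x \<in> U" "apply_op P f x \<noteq> 0" by blast
  have "\<exists>e>0. \<forall>g\<in>Ck_ball k U {x} e f. apply_op P g x \<noteq> 0"
  proof (rule ccontr)
    assume H: "\<not> (\<exists>e>0. \<forall>g\<in>Ck_ball k U {x} e f. apply_op P g x \<noteq> 0)"
    \<comment> \<open>A failure for every radius 1 / (n + 1) gives a sequence whose derivatives at x
      converge to those of f; this spares an explicit radius.\<close>
    define Q where "Q = (\<lambda>n g. g \<in> Ck_ball k U {x} (1 / real (Suc n)) f \<and> apply_op P g x = 0)"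
    have "\<exists>g. Q n g" for n
    proof -
      have "0 < 1 / real (Suc n)" by simp
      then show ?thesis using H unfolding Q_def by blast
    qed
    then obtain g' where "\<And>n. Q n (g' n)" by metis
    then have g: "\<And>n. g' n \<in> Ck_ball k U {x} (1 / real (Suc n)) f" "\<And>n. apply_op P (g' n) x = 0"
      unfolding Q_def by auto
    have "(\<lambda>n. partials is (g' n) x) \<longlonglongrightarrow> partials is f x" if "length is \<le> op_order P" for "is"
    proof (rule Lim_null[THEN iffD2], rule tendsto_rabs_zero_cancel, rule tendsto_sandwich[OF _ _ tendsto_const])
      show "(\<lambda>n. 1 / real (Suc n)) \<longlonglongrightarrow> 0" using LIMSEQ_inverse_real_of_nat by (simp add: inverse_eq_divide)
      have "\<bar>partials is (g' n) x - partials is f x\<bar> < 1 / real (Suc n)" for n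
        using g(1)[of n] that P by (simp add: Ck_ball_def)
      then show "\<forall>\<^sub>F n in sequentially. \<bar>partials is (g' n) x - partials is f x\<bar> \<le> 1 / real (Suc n)"
        by (intro always_eventually allI less_imp_le)
    qed simp
    then have "(\<lambda>n. apply_op P (g' n) x) \<longlonglongrightarrow> apply_op P f x" by (rule tendsto_apply_op)
    then have "(\<lambda>n. 0) \<longlonglongrightarrow> apply_op P f x" unfolding g(2) .
    then have "0 = apply_op P f x" by (rule LIMSEQ_unique[OF tendsto_const])
    then show False using x(2) by simp
  qed
  then obtain e where e: "0 < e" "\<forall>g\<in>Ck_ball k U {x} e f. apply_op P g x \<noteq> 0" by blast
  show "\<exists>T. openin (Ck_topology k U) T \<and> f \<in> T \<and> T \<subseteq> {f \<in> Ck_space k U. \<exists>x\<in>U. apply_op P f x \<noteq> 0}"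
  proof (intro exI conjI)
    show "openin (Ck_topology k U) (Ck_ball k U {x} e f)" using x(1) e(1) f by (intro openin_Ck_ball) auto
    show "f \<in> Ck_ball k U {x} e f" using e(1) f by (simp add: Ck_ball_def)
    show "Ck_ball k U {x} e f \<subseteq> {f \<in> Ck_space k U. \<exists>x\<in>U. apply_op P f x \<noteq> 0}"
      using e(2) x(1) by (auto simp: Ck_ball_def)
  qed
qed

text \<open>The segment from f to g, restricted to U because members of \<open>Ck_space\<close> are
  extensional.\<close>

definition Ck_path :: "(real^3) set \<Rightarrow> (real^3 \<Rightarrow> real) \<Rightarrow> (real^3 \<Rightarrow> real) \<Rightarrow> real \<Rightarrow> real^3 \<Rightarrow> real" where
  "Ck_path U f g t = restrict (\<lambda>x. (1 - t) * f x + t * g x) U"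

lemma Ck_path_space:
  assumes U: "open U" and f: "Ck_on k U f" and g: "Ck_on k U g"
  shows "Ck_path U f g t \<in> Ck_space k U"
proof -
  have "Ck_on k U (\<lambda>x. (1 - t) * f x + t * g x)" by (intro Ck_on_add Ck_on_cmult U f g)
  then have "Ck_on k U (Ck_path U f g t)" by (subst Ck_on_cong[OF U]) (simp_all add: Ck_path_def)
  then show ?thesis by (simp add: Ck_space_def Ck_path_def)
qed

text \<open>Continuity of the segment at its initial point, proved along the generation of the
  topology: finite intersections, unions and basic balls. The balls need not be centred at
  f.\<close>

lemma Ck_path_eventually:
  assumes U: "open U" and f: "Ck_on k U f" and g: "Ck_on k U g"
    and T: "openin (Ck_topology k U) T" "f \<in> T"
  shows "eventually (\<lambda>t. Ck_path U f g t \<in> T) (at_right 0)"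
proof -
  have part: "partials is (Ck_path U f g t) x = partials is f x + t * (partials is g x - partials is f x)"
    if "length is \<le> k" "x \<in> U" for "is" t x
  proof -
    have "partials is (Ck_path U f g t) x = partials is (\<lambda>x. (1 - t) * f x + t * g x) x"
      by (rule partials_cong_open[OF U that(2)]) (simp add: Ck_path_def)
    also have "\<dots> = (1 - t) * partials is f x + t * partials is g x" by (rule partials_lincomb[OF U f g that])
    finally show ?thesis by (simp add: algebra_simps)
  qed
  have ball: "eventually (\<lambda>t. Ck_path U f g t \<in> Ck_ball k U K e h) (at_right 0)"
    if K: "compact K" "K \<subseteq> U" and e: "0 < e" and h: "h \<in> Ck_space k U" and fh: "f \<in> Ck_ball k U K e h" for K e h
  proof -
    have one: "eventually (\<lambda>t. \<forall>x\<in>K. \<bar>partials is (Ck_path U f g t) x - partials is h x\<bar> < e) (at_right 0)"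
      if l: "length is \<le> k" for "is"
    proof (cases "K = {}")
      case False
      have c: "continuous_on K (partials is F)" if "Ck_on k U F" for F
        using that l K(2) unfolding Ck_on_def by (meson continuous_on_subset)
      have "continuous_on K (\<lambda>x. \<bar>partials is f x - partials is h x\<bar>)"
        using h by (intro continuous_intros c f) (simp add: Ck_space_def)
      then obtain x1 where x1: "x1 \<in> K" "\<And>x. x \<in> K \<Longrightarrow> \<bar>partials is f x - partials is h x\<bar> \<le> \<bar>partials is f x1 - partials is h x1\<bar>"
        using continuous_attains_sup[OF K(1) False] by blast
      have "continuous_on K (\<lambda>x. \<bar>partials is g x - partials is f x\<bar>)"
        by (intro continuous_intros c f g)
      then obtain x2 where x2: "x2 \<in> K" "\<And>x. x \<in> K \<Longrightarrow> \<bar>partials is g x - partials is f x\<bar> \<le> \<bar>partials is g x2 - partials is f x2\<bar>"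
        using continuous_attains_sup[OF K(1) False] by blast
      \<comment> \<open>The supremum m over the compact K is attained, hence strictly below e; this
        leaves the room e - m for the moving term.\<close>
      define m M where "m = \<bar>partials is f x1 - partials is h x1\<bar>" and "M = \<bar>partials is g x2 - partials is f x2\<bar>"
      have m: "m < e" using fh x1(1) l by (simp add: m_def Ck_ball_def)
      have M: "0 \<le> M" by (simp add: M_def)
      show ?thesis unfolding eventually_at_right_field
      proof (intro exI[of _ "(e - m) / (M + 1)"] conjI allI impI ballI)
        show "0 < (e - m) / (M + 1)" using m M by simp
        fix t x assume t: "0 < t" "t < (e - m) / (M + 1)" and x: "x \<in> K"
        have "\<bar>partials is (Ck_path U f g t) x - partials is h x\<bar>
            \<le> \<bar>partials is f x - partials is h x\<bar> + t * \<bar>partials is g x - partials is f x\<bar>"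
        proof -
          have "partials is (Ck_path U f g t) x - partials is h x
              = (partials is f x - partials is h x) + t * (partials is g x - partials is f x)"
            using part[OF l, of x t] x K(2) by auto
          then show ?thesis
            using t abs_triangle_ineq[of "partials is f x - partials is h x" "t * (partials is g x - partials is f x)"]
            by (simp only: abs_mult abs_of_pos)
        qed
        also have "\<dots> \<le> m + t * M" unfolding m_def M_def using x1(2)[OF x] x2(2)[OF x] t(1) by (intro add_mono mult_left_mono) auto
        also have "\<dots> < e"
        proof -
          have "t * M + t < e - m" using t(2) M by (simp add: field_simps)
          then show ?thesis using t(1) by linarith
        qed
        finally show "\<bar>partials is (Ck_path U f g t) x - partials is h x\<bar> < e" .
      qed
    qed simp
    have "finite {is :: 3 list. length is \<le> k}" using finite_lists_length_le[of "UNIV :: 3 set" k] by simp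
    then have "eventually (\<lambda>t. \<forall>is\<in>{is. length is \<le> k}. \<forall>x\<in>K. \<bar>partials is (Ck_path U f g t) x - partials is h x\<bar> < e) (at_right 0)"
      by (rule eventually_ball_finite) (use one in auto)
    then show ?thesis by eventually_elim (simp add: Ck_ball_def Ck_path_space[OF U f g])
  qed
  have "generate_topology_on {Ck_ball k U K e f | K e f. compact K \<and> K \<subseteq> U \<and> e > 0 \<and> f \<in> Ck_space k U} T"
    using T(1) unfolding Ck_topology_def openin_topology_generated_by_iff .
  then show ?thesis using T(2)
  proof (induction T)
    case (Int A B)
    then show ?case by (auto intro: eventually_conj)
  next
    case (UN A)
    then obtain S where S: "S \<in> A" "f \<in> S" by blast
    then have "eventually (\<lambda>t. Ck_path U f g t \<in> S) (at_right 0)" using UN.IH by blast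
    then show ?case by eventually_elim (use S(1) in blast)
  next
    case (Basis S)
    then show ?case using ball by blast
  qed simp
qed

text \<open>A nonempty open set contains the initial part of a segment from one of its members f to
  the translated sample g. The operator at x1 is a polynomial in the parameter, nonzero at parameter
  1, so it has finitely many roots and some parameter near 0 avoids them.\<close>

lemma dense_op_nonzero:
  assumes U: "open U" "U \<noteq> {}" and k: "6 \<le> k"
  defines "G \<equiv> {f \<in> Ck_space k U. \<exists>x\<in>U. apply_op obstruction f x \<noteq> 0}"
  shows "Ck_topology k U closure_of G = topspace (Ck_topology k U)"
  unfolding dense_intersects_open
proof (intro allI impI)
  fix T assume T: "openin (Ck_topology k U) T \<and> T \<noteq> {}"
  then obtain f where fT: "f \<in> T" by blast
  have "f \<in> Ck_space k U" using openin_subset[of "Ck_topology k U" T] T fT by auto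
  then have f: "Ck_on k U f" by (simp add: Ck_space_def)
  obtain x1 where x1: "x1 \<in> U" using U(2) by blast
  define g where "g = (\<lambda>x. sample (x + (- x1)))"
  have "Ck_on k UNIV g" unfolding g_def by (rule Ck_on_shift) (use smooth_sample smooth_def in blast)
  then have g: "Ck_on k U g" by (rule Ck_on_subset) simp
  have gx: "apply_op obstruction g x1 \<noteq> 0"
    unfolding g_def apply_op_shift using obstruction_sample by simp
  obtain p where p: "\<And>t. apply_op obstruction (\<lambda>x. (1 - t) * f x + t * g x) x1 = poly p t"
    using apply_op_path_poly[OF U(1) f g x1, of obstruction] op_order_obstruction k by auto
  have "poly p 1 \<noteq> 0" using p[of 1] gx by simp
  then have fin: "finite {t. poly p t = 0}" by (intro poly_roots_finite) auto
  have "eventually (\<lambda>t. Ck_path U f g t \<in> T) (at_right 0)" by (rule Ck_path_eventually[OF U(1) f g]) (use T fT in auto)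
  then obtain b where b: "0 < b" "\<And>t. 0 < t \<Longrightarrow> t < b \<Longrightarrow> Ck_path U f g t \<in> T" unfolding eventually_at_right_field by blast
  have "infinite {0<..<b}" using b(1) by simp
  then have "\<not> {0<..<b} \<subseteq> {t. poly p t = 0}" using finite_subset[OF _ fin] by blast
  then obtain t where t: "t \<in> {0<..<b}" "poly p t \<noteq> 0" unfolding subset_iff mem_Collect_eq by blast
  have "apply_op obstruction (Ck_path U f g t) x1 = apply_op obstruction (\<lambda>x. (1 - t) * f x + t * g x) x1"
    by (rule apply_op_cong_open[OF U(1) x1]) (simp add: Ck_path_def)
  then have "apply_op obstruction (Ck_path U f g t) x1 \<noteq> 0" using t(2) p by simp
  then have "Ck_path U f g t \<in> G" using x1 Ck_path_space[OF U(1) f g] unfolding G_def by blast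
  then show "G \<inter> T \<noteq> {}" using b(2)[of t] t(1) by auto
qed

theorem theorem1p1:
  shows "(\<exists>P. nonzero_op P \<and> op_order P \<le> 6 \<and>
            (\<forall>U f \<alpha>. open U \<and> connected U \<and> 0 < \<alpha> \<and> \<alpha> < 1 \<and>
                Ck_holder_on 6 \<alpha> U f \<and> \<not> f constant_on U \<longrightarrow>
                (\<forall>u. classical_solution U f u \<longrightarrow>
                   (\<forall>x\<in>U. u x = 0) \<or> (\<forall>x\<in>U. apply_op P f x = 0)) \<and>
                (\<forall>u. weak_solution U f u \<longrightarrow>
                   negligible {x \<in> U. u x \<noteq> 0} \<or> (\<forall>x\<in>U. apply_op P f x = 0)))) \<and>
         (\<forall>U k. open U \<and> connected U \<and> 7 \<le> k \<longrightarrow>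
            (\<exists>G. openin (Ck_topology k U) G \<and>
                 Ck_topology k U closure_of G = topspace (Ck_topology k U) \<and>
                 (\<forall>f\<in>G. only_trivial_solution U f)))"
proof (rule conjI)
  have trivial: "only_trivial_solution U f \<or> (\<forall>x\<in>U. apply_op obstruction f x = 0)"
    if "open U" "connected U" "Ck_holder_on 6 \<alpha> U f" for U f \<alpha>
    using only_trivial_solution_if_op_nonzero[OF that(1,2)] that(3) unfolding Ck_holder_on_def by blast
  show "\<exists>P. nonzero_op P \<and> op_order P \<le> 6 \<and>
            (\<forall>U f \<alpha>. open U \<and> connected U \<and> 0 < \<alpha> \<and> \<alpha> < 1 \<and>
                Ck_holder_on 6 \<alpha> U f \<and> \<not> f constant_on U \<longrightarrow>
                (\<forall>u. classical_solution U f u \<longrightarrow>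
                   (\<forall>x\<in>U. u x = 0) \<or> (\<forall>x\<in>U. apply_op P f x = 0)) \<and>
                (\<forall>u. weak_solution U f u \<longrightarrow>
                   negligible {x \<in> U. u x \<noteq> 0} \<or> (\<forall>x\<in>U. apply_op P f x = 0)))"
  proof (intro exI[of _ obstruction] conjI nonzero_op_obstruction op_order_obstruction allI impI)
    fix U f \<alpha> u
    assume A: "open U \<and> connected U \<and> 0 < \<alpha> \<and> \<alpha> < 1 \<and> Ck_holder_on 6 \<alpha> U f \<and> \<not> f constant_on U"
    then have "open U" "connected U" "Ck_holder_on 6 \<alpha> U f" by simp_all
    note t = trivial[OF this, unfolded only_trivial_solution_def]
    show "(\<forall>x\<in>U. u x = 0) \<or> (\<forall>x\<in>U. apply_op obstruction f x = 0)" if "classical_solution U f u"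
      using t that by auto
    show "negligible {x \<in> U. u x \<noteq> 0} \<or> (\<forall>x\<in>U. apply_op obstruction f x = 0)" if "weak_solution U f u"
      using t that by auto
  qed
  show "\<forall>U k. open U \<and> connected U \<and> 7 \<le> k \<longrightarrow>
            (\<exists>G. openin (Ck_topology k U) G \<and>
                 Ck_topology k U closure_of G = topspace (Ck_topology k U) \<and>
                 (\<forall>f\<in>G. only_trivial_solution U f))"
  proof (intro allI impI)
    fix U :: "(real^3) set" and k :: nat
    assume A: "open U \<and> connected U \<and> 7 \<le> k"
    show "\<exists>G. openin (Ck_topology k U) G \<and> Ck_topology k U closure_of G = topspace (Ck_topology k U) \<and>
                 (\<forall>f\<in>G. only_trivial_solution U f)"
    proof (cases "U = {}")
      \<comment> \<open>The density argument needs a point of the domain; over the empty set the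
        whole space has the required property.\<close>
      case True
      show ?thesis
        by (rule exI[of _ "topspace (Ck_topology k U)"])
          (simp only: openin_topspace closure_of_topspace, simp add: True only_trivial_solution_def)
    next
      case False
      let ?G = "{f \<in> Ck_space k U. \<exists>x\<in>U. apply_op obstruction f x \<noteq> 0}"
      have k: "6 \<le> k" using A by simp
      have "openin (Ck_topology k U) ?G"
        by (rule openin_op_nonzero) (use A k op_order_obstruction in auto)
      moreover have "Ck_topology k U closure_of ?G = topspace (Ck_topology k U)"
        using dense_op_nonzero[of U k] A False k by blast
      moreover have "only_trivial_solution U f" if "f \<in> ?G" for f
        using that only_trivial_solution_if_op_nonzero[of U f] Ck_on_mono[OF _ k, of U f] A
        by (auto simp: Ck_space_def)
      ultimately show ?thesis by blast
    qed
  qed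
qed

end
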